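(* Let $n\ge 1$. For any $(H_0,T_0,V_0)\in i\mathfrak u(n)\oplus\mathbb C^n\oplus\mathbb R$, there exists a Bochner-Kähler structure $\Omega$ on a neighborhood $U$ of $0\in\mathbb C^n$ whose unitary coframe bundle $\pi:P\to U$ contains a $u_0\in P_0=\pi^{-1}(0)$ for which $H(u_0)=H_0$, $T(u_0)=T_0$, and $V(u_0)=V_0$. Any two real-analytic Bochner-Kähler structures with this property are isomorphic on a neighborhood of $0\in\mathbb C^n$ (i.e. their germs at $0$ are isomorphic as germs of Kähler structures). Finally, any Bochner-Kähler structure that is $C^5$ is real-analytic.
   Context: $\mathbb C^n$ consists of columns; $z^*$ denotes conjugate transpose; $\mathfrak u(n)=\{a\in M_n(\mathbb C): a^*=-a\}$, so $i\mathfrak u(n)$ is the space of Hermitian $n\times n$ matrices. Let $(M,g,\Omega)$ be a Kähler manifold of complex dimension $n\ge1$. Its unitary coframe bundle $\pi:P\to M$ has as fiber $P_x$ the set of complex-linear isometries $u:T_xM\to\mathbb C^n$, with right $U(n)$-action $u\cdot a=a^{-1}\circ u$. Let $\omega$ be the $\mathbb C^n$-valued $1$-form on $P$ with $\omega(v)=u(\pi'(v))$ for $v\in T_uP$ (so $\pi^*\Omega=-\frac i2\,\omega^*\wedge\omega$), and let $\phi$ be the unique $\mathfrak u(n)$-valued $1$-form on $P$ with $d\omega=-\phi\wedge\omega$. The structure is called Bochner-Kähler if there are functions $H:P\to i\mathfrak u(n)$, $T:P\to\mathbb C^n$, $V:P\to\mathbb R$ satisfying the structure equations $$d\phi=-\phi\wedge\phi+H\,\omega^*\wedge\omega-H\,\omega\wedge\omega^*-\omega\wedge\omega^*H+(\omega^*\wedge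 H\omega)\,I_n+(\operatorname{tr}H)\bigl(\omega^*\wedge\omega\,I_n-\omega\wedge\omega^*\bigr),$$ $$dH=-\phi H+H\phi+T\omega^*+\omega T^*,\qquad dT=-\phi T+\bigl(H^2+(\operatorname{tr}H)H+V I_n\bigr)\omega,$$ $$dV=(\operatorname{tr}H)(T^*\omega+\omega^*T)+(T^*H\omega+\omega^*HT).$$ For $n\ge2$ this is equivalent to the vanishing of the Bochner curvature, i.e. the component of the Kähler curvature tensor complementary to the scalar curvature and traceless Ricci components in the $U(n)$-irreducible decomposition of the space of Kähler curvature tensors; for $n=1$ it is the definition. The functions $H,T,V$ are unique; $(H,T,V)$ is called the structure function. *)

theory Defs
  imports "HOL-Analysis.Analysis"
begin

section \<open>Regularity of maps on open subsets of Euclidean spaces\<close>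

primrec Cn_on :: "nat \<Rightarrow> 'a::euclidean_space set \<Rightarrow> ('a \<Rightarrow> 'b::real_normed_vector) \<Rightarrow> bool" where
  "Cn_on 0 S f \<longleftrightarrow> continuous_on S f"
| "Cn_on (Suc k) S f \<longleftrightarrow>
     (\<forall>x\<in>S. f differentiable (at x)) \<and>
     (\<forall>v. Cn_on k S (\<lambda>x. frechet_derivative f (at x) v))"

definition Ck_on :: "enat \<Rightarrow> 'a::euclidean_space set \<Rightarrow> ('a \<Rightarrow> 'b::real_normed_vector) \<Rightarrow> bool" where
  "Ck_on k S f \<longleftrightarrow> (\<forall>j. enat j \<le> k \<longrightarrow> Cn_on j S f)"

text \<open>Multi-indices are functions \<open>\<alpha>\<close> supported on \<open>Basis\<close>; \<open>has_sum\<close> is unconditional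
  summation, so the series below is an (absolutely) convergent multivariate power series.\<close>

definition real_analytic_on :: "'a::euclidean_space set \<Rightarrow> ('a \<Rightarrow> 'b::real_normed_vector) \<Rightarrow> bool" where
  "real_analytic_on S f \<longleftrightarrow>
     (\<forall>p\<in>S. \<exists>r>0. \<exists>a :: ('a \<Rightarrow> nat) \<Rightarrow> 'b. \<forall>y. norm y < r \<longrightarrow>
        ((\<lambda>\<alpha>. (\<Prod>b\<in>Basis. (y \<bullet> b) ^ \<alpha> b) *\<^sub>R a \<alpha>) has_sum f (p + y))
          {\<alpha>. \<forall>b. b \<notin> Basis \<longrightarrow> \<alpha> b = 0})"

section \<open>Differential forms on submanifolds of Euclidean spaces\<close>

text \<open>For an embedded submanifold \<open>S\<close>, the velocities at \<open>p\<close> of curves in \<open>S\<close> form the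
  tangent space of \<open>S\<close> at \<open>p\<close>.\<close>

definition tangent_space :: "'a::euclidean_space set \<Rightarrow> 'a \<Rightarrow> 'a set" where
  "tangent_space S p =
     {v. \<exists>\<gamma> e. e > 0 \<and> \<gamma> 0 = p \<and> (\<forall>t. \<bar>t\<bar> < e \<longrightarrow> \<gamma> t \<in> S) \<and>
           (\<gamma> has_vector_derivative v) (at (0::real))}"

text \<open>A 1-form (2-form) on \<open>S\<close> is a function \<open>\<alpha> p v\<close> (\<open>\<beta> p v w\<close>), of which only the values at
  \<open>p \<in> S\<close> and tangent vectors \<open>v\<close>, \<open>w\<close> of \<open>S\<close> matter. All statements below only use those.\<close>

definition has_differential_on ::
  "'a::euclidean_space set \<Rightarrow> ('a \<Rightarrow> 'b::real_normed_vector) \<Rightarrow> ('a \<Rightarrow> 'a \<Rightarrow> 'b) \<Rightarrow> bool" where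
  "has_differential_on S f \<theta> \<longleftrightarrow>
     (\<forall>p\<in>S. \<exists>D. (f has_derivative D) (at p within S) \<and> (\<forall>v\<in>tangent_space S p. D v = \<theta> p v))"

text \<open>The exterior derivative of a 1-form on \<open>S\<close> is the restriction of the exterior derivative
  of any local \<open>C\<^sup>1\<close> extension \<open>A\<close> to the ambient space; the convention is
  \<open>d\<alpha>(X,Y) = X(\<alpha>(Y)) - Y(\<alpha>(X)) - \<alpha>([X,Y])\<close>.\<close>

definition has_ext_derivative_on ::
  "'a::euclidean_space set \<Rightarrow> ('a \<Rightarrow> 'a \<Rightarrow> 'b::real_normed_vector) \<Rightarrow> ('a \<Rightarrow> 'a \<Rightarrow> 'a \<Rightarrow> 'b) \<Rightarrow> bool" where
  "has_ext_derivative_on S \<alpha> \<beta> \<longleftrightarrow>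
     (\<forall>p\<in>S. \<exists>W A. open W \<and> p \<in> W \<and>
        (\<forall>q\<in>W. linear (A q)) \<and> (\<forall>v. Ck_on 1 W (\<lambda>q. A q v)) \<and>
        (\<forall>q\<in>S \<inter> W. \<forall>v\<in>tangent_space S q. A q v = \<alpha> q v) \<and>
        (\<forall>v\<in>tangent_space S p. \<forall>w\<in>tangent_space S p.
           \<beta> p v w = frechet_derivative (\<lambda>q. A q w) (at p) v
                     - frechet_derivative (\<lambda>q. A q v) (at p) w))"

definition wedge :: "('b \<Rightarrow> 'c \<Rightarrow> 'd::ab_group_add) \<Rightarrow> ('a \<Rightarrow> 'b) \<Rightarrow> ('a \<Rightarrow> 'c) \<Rightarrow> 'a \<Rightarrow> 'a \<Rightarrow> 'd" where
  "wedge m \<alpha> \<beta> v w = m (\<alpha> v) (\<beta> w) - m (\<alpha> w) (\<beta> v)"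

section \<open>Complex vectors and matrices\<close>

definition adj :: "complex^'n^'n \<Rightarrow> complex^'n^'n" where
  "adj A = (\<chi> i j. cnj (A $ j $ i))"

definition hermitian :: "complex^'n^'n \<Rightarrow> bool" where
  "hermitian A \<longleftrightarrow> adj A = A"

definition skew_hermitian :: "complex^'n^'n \<Rightarrow> bool" where
  "skew_hermitian A \<longleftrightarrow> adj A = - A"

text \<open>\<open>star_dot a b\<close> is \<open>a\<^sup>* b\<close> and \<open>dot_star a b\<close> is \<open>a b\<^sup>*\<close>, for columns \<open>a\<close>, \<open>b\<close>.\<close>

definition star_dot :: "complex^'n \<Rightarrow> complex^'n \<Rightarrow> complex" where
  "star_dot a b = (\<Sum>i\<in>UNIV. cnj (a $ i) * b $ i)"

definition dot_star :: "complex^'n \<Rightarrow> complex^'n \<Rightarrow> complex^'n^'n" where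
  "dot_star a b = (\<chi> i j. a $ i * cnj (b $ j))"

definition holomorphic_map_on :: "(complex^'n) set \<Rightarrow> (complex^'n \<Rightarrow> complex^'m) \<Rightarrow> bool" where
  "holomorphic_map_on S f \<longleftrightarrow> (\<forall>x\<in>S. \<exists>A :: complex^'n^'m. (f has_derivative (\<lambda>v. A *v v)) (at x))"

section \<open>Bochner-Kaehler structures on open subsets of complex n-space\<close>

type_synonym 'n form2 = "complex^'n \<Rightarrow> complex^'n \<Rightarrow> complex^'n \<Rightarrow> real"
type_synonym 'n coframe = "(complex^'n) \<times> (complex^'n^'n)"

text \<open>The metric of the Kaehler form \<open>\<Omega>\<close> is \<open>g v w = \<Omega> v (\<i> w)\<close>. If \<open>g\<close> is the real part of
  \<open>v\<^sup>* h w\<close> then \<open>\<Omega> = -(\<i>/2) dz\<^sup>* \<and> h dz\<close> is its imaginary part.\<close>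

definition kaehler_form_on :: "enat \<Rightarrow> (complex^'n) set \<Rightarrow> 'n::finite form2 \<Rightarrow> bool" where
  "kaehler_form_on k U \<Omega> \<longleftrightarrow>
     open U \<and>
     (\<forall>v w. Ck_on k U (\<lambda>x. \<Omega> x v w)) \<and>
     (\<forall>x\<in>U. bilinear (\<Omega> x) \<and> (\<forall>v. \<Omega> x v v = 0) \<and>
        (\<forall>v w. \<Omega> x (\<i> *s v) (\<i> *s w) = \<Omega> x v w) \<and>
        (\<forall>v. v \<noteq> 0 \<longrightarrow> \<Omega> x v (\<i> *s v) > 0)) \<and>
     (\<forall>x\<in>U. \<forall>u v w.
        frechet_derivative (\<lambda>y. \<Omega> y v w) (at x) u
        + frechet_derivative (\<lambda>y. \<Omega> y w u) (at x) v
        + frechet_derivative (\<lambda>y. \<Omega> y u v) (at x) w = 0)"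

definition real_analytic_form_on :: "(complex^'n) set \<Rightarrow> 'n::finite form2 \<Rightarrow> bool" where
  "real_analytic_form_on U \<Omega> \<longleftrightarrow> (\<forall>v w. real_analytic_on U (\<lambda>x. \<Omega> x v w))"

text \<open>A complex-linear isometry from the tangent space at \<open>x\<close> to complex n-space is given by its
  matrix \<open>A\<close>.\<close>

definition coframe_bundle :: "(complex^'n) set \<Rightarrow> 'n::finite form2 \<Rightarrow> 'n coframe set" where
  "coframe_bundle U \<Omega> =
     {(x, A). x \<in> U \<and> (\<forall>v w. (A *v v) \<bullet> (A *v w) = \<Omega> x v (\<i> *s w))}"

definition taut_form :: "'n::finite coframe \<Rightarrow> 'n coframe \<Rightarrow> complex^'n" where
  "taut_form p v = snd p *v fst v"

definition connection_form ::
  "(complex^'n) set \<Rightarrow> 'n::finite form2 \<Rightarrow> ('n coframe \<Rightarrow> 'n coframe \<Rightarrow> complex^'n^'n) \<Rightarrow> bool" where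
  "connection_form U \<Omega> \<phi> \<longleftrightarrow>
     (let P = coframe_bundle U \<Omega> in
       (\<forall>p\<in>P. linear (\<phi> p) \<and> (\<forall>v\<in>tangent_space P p. skew_hermitian (\<phi> p v))) \<and>
       has_ext_derivative_on P taut_form (\<lambda>p v w. - wedge (*v) (\<phi> p) (taut_form p) v w))"

text \<open>Since \<open>\<phi>\<close> is unique on vectors tangent to the coframe bundle, the existential quantifier
  over \<open>\<phi>\<close> merely names it. A factor \<open>c I\<close> with scalar \<open>c\<close> is written \<open>mat c\<close>.\<close>

definition bochner_kaehler_on ::
  "enat \<Rightarrow> (complex^'n) set \<Rightarrow> 'n::finite form2 \<Rightarrow> ('n coframe \<Rightarrow> complex^'n^'n) \<Rightarrow>
   ('n coframe \<Rightarrow> complex^'n) \<Rightarrow> ('n coframe \<Rightarrow> real) \<Rightarrow> bool" where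
  "bochner_kaehler_on k U \<Omega> H T V \<longleftrightarrow>
     kaehler_form_on k U \<Omega> \<and>
     (let P = coframe_bundle U \<Omega>; \<omega> = taut_form in
       (\<forall>p\<in>P. hermitian (H p)) \<and>
       (\<exists>\<phi>. connection_form U \<Omega> \<phi> \<and>
         has_ext_derivative_on P \<phi> (\<lambda>p v w.
           - wedge (**) (\<phi> p) (\<phi> p) v w
           + H p ** mat (wedge star_dot (\<omega> p) (\<omega> p) v w)
           - H p ** wedge dot_star (\<omega> p) (\<omega> p) v w
           - wedge dot_star (\<omega> p) (\<omega> p) v w ** H p
           + mat (wedge star_dot (\<omega> p) (\<lambda>u. H p *v \<omega> p u) v w)
           + mat (trace (H p)) **
               (mat (wedge star_dot (\<omega> p) (\<omega> p) v w) - wedge dot_star (\<omega> p) (\<omega> p) v w)) \<and>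
         has_differential_on P H (\<lambda>p v.
           - (\<phi> p v ** H p) + H p ** \<phi> p v + dot_star (T p) (\<omega> p v) + dot_star (\<omega> p v) (T p)) \<and>
         has_differential_on P T (\<lambda>p v.
           - (\<phi> p v *v T p)
           + (H p ** H p + mat (trace (H p)) ** H p + mat (of_real (V p))) *v \<omega> p v) \<and>
         has_differential_on P (\<lambda>p. complex_of_real (V p)) (\<lambda>p v.
           trace (H p) * (star_dot (T p) (\<omega> p v) + star_dot (\<omega> p v) (T p))
           + (star_dot (T p) (H p *v \<omega> p v) + star_dot (\<omega> p v) (H p *v T p)))))"

definition attains_at_0 ::
  "enat \<Rightarrow> (complex^'n) set \<Rightarrow> 'n::finite form2 \<Rightarrow> complex^'n^'n \<Rightarrow> complex^'n \<Rightarrow> real \<Rightarrow> bool" where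
  "attains_at_0 k U \<Omega> H0 T0 V0 \<longleftrightarrow>
     open U \<and> 0 \<in> U \<and>
     (\<exists>H T V. bochner_kaehler_on k U \<Omega> H T V \<and>
       (\<exists>u0\<in>coframe_bundle U \<Omega>. fst u0 = 0 \<and> H u0 = H0 \<and> T u0 = T0 \<and> V u0 = V0))"

definition pullback_form :: "(complex^'n \<Rightarrow> complex^'n) \<Rightarrow> 'n::finite form2 \<Rightarrow> 'n form2" where
  "pullback_form f \<Omega> x v w =
     \<Omega> (f x) (frechet_derivative f (at x) v) (frechet_derivative f (at x) w)"

definition isomorphic_germs_at_0 ::
  "(complex^'n) set \<Rightarrow> 'n::finite form2 \<Rightarrow> (complex^'n) set \<Rightarrow> 'n form2 \<Rightarrow> bool" where
  "isomorphic_germs_at_0 U1 \<Omega>1 U2 \<Omega>2 \<longleftrightarrow>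
     (\<exists>N1 N2 f g. open N1 \<and> open N2 \<and> 0 \<in> N1 \<and> N1 \<subseteq> U1 \<and> N2 \<subseteq> U2 \<and>
        homeomorphism N1 N2 f g \<and> holomorphic_map_on N1 f \<and> holomorphic_map_on N2 g \<and>
        f 0 = 0 \<and> (\<forall>x\<in>N1. pullback_form f \<Omega>2 x = \<Omega>1 x))"

section \<open>Bochner-Kaehler structures on complex manifolds\<close>

text \<open>A complex manifold is a Hausdorff, second countable space with a holomorphic atlas. A chart
  is a pair of its domain and its coordinate map. A structure on the manifold, and functions on its
  unitary coframe bundle, are given by their coordinate representations, one for each chart, that
  agree on overlaps.\<close>

type_synonym ('m, 'n) chart = "'m set \<times> ('m \<Rightarrow> complex^'n)"

definition chart_image :: "('m, 'n) chart \<Rightarrow> (complex^'n) set" where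
  "chart_image c = snd c ` fst c"

definition transition_dom :: "('m, 'n) chart \<Rightarrow> ('m, 'n) chart \<Rightarrow> (complex^'n) set" where
  "transition_dom c c' = snd c ` (fst c \<inter> fst c')"

definition transition :: "('m, 'n) chart \<Rightarrow> ('m, 'n) chart \<Rightarrow> complex^'n \<Rightarrow> complex^'n" where
  "transition c c' = snd c' \<circ> inv_into (fst c) (snd c)"

definition complex_manifold :: "'m topology \<Rightarrow> ('m, 'n::finite) chart set \<Rightarrow> bool" where
  "complex_manifold X \<A> \<longleftrightarrow>
     Hausdorff_space X \<and>
     (\<exists>\<B>. countable \<B> \<and> (\<forall>B\<in>\<B>. openin X B) \<and>
        (\<forall>G x. openin X G \<and> x \<in> G \<longrightarrow> (\<exists>B\<in>\<B>. x \<in> B \<and> B \<subseteq> G))) \<and>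
     topspace X = (\<Union>c\<in>\<A>. fst c) \<and>
     (\<forall>c\<in>\<A>. openin X (fst c) \<and> open (chart_image c) \<and>
        homeomorphic_map (subtopology X (fst c)) (top_of_set (chart_image c)) (snd c)) \<and>
     (\<forall>c\<in>\<A>. \<forall>c'\<in>\<A>. holomorphic_map_on (transition_dom c c') (transition c c'))"

text \<open>A coframe with matrix \<open>B\<close> at \<open>\<tau> x\<close> in the chart \<open>c'\<close> has the matrix \<open>B (d\<tau>)\<^sub>x\<close> at \<open>x\<close> in the
  chart \<open>c\<close>, where \<open>\<tau>\<close> is the transition map from \<open>c\<close> to \<open>c'\<close>.\<close>

definition bochner_kaehler_manifold ::
  "enat \<Rightarrow> 'm topology \<Rightarrow> ('m, 'n::finite) chart set \<Rightarrow> (('m, 'n) chart \<Rightarrow> 'n form2) \<Rightarrow>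
   (('m, 'n) chart \<Rightarrow> 'n coframe \<Rightarrow> complex^'n^'n) \<Rightarrow>
   (('m, 'n) chart \<Rightarrow> 'n coframe \<Rightarrow> complex^'n) \<Rightarrow>
   (('m, 'n) chart \<Rightarrow> 'n coframe \<Rightarrow> real) \<Rightarrow> bool" where
  "bochner_kaehler_manifold k X \<A> \<Omega> H T V \<longleftrightarrow>
     complex_manifold X \<A> \<and>
     (\<forall>c\<in>\<A>. bochner_kaehler_on k (chart_image c) (\<Omega> c) (H c) (T c) (V c)) \<and>
     (\<forall>c\<in>\<A>. \<forall>c'\<in>\<A>. \<forall>x\<in>transition_dom c c'.
        let \<tau> = transition c c' in
          pullback_form \<tau> (\<Omega> c') x = \<Omega> c x \<and>
          (\<forall>B. (\<tau> x, B) \<in> coframe_bundle (chart_image c') (\<Omega> c') \<longrightarrow>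
             (let p = (x, B ** matrix (frechet_derivative \<tau> (at x))) in
               H c p = H c' (\<tau> x, B) \<and> T c p = T c' (\<tau> x, B) \<and> V c p = V c' (\<tau> x, B))))"

end

theory Submission
  imports Defs "HOL-Complex_Analysis.Complex_Analysis"
begin

text \<open>The functions \<open>H\<close>, \<open>T\<close>, \<open>V\<close> of a Bochner-Kaehler structure are the entries of a matrix \<open>X\<close> of size
  \<open>n + 2\<close> that is self-adjoint for a Hermitian form \<open>Jm\<close> of signature \<open>(n + 1, 1)\<close>. By the structure equations
  \<open>X\<close> is parallel for a connection \<open>\<Theta>\<^sub>0\<close> on the coframe bundle, built from \<open>\<phi>\<close>, \<open>\<omega>\<close>, \<open>H\<close> and \<open>T\<close>, which preserves
  \<open>Jm\<close> and has curvature \<open>(\<omega>\<^sup>* \<and> \<omega>) X = 2i \<Omega> X\<close>. If \<open>d\<mu> = -2i \<Omega>\<close>, then \<open>\<Theta> = \<Theta>\<^sub>0 + \<mu> X\<close> is flat. A frame \<open>G\<close> parallel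
  for \<open>\<Theta>\<close> conjugates \<open>X\<close> into its initial value \<open>X0\<close>, and its first column \<open>N = G e\<^sub>1\<close> is a map into the null
  cone of \<open>Jm\<close>. Modulo scaling and the complex flow of \<open>X0\<close>, \<open>N\<close> becomes a holomorphic chart \<open>y\<close>, in which \<open>\<Omega>\<close> is
  given by a formula that depends only on \<open>X0\<close> and is the restriction of a holomorphic function of \<open>y\<close> and its
  conjugate. This shows uniqueness and real-analyticity. Conversely, for every \<open>X0\<close> this formula defines a Kaehler
  form near \<open>0\<close> with a frame \<open>G\<close>, and the structure equations are the flatness of \<open>\<Theta> = G\<^sup>-\<^sup>1 dG\<close> together
  with \<open>dX = [X, \<Theta>]\<close> for \<open>X = G\<^sup>-\<^sup>1 X0 G\<close>.\<close>

text \<open>The twist flattens the connection because its curvature is a closed scalar 2-form times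
  the parallel matrix \<open>X\<close>: the cross terms of \<open>\<mu> X\<close> are absorbed by
  the derivative of \<open>X\<close>, and a scalar 1-form has square zero. The unitary frame and the
  primitive of the Kaehler form are arbitrary, so \<open>N\<close> has meaning only modulo phases
  and the flow of i \<open>X0\<close>. Both groups preserve \<open>Jm\<close>, and
  \<open>Jp N N = 0\<close>, \<open>Jp N (X0 N) = -1\<close> fix the levels of their moment maps.
  The structure is thus a Kaehler quotient of the flat space C^(n+2) with metric \<open>Jm\<close>:
  2n + 4 real dimensions, less two levels, less two orbit directions. The plane of \<open>N\<close>
  and \<open>X0 N\<close> has signature (1,1), so the metric left on its complement is positive.
  Complexifying the group replaces the quotient by complex orbits, for which the points
  \<open>Bv 1 y 0\<close> are a holomorphic slice; the real scaling and the real time that carry a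
  slice point into the level set come from an implicit function. It is holomorphic once the
  conjugate of \<open>y\<close> is made an independent variable, which is the source of
  analyticity.\<close>

no_notation fps_nth (infixl "$" 75)

section \<open>Differentiable maps\<close>

text \<open>The derivative \<open>f'\<close> is known only at points of \<open>S\<close>, while
  \<open>Cn_on\<close> speaks of \<open>frechet_derivative\<close>. The two are exchanged by the
  inner induction \<open>cong\<close>: on an open set \<open>Cn_on\<close> depends only on the
  values there.\<close>

lemma Cn_on_SucI:
  assumes "\<And>x. x \<in> S \<Longrightarrow> (f has_derivative f' x) (at x)"
    and "\<And>v. Cn_on k S (\<lambda>x. f' x v)" "open S"
  shows "Cn_on (Suc k) S f"
proof -
  have cong: "Cn_on k S g" if "Cn_on k S h" "\<And>x. x \<in> S \<Longrightarrow> g x = h x" for k and g h :: "'a \<Rightarrow> 'b"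
    using that
  proof (induction k arbitrary: g h)
    case 0
    then show ?case by (auto cong: continuous_on_cong)
  next
    case (Suc k)
    have fd: "frechet_derivative g (at x) = frechet_derivative h (at x)" "g differentiable at x"
      if "x \<in> S" for x
    proof -
      have d: "(h has_derivative frechet_derivative h (at x)) (at x)"
        using Suc.prems(1) that frechet_derivative_works by auto
      have "(g has_derivative frechet_derivative h (at x)) (at x)"
        by (rule has_derivative_transform_within_open[OF d \<open>open S\<close> that]) (simp add: Suc.prems(2))
      then show "frechet_derivative g (at x) = frechet_derivative h (at x)" "g differentiable at x"
        using frechet_derivative_at by (metis, metis differentiable_def)
    qed
    show ?case
      using Suc.prems Suc.IH[of "\<lambda>x. frechet_derivative h (at x) v" "\<lambda>x. frechet_derivative g (at x) v" for v]
      by (auto simp: fd)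
  qed
  have "frechet_derivative f (at x) = f' x" if "x \<in> S" for x
    using assms(1)[OF that] frechet_derivative_at by metis
  then show ?thesis
    using assms by (auto simp: differentiable_def intro!: cong[OF assms(2)])
qed

lemma Cn_on_cong:
  assumes "Cn_on k S f" "\<And>x. x \<in> S \<Longrightarrow> g x = f x" "open S"
  shows "Cn_on k S g"
proof (cases k)
  case 0
  then show ?thesis using assms by (auto cong: continuous_on_cong)
next
  case (Suc j)
  have d: "(f has_derivative frechet_derivative f (at x)) (at x)" if "x \<in> S" for x
    using assms(1) that frechet_derivative_works unfolding Suc by auto
  show ?thesis
    unfolding Suc
  proof (rule Cn_on_SucI[OF _ _ \<open>open S\<close>])
    show "(g has_derivative frechet_derivative f (at x)) (at x)" if "x \<in> S" for x
      by (rule has_derivative_transform_within_open[OF d \<open>open S\<close> that]) (simp_all add: that assms)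
    show "Cn_on j S (\<lambda>x. frechet_derivative f (at x) v)" for v
      using assms(1) Suc by simp
  qed
qed

lemma Cn_on_SucD:
  assumes "Cn_on (Suc k) S f" "x \<in> S"
  shows "(f has_derivative frechet_derivative f (at x)) (at x)"
  using assms frechet_derivative_works by auto

lemma Cn_on_SucD':
  assumes "Cn_on (Suc k) S f"
  shows "Cn_on k S (\<lambda>x. frechet_derivative f (at x) v)"
  using assms by auto

lemma Cn_on_imp_continuous_on: "Cn_on k S f \<Longrightarrow> continuous_on S f"
  by (cases k) (auto simp: continuous_at_imp_continuous_on differentiable_imp_continuous_within)

lemma Cn_on_Suc_imp: "Cn_on (Suc k) S f \<Longrightarrow> Cn_on k S f"
proof (induction k arbitrary: f)
  case 0
  then show ?case using Cn_on_imp_continuous_on[of "Suc 0" S f] by simp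
next
  case (Suc k)
  from Suc.prems have "\<forall>x\<in>S. f differentiable (at x)"
    "\<And>v. Cn_on (Suc k) S (\<lambda>x. frechet_derivative f (at x) v)"
    by (subst (asm) Cn_on.simps(2), blast)+
  with Suc.IH show ?case by simp
qed

lemma Cn_on_le: "Cn_on m S f \<Longrightarrow> k \<le> m \<Longrightarrow> Cn_on k S f"
proof (induction m)
  case (Suc m)
  then show ?case using Cn_on_Suc_imp by (auto simp: le_Suc_eq)
qed simp

lemma Cn_on_const: "open S \<Longrightarrow> Cn_on k S (\<lambda>x. c)"
proof (induction k arbitrary: c)
  case (Suc k)
  show ?case
    by (rule Cn_on_SucI[where f'="\<lambda>_ _. 0"]) (use Suc in auto)
qed auto

lemma Cn_on_add:
  assumes "open S" "Cn_on k S f" "Cn_on k S g"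
  shows "Cn_on k S (\<lambda>x. f x + g x)"
  using assms(2,3)
proof (induction k arbitrary: f g)
  case 0
  then show ?case by (auto intro: continuous_intros)
next
  case (Suc k)
  show ?case
    by (rule Cn_on_SucI[OF has_derivative_add[OF Cn_on_SucD[OF Suc.prems(1)] Cn_on_SucD[OF Suc.prems(2)]]])
       (auto intro!: Suc.IH Cn_on_SucD'[OF Suc.prems(1)] Cn_on_SucD'[OF Suc.prems(2)] \<open>open S\<close>)
qed

lemma Cn_on_sum:
  assumes "open S" "\<And>i. i \<in> I \<Longrightarrow> Cn_on k S (f i)"
  shows "Cn_on k S (\<lambda>x. \<Sum>i\<in>I. f i x)"
  using assms(2)
  by (induction I rule: infinite_finite_induct) (auto intro!: Cn_on_const Cn_on_add assms(1))

lemma Cn_on_linear: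
  assumes "open S" "bounded_linear L" "Cn_on k S f"
  shows "Cn_on k S (\<lambda>x. L (f x))"
  using assms(3)
proof (induction k arbitrary: f)
  case 0
  then show ?case using assms by (auto intro: bounded_linear.continuous_on)
next
  case (Suc k)
  show ?case
    by (rule Cn_on_SucI[OF bounded_linear.has_derivative[OF assms(2) Cn_on_SucD[OF Suc.prems]]])
       (auto intro!: Suc.IH Cn_on_SucD'[OF Suc.prems] \<open>open S\<close>)
qed

lemma Cn_on_id: "open S \<Longrightarrow> Cn_on k S (\<lambda>x. x)"
  by (cases k) (auto intro!: Cn_on_SucI[where f'="\<lambda>_ v. v"] Cn_on_const continuous_on_id)

lemma Cn_on_bilinear:
  assumes "open S" "bounded_bilinear B" "Cn_on k S f" "Cn_on k S g"
  shows "Cn_on k S (\<lambda>x. B (f x) (g x))"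
  using assms(3,4)
proof (induction k arbitrary: f g)
  case 0
  then show ?case using assms by (auto intro: bounded_bilinear.continuous_on)
next
  case (Suc k)
  show ?case
    by (rule Cn_on_SucI[OF bounded_bilinear.FDERIV[OF assms(2) Cn_on_SucD[OF Suc.prems(1)] Cn_on_SucD[OF Suc.prems(2)]]])
       (auto intro!: Suc.IH Cn_on_add Cn_on_SucD'[OF Suc.prems(1)] Cn_on_SucD'[OF Suc.prems(2)] \<open>open S\<close>
         Cn_on_Suc_imp[OF Suc.prems(1)] Cn_on_Suc_imp[OF Suc.prems(2)])
qed

lemmas Cn_on_mult = Cn_on_bilinear[OF _ bounded_bilinear_mult]
lemmas Cn_on_scaleR = Cn_on_bilinear[OF _ bounded_bilinear_scaleR]

lemma Cn_on_minus: "open S \<Longrightarrow> Cn_on k S f \<Longrightarrow> Cn_on k S (\<lambda>x. - f x)"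
  using Cn_on_linear[OF _ bounded_linear_minus[OF bounded_linear_ident]] by auto

lemma Cn_on_diff: "open S \<Longrightarrow> Cn_on k S f \<Longrightarrow> Cn_on k S g \<Longrightarrow> Cn_on k S (\<lambda>x. f x - g x)"
  using Cn_on_add[OF _ _ Cn_on_minus] by (metis (no_types, lifting) Cn_on_cong uminus_add_conv_diff add.commute)

lemma Cn_on_compose_linear:
  assumes "open S" "open T" "bounded_linear L" "\<And>x. x \<in> T \<Longrightarrow> L x \<in> S" "Cn_on k S f"
  shows "Cn_on k T (\<lambda>x. f (L x))"
  using assms(5)
proof (induction k arbitrary: f)
  case 0
  then show ?case using assms(3,4)
    by (auto intro!: continuous_on_compose2[of S f T L] linear_continuous_on[OF assms(3)] simp del: o_apply)
next
  case (Suc k)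
  have "((\<lambda>x. f (L x)) has_derivative (\<lambda>v. frechet_derivative f (at (L x)) (L v))) (at x)" if "x \<in> T" for x
    using has_derivative_compose[OF bounded_linear.has_derivative[OF assms(3) has_derivative_ident] Cn_on_SucD[OF Suc.prems assms(4)[OF that]]] .
  then show ?case
    by (rule Cn_on_SucI) (auto intro!: Suc.IH Cn_on_SucD'[OF Suc.prems] \<open>open T\<close>)
qed

lemma Cn_on_subset: "Cn_on k S f \<Longrightarrow> T \<subseteq> S \<Longrightarrow> Cn_on k T f"
  by (induction k arbitrary: f) (auto intro: continuous_on_subset)

lemma Cn_on_local:
  assumes "\<And>x. x \<in> S \<Longrightarrow> \<exists>N. open N \<and> x \<in> N \<and> Cn_on k N f"
  shows "Cn_on k S f"
  using assms
proof (induction k arbitrary: f)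
  case 0
  have "isCont f x" if "x \<in> S" for x
    using 0[OF that] by (auto simp: continuous_on_eq_continuous_at)
  then show ?case by (auto intro: continuous_at_imp_continuous_on)
next
  case (Suc k)
  show ?case
    unfolding Cn_on.simps
    by (intro conjI ballI allI Suc.IH) (use Suc.prems in \<open>fastforce+\<close>)
qed

lemma Cn_on_inverse_sqrt:
  fixes f :: "'a::euclidean_space \<Rightarrow> real"
  assumes "open S" "Cn_on k S f" "\<And>x. x \<in> S \<Longrightarrow> f x > 0"
  shows "Cn_on k S (\<lambda>x. inverse (sqrt (f x)))"
  using assms(2)
proof (induction k)
  case 0
  then show ?case using assms(3) by (fastforce intro!: continuous_intros)
next
  case (Suc k)
  let ?r = "\<lambda>x. inverse (sqrt (f x))"
  have d: "(?r has_derivative (\<lambda>v. - ((1/2) * (?r x * ?r x * ?r x)) * frechet_derivative f (at x) v)) (at x)"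
    if "x \<in> S" for x
  proof -
    have "f x > 0" "sqrt (f x) \<noteq> 0" using assms(3)[OF that] by auto
    then show ?thesis
      by (auto intro!: derivative_eq_intros Cn_on_SucD[OF Suc.prems that] simp: field_simps)
  qed
  have r: "Cn_on k S ?r" using Suc Cn_on_Suc_imp by blast
  show ?case
    by (rule Cn_on_SucI[OF d _ \<open>open S\<close>], assumption)
       (intro Cn_on_mult Cn_on_minus Cn_on_const r Cn_on_SucD'[OF Suc.prems] \<open>open S\<close>)
qed

lemma Cn_on_vec_lambda:
  fixes f :: "'i::finite \<Rightarrow> 'a::euclidean_space \<Rightarrow> 'b::real_normed_vector"
  assumes "open S" "\<And>i. Cn_on k S (f i)"
  shows "Cn_on k S (\<lambda>x. \<chi> i. f i x)"
proof -
  have L: "bounded_linear (axis i :: 'b \<Rightarrow> 'b ^ 'i)" for i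
  proof (rule bounded_linear_intro)
    show "norm (axis i x :: 'b ^ 'i) \<le> norm x * 1" for x
      unfolding norm_vec_def
      by (rule order.trans[OF L2_set_le_sum]) (simp_all add: axis_def if_distrib cong: if_cong)
  qed (auto simp: axis_def vec_eq_iff)
  have "(\<chi> i. f i x) = (\<Sum>i\<in>UNIV. axis i (f i x))" for x
    by (simp add: vec_eq_iff axis_def if_distrib cong: if_cong)
  then show ?thesis
    by (simp add: Cn_on_sum Cn_on_linear[OF assms(1) L] assms)
qed

lemma Cn_on_vec_nth:
  "open S \<Longrightarrow> Cn_on k S f \<Longrightarrow> Cn_on k S (\<lambda>x. f x $ i)"
  using Cn_on_linear[OF _ bounded_linear_vec_nth] by blast


subsection \<open>Symmetry of second derivatives\<close>

text \<open>Two mean value theorems: along \<open>u\<close> for the difference of \<open>f\<close>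
  in the direction \<open>v\<close>, then along \<open>v\<close> for the derivative in the direction
  \<open>u\<close>. The left side is symmetric in \<open>u\<close> and \<open>v\<close>, the right
  side contains one order of differentiation only, so exchanging the vectors compares the two mixed
  derivatives.\<close>

lemma second_difference_mean_value:
  fixes f :: "'a::euclidean_space \<Rightarrow> real"
  assumes "Cn_on 2 S f" "h > 0"
    and S: "\<And>s t. 0 \<le> s \<Longrightarrow> s \<le> h \<Longrightarrow> 0 \<le> t \<Longrightarrow> t \<le> h \<Longrightarrow> x + s *\<^sub>R u + t *\<^sub>R v \<in> S"
  obtains s t where "0 < s" "s < h" "0 < t" "t < h"
    "f (x + h *\<^sub>R u + h *\<^sub>R v) - f (x + h *\<^sub>R u) - f (x + h *\<^sub>R v) + f x =
     h\<^sup>2 * frechet_derivative (\<lambda>y. frechet_derivative f (at y) u) (at (x + s *\<^sub>R u + t *\<^sub>R v)) v"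
proof -
  have C: "Cn_on (Suc (Suc 0)) S f" using assms(1) by (simp add: numeral_2_eq_2)
  note d1 = Cn_on_SucD[OF C]
  note d2 = Cn_on_SucD[OF Cn_on_SucD'[OF C]]
  let ?\<phi> = "\<lambda>s. f (x + s *\<^sub>R u + h *\<^sub>R v) - f (x + s *\<^sub>R u)"
  have 1: "(?\<phi> has_real_derivative frechet_derivative f (at (x + s *\<^sub>R u + h *\<^sub>R v)) u
      - frechet_derivative f (at (x + s *\<^sub>R u)) u) (at s)" if "0 \<le> s" "s \<le> h" for s
  proof -
    have a: "x + s *\<^sub>R u + h *\<^sub>R v \<in> S" "x + s *\<^sub>R u \<in> S"
      using S[of s h] S[of s 0] that assms(2) by auto
    have l: "((\<lambda>s. x + s *\<^sub>R u + c) has_derivative (\<lambda>r. r *\<^sub>R u)) (at s)" for c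
      by (auto intro!: derivative_eq_intros)
    have D: "(?\<phi> has_derivative (\<lambda>r. frechet_derivative f (at (x + s *\<^sub>R u + h *\<^sub>R v)) (r *\<^sub>R u)
       - frechet_derivative f (at (x + s *\<^sub>R u)) (r *\<^sub>R u))) (at s)"
      by (intro has_derivative_diff has_derivative_compose[OF l d1[OF a(1)]]
            has_derivative_compose[OF l[of 0, simplified] d1[OF a(2)]])
    have "linear (frechet_derivative f (at y))" if "y \<in> S" for y
      using d1[OF that] has_derivative_linear by blast
    then show ?thesis
      unfolding has_field_derivative_def
      by (intro has_derivative_eq_rhs[OF D]) (use a in \<open>auto simp: fun_eq_iff linear_cmul algebra_simps\<close>)
  qed
  obtain s where s: "0 < s" "s < h" "?\<phi> h - ?\<phi> 0 = (h - 0) * (frechet_derivative f (at (x + s *\<^sub>R u + h *\<^sub>R v)) u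
      - frechet_derivative f (at (x + s *\<^sub>R u)) u)"
    using MVT2[OF assms(2) 1] by auto
  let ?\<psi> = "\<lambda>t. frechet_derivative f (at (x + s *\<^sub>R u + t *\<^sub>R v)) u"
  have 2: "(?\<psi> has_real_derivative frechet_derivative (\<lambda>y. frechet_derivative f (at y) u) (at (x + s *\<^sub>R u + t *\<^sub>R v)) v) (at t)"
    if "0 \<le> t" "t \<le> h" for t
  proof -
    have a: "x + s *\<^sub>R u + t *\<^sub>R v \<in> S" using S[of s t] s that by auto
    have l: "((\<lambda>t. x + s *\<^sub>R u + t *\<^sub>R v) has_derivative (\<lambda>r. r *\<^sub>R v)) (at t)"
      by (auto intro!: derivative_eq_intros)
    show ?thesis
      unfolding has_field_derivative_def
      by (rule has_derivative_eq_rhs[OF has_derivative_compose[OF l d2[OF a]]])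
         (use has_derivative_linear[OF d2[OF a]] in \<open>auto simp: fun_eq_iff linear_cmul\<close>)
  qed
  obtain t where t: "0 < t" "t < h" "?\<psi> h - ?\<psi> 0 = (h - 0) *
      frechet_derivative (\<lambda>y. frechet_derivative f (at y) u) (at (x + s *\<^sub>R u + t *\<^sub>R v)) v"
    using MVT2[OF assms(2) 2] by auto
  show ?thesis
    by (rule that[OF s(1,2) t(1,2)]) (use s(3) t(3) in \<open>simp add: power2_eq_square algebra_simps\<close>)
qed

text \<open>By symmetry of the second difference the two mixed derivatives agree at two points as
  close to \<open>x\<close> as desired; continuity of both excludes a gap at
  \<open>x\<close>.\<close>

lemma Cn_2_symmetric_real:
  fixes f :: "'a::euclidean_space \<Rightarrow> real"
  assumes "open S" "Cn_on 2 S f" "x \<in> S"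
  shows "frechet_derivative (\<lambda>y. frechet_derivative f (at y) u) (at x) v =
         frechet_derivative (\<lambda>y. frechet_derivative f (at y) v) (at x) u"
proof (rule ccontr)
  let ?P = "\<lambda>u v x. frechet_derivative (\<lambda>y. frechet_derivative f (at y) u) (at x) v"
  assume "?P u v x \<noteq> ?P v u x"
  define e where "e = \<bar>?P u v x - ?P v u x\<bar> / 2"
  have e: "e > 0" using \<open>?P u v x \<noteq> ?P v u x\<close> by (simp add: e_def)
  have cont: "continuous_on S (?P u v)" for u v
    using assms(2) by (simp add: numeral_2_eq_2)
  have "\<exists>d>0. \<forall>y. dist y x < d \<longrightarrow> dist (?P u v y) (?P u v x) < e" for u v
    using cont[of u v] assms(1,3) e unfolding continuous_on_eq_continuous_at[OF assms(1)] continuous_at_eps_delta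
    by (metis dist_commute)
  then obtain d1 d2 where d: "d1 > 0" "d2 > 0"
    "\<And>y. dist y x < d1 \<Longrightarrow> dist (?P u v y) (?P u v x) < e"
    "\<And>y. dist y x < d2 \<Longrightarrow> dist (?P v u y) (?P v u x) < e"
    by metis
  obtain d3 where d3: "d3 > 0" "ball x d3 \<subseteq> S"
    using assms(1,3) open_contains_ball by blast
  define d where "d = min d1 (min d2 d3)"
  have "d > 0" using d d3 by (simp add: d_def)
  \<comment> \<open>Keeps the parallelogram with sides \<open>h u\<close> and \<open>h v\<close>
    within distance \<open>d / 2\<close> of \<open>x\<close>; the summand 1 covers
    \<open>u = v = 0\<close>.\<close>
  define h where "h = d / (2 * (norm u + norm v + 1))"
  have pos: "norm u + norm v + 1 > 0" by (smt (verit) norm_ge_zero)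
  have h: "h > 0" using \<open>d > 0\<close> pos by (simp add: h_def)
  have near: "dist (x + s *\<^sub>R a + t *\<^sub>R b) x < d"
    if "0 \<le> s" "s \<le> h" "0 \<le> t" "t \<le> h" "{a,b} = {u,v}" for s t a b
  proof -
    have "dist (x + s *\<^sub>R a + t *\<^sub>R b) x \<le> s * norm a + t * norm b"
      using norm_triangle_ineq[of "s *\<^sub>R a" "t *\<^sub>R b"] that by (simp add: dist_norm add.assoc)
    also have "\<dots> \<le> h * norm a + h * norm b"
      using that by (intro add_mono mult_right_mono) auto
    also have "\<dots> \<le> h * (norm u + norm v + 1)"
      using that h by (auto simp: doubleton_eq_iff algebra_simps)
    also have "\<dots> = d / 2"
      unfolding h_def using pos by (simp del: mult_2 add: divide_simps) 
    finally show ?thesis using \<open>d > 0\<close> by simp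
  qed
  then have inS: "x + s *\<^sub>R a + t *\<^sub>R b \<in> S"
    if "0 \<le> s" "s \<le> h" "0 \<le> t" "t \<le> h" "{a,b} = {u,v}" for s t a b
    using near[OF that] d3 by (auto simp: d_def dist_commute subset_iff)
  obtain s t where st: "0 < s" "s < h" "0 < t" "t < h"
    "f (x + h *\<^sub>R u + h *\<^sub>R v) - f (x + h *\<^sub>R u) - f (x + h *\<^sub>R v) + f x = h\<^sup>2 * ?P u v (x + s *\<^sub>R u + t *\<^sub>R v)"
    using second_difference_mean_value[OF assms(2) h inS, of u v] by auto
  obtain s' t' where st': "0 < s'" "s' < h" "0 < t'" "t' < h"
    "f (x + h *\<^sub>R v + h *\<^sub>R u) - f (x + h *\<^sub>R v) - f (x + h *\<^sub>R u) + f x = h\<^sup>2 * ?P v u (x + s' *\<^sub>R v + t' *\<^sub>R u)"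
    using second_difference_mean_value[OF assms(2) h inS, of v u] by auto
  have "h\<^sup>2 * ?P u v (x + s *\<^sub>R u + t *\<^sub>R v) = h\<^sup>2 * ?P v u (x + s' *\<^sub>R v + t' *\<^sub>R u)"
    using st(5) st'(5) by (simp add: algebra_simps)
  then have "?P u v (x + s *\<^sub>R u + t *\<^sub>R v) = ?P v u (x + s' *\<^sub>R v + t' *\<^sub>R u)"
    using h by simp
  moreover have "dist (?P u v (x + s *\<^sub>R u + t *\<^sub>R v)) (?P u v x) < e"
    using d(3) near[of s t u v] st by (auto simp: d_def)
  moreover have "dist (?P v u (x + s' *\<^sub>R v + t' *\<^sub>R u)) (?P v u x) < e"
    using d(4) near[of s' t' v u] st' by (auto simp: d_def)
  ultimately show False
    unfolding e_def dist_real_def by (simp add: abs_if split: if_splits)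
qed

lemma Cn_2_symmetric:
  fixes f :: "'a::euclidean_space \<Rightarrow> 'b::euclidean_space"
  assumes "open S" "Cn_on 2 S f" "x \<in> S"
  shows "frechet_derivative (\<lambda>y. frechet_derivative f (at y) u) (at x) v =
         frechet_derivative (\<lambda>y. frechet_derivative f (at y) v) (at x) u"
proof (rule euclidean_eqI)
  fix b :: 'b assume "b \<in> Basis"
  have C: "Cn_on (Suc (Suc 0)) S f" using assms(2) by (simp add: numeral_2_eq_2)
  have bl: "bounded_linear (\<lambda>y::'b. y \<bullet> b)" by (rule bounded_linear_inner_left)
  have 1: "frechet_derivative (\<lambda>z. f z \<bullet> b) (at y) w = frechet_derivative f (at y) w \<bullet> b" if "y \<in> S" for y w
    using frechet_derivative_at[OF bounded_linear.has_derivative[OF bl Cn_on_SucD[OF C that]]] by metis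
  have 2: "frechet_derivative (\<lambda>y. frechet_derivative (\<lambda>z. f z \<bullet> b) (at y) w) (at x) w' =
      frechet_derivative (\<lambda>y. frechet_derivative f (at y) w) (at x) w' \<bullet> b" for w w'
  proof -
    have "((\<lambda>y. frechet_derivative f (at y) w \<bullet> b) has_derivative
        (\<lambda>w'. frechet_derivative (\<lambda>y. frechet_derivative f (at y) w) (at x) w' \<bullet> b)) (at x)"
      by (rule bounded_linear.has_derivative[OF bl Cn_on_SucD[OF Cn_on_SucD'[OF C] assms(3)]])
    then have "((\<lambda>y. frechet_derivative (\<lambda>z. f z \<bullet> b) (at y) w) has_derivative
        (\<lambda>w'. frechet_derivative (\<lambda>y. frechet_derivative f (at y) w) (at x) w' \<bullet> b)) (at x)"
      by (rule has_derivative_transform_within_open[OF _ assms(1,3)]) (simp add: 1)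
    then show ?thesis using frechet_derivative_at by metis
  qed
  have "Cn_on 2 S (\<lambda>z. f z \<bullet> b)" by (rule Cn_on_linear[OF assms(1) bl assms(2)])
  from Cn_2_symmetric_real[OF assms(1) this assms(3), of u v]
  show "frechet_derivative (\<lambda>y. frechet_derivative f (at y) u) (at x) v \<bullet> b =
         frechet_derivative (\<lambda>y. frechet_derivative f (at y) v) (at x) u \<bullet> b"
    by (simp add: 2)
qed

subsection \<open>Matrix operations\<close>

lemma matrix_add_distrib:
  "(A + A') ** B = A ** B + A' ** B" "A ** (B + B') = A ** B + A ** B'"
  "(A + A') *v x = A *v x + A' *v x" "A *v (x + x') = A *v x + A *v x'"
  for A :: "complex^'n::finite^'m::finite" and B :: "complex^'p::finite^'n"
  by (simp_all add: matrix_matrix_mult_def matrix_vector_mult_def vec_eq_iff sum.distrib algebra_simps)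

lemma matrix_scaleR_assoc:
  "(c *\<^sub>R A) ** B = c *\<^sub>R (A ** B)" "A ** (c *\<^sub>R B) = c *\<^sub>R (A ** B)" "(c *\<^sub>R A) *v x = c *\<^sub>R (A *v x)"
  "A *v (c *\<^sub>R x) = c *\<^sub>R (A *v x)"
  for A :: "complex^'n::finite^'m::finite" and B :: "complex^'p::finite^'n" and x :: "complex^'n"
  by (simp_all add: matrix_matrix_mult_def matrix_vector_mult_def vec_eq_iff scaleR_sum_right)

lemma matrix_diff_distrib:
  "(A - A') ** B = A ** B - A' ** B" "A ** (B - B') = A ** B - A ** B'"
  "(A - A') *v x = A *v x - A' *v x" "A *v (x - x') = A *v x - A *v x'"
  for A :: "complex^'n::finite^'m::finite" and B :: "complex^'p::finite^'n"
  by (simp_all add: matrix_matrix_mult_def matrix_vector_mult_def vec_eq_iff sum_subtractf algebra_simps)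

lemma bounded_bilinear_matrix_mult:
  "bounded_bilinear ((**) :: complex^'n::finite^'m::finite \<Rightarrow> complex^'p::finite^'n \<Rightarrow> complex^'p^'m)"
  unfolding bilinear_conv_bounded_bilinear[symmetric] bilinear_def
  by (auto intro!: linearI simp: matrix_add_distrib matrix_scaleR_assoc)

lemma bounded_bilinear_matrix_vector:
  "bounded_bilinear ((*v) :: complex^'n::finite^'m::finite \<Rightarrow> complex^'n \<Rightarrow> complex^'m)"
  unfolding bilinear_conv_bounded_bilinear[symmetric] bilinear_def
  by (auto intro!: linearI simp: matrix_add_distrib matrix_scaleR_assoc)

lemma bounded_bilinear_star_dot: "bounded_bilinear (star_dot :: complex^'n::finite \<Rightarrow> _ \<Rightarrow> _)"
  unfolding bilinear_conv_bounded_bilinear[symmetric] bilinear_def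
  by (auto intro!: linearI simp: star_dot_def algebra_simps sum.distrib scaleR_sum_right)

lemma bounded_bilinear_dot_star: "bounded_bilinear (dot_star :: complex^'n::finite \<Rightarrow> _ \<Rightarrow> _)"
  unfolding bilinear_conv_bounded_bilinear[symmetric] bilinear_def
  by (auto intro!: linearI simp: dot_star_def vec_eq_iff algebra_simps)

lemma bounded_linear_adj: "bounded_linear (adj :: complex^'n::finite^'n \<Rightarrow> _)"
  unfolding linear_conv_bounded_linear[symmetric]
  by (auto intro!: linearI simp: adj_def vec_eq_iff)

lemma bounded_linear_trace: "bounded_linear (trace :: complex^'n::finite^'n \<Rightarrow> _)"
  unfolding linear_conv_bounded_linear[symmetric]
  by (auto intro!: linearI simp: trace_def sum.distrib scaleR_sum_right)

lemma bounded_linear_mat: "bounded_linear (mat :: complex \<Rightarrow> complex^'n::finite^'n)"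
  unfolding linear_conv_bounded_linear[symmetric]
  by (auto intro!: linearI simp: mat_def vec_eq_iff)

lemma adj_adj [simp]: "adj (adj A) = A"
  by (simp add: adj_def vec_eq_iff)

lemma adj_mult: "adj (A ** B) = adj B ** adj A"
  by (simp add: adj_def matrix_matrix_mult_def vec_eq_iff mult.commute)

lemma adj_mat [simp]: "adj (mat c) = mat (cnj c)"
  by (auto simp: adj_def mat_def vec_eq_iff)

lemma star_dot_adj: "star_dot (A *v x) y = star_dot x (adj A *v y)"
  unfolding star_dot_def matrix_vector_mult_def adj_def
  by (simp add: sum_distrib_left sum_distrib_right mult_ac) (rule sum.swap)

lemma cnj_star_dot: "cnj (star_dot x y) = star_dot y x"
  by (simp add: star_dot_def mult.commute)

lemma star_dot_smult: "star_dot x (c *s y) = c * star_dot x y" "star_dot (c *s x) y = cnj c * star_dot x y"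
  by (simp_all add: star_dot_def sum_distrib_left mult_ac)

lemma inner_complex_vec: "x \<bullet> y = Re (star_dot x y)" for x y :: "complex^'n::finite"
  by (simp add: inner_vec_def star_dot_def inner_complex_def)

lemma star_dot_self: "star_dot x x = of_real ((norm x)\<^sup>2)" for x :: "complex^'n::finite"
proof (rule complex_eqI)
  show "Re (star_dot x x) = Re (of_real ((norm x)\<^sup>2))"
    by (simp add: power2_norm_eq_inner inner_complex_vec)
  show "Im (star_dot x x) = Im (of_real ((norm x)\<^sup>2))"
    by (simp add: star_dot_def)
qed


subsection \<open>Sections of the coframe bundle\<close>

lemma frechet_derivative_apply: "(f has_derivative D) (at x) \<Longrightarrow> frechet_derivative f (at x) v = D v"
  by (simp add: frechet_derivative_at[symmetric])

lemma bounded_bilinear_smult: "bounded_bilinear ((*s) :: complex \<Rightarrow> complex^'n::finite \<Rightarrow> _)"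
  unfolding bilinear_conv_bounded_bilinear[symmetric] bilinear_def
  by (auto intro!: linearI simp: vec_eq_iff algebra_simps)

lemma star_dot_add: "star_dot (x + y) z = star_dot x z + star_dot y z" "star_dot x (y + z) = star_dot x y + star_dot x z"
  "star_dot (x - y) z = star_dot x z - star_dot y z" "star_dot x (y - z) = star_dot x y - star_dot x z"
  by (simp_all add: star_dot_def algebra_simps sum.distrib sum_subtractf)

lemma star_dot_zero [simp]: "star_dot x 0 = 0" "star_dot 0 x = 0"
  by (simp_all add: star_dot_def)

lemma star_dot_sum: "star_dot x (\<Sum>i\<in>I. f i) = (\<Sum>i\<in>I. star_dot x (f i))"
  by (induction I rule: infinite_finite_induct) (simp_all add: star_dot_add)

lemma matrix_vector_smult: "A *v (c *s x) = c *s (A *v x)" for A :: "complex^'n::finite^'m"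
  by (simp add: matrix_vector_mult_def vec_eq_iff sum_distrib_left mult_ac)

lemma matrix_vector_sum: "A *v (\<Sum>i\<in>I. f i) = (\<Sum>i\<in>I. A *v f i)" for A :: "complex^'n::finite^'m::finite"
proof (induction I rule: infinite_finite_induct)
  case (insert i I)
  then show ?case by (simp add: matrix_add_distrib)
qed (simp_all add: matrix_vector_mult_def vec_eq_iff)

text \<open>Gram-Schmidt on the standard basis for the form given by \<open>K\<close>. Only ring
  operations and inverse square roots of positive functions occur, so the differentiability of
  \<open>K\<close> is inherited. The vanishing of the components outside \<open>B\<close> serves the
  induction: the new vector then has component 1 at \<open>a\<close>, hence is nonzero and has
  positive length.\<close>

lemma gram_schmidt_vectors:
  fixes K :: "'a::euclidean_space \<Rightarrow> complex^'n::finite^'n"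
  assumes S: "open S" and K: "Cn_on k S K" "\<And>x. x \<in> S \<Longrightarrow> hermitian (K x)"
    and pos: "\<And>x v. x \<in> S \<Longrightarrow> v \<noteq> 0 \<Longrightarrow> Re (star_dot v (K x *v v)) > 0"
    and "finite B"
  shows "\<exists>q :: 'n \<Rightarrow> 'a \<Rightarrow> complex^'n. (\<forall>b\<in>B. Cn_on k S (q b)) \<and>
    (\<forall>x\<in>S. \<forall>b\<in>B. \<forall>c\<in>B. star_dot (q b x) (K x *v q c x) = (if b = c then 1 else 0)) \<and>
    (\<forall>x\<in>S. \<forall>b\<in>B. \<forall>i. i \<notin> B \<longrightarrow> q b x $ i = 0)"
  using \<open>finite B\<close>
proof (induction B)
  case empty
  then show ?case by auto
next
  case (insert a B)
  then obtain q :: "'n \<Rightarrow> 'a \<Rightarrow> complex^'n" where q: "\<And>b. b \<in> B \<Longrightarrow> Cn_on k S (q b)"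
    "\<And>x b c. x \<in> S \<Longrightarrow> b \<in> B \<Longrightarrow> c \<in> B \<Longrightarrow> star_dot (q b x) (K x *v q c x) = (if b = c then 1 else 0)"
    "\<And>x b i. x \<in> S \<Longrightarrow> b \<in> B \<Longrightarrow> i \<notin> B \<Longrightarrow> q b x $ i = 0"
    by blast
  let ?e = "axis a 1 :: complex^'n"
  have swap: "cnj (star_dot v (K x *v w)) = star_dot w (K x *v v)" if "x \<in> S" for x v w
    using K(2)[OF that] by (simp add: cnj_star_dot star_dot_adj hermitian_def)
  define w where "w x = ?e - (\<Sum>c\<in>B. star_dot (q c x) (K x *v ?e) *s q c x)" for x
  define n where "n x = Re (star_dot (w x) (K x *v w x))" for x
  define r where "r x = inverse (sqrt (n x))" for x
  have Cw: "Cn_on k S w"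
    unfolding w_def
    by (intro Cn_on_diff Cn_on_const Cn_on_sum Cn_on_bilinear[OF _ bounded_bilinear_smult]
        Cn_on_bilinear[OF _ bounded_bilinear_star_dot] Cn_on_bilinear[OF _ bounded_bilinear_matrix_vector] K S q)
  have wa: "w x $ a = 1" if "x \<in> S" for x
    using q(3)[OF that] insert.hyps by (simp add: w_def axis_def)
  have w0: "w x $ i = 0" if "x \<in> S" "i \<notin> insert a B" for x i
    using q(3)[OF that(1)] that by (simp add: w_def axis_def)
  have npos: "n x > 0" if "x \<in> S" for x
    unfolding n_def using wa[OF that] by (intro pos that) auto
  have Cn: "Cn_on k S n"
    unfolding n_def
    by (intro Cn_on_linear[OF _ bounded_linear_Re] Cn_on_bilinear[OF _ bounded_bilinear_star_dot]
        Cn_on_bilinear[OF _ bounded_bilinear_matrix_vector] K S Cw)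
  have Cr: "Cn_on k S r"
    unfolding r_def using Cn_on_inverse_sqrt[OF S Cn npos] .
  have orth: "star_dot (q c x) (K x *v w x) = 0" if "x \<in> S" "c \<in> B" for x c
  proof -
    have "star_dot (q c x) (K x *v w x) = star_dot (q c x) (K x *v ?e) -
        (\<Sum>d\<in>B. star_dot (q d x) (K x *v ?e) * star_dot (q c x) (K x *v q d x))"
      by (simp add: w_def matrix_diff_distrib star_dot_add matrix_vector_sum star_dot_sum matrix_vector_smult star_dot_smult)
    also have "(\<Sum>d\<in>B. star_dot (q d x) (K x *v ?e) * star_dot (q c x) (K x *v q d x)) =
        (\<Sum>d\<in>B. star_dot (q d x) (K x *v ?e) * (if c = d then 1 else 0))"
      using that by (intro sum.cong) (auto simp: q)
    finally show ?thesis using that insert.hyps by (simp add: if_distrib cong: if_cong)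
  qed
  have scale: "star_dot v (K x *v (of_real s *s u)) = of_real s * star_dot v (K x *v u)"
    "star_dot (of_real s *s v) (K x *v u) = of_real s * star_dot v (K x *v u)" for v x s u
    by (simp_all add: star_dot_smult matrix_vector_smult)
  have nn: "star_dot (w x) (K x *v w x) = of_real (n x)" if "x \<in> S" for x
    using swap[OF that, of "w x" "w x"] by (simp add: n_def complex_eq_iff)
  define q' where "q' b x = (if b = a then of_real (r x) *s w x else q b x)" for b x
  have "a \<notin> B" by fact
  have 1: "Cn_on k S (q' b)" if "b \<in> insert a B" for b
  proof (cases "b = a")
    case True
    then show ?thesis
      using Cn_on_bilinear[OF S bounded_bilinear_smult Cn_on_linear[OF S bounded_linear_of_real Cr] Cw]
      by (simp add: q'_def[abs_def])
  qed (use that q in \<open>simp add: q'_def[abs_def]\<close>)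
  have 2: "star_dot (q' b x) (K x *v q' c x) = (if b = c then 1 else 0)"
    if "x \<in> S" "b \<in> insert a B" "c \<in> insert a B" for x b c
  proof -
    have o1: "star_dot (q d x) (K x *v w x) = 0" "star_dot (w x) (K x *v q d x) = 0" if "d \<in> B" for d
      using orth[OF \<open>x \<in> S\<close> that] swap[OF \<open>x \<in> S\<close>, of "q d x" "w x"] by auto
    have "of_real (r x) * (of_real (r x) * complex_of_real (n x)) = 1"
    proof -
      have "r x * (r x * n x) = 1"
        using npos[OF \<open>x \<in> S\<close>] by (simp add: r_def field_simps flip: power2_eq_square)
      then show ?thesis by (metis of_real_1 of_real_mult)
    qed
    then show ?thesis
      using that o1 nn[OF \<open>x \<in> S\<close>] q(2)[OF \<open>x \<in> S\<close>] \<open>a \<notin> B\<close>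
      by (auto simp: q'_def scale)
  qed
  have 3: "q' b x $ i = 0" if "x \<in> S" "b \<in> insert a B" "i \<notin> insert a B" for x b i
    using that q(3)[OF that(1)] w0[OF that(1,3)] by (auto simp: q'_def)
  show ?case using 1 2 3 by (intro exI[of _ q']) blast
qed

lemma gram_schmidt:
  fixes K :: "'a::euclidean_space \<Rightarrow> complex^'n::finite^'n"
  assumes S: "open S" and K: "Cn_on k S K" "\<And>x. x \<in> S \<Longrightarrow> hermitian (K x)"
    and pos: "\<And>x v. x \<in> S \<Longrightarrow> v \<noteq> 0 \<Longrightarrow> Re (star_dot v (K x *v v)) > 0"
  obtains Q :: "'a \<Rightarrow> complex^'n^'n" where "Cn_on k S Q" "\<And>x. x \<in> S \<Longrightarrow> adj (Q x) ** K x ** Q x = mat 1"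
proof -
  obtain q :: "'n \<Rightarrow> 'a \<Rightarrow> complex^'n" where q: "\<And>b. Cn_on k S (q b)"
    "\<And>x b c. x \<in> S \<Longrightarrow> star_dot (q b x) (K x *v q c x) = (if b = c then 1 else 0)"
    using gram_schmidt_vectors[OF assms finite, where B=UNIV] by simp blast
  define Q where "Q x = (\<chi> i j. q j x $ i)" for x
  have "Cn_on k S Q"
    unfolding Q_def by (intro Cn_on_vec_lambda S Cn_on_vec_nth q)
  moreover have "adj (Q x) ** K x ** Q x = mat 1" if "x \<in> S" for x
  proof -
    have "(adj (Q x) ** (K x ** Q x)) $ i $ j = star_dot (q i x) (K x *v q j x)" for i j
      by (simp add: adj_def Q_def matrix_matrix_mult_def matrix_vector_mult_def star_dot_def)
    then show ?thesis
      using q(2)[OF that] by (simp add: vec_eq_iff mat_def matrix_mul_assoc)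
  qed
  ultimately show ?thesis using that by blast
qed

section \<open>Kaehler forms as Hermitian matrices, and local unitary coframes\<close>

definition herm_form :: "'n::finite form2 \<Rightarrow> complex^'n \<Rightarrow> complex^'n \<Rightarrow> complex^'n \<Rightarrow> complex" where
  "herm_form \<Omega> x v w = Complex (\<Omega> x v (\<i> *s w)) (\<Omega> x v w)"

definition herm_matrix :: "'n::finite form2 \<Rightarrow> complex^'n \<Rightarrow> complex^'n^'n" where
  "herm_matrix \<Omega> x = (\<chi> i j. herm_form \<Omega> x (axis i 1) (axis j 1))"

lemma smult_i_i: "\<i> *s (\<i> *s v) = - v" for v :: "complex^'n"
  by (simp add: vec_eq_iff flip: mult.assoc)

context
  fixes k U and \<Omega> :: "'n::finite form2"
  assumes kf: "kaehler_form_on k U \<Omega>"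
begin

lemma kaehler_form_open: "open U"
  using kf by (simp add: kaehler_form_on_def)

lemma kaehler_form_bilinear: "x \<in> U \<Longrightarrow> bilinear (\<Omega> x)"
  using kf by (simp add: kaehler_form_on_def)

lemma kaehler_form_skew: assumes "x \<in> U" shows "\<Omega> x v w = - \<Omega> x w v"
proof -
  have "\<Omega> x (v + w) (v + w) = 0" "\<Omega> x v v = 0" "\<Omega> x w w = 0"
    using kf assms by (auto simp: kaehler_form_on_def)
  then show ?thesis
    using kaehler_form_bilinear[OF assms] by (simp add: bilinear_ladd bilinear_radd)
qed

lemma herm_form_smult:
  assumes "x \<in> U"
  shows "herm_form \<Omega> x v (c *s w) = c * herm_form \<Omega> x v w" "herm_form \<Omega> x (c *s v) w = cnj c * herm_form \<Omega> x v w"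
proof -
  note B = kaehler_form_bilinear[OF assms]
  have dec: "c *s v = Re c *\<^sub>R v + Im c *\<^sub>R (\<i> *s v)" for c and v :: "complex^'n"
    by (simp add: vec_eq_iff complex_eq_iff)
  have comm: "\<i> *s (c *s v) = c *s (\<i> *s v)" for v :: "complex^'n"
    by (simp add: vec_eq_iff)
  have sc: "\<i> *s (r *\<^sub>R v) = r *\<^sub>R (\<i> *s v)" for r and v :: "complex^'n"
    by (simp add: vec_eq_iff)
  have J: "\<Omega> x (\<i> *s v) w = - \<Omega> x v (\<i> *s w)" for v w
  proof -
    have "\<Omega> x (\<i> *s (\<i> *s v)) (\<i> *s w) = \<Omega> x (\<i> *s v) w"
      using kf assms unfolding kaehler_form_on_def by blast
    then show ?thesis by (simp add: smult_i_i bilinear_lneg[OF B])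
  qed
  show "herm_form \<Omega> x v (c *s w) = c * herm_form \<Omega> x v w"
    unfolding herm_form_def comm dec[of c]
    by (simp del: vector_smult_assoc add: vector_add_ldistrib sc smult_i_i bilinear_rsub[OF B] bilinear_radd[OF B] bilinear_rmul[OF B] smult_i_i bilinear_rneg[OF B] complex_eq_iff)
  show "herm_form \<Omega> x (c *s v) w = cnj c * herm_form \<Omega> x v w"
    unfolding herm_form_def dec[of c]
    by (simp del: vector_smult_assoc add: bilinear_ladd[OF B] bilinear_lmul[OF B] J smult_i_i bilinear_rneg[OF B] complex_eq_iff)
qed

lemma herm_form_sum:
  assumes "x \<in> U"
  shows "herm_form \<Omega> x v (\<Sum>i\<in>I. f i) = (\<Sum>i\<in>I. herm_form \<Omega> x v (f i))"
    "herm_form \<Omega> x (\<Sum>i\<in>I. f i) v = (\<Sum>i\<in>I. herm_form \<Omega> x (f i) v)"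
proof -
  note B = kaehler_form_bilinear[OF assms]
  have "herm_form \<Omega> x v (a + b) = herm_form \<Omega> x v a + herm_form \<Omega> x v b"
       "herm_form \<Omega> x (a + b) v = herm_form \<Omega> x a v + herm_form \<Omega> x b v" for a b
    by (simp_all add: herm_form_def vector_add_ldistrib bilinear_ladd[OF B] bilinear_radd[OF B] complex_eq_iff)
  moreover have "herm_form \<Omega> x v 0 = 0" "herm_form \<Omega> x 0 v = 0"
    using herm_form_smult(1)[OF assms, of v 0 0] herm_form_smult(2)[OF assms, of 0 0 v] by simp_all
  ultimately show "herm_form \<Omega> x v (\<Sum>i\<in>I. f i) = (\<Sum>i\<in>I. herm_form \<Omega> x v (f i))"
    "herm_form \<Omega> x (\<Sum>i\<in>I. f i) v = (\<Sum>i\<in>I. herm_form \<Omega> x (f i) v)"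
    by (induction I rule: infinite_finite_induct) simp_all
qed

lemma herm_form_matrix:
  assumes "x \<in> U"
  shows "herm_form \<Omega> x v w = star_dot v (herm_matrix \<Omega> x *v w)"
proof -
  have ex: "v = (\<Sum>i\<in>UNIV. v $ i *s axis i 1)" for v :: "complex^'n"
    by (simp add: vec_eq_iff axis_def if_distrib cong: if_cong)
  have "herm_form \<Omega> x v w = (\<Sum>i\<in>UNIV. \<Sum>j\<in>UNIV. w $ j * (cnj (v $ i) * herm_form \<Omega> x (axis i 1) (axis j 1)))"
    by (subst ex[of v], unfold herm_form_sum(2)[OF assms], intro sum.cong refl,
        subst ex[of w], unfold herm_form_sum(1)[OF assms]) (simp add: herm_form_smult[OF assms] mult_ac)
  also have "\<dots> = star_dot v (herm_matrix \<Omega> x *v w)"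
    by (simp add: star_dot_def matrix_vector_mult_def herm_matrix_def sum_distrib_left mult_ac)
  finally show ?thesis .
qed

lemma hermitian_herm_matrix: "x \<in> U \<Longrightarrow> hermitian (herm_matrix \<Omega> x)"
proof -
  assume x: "x \<in> U"
  have J: "- \<Omega> x v (\<i> *s w) = \<Omega> x (\<i> *s v) w" for v w
  proof -
    have "\<Omega> x (\<i> *s (\<i> *s v)) (\<i> *s w) = \<Omega> x (\<i> *s v) w"
      using kf x unfolding kaehler_form_on_def by blast
    then show ?thesis
      by (simp add: smult_i_i bilinear_lneg[OF kaehler_form_bilinear[OF x]] del: vector_smult_assoc)
  qed
  have "cnj (herm_form \<Omega> x v w) = herm_form \<Omega> x w v" for v w
    using J[of v w] kaehler_form_skew[OF x, of "\<i> *s v" w] kaehler_form_skew[OF x, of v w]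
    by (simp add: herm_form_def complex_eq_iff)
  then show ?thesis
    by (simp add: hermitian_def adj_def herm_matrix_def vec_eq_iff)
qed

lemma herm_matrix_pos: "x \<in> U \<Longrightarrow> v \<noteq> 0 \<Longrightarrow> Re (star_dot v (herm_matrix \<Omega> x *v v)) > 0"
  using kf by (simp add: kaehler_form_on_def herm_form_matrix[symmetric] herm_form_def)

lemma kaehler_form_eq: "x \<in> U \<Longrightarrow> \<Omega> x v w = Im (star_dot v (herm_matrix \<Omega> x *v w))"
  by (simp add: herm_form_matrix[symmetric] herm_form_def)

text \<open>The bundle asks for equality of real parts only. A complex-linear map that preserves
  them preserves the whole Hermitian form, as replacing \<open>w\<close> by \<open>-\<i> w\<close>
  recovers the imaginary part.\<close>

lemma coframe_bundle_iff: "(x, A) \<in> coframe_bundle U \<Omega> \<longleftrightarrow> x \<in> U \<and> adj A ** A = herm_matrix \<Omega> x"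
proof (cases "x \<in> U")
  case True
  have "(\<forall>v w. (A *v v) \<bullet> (A *v w) = \<Omega> x v (\<i> *s w)) \<longleftrightarrow>
    (\<forall>v w. star_dot (A *v v) (A *v w) = star_dot v (herm_matrix \<Omega> x *v w))" (is "?L = ?R")
  proof
    assume L: ?L
    show ?R
    proof (intro allI complex_eqI)
      fix v w
      show "Re (star_dot (A *v v) (A *v w)) = Re (star_dot v (herm_matrix \<Omega> x *v w))"
        using L by (simp add: inner_complex_vec herm_form_matrix[OF True, symmetric] herm_form_def)
      have "(A *v v) \<bullet> (A *v (-\<i> *s w)) = \<Omega> x v (\<i> *s (-\<i> *s w))"
        using L by blast
      moreover have "\<i> *s (-\<i> *s w) = w" by (simp add: vec_eq_iff flip: mult.assoc)
      ultimately show "Im (star_dot (A *v v) (A *v w)) = Im (star_dot v (herm_matrix \<Omega> x *v w))"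
        unfolding inner_complex_vec matrix_vector_smult star_dot_smult
        by (simp add: herm_form_matrix[OF True, symmetric] herm_form_def)
    qed
  next
    assume ?R
    then show ?L
      by (simp add: inner_complex_vec herm_form_matrix[OF True, symmetric] herm_form_def)
  qed
  also have "\<dots> \<longleftrightarrow> adj A ** A = herm_matrix \<Omega> x"
  proof
    assume R: "\<forall>v w. star_dot (A *v v) (A *v w) = star_dot v (herm_matrix \<Omega> x *v w)"
    have "star_dot (axis i 1) (B *v axis j 1) = B $ i $ j" for B :: "complex^'n^'n" and i j
      by (simp add: star_dot_def matrix_vector_mult_def axis_def if_distrib if_distribR cong: if_cong)
    then have "(adj A ** A) $ i $ j = herm_matrix \<Omega> x $ i $ j" for i j
      using R[rule_format, of "axis i 1" "axis j 1"] by (metis star_dot_adj matrix_vector_mul_assoc)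
    then show "adj A ** A = herm_matrix \<Omega> x" by (simp add: vec_eq_iff)
  qed (simp add: star_dot_adj matrix_vector_mul_assoc)
  finally show ?thesis using True by (simp add: coframe_bundle_def)
qed (simp add: coframe_bundle_def)

lemma Cn_on_herm_matrix: "enat m \<le> k \<Longrightarrow> Cn_on m U (herm_matrix \<Omega>)"
proof -
  assume "enat m \<le> k"
  then have C: "Cn_on m U (\<lambda>x. \<Omega> x v w)" for v w
    using kf by (simp add: kaehler_form_on_def Ck_on_def)
  have "herm_matrix \<Omega> = (\<lambda>x. \<chi> i j. of_real (\<Omega> x (axis i 1) (\<i> *s axis j 1)) + \<i> * of_real (\<Omega> x (axis i 1) (axis j 1)))"
    by (simp add: herm_matrix_def herm_form_def vec_eq_iff fun_eq_iff complex_eq_iff)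
  moreover have "Cn_on m U \<dots>"
    by (intro Cn_on_vec_lambda Cn_on_add Cn_on_mult Cn_on_const
        Cn_on_linear[OF _ bounded_linear_of_real] C kaehler_form_open)
  ultimately show ?thesis by simp
qed

text \<open>If \<open>adj Q K Q\<close> is the identity, then \<open>adj Q K\<close> is the inverse
  of \<open>Q\<close> and a unitary coframe; as a product it is as differentiable as its factors. A
  constant unitary matrix on the left moves the section inside the bundle, which leaves its value at
  \<open>x0\<close> free to be prescribed.\<close>

lemma coframe_section:
  assumes "enat m \<le> k"
  obtains A where "Cn_on m U A" "\<And>x. x \<in> U \<Longrightarrow> (x, A x) \<in> coframe_bundle U \<Omega>"
    "(x0, A0) \<in> coframe_bundle U \<Omega> \<Longrightarrow> A x0 = A0"
proof -
  let ?K = "herm_matrix \<Omega>"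
  obtain Q where Q: "Cn_on m U Q" "\<And>x. x \<in> U \<Longrightarrow> adj (Q x) ** ?K x ** Q x = mat 1"
    using gram_schmidt[OF kaehler_form_open Cn_on_herm_matrix[OF assms] hermitian_herm_matrix herm_matrix_pos]
    by blast
  define A where "A x = adj (Q x) ** ?K x" for x
  have CA: "Cn_on m U A"
    unfolding A_def
    by (intro Cn_on_bilinear[OF _ bounded_bilinear_matrix_mult] Cn_on_linear[OF _ bounded_linear_adj]
        kaehler_form_open Q Cn_on_herm_matrix assms)
  have AQ: "A x ** Q x = mat 1" if "x \<in> U" for x
    using Q(2)[OF that] by (simp add: A_def)
  then have QA: "Q x ** A x = mat 1" if "x \<in> U" for x
    using that matrix_left_right_inverse by blast
  have AA: "adj (A x) ** A x = ?K x" if "x \<in> U" for x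
  proof -
    have "adj (A x) ** (adj (Q x) ** ?K x ** Q x) ** A x = adj (A x) ** A x"
      using Q(2)[OF that] by simp
    moreover have "adj (A x) ** adj (Q x) = mat 1"
      using QA[OF that] by (metis adj_mult adj_mat complex_cnj_one)
    ultimately show ?thesis
      using QA[OF that] by (metis matrix_mul_assoc matrix_mul_lid matrix_mul_rid)
  qed
  \<comment> \<open>The unitary matrix that carries the coframe found at \<open>x0\<close> to
    \<open>A0\<close>. If \<open>A0\<close> is no coframe there, any unitary matrix will do, and the
    identity is taken.\<close>
  define C where "C = (if (x0, A0) \<in> coframe_bundle U \<Omega> then A0 ** Q x0 else mat 1)"
  have CC: "adj C ** C = mat 1"
    using Q(2)[of x0] by (auto simp: C_def adj_mult matrix_mul_assoc coframe_bundle_iff)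
      (metis matrix_mul_assoc)
  show ?thesis
  proof
    show "Cn_on m U (\<lambda>x. C ** A x)"
      by (intro Cn_on_bilinear[OF _ bounded_bilinear_matrix_mult] Cn_on_const kaehler_form_open CA)
    show "(x, C ** A x) \<in> coframe_bundle U \<Omega>" if "x \<in> U" for x
      using that AA[OF that] CC unfolding coframe_bundle_iff adj_mult
      by (metis matrix_mul_assoc matrix_mul_lid)
    show "C ** A x0 = A0" if "(x0, A0) \<in> coframe_bundle U \<Omega>"
      using that QA[of x0] by (simp add: C_def coframe_bundle_iff matrix_mul_assoc[symmetric])
  qed
qed

end

subsection \<open>Pulling forms back along a map into a subset\<close>

lemma Cn_on_1_compose:
  fixes g :: "'b::euclidean_space \<Rightarrow> 'c::real_normed_vector" and s :: "'a::euclidean_space \<Rightarrow> 'b"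
  assumes "open N" "open W" "Cn_on 1 W g" "Cn_on 1 N s" "s ` N \<subseteq> W"
  shows "Cn_on 1 N (\<lambda>x. g (s x))"
proof -
  have g: "Cn_on (Suc 0) W g" and s: "Cn_on (Suc 0) N s" using assms by auto
  let ?g = "\<lambda>x. frechet_derivative g (at x)" and ?s = "\<lambda>x. frechet_derivative s (at x)"
  have d: "((\<lambda>x. g (s x)) has_derivative (\<lambda>v. ?g (s x) (?s x v))) (at x)" if "x \<in> N" for x
    by (rule has_derivative_compose[OF Cn_on_SucD[OF s that] Cn_on_SucD[OF g]]) (use assms that in auto)
  have exp: "?g (s x) (?s x v) = (\<Sum>b\<in>Basis. (?s x v \<bullet> b) *\<^sub>R ?g (s x) b)" if "x \<in> N" for x v
  proof -
    have "linear (?g (s x))"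
      using Cn_on_SucD[OF g, of "s x"] has_derivative_linear assms that by blast
    then show ?thesis
      by (subst euclidean_representation[of "?s x v", symmetric]) (simp add: linear_sum linear_cmul)
  qed
  have c: "continuous_on N (\<lambda>x. ?s x v)" "continuous_on W (\<lambda>x. ?g x b)" for v b
    using g s by auto
  have "continuous_on N (\<lambda>x. \<Sum>b\<in>Basis. (?s x v \<bullet> b) *\<^sub>R ?g (s x) b)" for v
    using assms(5)
    by (intro continuous_intros c continuous_on_compose2[OF c(2) Cn_on_imp_continuous_on[OF s]]) auto
  then have "Cn_on 0 N (\<lambda>x. ?g (s x) (?s x v))" for v
    by (simp add: exp cong: continuous_on_cong)
  then show ?thesis
    using Cn_on_SucI[OF d, of N 0] assms(1) by simp
qed

lemma tangent_space_section:
  assumes "open U" "\<And>x. x \<in> U \<Longrightarrow> s x \<in> P" "(s has_derivative s') (at x)" "x \<in> U"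
  shows "s' v \<in> tangent_space P (s x)"
proof -
  \<comment> \<open>The curve is frozen at \<open>s x\<close> where the line has left
    \<open>U\<close>, so that it stays in \<open>P\<close> for all times; near 0 it is the image of
    the line.\<close>
  define \<gamma> where "\<gamma> t = (if x + t *\<^sub>R v \<in> U then s (x + t *\<^sub>R v) else s x)" for t :: real
  have "open ((\<lambda>t. x + t *\<^sub>R v) -` U)"
    by (rule open_vimage[OF assms(1)]) (auto intro!: continuous_intros)
  moreover have "0 \<in> (\<lambda>t. x + t *\<^sub>R v) -` U" using assms(4) by simp
  moreover have "(\<gamma> has_derivative (\<lambda>r. r *\<^sub>R s' v)) (at 0)"
  proof (rule has_derivative_transform_within_open[OF _ calculation])
    have "((\<lambda>t. x + t *\<^sub>R v) has_derivative (\<lambda>r. r *\<^sub>R v)) (at 0)"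
      by (auto intro!: derivative_eq_intros)
    then have "((\<lambda>t. s (x + t *\<^sub>R v)) has_derivative (\<lambda>r. s' (r *\<^sub>R v))) (at 0)"
      by (rule has_derivative_compose) (use assms in simp)
    moreover have "s' (r *\<^sub>R v) = r *\<^sub>R s' v" for r
      using has_derivative_linear[OF assms(3)] by (rule linear_cmul)
    ultimately show "((\<lambda>t. s (x + t *\<^sub>R v)) has_derivative (\<lambda>r. r *\<^sub>R s' v)) (at 0)" by simp
  qed (simp add: \<gamma>_def)
  then have "(\<gamma> has_vector_derivative s' v) (at 0)" by (simp add: has_vector_derivative_def)
  then show ?thesis
    unfolding tangent_space_def
    by (intro CollectI exI[of _ \<gamma>] exI[of _ 1]) (auto simp: \<gamma>_def assms)
qed

definition ext_deriv :: "('a::euclidean_space \<Rightarrow> 'a \<Rightarrow> 'b::real_normed_vector) \<Rightarrow> 'a \<Rightarrow> 'a \<Rightarrow> 'a \<Rightarrow> 'b" where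
  "ext_deriv \<alpha> x v w = frechet_derivative (\<lambda>y. \<alpha> y w) (at x) v - frechet_derivative (\<lambda>y. \<alpha> y v) (at x) w"

text \<open>With a local extension \<open>A\<close> of the form, the derivative of
  \<open>A (s y) (s' y w)\<close> in the direction \<open>v\<close> is the derivative of
  \<open>A\<close> along the section plus \<open>A\<close> applied to the second derivative of
  \<open>s\<close>. The latter is symmetric in \<open>v\<close> and \<open>w\<close> and drops out,
  which is why the section has to be C^2. The extensions differ from point to point, so
  differentiability is glued from local statements.\<close>

lemma pullback_ext_derivative:
  fixes s :: "'a::euclidean_space \<Rightarrow> 'c::euclidean_space" and \<alpha> :: "'c \<Rightarrow> 'c \<Rightarrow> 'b::euclidean_space"
  assumes U: "open U" and s: "Cn_on 2 U s" "\<And>x. x \<in> U \<Longrightarrow> s x \<in> P"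
    and ext: "has_ext_derivative_on P \<alpha> \<beta>"
  defines "a \<equiv> \<lambda>x v. \<alpha> (s x) (frechet_derivative s (at x) v)"
  shows "Cn_on 1 U (\<lambda>x. a x v)"
    and "x \<in> U \<Longrightarrow> ext_deriv a x v w = \<beta> (s x) (frechet_derivative s (at x) v) (frechet_derivative s (at x) w)"
proof -
  let ?s = "\<lambda>x. frechet_derivative s (at x)"
  have s2: "Cn_on (Suc (Suc 0)) U s" using s(1) by (simp add: numeral_2_eq_2)
  note ds = Cn_on_SucD[OF s2] and C1s = Cn_on_SucD'[OF s2]
  have tan: "?s x v \<in> tangent_space P (s x)" if "x \<in> U" for x v
    by (rule tangent_space_section[OF U s(2) ds that]) (simp_all add: that)
  have main: "\<exists>N. open N \<and> x \<in> N \<and> (\<forall>v. Cn_on 1 N (\<lambda>x. a x v)) \<and>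
     (\<forall>v w. ext_deriv a x v w = \<beta> (s x) (?s x v) (?s x w))" if x: "x \<in> U" for x
  proof -
    obtain W A where W: "open W" "s x \<in> W" and lin: "\<And>q. q \<in> W \<Longrightarrow> linear (A q)"
      and CA: "\<And>v. Ck_on 1 W (\<lambda>q. A q v)"
      and eq: "\<And>q v. q \<in> P \<inter> W \<Longrightarrow> v \<in> tangent_space P q \<Longrightarrow> A q v = \<alpha> q v"
      and \<beta>: "\<And>v w. v \<in> tangent_space P (s x) \<Longrightarrow> w \<in> tangent_space P (s x) \<Longrightarrow>
           \<beta> (s x) v w = frechet_derivative (\<lambda>q. A q w) (at (s x)) v - frechet_derivative (\<lambda>q. A q v) (at (s x)) w"
      using ext s(2)[OF x] unfolding has_ext_derivative_on_def by metis
    have CA1: "Cn_on (Suc 0) W (\<lambda>q. A q v)" for v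
      using CA[of v] unfolding Ck_on_def One_nat_def[symmetric] by (simp add: one_enat_def del: Cn_on.simps One_nat_def)
    define N where "N = U \<inter> s -` W"
    have N: "open N" "x \<in> N" "N \<subseteq> U" "s ` N \<subseteq> W"
      using continuous_open_preimage[OF Cn_on_imp_continuous_on[OF s(1)] U W(1)] W x by (auto simp: N_def)
    have aeq: "a y v = (\<Sum>b\<in>Basis. (?s y v \<bullet> b) *\<^sub>R A (s y) b)" if "y \<in> N" for y v
    proof -
      have y: "y \<in> U" "s y \<in> W" using that by (auto simp: N_def)
      have "a y v = A (s y) (?s y v)" unfolding a_def using eq s(2) y tan by auto
      also have "\<dots> = (\<Sum>b\<in>Basis. (?s y v \<bullet> b) *\<^sub>R A (s y) b)"
        using lin[OF y(2)]
        by (subst euclidean_representation[of "?s y v", symmetric]) (simp add: linear_sum linear_cmul)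
      finally show ?thesis .
    qed
    have C1sN: "Cn_on (Suc 0) N (\<lambda>x. ?s x v)" for v
      using Cn_on_subset[OF C1s N(3)] .
    have CsN: "Cn_on 1 N s" using Cn_on_subset[OF Cn_on_Suc_imp[OF s2] N(3)] by simp
    have CAs: "Cn_on 1 N (\<lambda>y. A (s y) b)" for b
      by (rule Cn_on_1_compose[OF N(1) W(1) _ CsN N(4)]) (use CA1 in simp)
    have "Cn_on 1 N (\<lambda>y. \<Sum>b\<in>Basis. (?s y v \<bullet> b) *\<^sub>R A (s y) b)" for v
      using C1sN[of v] CAs
      by (intro Cn_on_sum Cn_on_scaleR Cn_on_linear[OF _ bounded_linear_inner_left] N) auto
    then have CaN: "Cn_on 1 N (\<lambda>x. a x v)" for v
      by (rule Cn_on_cong) (use aeq N in auto)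
    let ?A = "\<lambda>b. frechet_derivative (\<lambda>q. A q b) (at (s x))"
    have da: "frechet_derivative (\<lambda>x. a x w) (at x) v =
      frechet_derivative (\<lambda>q. A q (?s x w)) (at (s x)) (?s x v) + A (s x) (frechet_derivative (\<lambda>y. ?s y w) (at x) v)" for v w
    proof -
      have "((\<lambda>y. \<Sum>b\<in>Basis. (?s y w \<bullet> b) *\<^sub>R A (s y) b) has_derivative
        (\<lambda>v. \<Sum>b\<in>Basis. (?s x w \<bullet> b) *\<^sub>R ?A b (?s x v) + (frechet_derivative (\<lambda>y. ?s y w) (at x) v \<bullet> b) *\<^sub>R A (s x) b)) (at x)"
        by (intro has_derivative_sum has_derivative_scaleR
            bounded_linear.has_derivative[OF bounded_linear_inner_left] Cn_on_SucD[OF C1sN] N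
            has_derivative_compose[OF ds Cn_on_SucD[OF CA1]] x W)
      then have "((\<lambda>x. a x w) has_derivative
        (\<lambda>v. \<Sum>b\<in>Basis. (?s x w \<bullet> b) *\<^sub>R ?A b (?s x v) + (frechet_derivative (\<lambda>y. ?s y w) (at x) v \<bullet> b) *\<^sub>R A (s x) b)) (at x)"
        by (rule has_derivative_transform_within_open[OF _ N(1,2)]) (simp add: aeq)
      then have 1: "frechet_derivative (\<lambda>x. a x w) (at x) v =
        (\<Sum>b\<in>Basis. (?s x w \<bullet> b) *\<^sub>R ?A b (?s x v) + (frechet_derivative (\<lambda>y. ?s y w) (at x) v \<bullet> b) *\<^sub>R A (s x) b)"
        by (rule frechet_derivative_apply)
      have exp: "A q u = (\<Sum>b\<in>Basis. (u \<bullet> b) *\<^sub>R A q b)" if "q \<in> W" for q u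
        using lin[OF that]
        by (subst euclidean_representation[of u, symmetric]) (simp add: linear_sum linear_cmul)
      have "((\<lambda>q. \<Sum>b\<in>Basis. (?s x w \<bullet> b) *\<^sub>R A q b) has_derivative
          (\<lambda>v. \<Sum>b\<in>Basis. (?s x w \<bullet> b) *\<^sub>R ?A b v)) (at (s x))"
        by (intro has_derivative_sum has_derivative_scaleR_right Cn_on_SucD[OF CA1] W)
      then have "((\<lambda>q. A q (?s x w)) has_derivative (\<lambda>v. \<Sum>b\<in>Basis. (?s x w \<bullet> b) *\<^sub>R ?A b v)) (at (s x))"
        by (rule has_derivative_transform_within_open[OF _ W]) (simp add: exp[symmetric])
      then have "frechet_derivative (\<lambda>q. A q (?s x w)) (at (s x)) v = (\<Sum>b\<in>Basis. (?s x w \<bullet> b) *\<^sub>R ?A b v)" for v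
        by (rule frechet_derivative_apply)
      then show ?thesis
        unfolding 1 by (simp add: sum.distrib exp[OF W(2), symmetric])
    qed
    have "ext_deriv a x v w = \<beta> (s x) (?s x v) (?s x w)" for v w
      unfolding ext_deriv_def da \<beta>[OF tan[OF x] tan[OF x]]
      by (simp add: Cn_2_symmetric[OF U s(1) x, of v w])
    with N CaN show ?thesis by blast
  qed
  show "Cn_on 1 U (\<lambda>x. a x v)" by (rule Cn_on_local) (use main in blast)
  show "ext_deriv a x v w = \<beta> (s x) (?s x v) (?s x w)" if "x \<in> U" using main that by blast
qed


section \<open>Block matrices\<close>

lemma sum_option_option:
  fixes f :: "'n::finite option option \<Rightarrow> 'b::comm_monoid_add"
  shows "(\<Sum>i\<in>UNIV. f i) = f None + f (Some None) + (\<Sum>j\<in>UNIV. f (Some (Some j)))"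
proof -
  have "(\<Sum>i\<in>UNIV. g i) = g None + (\<Sum>j\<in>UNIV. g (Some j))" for g :: "'a::finite option \<Rightarrow> 'b"
    by (simp add: UNIV_option_conv sum.reindex)
  from this[of f] this[of "\<lambda>j. f (Some j)"] show ?thesis by (simp add: add.assoc)
qed

lemma all_option_option: "(\<forall>i::'n option option. P i) \<longleftrightarrow> P None \<and> P (Some None) \<and> (\<forall>j. P (Some (Some j)))"
  by (metis not_None_eq)

text \<open>The row of a block matrix in the middle column is written as the adjoint of a column, so that
  \<open>Blk a b c d M e f g i\<close> is \<open>[[a, b\<^sup>*, c], [d, M, e], [f, g\<^sup>*, i]]\<close>.\<close>

definition Blk :: "complex \<Rightarrow> complex^'n \<Rightarrow> complex \<Rightarrow> complex^'n \<Rightarrow> complex^'n^'n \<Rightarrow> complex^'n \<Rightarrow>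
    complex \<Rightarrow> complex^'n \<Rightarrow> complex \<Rightarrow> complex^('n::finite option option)^('n option option)" where
  "Blk a b c d M e f g i = (\<chi> r s. case r of
     None \<Rightarrow> (case s of None \<Rightarrow> a | Some None \<Rightarrow> c | Some (Some k) \<Rightarrow> cnj (b $ k))
   | Some None \<Rightarrow> (case s of None \<Rightarrow> f | Some None \<Rightarrow> i | Some (Some k) \<Rightarrow> cnj (g $ k))
   | Some (Some j) \<Rightarrow> (case s of None \<Rightarrow> d $ j | Some None \<Rightarrow> e $ j | Some (Some k) \<Rightarrow> M $ j $ k))"

definition Bv :: "complex \<Rightarrow> complex^'n \<Rightarrow> complex \<Rightarrow> complex^('n::finite option option)" where
  "Bv a y b = (\<chi> r. case r of None \<Rightarrow> a | Some None \<Rightarrow> b | Some (Some j) \<Rightarrow> y $ j)"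

lemma Blk_nth [simp]:
  "Blk a b c d M e f g i $ None $ None = a"
  "Blk a b c d M e f g i $ None $ Some None = c"
  "Blk a b c d M e f g i $ None $ Some (Some k) = cnj (b $ k)"
  "Blk a b c d M e f g i $ Some None $ None = f"
  "Blk a b c d M e f g i $ Some None $ Some None = i"
  "Blk a b c d M e f g i $ Some None $ Some (Some k) = cnj (g $ k)"
  "Blk a b c d M e f g i $ Some (Some j) $ None = d $ j"
  "Blk a b c d M e f g i $ Some (Some j) $ Some None = e $ j"
  "Blk a b c d M e f g i $ Some (Some j) $ Some (Some k) = M $ j $ k"
  by (simp_all add: Blk_def)

lemma Bv_nth [simp]: "Bv a y b $ None = a" "Bv a y b $ Some None = b" "Bv a y b $ Some (Some j) = y $ j"
  by (simp_all add: Bv_def)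

lemma Blk_eq_iff: "Blk a b c d M e f g i = Blk a' b' c' d' M' e' f' g' i' \<longleftrightarrow>
    a = a' \<and> b = b' \<and> c = c' \<and> d = d' \<and> M = M' \<and> e = e' \<and> f = f' \<and> g = g' \<and> i = i'"
  by (auto simp: vec_eq_iff all_option_option)

lemma Blk_eqD:
  assumes "Blk a b c d M e f g i = Blk a' b' c' d' M' e' f' g' i'"
  shows "a = a'" "b = b'" "c = c'" "d = d'" "M = M'" "e = e'" "f = f'" "g = g'" "i = i'"
  using assms by (simp_all add: Blk_eq_iff)

lemma Bv_eq_iff: "Bv a y b = Bv a' y' b' \<longleftrightarrow> a = a' \<and> y = y' \<and> b = b'"
  by (auto simp: vec_eq_iff all_option_option)

lemma Blk_cases:
  obtains a b c d M e f g i where "X = Blk a b c d M e f g i"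
proof
  show "X = Blk (X $ None $ None) (\<chi> k. cnj (X $ None $ Some (Some k))) (X $ None $ Some None)
     (\<chi> j. X $ Some (Some j) $ None) (\<chi> j k. X $ Some (Some j) $ Some (Some k)) (\<chi> j. X $ Some (Some j) $ Some None)
     (X $ Some None $ None) (\<chi> k. cnj (X $ Some None $ Some (Some k))) (X $ Some None $ Some None)"
    by (simp add: vec_eq_iff all_option_option)
qed

lemma Bv_cases: obtains a y b where "x = Bv a y b"
proof
  show "x = Bv (x $ None) (\<chi> j. x $ Some (Some j)) (x $ Some None)"
    by (simp add: vec_eq_iff all_option_option)
qed

lemma mat_mult_nth: "(mat c ** M) $ i $ j = c * M $ i $ j" "(M ** mat c) $ i $ j = c * M $ i $ j"
  for M :: "complex^'n::finite^'n"
  by (simp_all add: matrix_matrix_mult_def mat_def if_distrib if_distribR mult.commute cong: if_cong)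

lemma mat_nth: "mat c $ i $ j = (if i = j then c else 0)"
  by (simp add: mat_def)

lemma mat_mult_commute: "mat c ** M = M ** mat c" for M :: "complex^'n::finite^'n"
  by (simp add: vec_eq_iff mat_mult_nth)

lemma mat_vec_mult [simp]: "mat c *v x = c *s x" for x :: "complex^'n::finite"
  by (simp add: matrix_vector_mult_def mat_def vec_eq_iff if_distrib if_distribR cong: if_cong)

lemma Blk_add: "Blk a b c d M e f g i + Blk a' b' c' d' M' e' f' g' i' =
    Blk (a + a') (b + b') (c + c') (d + d') (M + M') (e + e') (f + f') (g + g') (i + i')"
  by (simp add: vec_eq_iff all_option_option)

lemma Blk_diff: "Blk a b c d M e f g i - Blk a' b' c' d' M' e' f' g' i' =
    Blk (a - a') (b - b') (c - c') (d - d') (M - M') (e - e') (f - f') (g - g') (i - i')"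
  by (simp add: vec_eq_iff all_option_option)

lemma Blk_zero: "0 = Blk 0 0 0 0 0 0 0 0 0"
  by (simp add: vec_eq_iff all_option_option)

lemma Blk_mat: "mat k = Blk k 0 0 0 (mat k) 0 0 0 k"
  by (auto simp: vec_eq_iff all_option_option mat_def)

lemma Blk_scale: "mat k ** Blk a b c d M e f g i =
    Blk (k * a) (cnj k *s b) (k * c) (k *s d) (mat k ** M) (k *s e) (k * f) (cnj k *s g) (k * i)"
  by (simp add: vec_eq_iff all_option_option mat_mult_nth)

lemma Blk_scaleR: "r *\<^sub>R Blk a b c d M e f g i =
    Blk (r *\<^sub>R a) (r *\<^sub>R b) (r *\<^sub>R c) (r *\<^sub>R d) (r *\<^sub>R M) (r *\<^sub>R e) (r *\<^sub>R f) (r *\<^sub>R g) (r *\<^sub>R i)"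
  by (simp add: vec_eq_iff all_option_option)

lemma Blk_adj: "adj (Blk a b c d M e f g i) = Blk (cnj a) d (cnj f) b (adj M) g (cnj c) e (cnj i)"
  by (simp add: vec_eq_iff all_option_option adj_def)

lemma Blk_trace: "trace (Blk a b c d M e f g i) = a + trace M + i"
  by (simp add: trace_def sum_option_option)

lemma Blk_mult: "Blk a b c d M e f g i ** Blk a' b' c' d' M' e' f' g' i' =
    Blk (a * a' + star_dot b d' + c * f') (cnj a *s b' + adj M' *v b + cnj c *s g') (a * c' + star_dot b e' + c * i')
        (a' *s d + M *v d' + f' *s e) (dot_star d b' + M ** M' + dot_star e g') (c' *s d + M *v e' + i' *s e)
        (f * a' + star_dot g d' + i * f') (cnj f *s b' + adj M' *v g + cnj i *s g') (f * c' + star_dot g e' + i * i')"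
proof -
  have "(\<Sum>k\<in>UNIV. cnj (b $ k) * M' $ k $ j) = cnj ((adj M' *v b) $ j)" for j and b :: "complex^'a" and M'
    by (simp add: matrix_vector_mult_def adj_def mult.commute)
  then show ?thesis
    by (simp add: vec_eq_iff all_option_option matrix_matrix_mult_def sum_option_option)
       (simp add: star_dot_def matrix_vector_mult_def dot_star_def mult_ac)
qed

lemma Bv_mult: "Blk a b c d M e f g i *v Bv a' y' b' =
    Bv (a * a' + star_dot b y' + c * b') (a' *s d + M *v y' + b' *s e) (f * a' + star_dot g y' + i * b')"
  by (simp add: vec_eq_iff all_option_option matrix_vector_mult_def sum_option_option)
     (simp add: star_dot_def matrix_vector_mult_def mult_ac)

lemma Bv_star_dot: "star_dot (Bv a y b) (Bv a' y' b') = cnj a * a' + star_dot y y' + cnj b * b'"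
  by (simp add: star_dot_def sum_option_option)

lemma Bv_add: "Bv a y b + Bv a' y' b' = Bv (a + a') (y + y') (b + b')"
  by (simp add: vec_eq_iff all_option_option)

lemma Bv_smult: "k *s Bv a y b = Bv (k * a) (k *s y) (k * b)"
  by (simp add: vec_eq_iff all_option_option)

lemma Bv_zero: "0 = Bv 0 0 0"
  by (simp add: vec_eq_iff all_option_option)

lemma bounded_linear_Blk:
  assumes "bounded_linear a" "bounded_linear b" "bounded_linear c" "bounded_linear d" "bounded_linear M"
    "bounded_linear e" "bounded_linear f" "bounded_linear g" "bounded_linear i"
  shows "bounded_linear (\<lambda>x::'x::euclidean_space. Blk (a x) (b x) (c x) (d x) (M x) (e x) (f x) (g x) (i x))"
  using assms unfolding linear_conv_bounded_linear[symmetric]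
  by (auto intro!: linearI simp: linear_add linear_cmul Blk_add Blk_scaleR)

section \<open>The matrix \<open>X\<close>, its connection, and the algebra of their
  curvature\<close>

definition Bvi :: "complex^'n \<Rightarrow> complex^('n::finite option option)" where
  "Bvi y = Bv 0 y 0"

text \<open>On \<open>Bv a y b\<close> this form is the squared norm of \<open>y\<close> minus twice
  the real part of \<open>cnj a * b\<close>: the first and last basis vectors are a null
  pair.\<close>

definition Jm :: "complex^('n::finite option option)^('n option option)" where
  "Jm = Blk 0 0 (-1) 0 (mat 1) 0 (-1) 0 0"

text \<open>The trace is zero. The entry 1 in the lower left corner says that the Hermitian form of
  \<open>Jm\<close> takes the value -1 on the first basis vector and its image under
  \<open>X\<close>.\<close>

definition Xm :: "complex^'n^'n \<Rightarrow> complex^'n \<Rightarrow> real \<Rightarrow> complex^('n::finite option option)^('n option option)" where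
  "Xm H T V = Blk (- (trace H / 2)) (- T) ((trace H)\<^sup>2 / 4 - of_real V) 0 H T 1 0 (- (trace H / 2))"

text \<open>Among the \<open>Jm\<close>-skew matrices with lower left entry 0 and middle part
  \<open>\<omega>\<close> of the first column, the entries formed from \<open>H\<close> and
  \<open>T\<close> are forced: they are what is needed for the commutator with \<open>X\<close> to
  have the block shape of a derivative of \<open>X\<close>. \<open>Tm_exhaust\<close> below is this
  statement. The scalar \<open>\<tau>\<close> commutes with everything and is fixed later by the
  curvature.\<close>

definition Tm :: "complex \<Rightarrow> complex^'n^'n \<Rightarrow> complex^'n \<Rightarrow> complex^'n^'n \<Rightarrow> complex^'n \<Rightarrow>
    complex^('n::finite option option)^('n option option)" where
  "Tm \<tau> H T \<phi> \<omega> = Blk \<tau> (H *v \<omega> + (trace H / 2) *s \<omega>) ((star_dot \<omega> T - star_dot T \<omega>) / 2)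
     \<omega> (\<phi> + mat \<tau>) (H *v \<omega> + (trace H / 2) *s \<omega>) 0 \<omega> \<tau>"

lemma dot_star_mult: "dot_star x y *v z = star_dot y z *s x" "M ** dot_star x y = dot_star (M *v x) y"
  "dot_star x y ** M = dot_star x (adj M *v y)"
  for M :: "complex^'n::finite^'n"
  by (simp_all add: dot_star_def star_dot_def matrix_vector_mult_def matrix_matrix_mult_def adj_def vec_eq_iff
      sum_distrib_left sum_distrib_right mult_ac)

lemma dot_star_add: "dot_star (x + y) z = dot_star x z + dot_star y z" "dot_star x (y + z) = dot_star x y + dot_star x z"
  "dot_star (x - y) z = dot_star x z - dot_star y z" "dot_star x (y - z) = dot_star x y - dot_star x z"
  by (simp_all add: dot_star_def vec_eq_iff algebra_simps)

lemma dot_star_zero [simp]: "dot_star 0 x = 0" "dot_star x 0 = 0"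
  by (simp_all add: dot_star_def vec_eq_iff)

lemma dot_star_nth: "dot_star x y $ i $ j = x $ i * cnj (y $ j)"
  by (simp add: dot_star_def)

lemma adj_add: "adj (A + B) = adj A + adj B" "adj (A - B) = adj A - adj B" "adj (- A) = - adj A"
  by (simp_all add: adj_def vec_eq_iff)

lemma trace_dot_star: "trace (dot_star x y) = star_dot y x"
  by (simp add: trace_def dot_star_def star_dot_def mult.commute)

lemma trace_simps: "trace (A + B) = trace A + trace B" "trace (A - B) = trace A - trace B" "trace (- A) = - trace A"
  "trace (mat c :: complex^'n::finite^'n) = of_nat CARD('n) * c" "trace (mat c ** A) = c * trace A"
  "trace (A ** mat c) = c * trace A"
  for A B :: "complex^'n::finite^'n"
  by (simp_all add: trace_def sum.distrib sum_subtractf sum_negf mat_mult_nth sum_distrib_left) (simp add: mat_def)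

lemma cnj_trace: "cnj (trace A) = trace (adj A)"
  by (simp add: trace_def adj_def)

lemma Jm_Jm: "Jm ** Jm = mat 1"
  by (simp add: Jm_def Blk_mult) (simp add: Blk_mat)

lemma adj_Jm: "adj Jm = Jm"
  by (simp add: Jm_def Blk_adj)

lemma smult_simps: "(a + b) *s x = a *s x + b *s x" "(a - b) *s x = a *s x - b *s x" "(- a) *s x = - (a *s x)"
  "a *s (x + y) = a *s x + a *s y" "a *s (x - y) = a *s x - a *s y" "a *s (- x) = - (a *s x)"
  for x y :: "complex^'n"
  by (simp_all add: vec_eq_iff algebra_simps)

lemma minus_mult: "(- A) ** B = - (A ** B)" "A ** (- B) = - (A ** B)" "(- A) *v x = - (A *v x)" "A *v (- x) = - (A *v x)"
  "star_dot (- x) y = - star_dot x y" "star_dot x (- y) = - star_dot x y"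
  "dot_star (- x) y = - dot_star x y" "dot_star x (- y) = - dot_star x y"
  for A B :: "complex^'n::finite^'n" and x y :: "complex^'n"
  by (simp_all add: matrix_matrix_mult_def matrix_vector_mult_def star_dot_def dot_star_def vec_eq_iff sum_negf)

lemma mat_add: "mat (a + b) = mat a + (mat b :: complex^'n::finite^'n)" "mat (a - b) = mat a - (mat b :: complex^'n^'n)"
  "mat (- a) = - (mat a :: complex^'n^'n)"
  by (simp_all add: mat_def vec_eq_iff)

lemma Tm_skew:
  assumes "adj H = H" "adj \<phi> = - \<phi>" "cnj \<tau> = - \<tau>"
  shows "adj (Tm \<tau> H T \<phi> \<omega>) ** Jm + Jm ** Tm \<tau> H T \<phi> \<omega> = 0"
proof -
  have "cnj (trace H) = trace H" using assms by (simp add: cnj_trace)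
  then show ?thesis
    using assms
    by (simp add: Tm_def Jm_def Blk_adj Blk_mult Blk_add Blk_zero Blk_eq_iff cnj_star_dot adj_add mat_add)
qed

lemma Xm_herm:
  assumes "adj H = H"
  shows "adj (Xm H T V) ** Jm = Jm ** Xm H T V"
proof -
  have "cnj (trace H) = trace H" using assms by (simp add: cnj_trace)
  then show ?thesis
    using assms by (simp add: Xm_def Jm_def Blk_adj Blk_mult Blk_eq_iff)
qed

text \<open>The derivatives of \<open>H\<close>, \<open>T\<close> and \<open>V\<close> prescribed by the structure equations say that \<open>Xm H T V\<close>
  is parallel for the connection \<open>Tm\<close>.\<close>

lemma Xm_parallel:
  fixes H \<phi> :: "complex^'n::finite^'n"
  assumes H: "adj H = H"
    and dH: "H' = - (\<phi> ** H) + H ** \<phi> + dot_star T \<omega> + dot_star \<omega> T"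
    and dT: "T' = - (\<phi> *v T) + (H ** H + mat (trace H) ** H + mat (of_real V)) *v \<omega>"
    and dV: "V' = trace H * (star_dot T \<omega> + star_dot \<omega> T) + (star_dot T (H *v \<omega>) + star_dot \<omega> (H *v T))"
    and \<phi>: "adj \<phi> = - \<phi>" and \<tau>: "cnj \<tau> = - \<tau>"
  shows "Blk (- (trace H' / 2)) (- T') (trace H * trace H' / 2 - V') 0 H' T' 0 0 (- (trace H' / 2)) =
    Xm H T V ** Tm \<tau> H T \<phi> \<omega> - Tm \<tau> H T \<phi> \<omega> ** Xm H T V"
proof -
  have c: "cnj (trace H) = trace H" using H by (simp add: cnj_trace)
  have t: "trace H' = star_dot T \<omega> + star_dot \<omega> T"
    unfolding dH by (simp add: trace_simps trace_dot_star trace_mul_sym[of \<phi> H])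
  have sd: "star_dot (H *v x) y = star_dot x (H *v y)" for x y
    by (simp add: star_dot_adj H)
  have mH: "mat z ** H = H ** mat z" for z by (rule mat_mult_commute)
  show ?thesis
    unfolding t unfolding dH dT dV Xm_def Tm_def Blk_mult Blk_diff Blk_eq_iff
    apply (intro conjI)
    apply (simp_all only: c H \<phi> \<tau> adj_add adj_mat adj_mult minus_mult matrix_add_distrib matrix_diff_distrib star_dot_add star_dot_smult sd
          dot_star_add dot_star_mult matrix_vector_mul_assoc[symmetric] smult_simps matrix_vector_smult cnj_star_dot star_dot_zero dot_star_zero mat_vec_mult
          complex_cnj_mult complex_cnj_diff complex_cnj_minus complex_cnj_zero complex_cnj_one complex_cnj_divide complex_cnj_power complex_cnj_numeral complex_cnj_complex_of_real
          mat_mult_commute[of \<tau>])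
    subgoal by (simp add: field_simps)
    subgoal by (simp add: vec_eq_iff field_simps power2_eq_square)
    subgoal by (simp add: field_simps power2_eq_square)
    subgoal by (simp add: vec_eq_iff field_simps power2_eq_square)
    subgoal by (simp add: vec_eq_iff dot_star_nth field_simps power2_eq_square)
    subgoal by (simp add: vec_eq_iff field_simps power2_eq_square)
    subgoal by (simp add: field_simps power2_eq_square)
    subgoal by (simp add: vec_eq_iff field_simps power2_eq_square)
    subgoal by (simp add: field_simps power2_eq_square)
    done
qed

text \<open>This is where n + 2 comes from: in the first bracket 2 from the products of
  \<open>H\<close> with \<open>\<omega> \<and> \<omega>\<^sup>*\<close> and n from the scalar term,
  and in the second 1, n and 1 from the terms with \<open>H\<close> and with its trace. A scalar
  part of the connection equal to the trace of \<open>\<phi>\<close> divided by -(n + 2) therefore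
  cancels the scalar terms of the curvature exactly.\<close>

lemma trace_curvature:
  fixes H P Q d\<phi> :: "complex^'n::finite^'n"
  assumes d\<phi>: "d\<phi> = - (P ** Q - Q ** P) + H ** mat (star_dot a b - star_dot b a)
      - H ** (dot_star a b - dot_star b a) - (dot_star a b - dot_star b a) ** H
      + mat (star_dot a (H *v b) - star_dot b (H *v a))
      + mat (trace H) ** (mat (star_dot a b - star_dot b a) - (dot_star a b - dot_star b a))"
    and H: "adj H = H"
  shows "trace d\<phi> = of_nat (CARD('n) + 2) *
    (star_dot a (H *v b) - star_dot b (H *v a) + trace H * (star_dot a b - star_dot b a))"
proof -
  have sd: "star_dot (H *v x) y = star_dot x (H *v y)" for x y
    by (simp add: star_dot_adj H)
  show ?thesis
    unfolding d\<phi>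
    by (simp add: trace_simps trace_mul_sym[of Q P] matrix_diff_distrib dot_star_mult trace_dot_star star_dot_smult H sd algebra_simps)
qed

text \<open>All forms are evaluated on a pair of tangent vectors: \<open>P\<close>, \<open>Q\<close>
  are the values of \<open>\<phi>\<close>, \<open>a\<close>, \<open>b\<close> those of
  \<open>\<omega>\<close>, \<open>Ha\<close>, \<open>Hb\<close>, \<open>Ta\<close>,
  \<open>Tb\<close> the derivatives of \<open>H\<close> and \<open>T\<close>, and
  \<open>d\<omega>\<close>, \<open>d\<phi>\<close>, \<open>d\<tau>\<close>, \<open>d\<zeta>\<close>,
  \<open>d\<kappa>\<close> the exterior derivatives of the blocks. The curvature then becomes an
  identity of matrices, checked block by block.\<close>

lemma Tm_curvature:
  fixes H P Q d\<phi> :: "complex^'n::finite^'n"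
  assumes H: "adj H = H" and P: "adj P = - P" and Q: "adj Q = - Q" and p: "cnj p = - p" and q: "cnj q = - q"
    and d\<omega>: "d\<omega> = - (P *v b - Q *v a)"
    and d\<phi>: "d\<phi> = - (P ** Q - Q ** P) + H ** mat (star_dot a b - star_dot b a)
      - H ** (dot_star a b - dot_star b a) - (dot_star a b - dot_star b a) ** H
      + mat (star_dot a (H *v b) - star_dot b (H *v a))
      + mat (trace H) ** (mat (star_dot a b - star_dot b a) - (dot_star a b - dot_star b a))"
    and Ha: "Ha = - (P ** H) + H ** P + dot_star T a + dot_star a T"
    and Hb: "Hb = - (Q ** H) + H ** Q + dot_star T b + dot_star b T"
    and Ta: "Ta = - (P *v T) + (H ** H + mat (trace H) ** H + mat (of_real V)) *v a"
    and Tb: "Tb = - (Q *v T) + (H ** H + mat (trace H) ** H + mat (of_real V)) *v b"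
    and d\<tau>: "d\<tau> = - trace d\<phi> / of_nat (CARD('n) + 2)"
    and d\<zeta>: "d\<zeta> = Ha *v b - Hb *v a + H *v d\<omega> + ((trace Ha / 2) *s b - (trace Hb / 2) *s a + (trace H / 2) *s d\<omega>)"
    and d\<kappa>: "d\<kappa> = (star_dot d\<omega> T + star_dot b Ta - star_dot a Tb - (star_dot T d\<omega> + star_dot Ta b - star_dot Tb a)) / 2"
  shows "Blk d\<tau> d\<zeta> d\<kappa> d\<omega> (d\<phi> + mat d\<tau>) d\<zeta> 0 d\<omega> d\<tau>
      + (Tm p H T P a ** Tm q H T Q b - Tm q H T Q b ** Tm p H T P a)
    = mat (star_dot a b - star_dot b a) ** Xm H T V"
proof -
  have c: "cnj (trace H) = trace H" using H by (simp add: cnj_trace)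
  have t: "trace Ha = star_dot T a + star_dot a T" "trace Hb = star_dot T b + star_dot b T"
    unfolding Ha Hb by (simp_all add: trace_simps trace_dot_star trace_mul_sym[of _ H])
  have sd: "star_dot (H *v x) y = star_dot x (H *v y)" "star_dot (P *v x) y = - star_dot x (P *v y)"
      "star_dot (Q *v x) y = - star_dot x (Q *v y)" for x y
    by (simp_all add: star_dot_adj H P Q minus_mult)
  have d\<tau>': "d\<tau> = - (star_dot a (H *v b) - star_dot b (H *v a) + trace H * (star_dot a b - star_dot b a))"
  proof -
    have "of_nat (CARD('n) + 2) \<noteq> (0::complex)" by (simp only: of_nat_eq_0_iff)
    then show ?thesis unfolding d\<tau> trace_curvature[OF d\<phi> H] by (simp del: of_nat_add)
  qed
  show ?thesis
    unfolding d\<tau>' d\<zeta> d\<kappa> d\<phi> t unfolding Ha Hb d\<omega> Ta Tb Tm_def Xm_def Blk_mult Blk_diff Blk_add Blk_scale Blk_eq_iff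
    apply (intro conjI)
    apply (simp_all only: c H P Q p q adj_add adj_mat adj_mult minus_mult matrix_add_distrib matrix_diff_distrib star_dot_add star_dot_smult sd
          dot_star_add dot_star_mult matrix_vector_mul_assoc[symmetric] smult_simps matrix_vector_smult cnj_star_dot star_dot_zero dot_star_zero mat_vec_mult
          complex_cnj_mult complex_cnj_diff complex_cnj_minus complex_cnj_zero complex_cnj_one complex_cnj_divide complex_cnj_power complex_cnj_numeral complex_cnj_complex_of_real)
    subgoal by (simp add: field_simps)
    subgoal by (simp add: vec_eq_iff field_simps power2_eq_square)
    subgoal by (simp add: field_simps power2_eq_square)
    subgoal by (simp add: vec_eq_iff field_simps power2_eq_square)
    subgoal by (simp add: vec_eq_iff dot_star_nth mat_mult_nth mat_nth matrix_diff_distrib c field_simps power2_eq_square)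
    subgoal by (simp add: vec_eq_iff field_simps power2_eq_square)
    subgoal by (simp add: field_simps power2_eq_square)
    subgoal by (simp add: vec_eq_iff field_simps power2_eq_square)
    subgoal by (simp add: field_simps power2_eq_square)
    done
qed


section \<open>Poincare lemma and flat connections\<close>

text \<open>Continuity of the derivative is asked only in each fixed direction, as 1-forms provide
  it; in finite dimension this gives the continuity in operator norm needed to differentiate under
  the integral.\<close>

lemma leibniz_parametric:
  fixes F :: "'a::euclidean_space \<Rightarrow> real \<Rightarrow> 'b::euclidean_space"
  assumes S: "open S" "convex S"
    and D: "\<And>x t. x \<in> S \<Longrightarrow> t \<in> {0..1} \<Longrightarrow> ((\<lambda>x. F x t) has_derivative F' x t) (at x)"
    and cF: "\<And>x. x \<in> S \<Longrightarrow> continuous_on {0..1} (F x)"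
    and cF': "\<And>v. continuous_on (S \<times> {0..1}) (\<lambda>(x, t). F' x t v)"
  shows "x \<in> S \<Longrightarrow> ((\<lambda>x. integral {0..1} (F x)) has_derivative (\<lambda>v. integral {0..1} (\<lambda>t. F' x t v))) (at x)"
    and "Cn_on 1 S (\<lambda>x. integral {0..1} (F x))"
proof -
  define fx where "fx x t = Blinfun (F' x t)" for x t
  have ap: "blinfun_apply (fx x t) = F' x t" if "x \<in> S" "t \<in> {0..1}" for x t
    using has_derivative_bounded_linear[OF D[OF that]] by (simp add: fx_def bounded_linear_Blinfun_apply)
  have cfx: "continuous_on (S \<times> cbox 0 1) (\<lambda>(x, t). fx x t)"
    unfolding split_beta cbox_interval
    by (rule continuous_on_blinfun_componentwise, rule continuous_on_eq[OF cF'[unfolded split_beta]])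
       (auto simp: ap)
  have d: "((\<lambda>x. integral {0..1} (F x)) has_derivative (\<lambda>v. integral {0..1} (\<lambda>t. F' x t v))) (at x)" if x: "x \<in> S" for x
  proof -
    have "((\<lambda>x. integral (cbox 0 1) (F x)) has_derivative integral (cbox 0 1) (fx x)) (at x within S)"
    proof (rule leibniz_rule[OF _ _ cfx x S(2)])
      show "((\<lambda>x. F x t) has_derivative blinfun_apply (fx x t)) (at x within S)" if "x \<in> S" "t \<in> cbox 0 1" for x t
        using D[of x t] that ap[of x t] by (auto intro: has_derivative_at_withinI)
      show "F x integrable_on cbox 0 1" if "x \<in> S" for x
        using cF[OF that] by (simp add: integrable_continuous_real)
    qed
    moreover have "blinfun_apply (integral (cbox 0 1) (fx x)) v = integral {0..1} (\<lambda>t. F' x t v)" for v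
    proof -
      have "continuous_on (cbox 0 1) (fx x)"
        using continuous_on_compose2[OF cfx continuous_on_Pair[OF continuous_on_const continuous_on_id], of x "cbox 0 1"] x by auto
      then have "blinfun_apply (integral (cbox 0 1) (fx x)) v = integral (cbox 0 1) (\<lambda>t. blinfun_apply (fx x t) v)"
        by (intro blinfun_apply_integral integrable_continuous) auto
      also have "\<dots> = integral {0..1} (\<lambda>t. F' x t v)"
        unfolding cbox_interval by (intro integral_cong) (simp add: ap x)
      finally show ?thesis .
    qed
    then have "(\<lambda>v. integral {0..1} (\<lambda>t. F' x t v)) = blinfun_apply (integral (cbox 0 1) (fx x))"
      by (simp add: fun_eq_iff)
    ultimately show ?thesis
      using x S(1) by (simp add: at_within_open[OF x S(1)] cbox_interval)
  qed
  then show "x \<in> S \<Longrightarrow> ((\<lambda>x. integral {0..1} (F x)) has_derivative (\<lambda>v. integral {0..1} (\<lambda>t. F' x t v))) (at x)" .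
  have "continuous_on S (\<lambda>x. integral (cbox 0 1) (\<lambda>t. F' x t v))" for v
    by (rule integral_continuous_on_param) (use cF'[of v] in \<open>simp add: cbox_interval\<close>)
  then show "Cn_on 1 S (\<lambda>x. integral {0..1} (F x))"
    using Cn_on_SucI[OF d, of S 0] S(1) by (simp add: cbox_interval)
qed

locale C1_form =
  fixes S :: "'a::euclidean_space set" and \<alpha> :: "'a \<Rightarrow> 'a \<Rightarrow> 'b::euclidean_space"
  assumes S: "open S"
    and lin: "x \<in> S \<Longrightarrow> linear (\<alpha> x)"
    and C1: "Cn_on 1 S (\<lambda>x. \<alpha> x v)"
begin

definition D where "D x y v = frechet_derivative (\<lambda>x. \<alpha> x y) (at x) v"

lemma has_D: "x \<in> S \<Longrightarrow> ((\<lambda>x. \<alpha> x y) has_derivative D x y) (at x)"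
  using Cn_on_SucD[of 0 S "\<lambda>x. \<alpha> x y" x] C1[of y] unfolding D_def[abs_def] by simp

lemma expand: "x \<in> S \<Longrightarrow> \<alpha> x y = (\<Sum>b\<in>Basis. (y \<bullet> b) *\<^sub>R \<alpha> x b)"
  using lin[of x]
  by (subst euclidean_representation[of y, symmetric]) (simp add: linear_sum linear_cmul)

lemma expand_D: "x \<in> S \<Longrightarrow> D x y v = (\<Sum>b\<in>Basis. (y \<bullet> b) *\<^sub>R D x b v)"
proof -
  assume x: "x \<in> S"
  have "((\<lambda>x. \<Sum>b\<in>Basis. (y \<bullet> b) *\<^sub>R \<alpha> x b) has_derivative (\<lambda>v. \<Sum>b\<in>Basis. (y \<bullet> b) *\<^sub>R D x b v)) (at x)"
    by (intro has_derivative_sum has_derivative_scaleR_right has_D x)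
  then have "((\<lambda>x. \<alpha> x y) has_derivative (\<lambda>v. \<Sum>b\<in>Basis. (y \<bullet> b) *\<^sub>R D x b v)) (at x)"
    by (rule has_derivative_transform_within_open[OF _ S x]) (simp add: expand[symmetric])
  then show ?thesis unfolding D_def by (rule frechet_derivative_apply)
qed

lemma linear_D: "x \<in> S \<Longrightarrow> linear (D x y)"
  using has_D has_derivative_linear by blast

lemma ext_D: "ext_deriv \<alpha> x v w = D x w v - D x v w"
  by (simp add: ext_deriv_def D_def)

lemma cont_apply:
  assumes "continuous_on X p" "p ` X \<subseteq> S" "continuous_on X y"
  shows "continuous_on X (\<lambda>x. \<alpha> (p x) (y x))"
proof -
  have c: "continuous_on S (\<lambda>x. \<alpha> x b)" for b
    using Cn_on_imp_continuous_on[OF C1] .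
  have "continuous_on X (\<lambda>x. \<Sum>b\<in>Basis. (y x \<bullet> b) *\<^sub>R \<alpha> (p x) b)"
    by (intro continuous_intros assms continuous_on_compose2[OF c assms(1,2)])
  then show ?thesis
    by (rule continuous_on_eq) (use assms expand in auto)
qed

lemma cont_D:
  assumes "continuous_on X p" "p ` X \<subseteq> S" "continuous_on X y" "continuous_on X v"
  shows "continuous_on X (\<lambda>x. D (p x) (y x) (v x))"
proof -
  have c: "continuous_on S (\<lambda>x. D x b c)" for b c
    using C1[of b] by (simp add: D_def)
  have eq: "D x y v = (\<Sum>b\<in>Basis. (y \<bullet> b) *\<^sub>R (\<Sum>c\<in>Basis. (v \<bullet> c) *\<^sub>R D x b c))" if "x \<in> S" for x y v
  proof -
    have "D x b v = (\<Sum>c\<in>Basis. (v \<bullet> c) *\<^sub>R D x b c)" for b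
      using linear_D[OF that, of b]
      by (subst euclidean_representation[of v, symmetric]) (simp add: linear_sum linear_cmul)
    then show ?thesis using expand_D[OF that, of y v] by simp
  qed
  have "continuous_on X (\<lambda>x. \<Sum>b\<in>Basis. (y x \<bullet> b) *\<^sub>R (\<Sum>c\<in>Basis. (v x \<bullet> c) *\<^sub>R D (p x) b c))"
    by (intro continuous_intros assms continuous_on_compose2[OF c assms(1,2)])
  then show ?thesis
    by (rule continuous_on_eq) (use assms eq in auto)
qed

lemma has_derivative_apply:
  assumes p: "(p has_derivative p') (at x)" and y: "(y has_derivative y') (at x)" and px: "p x \<in> S"
  shows "((\<lambda>x. \<alpha> (p x) (y x)) has_derivative (\<lambda>v. \<alpha> (p x) (y' v) + D (p x) (y x) (p' v))) (at x)"
proof -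
  have "((\<lambda>z. \<Sum>b\<in>Basis. (y z \<bullet> b) *\<^sub>R \<alpha> (p z) b) has_derivative
     (\<lambda>v. \<Sum>b\<in>Basis. (y x \<bullet> b) *\<^sub>R D (p x) b (p' v) + (y' v \<bullet> b) *\<^sub>R \<alpha> (p x) b)) (at x)"
    by (intro has_derivative_sum has_derivative_scaleR bounded_linear.has_derivative[OF bounded_linear_inner_left]
        y has_derivative_compose[OF p has_D[OF px]])
  moreover obtain N where "open N" "x \<in> N" "\<And>z. z \<in> N \<Longrightarrow> p z \<in> S"
    using has_derivative_continuous[OF p] S px
    by (metis continuous_at_open)
  ultimately have "((\<lambda>x. \<alpha> (p x) (y x)) has_derivative
     (\<lambda>v. \<Sum>b\<in>Basis. (y x \<bullet> b) *\<^sub>R D (p x) b (p' v) + (y' v \<bullet> b) *\<^sub>R \<alpha> (p x) b)) (at x)"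
    by (elim has_derivative_transform_within_open) (assumption, assumption, rule expand[symmetric], blast)
  then show ?thesis
    by (rule has_derivative_eq_rhs) (simp add: fun_eq_iff sum.distrib expand[OF px, of "y' v" for v] expand_D[OF px, of "y x"] add.commute)
qed

end

section \<open>Homotopy formulas for 1-forms and 2-forms on a ball\<close>

lemma ball_ray:
  fixes x0 :: "'a::real_normed_vector"
  assumes "x \<in> ball x0 r" "0 \<le> t" "t \<le> 1"
  shows "x0 + t *\<^sub>R (x - x0) \<in> ball x0 r"
proof -
  have "t * norm (x - x0) \<le> norm (x - x0)" using assms by (simp add: mult_left_le_one_le)
  then show ?thesis using assms by (simp add: dist_norm norm_minus_commute)
qed

definition radial_primitive :: "'a::euclidean_space \<Rightarrow> ('a \<Rightarrow> 'a \<Rightarrow> 'b::euclidean_space) \<Rightarrow> 'a \<Rightarrow> 'b" where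
  "radial_primitive x0 \<alpha> x = integral {0..1} (\<lambda>t. \<alpha> (x0 + t *\<^sub>R (x - x0)) (x - x0))"

text \<open>The radial integral is a primitive up to an integral of the exterior derivative. Under
  the integral the form is differentiated along \<open>v\<close> and evaluated on
  \<open>x - x0\<close>; exchanging the two vectors costs \<open>ext_deriv\<close>, and what remains
  is the derivative of \<open>t\<close> times the value on \<open>v\<close> along the ray, which
  integrates to \<open>\<alpha> x v\<close>.\<close>

lemma radial_primitive_derivative:
  assumes "C1_form (ball x0 r) \<alpha>"
  shows "x \<in> ball x0 r \<Longrightarrow> (radial_primitive x0 \<alpha> has_derivative
      (\<lambda>v. \<alpha> x v + integral {0..1} (\<lambda>t. t *\<^sub>R ext_deriv \<alpha> (x0 + t *\<^sub>R (x - x0)) v (x - x0)))) (at x)"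
    and "Cn_on 1 (ball x0 r) (radial_primitive x0 \<alpha>)"
proof -
  interpret C1_form "ball x0 r" \<alpha> by fact
  let ?S = "ball x0 r"
  let ?g = "\<lambda>x t. x0 + t *\<^sub>R (x - x0)"
  let ?F' = "\<lambda>x t v. \<alpha> (?g x t) v + D (?g x t) (x - x0) (t *\<^sub>R v)"
  note g = ball_ray
  have eq: "radial_primitive x0 \<alpha> = (\<lambda>x. integral {0..1} (\<lambda>t. \<alpha> (?g x t) (x - x0)))"
    by (simp add: fun_eq_iff radial_primitive_def)
  have d: "((\<lambda>x. \<alpha> (?g x t) (x - x0)) has_derivative ?F' x t) (at x)" if "x \<in> ?S" "t \<in> {0..1}" for x t
    by (rule has_derivative_apply) (use that g[of x x0 r t] in \<open>auto intro!: derivative_eq_intros\<close>)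
  have c: "continuous_on {0..1} (\<lambda>t. \<alpha> (?g x t) (x - x0))" if "x \<in> ?S" for x
    by (intro cont_apply continuous_intros) (use that g in auto)
  have c': "continuous_on (?S \<times> {0..1}) (\<lambda>(x, t). ?F' x t v)" for v
    unfolding split_beta
    by (intro continuous_on_add cont_apply cont_D continuous_intros) (use g in \<open>auto simp del: mem_ball\<close>)
  have L: "((\<lambda>x. integral {0..1} (\<lambda>t. \<alpha> (?g x t) (x - x0))) has_derivative
      (\<lambda>v. integral {0..1} (\<lambda>t. ?F' x t v))) (at x)" if "x \<in> ?S" for x
    by (rule leibniz_parametric(1)[OF open_ball convex_ball d c c']) (rule that | assumption)+
  show "Cn_on 1 ?S (radial_primitive x0 \<alpha>)"
    unfolding eq by (rule leibniz_parametric(2)[OF open_ball convex_ball d c c']) assumption+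
  show "(radial_primitive x0 \<alpha> has_derivative
      (\<lambda>v. \<alpha> x v + integral {0..1} (\<lambda>t. t *\<^sub>R ext_deriv \<alpha> (?g x t) v (x - x0)))) (at x)" if x: "x \<in> ?S"
    unfolding eq
  proof (rule has_derivative_eq_rhs[OF L[OF x]], rule ext)
    fix v
    let ?y = "x - x0"
    let ?h = "\<lambda>t. \<alpha> (?g x t) v + D (?g x t) v (t *\<^sub>R ?y)"
    have gS: "?g x t \<in> ?S" if "t \<in> {0..1}" for t using g x that by auto
    have split: "?F' x t v = ?h t + t *\<^sub>R ext_deriv \<alpha> (?g x t) v ?y" if "t \<in> {0..1}" for t
      by (simp add: ext_D linear_cmul[OF linear_D[OF gS[OF that]]] scaleR_diff_right[where x="D p q u" and y="D p' q' u'" for p q u p' q' u'])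
    have ch: "continuous_on {0..1} ?h"
      by (intro continuous_on_add cont_apply cont_D continuous_intros) (use gS in auto)
    have ce: "continuous_on {0..1} (\<lambda>t. t *\<^sub>R ext_deriv \<alpha> (?g x t) v ?y)"
      unfolding ext_D by (intro continuous_on_diff continuous_on_scaleR cont_D continuous_intros) (use gS in auto)
    \<comment> \<open>The integrand \<open>?h\<close> is the derivative of \<open>t\<close> times
      the value of the form on \<open>v\<close>; the factor \<open>t\<close> removes the
      contribution of \<open>x0\<close>.\<close>
    have "(?h has_integral 1 *\<^sub>R \<alpha> (?g x 1) v - 0 *\<^sub>R \<alpha> (?g x 0) v) {0..1}"
    proof (rule fundamental_theorem_of_calculus)
      fix t :: real assume t: "t \<in> {0..1}"
      have "((\<lambda>t. \<alpha> (?g x t) v) has_derivative (\<lambda>s. D (?g x t) v (s *\<^sub>R ?y))) (at t)"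
        by (rule has_derivative_compose[where f="?g x" and g="\<lambda>x. \<alpha> x v", OF _ has_D[OF gS[OF t]]]) (auto intro!: derivative_eq_intros)
      then have "((\<lambda>t. t *\<^sub>R \<alpha> (?g x t) v) has_derivative (\<lambda>s. t *\<^sub>R D (?g x t) v (s *\<^sub>R ?y) + s *\<^sub>R \<alpha> (?g x t) v)) (at t)"
        by (intro has_derivative_scaleR has_derivative_ident)
      then show "((\<lambda>t. t *\<^sub>R \<alpha> (?g x t) v) has_vector_derivative ?h t) (at t within {0..1})"
        unfolding has_vector_derivative_def
        by (rule has_derivative_at_withinI[OF has_derivative_eq_rhs])
           (simp add: fun_eq_iff linear_cmul[OF linear_D[OF gS[OF t]]] scaleR_add_right add.commute mult.commute)
    qed simp
    then have i: "integral {0..1} ?h = \<alpha> x v" by (simp add: integral_unique)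
    have "integral {0..1} (\<lambda>t. ?F' x t v) = integral {0..1} (\<lambda>t. ?h t + t *\<^sub>R ext_deriv \<alpha> (?g x t) v ?y)"
      by (rule integral_cong) (use split in simp)
    also have "\<dots> = integral {0..1} ?h + integral {0..1} (\<lambda>t. t *\<^sub>R ext_deriv \<alpha> (?g x t) v ?y)"
      by (rule Henstock_Kurzweil_Integration.integral_add) (intro integrable_continuous_real ch ce)+
    finally show "integral {0..1} (\<lambda>t. ?F' x t v) =
       \<alpha> x v + integral {0..1} (\<lambda>t. t *\<^sub>R ext_deriv \<alpha> (?g x t) v ?y)" by (simp add: i)
  qed
qed

text \<open>The primitive integrates \<open>t\<close> times \<open>\<Omega>\<close> with
  \<open>x - x0\<close> in the first slot along the ray. By closedness and skew symmetry, the
  integrand of its exterior derivative is the derivative in \<open>t\<close> of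
  \<open>t\<^sup>2\<close> times \<open>\<Omega>\<close> on \<open>v\<close>, \<open>w\<close> along
  the ray.\<close>

lemma poincare_2_form:
  fixes \<Omega> :: "'a::euclidean_space \<Rightarrow> 'a \<Rightarrow> 'a \<Rightarrow> real"
  assumes bil: "\<And>x. x \<in> ball x0 r \<Longrightarrow> bilinear (\<Omega> x)" and skew: "\<And>x v w. x \<in> ball x0 r \<Longrightarrow> \<Omega> x v w = - \<Omega> x w v"
    and C1: "\<And>v w. Cn_on 1 (ball x0 r) (\<lambda>x. \<Omega> x v w)"
    and closed: "\<And>x u v w. x \<in> ball x0 r \<Longrightarrow>
        frechet_derivative (\<lambda>y. \<Omega> y v w) (at x) u + frechet_derivative (\<lambda>y. \<Omega> y w u) (at x) v
        + frechet_derivative (\<lambda>y. \<Omega> y u v) (at x) w = 0"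
  obtains lam where "C1_form (ball x0 r) lam" "\<And>x v w. x \<in> ball x0 r \<Longrightarrow> ext_deriv lam x v w = \<Omega> x v w"
proof -
  let ?S = "ball x0 r"
  let ?g = "\<lambda>x t. x0 + t *\<^sub>R (x - x0)"
  let ?D = "\<lambda>x v w u. frechet_derivative (\<lambda>y. \<Omega> y v w) (at x) u"
  have C1': "Cn_on (Suc 0) ?S (\<lambda>x. \<Omega> x v w)" for v w using C1 by simp
  note g = ball_ray
  have form: "C1_form ?S (\<lambda>x v. \<Omega> x v w)" for w
    using bil C1 by (auto simp: C1_form_def bilinear_def simp del: Cn_on.simps One_nat_def)
  define lam where "lam x w = integral {0..1} (\<lambda>t. t * \<Omega> (?g x t) (x - x0) w)" for x w
  have Dsk: "?D x v w u = - ?D x w v u" if "x \<in> ?S" for x v w u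
  proof -
    have "((\<lambda>y. - \<Omega> y w v) has_derivative (\<lambda>u. - ?D x w v u)) (at x)"
      by (rule has_derivative_minus[OF Cn_on_SucD[OF C1' that]])
    then have "((\<lambda>y. \<Omega> y v w) has_derivative (\<lambda>u. - ?D x w v u)) (at x)"
      by (rule has_derivative_transform_within_open[OF _ open_ball that]) (simp add: skew[of _ v w])
    then show ?thesis by (rule frechet_derivative_apply)
  qed
  let ?F' = "\<lambda>w x t v. t * (\<Omega> (?g x t) v w + ?D (?g x t) (x - x0) w (t *\<^sub>R v))"
  have L: "x \<in> ?S \<Longrightarrow> ((\<lambda>x. lam x w) has_derivative (\<lambda>v. integral {0..1} (\<lambda>t. ?F' w x t v))) (at x)"
     "Cn_on 1 ?S (\<lambda>x. lam x w)" for x w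
  proof -
    interpret C1_form ?S "\<lambda>x v. \<Omega> x v w" by (rule form)
    have eqD: "D x y v = ?D x y w v" for x y v by (simp add: D_def)
    have d: "((\<lambda>x. t * \<Omega> (?g x t) (x - x0) w) has_derivative ?F' w x t) (at x)" if "x \<in> ?S" "t \<in> {0..1}" for x t
      unfolding eqD[symmetric]
      by (rule has_derivative_mult_right[OF has_derivative_apply]) (use that g[of x x0 r t] in \<open>auto intro!: derivative_eq_intros\<close>)
    have c: "continuous_on {0..1} (\<lambda>t. t * \<Omega> (?g x t) (x - x0) w)" if "x \<in> ?S" for x
      by (intro continuous_on_mult cont_apply continuous_intros) (use that g in auto)
    have c': "continuous_on (?S \<times> {0..1}) (\<lambda>(x, t). ?F' w x t v)" for v
      unfolding split_beta eqD[symmetric]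
      by (intro continuous_on_mult continuous_on_add cont_apply cont_D continuous_intros) (use g in \<open>auto simp del: mem_ball\<close>)
    show "x \<in> ?S \<Longrightarrow> ((\<lambda>x. lam x w) has_derivative (\<lambda>v. integral {0..1} (\<lambda>t. ?F' w x t v))) (at x)"
      "Cn_on 1 ?S (\<lambda>x. lam x w)"
      unfolding lam_def
      by (rule leibniz_parametric[OF open_ball convex_ball d c c'], assumption+)+
  qed
  have ext: "ext_deriv lam x v w = \<Omega> x v w" if x: "x \<in> ?S" for x v w
  proof -
    let ?y = "x - x0"
    have gS: "?g x t \<in> ?S" if "t \<in> {0..1}" for t using g x that by auto
    have c: "continuous_on {0..1} (\<lambda>t. ?F' w x t v)" for v w
    proof -
      interpret C1_form ?S "\<lambda>x v. \<Omega> x v w" by (rule form)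
      have eqD: "D x y v = ?D x y w v" for x y v by (simp add: D_def)
      show ?thesis unfolding eqD[symmetric]
        by (intro continuous_on_mult continuous_on_add cont_apply cont_D continuous_intros) (use gS in auto)
    qed
    have "ext_deriv lam x v w = integral {0..1} (\<lambda>t. ?F' w x t v) - integral {0..1} (\<lambda>t. ?F' v x t w)"
      unfolding ext_deriv_def using frechet_derivative_apply[OF L(1)[OF x]] by simp
    also have "\<dots> = integral {0..1} (\<lambda>t. ?F' w x t v - ?F' v x t w)"
      by (rule Henstock_Kurzweil_Integration.integral_diff[symmetric]; rule integrable_continuous_real; rule c)
    also have "\<dots> = integral {0..1} (\<lambda>t. 2 * t * \<Omega> (?g x t) v w + t\<^sup>2 * ?D (?g x t) v w ?y)"
    proof (rule integral_cong)
      fix t :: real assume t: "t \<in> {0..1}"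
      have lin: "?D (?g x t) a b (t *\<^sub>R u) = t * ?D (?g x t) a b u" for a b u
        using has_derivative_linear[OF Cn_on_SucD[OF C1' gS[OF t]]] by (simp add: linear_cmul)
      show "?F' w x t v - ?F' v x t w = 2 * t * \<Omega> (?g x t) v w + t\<^sup>2 * ?D (?g x t) v w ?y"
      proof -
        have 1: "?D (?g x t) ?y w v - ?D (?g x t) ?y v w = ?D (?g x t) v w ?y"
          using closed[OF gS[OF t], of v w "?y"] Dsk[OF gS[OF t], of w "?y" v] by linarith
        have "?F' w x t v - ?F' v x t w = t * (\<Omega> (?g x t) v w - \<Omega> (?g x t) w v)
            + t\<^sup>2 * (?D (?g x t) ?y w v - ?D (?g x t) ?y v w)"
          unfolding lin by (simp only: power2_eq_square) algebra
        also have "\<Omega> (?g x t) v w - \<Omega> (?g x t) w v = 2 * \<Omega> (?g x t) v w"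
          using skew[OF gS[OF t], of v w] by simp
        finally show ?thesis unfolding 1 by (simp only: mult_ac)
      qed
    qed
    also have "\<dots> = 1\<^sup>2 * \<Omega> (?g x 1) v w - 0\<^sup>2 * \<Omega> (?g x 0) v w"
    proof (rule integral_unique, rule fundamental_theorem_of_calculus)
      fix t :: real assume t: "t \<in> {0..1}"
      have "((\<lambda>t. \<Omega> (?g x t) v w) has_derivative (\<lambda>s. ?D (?g x t) v w (s *\<^sub>R ?y))) (at t)"
        by (rule has_derivative_compose[where f="?g x" and g="\<lambda>x. \<Omega> x v w", OF _ Cn_on_SucD[OF C1' gS[OF t]]]) (auto intro!: derivative_eq_intros)
      then have "((\<lambda>t. t\<^sup>2 * \<Omega> (?g x t) v w) has_derivative
          (\<lambda>s. t\<^sup>2 * ?D (?g x t) v w (s *\<^sub>R ?y) + (2 * t * s) * \<Omega> (?g x t) v w)) (at t)"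
        by (auto intro!: derivative_eq_intros)
      then show "((\<lambda>t. t\<^sup>2 * \<Omega> (?g x t) v w) has_vector_derivative
            2 * t * \<Omega> (?g x t) v w + t\<^sup>2 * ?D (?g x t) v w ?y) (at t within {0..1})"
        unfolding has_vector_derivative_def
        by (rule has_derivative_at_withinI[OF has_derivative_eq_rhs])
           (simp add: fun_eq_iff linear_cmul[OF has_derivative_linear[OF Cn_on_SucD[OF C1' gS[OF t]]]] distrib_left add.commute mult_ac)
    qed simp
    finally show ?thesis by simp
  qed
  have "linear (lam x)" if x: "x \<in> ?S" for x
  proof -
    have gS: "?g x t \<in> ?S" if "t \<in> {0..1}" for t using g x that by auto
    have c: "(\<lambda>t. t * \<Omega> (?g x t) (x - x0) w) integrable_on {0..1}" for w
    proof -
      interpret C1_form ?S "\<lambda>x v. \<Omega> x v w" by (rule form)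
      show ?thesis
        by (intro integrable_continuous_real continuous_on_mult cont_apply continuous_intros) (use gS in auto)
    qed
    show ?thesis
    proof (rule linearI)
      fix w w' :: 'a and c' :: real
      have "integral {0..1} (\<lambda>t. t * \<Omega> (?g x t) (x - x0) (w + w')) =
         integral {0..1} (\<lambda>t. t * \<Omega> (?g x t) (x - x0) w + t * \<Omega> (?g x t) (x - x0) w')"
        by (rule integral_cong) (use bil[OF gS] in \<open>simp add: bilinear_radd algebra_simps\<close>)
      then show "lam x (w + w') = lam x w + lam x w'"
        unfolding lam_def using Henstock_Kurzweil_Integration.integral_add[OF c c] by simp
      have "integral {0..1} (\<lambda>t. t * \<Omega> (?g x t) (x - x0) (c' *\<^sub>R w)) =
         integral {0..1} (\<lambda>t. c' * (t * \<Omega> (?g x t) (x - x0) w))"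
        by (rule integral_cong) (use bil[OF gS] in \<open>simp add: bilinear_rmul algebra_simps\<close>)
      then show "lam x (c' *\<^sub>R w) = c' *\<^sub>R lam x w"
        unfolding lam_def by simp
    qed
  qed
  then have "C1_form ?S lam" using L(2) by (auto simp: C1_form_def simp del: Cn_on.simps One_nat_def)
  with ext show ?thesis using that by blast
qed


lemma C1_form_subset: "C1_form S \<alpha> \<Longrightarrow> open T \<Longrightarrow> T \<subseteq> S \<Longrightarrow> C1_form T \<alpha>"
  unfolding C1_form_def using Cn_on_subset by blast

lemma C1_form_bilinear:
  fixes f :: "'a::euclidean_space \<Rightarrow> 'c::euclidean_space" and \<alpha> :: "'a \<Rightarrow> 'a \<Rightarrow> 'b::euclidean_space"
    and B :: "'c \<Rightarrow> 'b \<Rightarrow> 'd::euclidean_space"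
  assumes bb: "bounded_bilinear B" and \<alpha>: "C1_form S \<alpha>" and f: "Cn_on 1 S f"
  shows "C1_form S (\<lambda>x v. B (f x) (\<alpha> x v))"
    and "x \<in> S \<Longrightarrow> ext_deriv (\<lambda>x v. B (f x) (\<alpha> x v)) x v w =
      B (frechet_derivative f (at x) v) (\<alpha> x w) - B (frechet_derivative f (at x) w) (\<alpha> x v) + B (f x) (ext_deriv \<alpha> x v w)"
proof -
  interpret C1_form S \<alpha> by fact
  show "C1_form S (\<lambda>x v. B (f x) (\<alpha> x v))"
    using S lin C1 f unfolding C1_form_def
    by (auto intro!: Cn_on_bilinear[OF _ bb] linear_compose[OF lin, unfolded o_def]
        bounded_linear.linear[OF bounded_bilinear.bounded_linear_right[OF bb]] simp del: Cn_on.simps One_nat_def)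
  assume x: "x \<in> S"
  have df: "(f has_derivative frechet_derivative f (at x)) (at x)"
    using Cn_on_SucD[OF _ x, of 0 f] f by simp
  have "frechet_derivative (\<lambda>x. B (f x) (\<alpha> x w)) (at x) v = B (f x) (D x w v) + B (frechet_derivative f (at x) v) (\<alpha> x w)" for v w
    by (rule frechet_derivative_apply[OF bounded_bilinear.FDERIV[OF bb df has_D[OF x]]])
  then show "ext_deriv (\<lambda>x v. B (f x) (\<alpha> x v)) x v w =
      B (frechet_derivative f (at x) v) (\<alpha> x w) - B (frechet_derivative f (at x) w) (\<alpha> x v) + B (f x) (ext_deriv \<alpha> x v w)"
    by (simp add: ext_deriv_def ext_D[unfolded ext_deriv_def] bounded_bilinear.diff_right[OF bb])
qed

lemmas C1_form_mult = C1_form_bilinear[OF bounded_bilinear_matrix_mult]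

text \<open>Picard iteration: the failure \<open>dG\<^sub>k - G\<^sub>k \<Theta>\<close> of the iterates
  \<open>G\<^sub>k\<^sub>+\<^sub>1 = 1 + radial primitive of G\<^sub>k \<Theta>\<close> to be parallel is, by flatness of \<open>\<Theta>\<close>, again an integral
  of the previous failure, so it tends to zero.\<close>

theorem flat_connection_solution:
  fixes \<Theta> :: "'a::euclidean_space \<Rightarrow> 'a \<Rightarrow> complex^'k::finite^'k"
  assumes form: "C1_form U \<Theta>" and x0: "x0 \<in> U"
    and flat: "\<And>x v w. x \<in> U \<Longrightarrow> ext_deriv \<Theta> x v w = - (\<Theta> x v ** \<Theta> x w - \<Theta> x w ** \<Theta> x v)"
  obtains r G where "r > 0" "ball x0 r \<subseteq> U" "G x0 = mat 1"
    "\<And>x. x \<in> ball x0 r \<Longrightarrow> (G has_derivative (\<lambda>v. G x ** \<Theta> x v)) (at x)"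
proof -
  interpret U: C1_form U \<Theta> by fact
  obtain r1 where r1: "r1 > 0" "cball x0 r1 \<subseteq> U"
    using U.S x0 open_contains_cball by blast
  obtain C where C: "C > 0" "\<And>x v. x \<in> cball x0 r1 \<Longrightarrow> norm (\<Theta> x v) \<le> C * norm v"
  proof -
    have "\<exists>K. \<forall>x\<in>cball x0 r1. norm (\<Theta> x b) \<le> K" for b
    proof -
      have "compact ((\<lambda>x. \<Theta> x b) ` cball x0 r1)"
        by (intro compact_continuous_image continuous_on_subset[OF Cn_on_imp_continuous_on[OF U.C1] r1(2)]) auto
      then show ?thesis using compact_imp_bounded bounded_iff by (metis imageI)
    qed
    then obtain K where K: "\<And>b x. x \<in> cball x0 r1 \<Longrightarrow> norm (\<Theta> x b) \<le> K b" by metis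
    have "norm (\<Theta> x v) \<le> ((\<Sum>b\<in>Basis. \<bar>K b\<bar>) + 1) * norm v" if x: "x \<in> cball x0 r1" for x v
    proof -
      have "norm (\<Theta> x v) \<le> (\<Sum>b\<in>Basis. norm ((v \<bullet> b) *\<^sub>R \<Theta> x b))"
        using U.expand[of x v] x r1 by (metis norm_sum subsetD)
      also have "\<dots> \<le> (\<Sum>b\<in>Basis. norm v * \<bar>K b\<bar>)"
        using K[OF x] Basis_le_norm by (intro sum_mono) (auto intro!: mult_mono order.trans[OF K[OF x]])
      also have "\<dots> \<le> ((\<Sum>b\<in>Basis. \<bar>K b\<bar>) + 1) * norm v"
        by (simp add: sum_distrib_left algebra_simps)
      finally show ?thesis .
    qed
    moreover have "(\<Sum>b\<in>Basis. \<bar>K b\<bar>) + 1 > 0" by (smt (verit) sum_nonneg abs_ge_zero)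
    ultimately show ?thesis using that by blast
  qed
  obtain Km where Km: "Km > 0" "\<And>(A :: complex^'k^'k) (B :: complex^'k^'k). norm (A ** B) \<le> norm A * norm B * Km"
    using bounded_bilinear.pos_bounded[OF bounded_bilinear_matrix_mult] by blast
  \<comment> \<open>On this ball one Picard step contracts by \<open>q = Km C r\<close>, which is at
    most 1/8; the value 1/8 is what the recursion for the failure \<open>E\<close> needs
    below.\<close>
  define r where "r = min r1 (1 / (8 * Km * C))"
  have r: "r > 0" using r1 Km C by (simp add: r_def)
  let ?B = "ball x0 r"
  have BU: "?B \<subseteq> U" using r1 by (auto simp: r_def)
  have \<Theta>b: "norm (\<Theta> x v) \<le> C * norm v" if "x \<in> ?B" for x v
    using C(2) that by (auto simp: r_def)
  define q where "q = Km * C * r"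
  have q: "0 \<le> q" "q \<le> 1 / 8"
  proof -
    have "Km * C * r \<le> Km * C * (1 / (8 * Km * C))"
      using Km C by (intro mult_left_mono) (auto simp: r_def)
    then show "q \<le> 1 / 8" using Km C by (simp add: q_def)
    show "0 \<le> q" using Km C r by (simp add: q_def)
  qed
  have form: "C1_form ?B \<Theta>" by (rule C1_form_subset[OF \<open>C1_form U \<Theta>\<close> open_ball BU])
  then interpret C1_form ?B \<Theta> .
  have mb: "norm (A ** \<Theta> x v) \<le> Km * C * norm A * norm v" if "x \<in> ?B" for A :: "complex^'k^'k" and x v
  proof -
    have "norm (A ** \<Theta> x v) \<le> norm A * norm (\<Theta> x v) * Km" by (rule Km)
    also have "\<dots> \<le> norm A * (C * norm v) * Km"
      using \<Theta>b[OF that] Km by (intro mult_right_mono mult_left_mono) auto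
    finally show ?thesis by (simp add: mult_ac)
  qed
  define G where "G = rec_nat (\<lambda>x. mat 1) (\<lambda>_ G x. mat 1 + radial_primitive x0 (\<lambda>x v. G x ** \<Theta> x v) x)"
  have G0: "G 0 = (\<lambda>x. mat 1)"
    and GS: "G (Suc k) = (\<lambda>x. mat 1 + radial_primitive x0 (\<lambda>x v. G k x ** \<Theta> x v) x)" for k
    by (simp_all add: G_def)
  have CG: "Cn_on 1 ?B (G k)" for k
  proof (induction k)
    case 0
    show ?case unfolding G0 by (rule Cn_on_const) simp
  next
    case (Suc k)
    show ?case unfolding GS
      by (intro Cn_on_add Cn_on_const radial_primitive_derivative(2) C1_form_mult(1) form Suc open_ball)
  qed
  let ?G' = "\<lambda>k x. frechet_derivative (G k) (at x)"
  have dG: "(G k has_derivative ?G' k x) (at x)" if "x \<in> ?B" for k x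
    using Cn_on_SucD[OF _ that, of 0 "G k"] CG[of k] by simp
  define E where "E k x v = ?G' k x v - G k x ** \<Theta> x v" for k x v
  let ?g = "\<lambda>x t. x0 + t *\<^sub>R (x - x0)"
  have gB: "?g x t \<in> ?B" if "x \<in> ?B" "t \<in> {0..1}" for x t
    using ball_ray[of x x0 r t] that by auto
  \<comment> \<open>Flatness enters only here: the derivative of \<open>\<Theta>\<close> supplies
    the product of \<open>\<Theta>\<close> with itself that turns the derivative of
    \<open>G k\<close> into the failure \<open>E k\<close>.\<close>
  have extG: "ext_deriv (\<lambda>x v. G k x ** \<Theta> x v) x v w = E k x v ** \<Theta> x w - E k x w ** \<Theta> x v" if "x \<in> ?B" for k x v w
  proof -
    have "x \<in> U" using that BU by blast
    show ?thesis
      unfolding C1_form_mult(2)[OF form CG that] flat[OF \<open>x \<in> U\<close>] E_def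
      by (simp add: matrix_diff_distrib minus_mult matrix_mul_assoc)
  qed
  have contE: "continuous_on {0..1} (\<lambda>t. t *\<^sub>R (E k (?g x t) v ** \<Theta> (?g x t) w - E k (?g x t) w ** \<Theta> (?g x t) v))"
    if "x \<in> ?B" for k x v w
  proof -
    interpret g: C1_form ?B "\<lambda>x v. G k x ** \<Theta> x v" by (intro C1_form_mult form CG)
    have "continuous_on {0..1} (\<lambda>t. t *\<^sub>R ext_deriv (\<lambda>x v. G k x ** \<Theta> x v) (?g x t) v w)"
      unfolding g.ext_D by (intro continuous_on_scaleR continuous_on_diff g.cont_D continuous_intros) (use gB that in auto)
    then show ?thesis by (rule continuous_on_eq) (use extG gB that in auto)
  qed
  have G'S: "?G' (Suc k) x v = G k x ** \<Theta> x v +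
      integral {0..1} (\<lambda>t. t *\<^sub>R (E k (?g x t) v ** \<Theta> (?g x t) (x - x0) - E k (?g x t) (x - x0) ** \<Theta> (?g x t) v))"
    if x: "x \<in> ?B" for k x v
  proof -
    have "(G (Suc k) has_derivative (\<lambda>v. 0 + (G k x ** \<Theta> x v +
        integral {0..1} (\<lambda>t. t *\<^sub>R ext_deriv (\<lambda>x v. G k x ** \<Theta> x v) (?g x t) v (x - x0))))) (at x)"
      unfolding GS
      by (intro has_derivative_add has_derivative_const radial_primitive_derivative(1)[where r=r] C1_form_mult form CG x)
    from frechet_derivative_apply[OF this, of v]
    have "?G' (Suc k) x v = G k x ** \<Theta> x v +
        integral {0..1} (\<lambda>t. t *\<^sub>R ext_deriv (\<lambda>x v. G k x ** \<Theta> x v) (?g x t) v (x - x0))" by simp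
    also have "integral {0..1} (\<lambda>t. t *\<^sub>R ext_deriv (\<lambda>x v. G k x ** \<Theta> x v) (?g x t) v (x - x0)) =
       integral {0..1} (\<lambda>t. t *\<^sub>R (E k (?g x t) v ** \<Theta> (?g x t) (x - x0) - E k (?g x t) (x - x0) ** \<Theta> (?g x t) v))"
      by (rule integral_cong) (use extG gB x in auto)
    finally show ?thesis .
  qed
  have nx: "norm (x - x0) \<le> r" if "x \<in> ?B" for x
    using that by (simp add: dist_norm norm_minus_commute)
  define M where "M = norm (mat 1 :: complex^'k^'k)"
  have "M \<ge> 0" by (simp add: M_def)
  have d: "norm (G (Suc k) x - G k x) \<le> M * q ^ Suc k" if "x \<in> ?B" for k x
    using that
  proof (induction k arbitrary: x)
    case 0
    have c: "continuous_on {0..1} (\<lambda>t. mat 1 ** \<Theta> (?g x t) (x - x0))"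
      using cont_apply[of "{0..1}" "?g x" "\<lambda>_. x - x0"] gB 0 by (force intro!: continuous_intros)
    have "norm (integral {0..1} (\<lambda>t. mat 1 ** \<Theta> (?g x t) (x - x0))) \<le> (M * q) * (1 - 0)"
    proof (rule integral_bound[OF _ c])
      fix t :: real assume "t \<in> {0..1}"
      then have "norm (mat 1 ** \<Theta> (?g x t) (x - x0)) \<le> Km * C * M * norm (x - x0)"
        unfolding M_def using gB 0 by (intro mb) auto
      also have "\<dots> \<le> Km * C * M * r"
        using nx[OF 0] Km C \<open>M \<ge> 0\<close> by (intro mult_left_mono) auto
      finally show "norm (mat 1 ** \<Theta> (?g x t) (x - x0)) \<le> M * q" by (simp add: q_def mult_ac)
    qed simp
    then show ?case by (simp only: G0 GS radial_primitive_def) simp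
  next
    case (Suc k)
    have ci: "continuous_on {0..1} (\<lambda>t. G j (?g x t) ** \<Theta> (?g x t) (x - x0))" for j
      using C1_form.cont_apply[OF C1_form_mult(1)[OF form CG], of "{0..1}" "?g x" "\<lambda>_. x - x0" j] gB Suc.prems
      by (force intro!: continuous_intros)
    have c: "continuous_on {0..1} (\<lambda>t. (G (Suc k) (?g x t) - G k (?g x t)) ** \<Theta> (?g x t) (x - x0))"
      unfolding matrix_diff_distrib by (intro continuous_on_diff ci)
    have "G (Suc (Suc k)) x - G (Suc k) x =
      integral {0..1} (\<lambda>t. G (Suc k) (?g x t) ** \<Theta> (?g x t) (x - x0)) - integral {0..1} (\<lambda>t. G k (?g x t) ** \<Theta> (?g x t) (x - x0))"
      by (subst (1 2) GS) (simp add: radial_primitive_def)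
    also have "\<dots> = integral {0..1} (\<lambda>t. (G (Suc k) (?g x t) - G k (?g x t)) ** \<Theta> (?g x t) (x - x0))"
      unfolding matrix_diff_distrib
      by (rule Henstock_Kurzweil_Integration.integral_diff[symmetric]) (intro integrable_continuous_real ci)+
    also have "norm \<dots> \<le> (M * q ^ Suc (Suc k)) * (1 - 0)"
    proof (rule integral_bound[OF _ c])
      fix t :: real assume t: "t \<in> {0..1}"
      let ?d = "G (Suc k) (?g x t) - G k (?g x t)"
      have "norm (?d ** \<Theta> (?g x t) (x - x0)) \<le> Km * C * norm ?d * norm (x - x0)"
        using gB t Suc.prems by (intro mb) auto
      also have "\<dots> \<le> Km * C * (M * q ^ Suc k) * r"
        using nx[OF Suc.prems] Suc.IH[OF gB[OF Suc.prems t]] Km C \<open>M \<ge> 0\<close> q by (intro mult_mono mult_left_mono) auto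
      finally show "norm (?d ** \<Theta> (?g x t) (x - x0)) \<le> M * q ^ Suc (Suc k)" by (simp add: q_def mult_ac)
    qed simp
    finally show ?case by simp
  qed
  \<comment> \<open>\<open>N\<close> bounds the initial failure, which is \<open>-\<Theta>\<close>.
    Moreover \<open>Km C (M + 1)\<close> is a quarter of \<open>N\<close>, so with \<open>q\<close>
    at most 1/8 each of the two terms of the recursion is at most a quarter of the previous bound,
    and the bound is halved.\<close>
  define N where "N = 4 * Km * C * (M + 1)"
  have N: "N \<ge> 0" using Km C \<open>M \<ge> 0\<close> by (simp add: N_def)
  have e: "norm (E k x v) \<le> N * (1/2) ^ k * norm v" if "x \<in> ?B" for k x v
    using that
  proof (induction k arbitrary: x v)
    case 0
    have "?G' 0 x v = 0"
      unfolding G0 by (rule frechet_derivative_apply[OF has_derivative_const])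
    then have "norm (E 0 x v) \<le> Km * C * M * norm v"
      using mb[OF 0, of "mat 1" v] by (simp add: E_def G0 M_def)
    also have "\<dots> \<le> N * norm v"
      using Km C \<open>M \<ge> 0\<close> by (intro mult_right_mono) (auto simp: N_def mult_le_cancel_left algebra_simps)
    finally show ?case by simp
  next
    case (Suc k)
    let ?I = "\<lambda>t. t *\<^sub>R (E k (?g x t) v ** \<Theta> (?g x t) (x - x0) - E k (?g x t) (x - x0) ** \<Theta> (?g x t) v)"
    have "E (Suc k) x v = integral {0..1} ?I - (G (Suc k) x - G k x) ** \<Theta> x v"
      unfolding E_def[of "Suc k"] G'S[OF Suc.prems] by (simp add: matrix_diff_distrib)
    then have "norm (E (Suc k) x v) \<le> norm (integral {0..1} ?I) + norm ((G (Suc k) x - G k x) ** \<Theta> x v)"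
      by (simp add: norm_triangle_ineq4)
    also have "norm (integral {0..1} ?I) \<le> (2 * q * (N * (1/2) ^ k * norm v)) * (1 - 0)"
    proof (rule integral_bound[OF _ contE[OF Suc.prems]])
      fix t :: real assume t: "t \<in> {0..1}"
      note gt = gB[OF Suc.prems t]
      have b: "norm (E k (?g x t) u ** \<Theta> (?g x t) u') \<le> Km * C * (N * (1/2) ^ k * norm u) * norm u'" for u u'
      proof -
        have "norm (E k (?g x t) u ** \<Theta> (?g x t) u') \<le> Km * C * norm (E k (?g x t) u) * norm u'"
          by (rule mb[OF gt])
        also have "\<dots> \<le> Km * C * (N * (1/2) ^ k * norm u) * norm u'"
          using Suc.IH[OF gt, of u] Km C by (intro mult_right_mono mult_left_mono) auto
        finally show ?thesis .
      qed
      let ?a = "E k (?g x t) v ** \<Theta> (?g x t) (x - x0)" and ?b = "E k (?g x t) (x - x0) ** \<Theta> (?g x t) v"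
      have "norm (?I t) \<le> 1 * norm (?a - ?b)"
        using t by (simp add: mult_left_le_one_le)
      also have "\<dots> \<le> norm ?a + norm ?b" by (simp add: norm_triangle_ineq4)
      also have "\<dots> \<le> 2 * (Km * C * (N * (1/2) ^ k * norm v) * norm (x - x0))"
        using b[of v "x - x0"] b[of "x - x0" v] by (simp add: mult_ac)
      also have "\<dots> \<le> 2 * (Km * C * (N * (1/2) ^ k * norm v) * r)"
        using nx[OF Suc.prems] Km C N by (intro mult_left_mono) auto
      finally show "norm (?I t) \<le> 2 * q * (N * (1/2) ^ k * norm v)" by (simp add: q_def mult_ac)
    qed simp
    also have "norm ((G (Suc k) x - G k x) ** \<Theta> x v) \<le> Km * C * (M * q ^ Suc k) * norm v"
      using mb[OF Suc.prems, of "G (Suc k) x - G k x" v] d[OF Suc.prems, of k] Km C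
      by (smt (verit, best) mult_left_mono mult_right_mono norm_ge_zero mult_nonneg_nonneg)
    also have "(2 * q * (N * (1/2) ^ k * norm v)) * (1 - 0) + Km * C * (M * q ^ Suc k) * norm v \<le> N * (1/2) ^ Suc k * norm v"
    proof -
      have 1: "2 * q * (N * (1/2) ^ k * norm v) \<le> (1/4) * (N * (1/2) ^ k * norm v)"
        using q N by (intro mult_right_mono) auto
      have "q ^ Suc k \<le> (1/2) ^ k * 1"
        unfolding power_Suc2 using q by (intro mult_mono power_mono) auto
      then have "Km * C * (M * q ^ Suc k) \<le> Km * C * ((M + 1) * (1/2) ^ k)"
        using Km C \<open>M \<ge> 0\<close> q by (intro mult_left_mono mult_mono) auto
      also have "\<dots> = (1/4) * (N * (1/2) ^ k)" by (simp add: N_def)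
      finally have "Km * C * (M * q ^ Suc k) * norm v \<le> (1/4) * (N * (1/2) ^ k) * norm v"
        by (intro mult_right_mono) auto
      with 1 show ?thesis by simp
    qed
    finally show ?case by simp
  qed
  have "summable (\<lambda>k. M * q ^ Suc k)"
    using q by (intro summable_mult) (simp add: summable_geometric)
  from Weierstrass_m_test[OF d this]
  have "uniform_limit ?B (\<lambda>n x. \<Sum>i<n. G (Suc i) x - G i x) (\<lambda>x. \<Sum>i. G (Suc i) x - G i x) sequentially" .
  then have "uniform_limit ?B (\<lambda>n x. mat 1 + (\<Sum>i<n. G (Suc i) x - G i x)) (\<lambda>x. mat 1 + (\<Sum>i. G (Suc i) x - G i x)) sequentially"
    by (intro uniform_limit_intros)
  moreover have "(\<lambda>n x. mat 1 + (\<Sum>i<n. G (Suc i) x - G i x)) = G"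
    by (simp add: fun_eq_iff sum_lessThan_telescope[of "\<lambda>i. G i x" for x] G0)
  moreover define L where "L x = mat 1 + (\<Sum>i. G (Suc i) x - G i x)" for x
  ultimately have lim: "uniform_limit ?B G L sequentially" by (simp add: L_def[abs_def])
  have limN: "(\<lambda>n. N * (1/2) ^ n) \<longlonglongrightarrow> N * 0"
    by (intro tendsto_mult tendsto_const LIMSEQ_power_zero) simp
  \<comment> \<open>The derivative of \<open>G n\<close> is \<open>G n\<close> times
    \<open>\<Theta>\<close> plus the failure \<open>E n\<close>, so it converges uniformly on
    bounded vectors to \<open>L\<close> times \<open>\<Theta>\<close>, and the limit may be
    differentiated.\<close>
  have "\<exists>g. \<forall>x\<in>?B. (\<lambda>n. G n x) \<longlonglongrightarrow> g x \<and> (g has_derivative (\<lambda>v. L x ** \<Theta> x v)) (at x within ?B)"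
  proof (rule has_derivative_sequence[OF convex_ball])
    show "(G n has_derivative ?G' n x) (at x within ?B)" if "x \<in> ?B" for n x
      using dG[OF that] by (rule has_derivative_at_withinI)
    show "\<forall>\<^sub>F n in sequentially. \<forall>x\<in>?B. \<forall>h. norm (?G' n x h - L x ** \<Theta> x h) \<le> e * norm h" if "e > 0" for e
    proof -
      have "\<forall>\<^sub>F n in sequentially. N * (1/2) ^ n < e / 2"
        using order_tendstoD(2)[OF limN, of "e/2"] that by simp
      moreover have "\<forall>\<^sub>F n in sequentially. \<forall>x\<in>?B. dist (G n x) (L x) < e / (2 * Km * C)"
        using lim that Km C unfolding uniform_limit_iff by simp
      ultimately show ?thesis
      proof eventually_elim
        case (elim n)
        show ?case
        proof (intro ballI allI)
          fix x h assume x: "x \<in> ?B"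
          have "?G' n x h - L x ** \<Theta> x h = E n x h + (G n x - L x) ** \<Theta> x h"
            by (simp add: E_def matrix_diff_distrib)
          then have "norm (?G' n x h - L x ** \<Theta> x h) \<le> norm (E n x h) + norm ((G n x - L x) ** \<Theta> x h)"
            by (simp add: norm_triangle_ineq)
          also have "\<dots> \<le> N * (1/2) ^ n * norm h + Km * C * norm (G n x - L x) * norm h"
            by (intro add_mono e mb x)
          also have "\<dots> \<le> e / 2 * norm h + Km * C * (e / (2 * Km * C)) * norm h"
            using elim x Km C by (intro add_mono mult_right_mono mult_left_mono) (auto simp: dist_norm intro: less_imp_le)
          also have "\<dots> = e * norm h" using Km C by simp
          finally show "norm (?G' n x h - L x ** \<Theta> x h) \<le> e * norm h" .
        qed
      qed
    qed
    show "x0 \<in> ?B" using r by simp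
    show "(\<lambda>n. G n x0) \<longlonglongrightarrow> L x0"
      using tendsto_uniform_limitI[OF lim] r by simp
  qed
  then obtain g where g: "\<And>x. x \<in> ?B \<Longrightarrow> (\<lambda>n. G n x) \<longlonglongrightarrow> g x"
    "\<And>x. x \<in> ?B \<Longrightarrow> (g has_derivative (\<lambda>v. L x ** \<Theta> x v)) (at x within ?B)" by blast
  have gL: "g x = L x" if "x \<in> ?B" for x
    using LIMSEQ_unique[OF g(1)[OF that] tendsto_uniform_limitI[OF lim that]] .
  have "G k x0 = mat 1" for k
  proof (cases k)
    case (Suc j)
    interpret g: C1_form ?B "\<lambda>x v. G j x ** \<Theta> x v" by (intro C1_form_mult form CG)
    have "G j x0 ** \<Theta> x0 0 = 0" using linear_0[OF g.lin[of x0]] r by simp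
    then show ?thesis unfolding Suc GS by (simp add: radial_primitive_def)
  qed (simp add: G0)
  then have "g x0 = mat 1" using g(1)[of x0] r by (simp add: LIMSEQ_const_iff)
  moreover have "(g has_derivative (\<lambda>v. g x ** \<Theta> x v)) (at x)" if "x \<in> ?B" for x
    using g(2)[OF that] gL[OF that] that at_within_open[OF that open_ball] by simp
  ultimately show ?thesis using that[OF r BU] by blast
qed


section \<open>The developing frame of a Bochner-Kaehler structure\<close>

lemma C1_form_linear:
  assumes "bounded_linear L" "C1_form S \<alpha>"
  shows "C1_form S (\<lambda>x v. L (\<alpha> x v))" "x \<in> S \<Longrightarrow> ext_deriv (\<lambda>x v. L (\<alpha> x v)) x v w = L (ext_deriv \<alpha> x v w)"
proof -
  interpret C1_form S \<alpha> by fact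
  show "C1_form S (\<lambda>x v. L (\<alpha> x v))"
    unfolding C1_form_def
    using S C1 linear_compose[OF lin bounded_linear.linear[OF assms(1)], unfolded o_def] Cn_on_linear[OF S assms(1) C1] by blast
  assume x: "x \<in> S"
  have "frechet_derivative (\<lambda>x. L (\<alpha> x w)) (at x) v = L (D x w v)" for v w
    by (rule frechet_derivative_apply[OF bounded_linear.has_derivative[OF assms(1) has_D[OF x]]])
  then show "ext_deriv (\<lambda>x v. L (\<alpha> x v)) x v w = L (ext_deriv \<alpha> x v w)"
    by (simp add: ext_deriv_def ext_D[unfolded ext_deriv_def] linear_diff[OF bounded_linear.linear[OF assms(1)]])
qed

lemma C1_form_add:
  assumes "C1_form S \<alpha>" "C1_form S \<beta>"
  shows "C1_form S (\<lambda>x v. \<alpha> x v + \<beta> x v)"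
    "x \<in> S \<Longrightarrow> ext_deriv (\<lambda>x v. \<alpha> x v + \<beta> x v) x v w = ext_deriv \<alpha> x v w + ext_deriv \<beta> x v w"
proof -
  interpret a: C1_form S \<alpha> by fact
  interpret b: C1_form S \<beta> by fact
  show "C1_form S (\<lambda>x v. \<alpha> x v + \<beta> x v)"
    unfolding C1_form_def
    using a.S linear_compose_add[OF a.lin b.lin] Cn_on_add[OF a.S a.C1 b.C1] by blast
  assume x: "x \<in> S"
  have "frechet_derivative (\<lambda>x. \<alpha> x w + \<beta> x w) (at x) v = a.D x w v + b.D x w v" for v w
    by (rule frechet_derivative_apply[OF has_derivative_add[OF a.has_D[OF x] b.has_D[OF x]]])
  then show "ext_deriv (\<lambda>x v. \<alpha> x v + \<beta> x v) x v w = ext_deriv \<alpha> x v w + ext_deriv \<beta> x v w"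
    by (simp add: ext_deriv_def a.ext_D[unfolded ext_deriv_def] b.ext_D[unfolded ext_deriv_def])
qed

lemma C1_form_diff:
  assumes "C1_form S \<alpha>" "C1_form S \<beta>"
  shows "C1_form S (\<lambda>x v. \<alpha> x v - \<beta> x v)"
    "x \<in> S \<Longrightarrow> ext_deriv (\<lambda>x v. \<alpha> x v - \<beta> x v) x v w = ext_deriv \<alpha> x v w - ext_deriv \<beta> x v w"
proof -
  note m = C1_form_linear[OF bounded_linear_minus[OF bounded_linear_ident] assms(2)]
  show "C1_form S (\<lambda>x v. \<alpha> x v - \<beta> x v)"
    using C1_form_add(1)[OF assms(1) m(1)] by simp
  show "ext_deriv (\<lambda>x v. \<alpha> x v - \<beta> x v) x v w = ext_deriv \<alpha> x v w - ext_deriv \<beta> x v w" if "x \<in> S"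
    using C1_form_add(2)[OF assms(1) m(1) that] m(2)[OF that] by simp
qed

lemma bounded_linear_Blk_tuple:
  "bounded_linear (\<lambda>(a, b, c, d, M, e, f, g, i). Blk a b c d M e f g i)"
  unfolding split_beta by (intro bounded_linear_Blk bounded_linear_intros)

lemma has_derivative_Blk:
  assumes "(a has_derivative a') (at x within X)" "(b has_derivative b') (at x within X)" "(c has_derivative c') (at x within X)" "(d has_derivative d') (at x within X)"
    "(M has_derivative M') (at x within X)" "(e has_derivative e') (at x within X)" "(f has_derivative f') (at x within X)" "(g has_derivative g') (at x within X)" "(i has_derivative i') (at x within X)"
  shows "((\<lambda>x. Blk (a x) (b x) (c x) (d x) (M x) (e x) (f x) (g x) (i x)) has_derivative
    (\<lambda>v. Blk (a' v) (b' v) (c' v) (d' v) (M' v) (e' v) (f' v) (g' v) (i' v))) (at x within X)"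
proof -
  have "((\<lambda>x. (a x, b x, c x, d x, M x, e x, f x, g x, i x)) has_derivative
      (\<lambda>v. (a' v, b' v, c' v, d' v, M' v, e' v, f' v, g' v, i' v))) (at x within X)"
    by (intro has_derivative_Pair assms)
  from bounded_linear.has_derivative[OF bounded_linear_Blk_tuple this] show ?thesis by simp
qed

lemma Cn_on_Pair:
  assumes "open S" "Cn_on k S f" "Cn_on k S g"
  shows "Cn_on k S (\<lambda>x. (f x, g x))"
proof -
  have "bounded_linear (\<lambda>a::'b. (a, 0::'c))" "bounded_linear (\<lambda>b::'c. (0::'b, b))"
    by (intro bounded_linear_Pair bounded_linear_ident bounded_linear_zero)+
  from Cn_on_add[OF assms(1) Cn_on_linear[OF assms(1) this(1) assms(2)] Cn_on_linear[OF assms(1) this(2) assms(3)]]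
  show ?thesis by simp
qed

lemma C1_form_Pair:
  assumes "C1_form S \<alpha>" "C1_form S \<beta>"
  shows "C1_form S (\<lambda>x v. (\<alpha> x v, \<beta> x v))"
    "x \<in> S \<Longrightarrow> ext_deriv (\<lambda>x v. (\<alpha> x v, \<beta> x v)) x v w = (ext_deriv \<alpha> x v w, ext_deriv \<beta> x v w)"
proof -
  interpret a: C1_form S \<alpha> by fact
  interpret b: C1_form S \<beta> by fact
  have "linear (\<lambda>v. (\<alpha> x v, \<beta> x v))" if "x \<in> S" for x
    using a.lin[OF that] b.lin[OF that] by (auto intro!: linearI simp: linear_add linear_cmul)
  then show "C1_form S (\<lambda>x v. (\<alpha> x v, \<beta> x v))"
    unfolding C1_form_def using a.S Cn_on_Pair[OF a.S a.C1 b.C1] by blast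
  assume x: "x \<in> S"
  have "frechet_derivative (\<lambda>x. (\<alpha> x w, \<beta> x w)) (at x) v = (a.D x w v, b.D x w v)" for v w
    by (rule frechet_derivative_apply[OF has_derivative_Pair[OF a.has_D[OF x] b.has_D[OF x]]])
  then show "ext_deriv (\<lambda>x v. (\<alpha> x v, \<beta> x v)) x v w = (ext_deriv \<alpha> x v w, ext_deriv \<beta> x v w)"
    by (simp add: ext_deriv_def a.ext_D[unfolded ext_deriv_def] b.ext_D[unfolded ext_deriv_def])
qed

lemma C1_form_zero: "open S \<Longrightarrow> C1_form S (\<lambda>x v. 0)" "ext_deriv (\<lambda>x v. 0) x v w = 0"
  by (auto simp: C1_form_def ext_deriv_def linear_zero frechet_derivative_apply[OF has_derivative_const]
      intro!: Cn_on_const simp del: Cn_on.simps One_nat_def)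

lemma C1_form_Blk:
  assumes "C1_form S a" "C1_form S b" "C1_form S c" "C1_form S d" "C1_form S M" "C1_form S e" "C1_form S f"
    "C1_form S g" "C1_form S i"
  shows "C1_form S (\<lambda>x v. Blk (a x v) (b x v) (c x v) (d x v) (M x v) (e x v) (f x v) (g x v) (i x v))"
    and "x \<in> S \<Longrightarrow> ext_deriv (\<lambda>x v. Blk (a x v) (b x v) (c x v) (d x v) (M x v) (e x v) (f x v) (g x v) (i x v)) x v w =
     Blk (ext_deriv a x v w) (ext_deriv b x v w) (ext_deriv c x v w) (ext_deriv d x v w) (ext_deriv M x v w)
       (ext_deriv e x v w) (ext_deriv f x v w) (ext_deriv g x v w) (ext_deriv i x v w)"
proof -
  note f = assms(9)
  note f = C1_form_Pair[OF assms(8) f] note f = C1_form_Pair[OF assms(7) f(1)] f(2)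
  note f = C1_form_Pair[OF assms(6) f(1)] f(2-) note f = C1_form_Pair[OF assms(5) f(1)] f(2-)
  note f = C1_form_Pair[OF assms(4) f(1)] f(2-) note f = C1_form_Pair[OF assms(3) f(1)] f(2-)
  note f = C1_form_Pair[OF assms(2) f(1)] f(2-) note f = C1_form_Pair[OF assms(1) f(1)] f(2-)
  note L = C1_form_linear[OF bounded_linear_Blk_tuple f(1)]
  show "C1_form S (\<lambda>x v. Blk (a x v) (b x v) (c x v) (d x v) (M x v) (e x v) (f x v) (g x v) (i x v))"
    using L(1) by simp
  show "ext_deriv (\<lambda>x v. Blk (a x v) (b x v) (c x v) (d x v) (M x v) (e x v) (f x v) (g x v) (i x v)) x v w =
     Blk (ext_deriv a x v w) (ext_deriv b x v w) (ext_deriv c x v w) (ext_deriv d x v w) (ext_deriv M x v w)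
       (ext_deriv e x v w) (ext_deriv f x v w) (ext_deriv g x v w) (ext_deriv i x v w)" if "x \<in> S"
    using L(2)[OF that, of v w] unfolding f(2-)[OF that] by simp
qed

text \<open>The structure equations, pulled back along a section of the coframe bundle.\<close>

locale bk_frame =
  fixes S :: "(complex^'n::finite) set" and A :: "complex^'n \<Rightarrow> complex^'n^'n"
    and \<phi> :: "complex^'n \<Rightarrow> complex^'n \<Rightarrow> complex^'n^'n"
    and H :: "complex^'n \<Rightarrow> complex^'n^'n" and T :: "complex^'n \<Rightarrow> complex^'n" and V :: "complex^'n \<Rightarrow> real"
  assumes form_A: "C1_form S (\<lambda>x v. A x *v v)"
    and form_\<phi>: "C1_form S \<phi>"
    and adj_\<phi>: "x \<in> S \<Longrightarrow> adj (\<phi> x v) = - \<phi> x v"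
    and adj_H: "x \<in> S \<Longrightarrow> adj (H x) = H x"
    and torsion: "x \<in> S \<Longrightarrow> ext_deriv (\<lambda>x v. A x *v v) x v w = - (\<phi> x v *v (A x *v w) - \<phi> x w *v (A x *v v))"
    and curvature: "x \<in> S \<Longrightarrow> ext_deriv \<phi> x v w = - (\<phi> x v ** \<phi> x w - \<phi> x w ** \<phi> x v)
      + H x ** mat (star_dot (A x *v v) (A x *v w) - star_dot (A x *v w) (A x *v v))
      - H x ** (dot_star (A x *v v) (A x *v w) - dot_star (A x *v w) (A x *v v))
      - (dot_star (A x *v v) (A x *v w) - dot_star (A x *v w) (A x *v v)) ** H x
      + mat (star_dot (A x *v v) (H x *v (A x *v w)) - star_dot (A x *v w) (H x *v (A x *v v)))
      + mat (trace (H x)) ** (mat (star_dot (A x *v v) (A x *v w) - star_dot (A x *v w) (A x *v v))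
           - (dot_star (A x *v v) (A x *v w) - dot_star (A x *v w) (A x *v v)))"
    and dH: "x \<in> S \<Longrightarrow> (H has_derivative (\<lambda>v. - (\<phi> x v ** H x) + H x ** \<phi> x v
      + dot_star (T x) (A x *v v) + dot_star (A x *v v) (T x))) (at x)"
    and dT: "x \<in> S \<Longrightarrow> (T has_derivative (\<lambda>v. - (\<phi> x v *v T x)
      + (H x ** H x + mat (trace (H x)) ** H x + mat (of_real (V x))) *v (A x *v v))) (at x)"
    and dV: "x \<in> S \<Longrightarrow> ((\<lambda>x. complex_of_real (V x)) has_derivative (\<lambda>v.
      trace (H x) * (star_dot (T x) (A x *v v) + star_dot (A x *v v) (T x))
      + (star_dot (T x) (H x *v (A x *v v)) + star_dot (A x *v v) (H x *v T x)))) (at x)"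
begin

lemma S: "open S"
  using form_A by (simp add: C1_form_def)

definition \<omega> where "\<omega> x v = A x *v v"
text \<open>The multiple of the identity for which the connection \<open>\<Theta>0\<close> has trace
  zero.\<close>

definition \<tau> where "\<tau> x v = - trace (\<phi> x v) / of_nat (CARD('n) + 2)"
definition X where "X x = Xm (H x) (T x) (V x)"
definition \<Theta>0 where "\<Theta>0 x v = Tm (\<tau> x v) (H x) (T x) (\<phi> x v) (\<omega> x v)"

lemma cont_\<phi>: "continuous_on S (\<lambda>x. \<phi> x v)" and cont_\<omega>: "continuous_on S (\<lambda>x. A x *v v)"
  using C1_form.C1[OF form_\<phi>] C1_form.C1[OF form_A] Cn_on_imp_continuous_on by blast+

lemma cont_HTV: "continuous_on S H" "continuous_on S T" "continuous_on S (\<lambda>x. complex_of_real (V x))"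
proof -
  have c: "continuous_on S f" if "\<And>x. x \<in> S \<Longrightarrow> (f has_derivative f' x) (at x)"
    for f :: "complex^'n \<Rightarrow> 'z::real_normed_vector" and f'
    using has_derivative_continuous[OF that] by (rule continuous_at_imp_continuous_on[OF ballI])
  show "continuous_on S H" "continuous_on S T" "continuous_on S (\<lambda>x. complex_of_real (V x))"
    by (rule c[OF dH] c[OF dT] c[OF dV]; assumption)+
qed

lemmas cont_intros = continuous_intros cont_\<phi> cont_\<omega> cont_HTV
  bounded_bilinear.continuous_on[OF bounded_bilinear_matrix_mult]
  bounded_bilinear.continuous_on[OF bounded_bilinear_matrix_vector]
  bounded_bilinear.continuous_on[OF bounded_bilinear_star_dot]
  bounded_bilinear.continuous_on[OF bounded_bilinear_dot_star]
  bounded_linear.continuous_on[OF bounded_linear_trace] bounded_linear.continuous_on[OF bounded_linear_mat]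

lemma C1_H: "Cn_on 1 S H" and C1_T: "Cn_on 1 S T" and C1_V: "Cn_on 1 S (\<lambda>x. complex_of_real (V x))"
  unfolding One_nat_def
  by (rule Cn_on_SucI[OF dH _ S] Cn_on_SucI[OF dT _ S] Cn_on_SucI[OF dV _ S];
      simp only: Cn_on.simps; intro cont_intros)+

lemma adj_\<tau>: "x \<in> S \<Longrightarrow> cnj (\<tau> x v) = - \<tau> x v"
  using adj_\<phi>[of x v] by (simp add: \<tau>_def cnj_trace trace_simps)

lemma form_\<tau>: "C1_form S \<tau>" "x \<in> S \<Longrightarrow> ext_deriv \<tau> x v w = - trace (ext_deriv \<phi> x v w) / of_nat (CARD('n) + 2)"
proof -
  have L: "bounded_linear (\<lambda>M :: complex^'n^'n. - trace M / of_nat (CARD('n) + 2))"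
    by (intro bounded_linear_divide[THEN bounded_linear_compose] bounded_linear_minus bounded_linear_trace)
  have eq: "\<tau> = (\<lambda>x v. - trace (\<phi> x v) / of_nat (CARD('n) + 2))"
    by (intro ext) (rule \<tau>_def)
  show "C1_form S \<tau>" unfolding eq by (rule C1_form_linear(1)[OF L form_\<phi>])
  show "ext_deriv \<tau> x v w = - trace (ext_deriv \<phi> x v w) / of_nat (CARD('n) + 2)" if "x \<in> S"
    unfolding eq by (rule C1_form_linear(2)[OF L form_\<phi> that])
qed

lemma form_\<omega>: "C1_form S \<omega>"
  using form_A unfolding \<omega>_def[abs_def] .

definition \<zeta> where "\<zeta> x v = H x *v \<omega> x v + (trace (H x) / 2) *s \<omega> x v"
definition \<kappa> where "\<kappa> x v = (star_dot (\<omega> x v) (T x) - star_dot (T x) (\<omega> x v)) / 2"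

abbreviation "H' x v \<equiv> frechet_derivative H (at x) v"
abbreviation "T' x v \<equiv> frechet_derivative T (at x) v"

lemma form_\<zeta>: "C1_form S \<zeta>"
  "x \<in> S \<Longrightarrow> ext_deriv \<zeta> x v w = H' x v *v \<omega> x w - H' x w *v \<omega> x v + H x *v ext_deriv \<omega> x v w
     + ((trace (H' x v) / 2) *s \<omega> x w - (trace (H' x w) / 2) *s \<omega> x v + (trace (H x) / 2) *s ext_deriv \<omega> x v w)"
proof -
  have L: "bounded_linear (\<lambda>M :: complex^'n^'n. trace M / 2)"
    by (intro bounded_linear_divide[THEN bounded_linear_compose] bounded_linear_trace)
  have C: "Cn_on 1 S (\<lambda>x. trace (H x) / 2)"
    by (rule Cn_on_linear[OF S L C1_H])
  have dtr: "frechet_derivative (\<lambda>x. trace (H x) / 2) (at x) v = trace (H' x v) / 2" if "x \<in> S" for x v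
    by (rule frechet_derivative_apply[OF bounded_linear.has_derivative[OF L]])
       (use Cn_on_SucD[OF _ that, of 0] C1_H in simp)
  note f1 = C1_form_bilinear[OF bounded_bilinear_matrix_vector form_\<omega> C1_H]
  note f2 = C1_form_bilinear[OF bounded_bilinear_smult form_\<omega> C]
  show "C1_form S \<zeta>"
    using C1_form_add(1)[OF f1(1) f2(1)] unfolding \<zeta>_def[abs_def] .
  show "ext_deriv \<zeta> x v w = H' x v *v \<omega> x w - H' x w *v \<omega> x v + H x *v ext_deriv \<omega> x v w
     + ((trace (H' x v) / 2) *s \<omega> x w - (trace (H' x w) / 2) *s \<omega> x v + (trace (H x) / 2) *s ext_deriv \<omega> x v w)"
    if "x \<in> S"
    using C1_form_add(2)[OF f1(1) f2(1) that, of v w] unfolding f1(2)[OF that] f2(2)[OF that] dtr[OF that] \<zeta>_def[abs_def] .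
qed

lemma form_\<kappa>: "C1_form S \<kappa>"
  "x \<in> S \<Longrightarrow> ext_deriv \<kappa> x v w = (star_dot (ext_deriv \<omega> x v w) (T x) + star_dot (\<omega> x w) (T' x v) - star_dot (\<omega> x v) (T' x w)
     - (star_dot (T x) (ext_deriv \<omega> x v w) + star_dot (T' x v) (\<omega> x w) - star_dot (T' x w) (\<omega> x v))) / 2"
proof -
  note f1 = C1_form_bilinear[OF bounded_bilinear.flip[OF bounded_bilinear_star_dot] form_\<omega> C1_T]
  note f2 = C1_form_bilinear[OF bounded_bilinear_star_dot form_\<omega> C1_T]
  note f = C1_form_linear[OF bounded_linear_divide[of 2] C1_form_diff(1)[OF f1(1) f2(1)]]
  show "C1_form S \<kappa>"
    using f(1) unfolding \<kappa>_def[abs_def] .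
  show "ext_deriv \<kappa> x v w = (star_dot (ext_deriv \<omega> x v w) (T x) + star_dot (\<omega> x w) (T' x v) - star_dot (\<omega> x v) (T' x w)
     - (star_dot (T x) (ext_deriv \<omega> x v w) + star_dot (T' x v) (\<omega> x w) - star_dot (T' x w) (\<omega> x v))) / 2" if "x \<in> S"
    using f(2)[OF that, of v w] unfolding C1_form_diff(2)[OF f1(1) f2(1) that] f1(2)[OF that] f2(2)[OF that] \<kappa>_def[abs_def]
    by (simp add: algebra_simps)
qed

lemma \<Theta>0_eq: "\<Theta>0 = (\<lambda>x v. Blk (\<tau> x v) (\<zeta> x v) (\<kappa> x v) (\<omega> x v) (\<phi> x v + mat (\<tau> x v)) (\<zeta> x v) 0 (\<omega> x v) (\<tau> x v))"
  by (simp add: fun_eq_iff \<Theta>0_def Tm_def \<zeta>_def \<kappa>_def)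

lemma form_\<Theta>0: "C1_form S \<Theta>0"
  and ext_\<Theta>0: "x \<in> S \<Longrightarrow> ext_deriv \<Theta>0 x v w = mat (star_dot (\<omega> x v) (\<omega> x w) - star_dot (\<omega> x w) (\<omega> x v)) ** X x
      - (\<Theta>0 x v ** \<Theta>0 x w - \<Theta>0 x w ** \<Theta>0 x v)"
proof -
  note mt = C1_form_linear[OF bounded_linear_mat form_\<tau>(1)]
  note f\<phi> = C1_form_add[OF form_\<phi> mt(1)]
  note F = C1_form_Blk[OF form_\<tau>(1) form_\<zeta>(1) form_\<kappa>(1) form_\<omega> f\<phi>(1) form_\<zeta>(1) C1_form_zero(1)[OF S] form_\<omega> form_\<tau>(1)]
  show "C1_form S \<Theta>0" unfolding \<Theta>0_eq by (rule F(1))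
  assume x: "x \<in> S"
  have e: "ext_deriv \<Theta>0 x v w = Blk (ext_deriv \<tau> x v w) (ext_deriv \<zeta> x v w) (ext_deriv \<kappa> x v w) (ext_deriv \<omega> x v w)
     (ext_deriv \<phi> x v w + mat (ext_deriv \<tau> x v w)) (ext_deriv \<zeta> x v w) 0 (ext_deriv \<omega> x v w) (ext_deriv \<tau> x v w)"
    unfolding \<Theta>0_eq F(2)[OF x] f\<phi>(2)[OF x] mt(2)[OF x] C1_form_zero(2) ..
  have d\<omega>: "ext_deriv \<omega> x v w = - (\<phi> x v *v \<omega> x w - \<phi> x w *v \<omega> x v)"
    using torsion[OF x] unfolding \<omega>_def[abs_def] .
  have hH: "H' x u = - (\<phi> x u ** H x) + H x ** \<phi> x u + dot_star (T x) (\<omega> x u) + dot_star (\<omega> x u) (T x)" for u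
    unfolding \<omega>_def by (rule frechet_derivative_apply[OF dH[OF x]])
  have hT: "T' x u = - (\<phi> x u *v T x) + (H x ** H x + mat (trace (H x)) ** H x + mat (of_real (V x))) *v \<omega> x u" for u
    unfolding \<omega>_def by (rule frechet_derivative_apply[OF dT[OF x]])
  have "ext_deriv \<Theta>0 x v w + (\<Theta>0 x v ** \<Theta>0 x w - \<Theta>0 x w ** \<Theta>0 x v) =
      mat (star_dot (\<omega> x v) (\<omega> x w) - star_dot (\<omega> x w) (\<omega> x v)) ** X x"
    unfolding e \<Theta>0_def X_def
    by (rule Tm_curvature[OF adj_H[OF x] adj_\<phi>[OF x] adj_\<phi>[OF x] adj_\<tau>[OF x] adj_\<tau>[OF x]
        d\<omega> curvature[OF x, folded \<omega>_def] hH hH hT hT form_\<tau>(2)[OF x] form_\<zeta>(2)[OF x] form_\<kappa>(2)[OF x]])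
  then show "ext_deriv \<Theta>0 x v w = mat (star_dot (\<omega> x v) (\<omega> x w) - star_dot (\<omega> x w) (\<omega> x v)) ** X x
      - (\<Theta>0 x v ** \<Theta>0 x w - \<Theta>0 x w ** \<Theta>0 x v)"
    by (simp add: eq_diff_eq)
qed

lemma dX: "x \<in> S \<Longrightarrow> (X has_derivative (\<lambda>v. X x ** \<Theta>0 x v - \<Theta>0 x v ** X x)) (at x)"
proof -
  assume x: "x \<in> S"
  let ?V' = "\<lambda>v. trace (H x) * (star_dot (T x) (\<omega> x v) + star_dot (\<omega> x v) (T x))
      + (star_dot (T x) (H x *v \<omega> x v) + star_dot (\<omega> x v) (H x *v T x))"
  have dH': "(H has_derivative H' x) (at x)" and dT': "(T has_derivative T' x) (at x)"
    using Cn_on_SucD[OF _ x, of 0] C1_H C1_T by simp_all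
  have dtr: "((\<lambda>x. trace (H x)) has_derivative (\<lambda>v. trace (H' x v))) (at x)"
    by (rule bounded_linear.has_derivative[OF bounded_linear_trace dH'])
  then have dtr2: "((\<lambda>x. trace (H x) / 2) has_derivative (\<lambda>v. trace (H' x v) / 2)) (at x)"
    by (auto intro!: derivative_eq_intros)
  have dtr4: "((\<lambda>x. (trace (H x))\<^sup>2 / 4) has_derivative (\<lambda>v. trace (H x) * trace (H' x v) / 2)) (at x)"
    using dtr by (auto intro!: derivative_eq_intros simp: fun_eq_iff power2_eq_square)
  have "(X has_derivative (\<lambda>v. Blk (- (trace (H' x v) / 2)) (- T' x v) (trace (H x) * trace (H' x v) / 2 - ?V' v) 0 (H' x v) (T' x v) 0 0
      (- (trace (H' x v) / 2)))) (at x)"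
    unfolding X_def[abs_def] Xm_def
    by (intro has_derivative_Blk dH' dT' dtr2 has_derivative_diff[OF dtr4 dV[OF x, folded \<omega>_def]] has_derivative_minus has_derivative_const)
  moreover have "Blk (- (trace (H' x v) / 2)) (- T' x v) (trace (H x) * trace (H' x v) / 2 - ?V' v) 0 (H' x v) (T' x v) 0 0
      (- (trace (H' x v) / 2)) = X x ** \<Theta>0 x v - \<Theta>0 x v ** X x" for v
    unfolding X_def \<Theta>0_def
    by (rule Xm_parallel[OF adj_H[OF x] _ _ refl adj_\<phi>[OF x] adj_\<tau>[OF x]])
       (simp_all add: \<omega>_def frechet_derivative_apply[OF dH[OF x]] frechet_derivative_apply[OF dT[OF x]])
  ultimately show ?thesis by simp
qed

lemma C1_X: "Cn_on 1 S X"
  unfolding One_nat_def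
proof (rule Cn_on_SucI[OF dX _ S])
  have "continuous_on S X" using dX has_derivative_continuous by (blast intro: continuous_at_imp_continuous_on)
  moreover have "continuous_on S (\<lambda>x. \<Theta>0 x v)" for v
    using Cn_on_imp_continuous_on[OF C1_form.C1[OF form_\<Theta>0]] .
  ultimately show "Cn_on 0 S (\<lambda>x. X x ** \<Theta>0 x v - \<Theta>0 x v ** X x)" for v
    by (auto intro!: cont_intros)
qed

text \<open>The exterior derivative of the scalar \<open>-2 \<i> lam\<close> cancels the curvature
  of \<open>\<Theta>0\<close>. Where this scalar meets \<open>\<Theta>0\<close> in the product, the
  commutators of \<open>X\<close> with \<open>\<Theta>0\<close> cancel against the derivative of
  \<open>X\<close>. The scalar is imaginary and \<open>X\<close> is selfadjoint, so
  \<open>Jm\<close> is still preserved; a multiple of \<open>X\<close> commutes with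
  \<open>X\<close>, so \<open>X\<close> stays parallel.\<close>

lemma flat_frame:
  assumes lam: "C1_form S lam" "\<And>x v w. x \<in> S \<Longrightarrow> ext_deriv lam x v w = Im (star_dot (A x *v v) (A x *v w))"
  defines "\<Theta> \<equiv> \<lambda>x v. \<Theta>0 x v + mat (- 2 * \<i> * of_real (lam x v)) ** X x"
  shows "C1_form S \<Theta>" "x \<in> S \<Longrightarrow> ext_deriv \<Theta> x v w = - (\<Theta> x v ** \<Theta> x w - \<Theta> x w ** \<Theta> x v)"
    "x \<in> S \<Longrightarrow> adj (\<Theta> x v) ** Jm + Jm ** \<Theta> x v = 0"
    "x \<in> S \<Longrightarrow> X x ** \<Theta>0 x v - \<Theta>0 x v ** X x = X x ** \<Theta> x v - \<Theta> x v ** X x"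
proof -
  define \<mu> where "\<mu> x v = - 2 * \<i> * of_real (lam x v)" for x v
  have L: "bounded_linear (\<lambda>r. mat (- 2 * \<i> * of_real r) :: complex^('n option option)^('n option option))"
    by (intro bounded_linear_compose[OF bounded_linear_mat] bounded_linear_compose[OF bounded_linear_mult_right bounded_linear_of_real])
  note f1 = C1_form_linear[OF L lam(1), folded \<mu>_def]
  note f2 = C1_form_bilinear[OF bounded_bilinear.flip[OF bounded_bilinear_matrix_mult] f1(1) C1_X]
  note f = C1_form_add[OF form_\<Theta>0 f2(1)]
  have \<Theta>: "\<Theta> = (\<lambda>x v. \<Theta>0 x v + mat (\<mu> x v) ** X x)" by (simp add: \<Theta>_def \<mu>_def)
  show "C1_form S \<Theta>" unfolding \<Theta> by (rule f(1))
  assume x: "x \<in> S"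
  let ?X = "X x" and ?X' = "\<lambda>v. X x ** \<Theta>0 x v - \<Theta>0 x v ** X x"
  have comm: "?X ** mat c = mat c ** ?X" "\<Theta>0 x u ** mat c = mat c ** \<Theta>0 x u" for c u
    by (simp_all add: mat_mult_commute)
  have \<Omega>: "mat (- 2 * \<i> * of_real (Im (star_dot (A x *v v) (A x *v w)))) =
      - (mat (star_dot (\<omega> x v) (\<omega> x w) - star_dot (\<omega> x w) (\<omega> x v)) :: complex^('n option option)^('n option option))"
  proof -
    have "star_dot (\<omega> x w) (\<omega> x v) = cnj (star_dot (\<omega> x v) (\<omega> x w))" by (simp add: cnj_star_dot)
    then have "- 2 * \<i> * of_real (Im (star_dot (A x *v v) (A x *v w))) = - (star_dot (\<omega> x v) (\<omega> x w) - star_dot (\<omega> x w) (\<omega> x v))"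
      by (simp add: \<omega>_def complex_eq_iff)
    then show ?thesis by (simp only: mat_add)
  qed
  have dXe: "frechet_derivative X (at x) u = ?X' u" for u
    by (rule frechet_derivative_apply[OF dX[OF x]])
  have e: "ext_deriv \<Theta> x v w = ext_deriv \<Theta>0 x v w + (mat (\<mu> x w) ** ?X' v - mat (\<mu> x v) ** ?X' w
      - mat (star_dot (\<omega> x v) (\<omega> x w) - star_dot (\<omega> x w) (\<omega> x v)) ** ?X)"
    unfolding \<Theta> f(2)[OF x] f2(2)[OF x] dXe f1(2)[OF x] lam(2)[OF x] \<Omega> by (simp add: minus_mult)
  have "\<Theta> x v ** \<Theta> x w - \<Theta> x w ** \<Theta> x v = \<Theta>0 x v ** \<Theta>0 x w - \<Theta>0 x w ** \<Theta>0 x v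
     - mat (\<mu> x w) ** ?X' v + mat (\<mu> x v) ** ?X' w"
  proof -
    have 1: "\<Theta>0 x u ** (mat c ** ?X) = mat c ** (\<Theta>0 x u ** ?X)" "(mat c ** ?X) ** \<Theta>0 x u = mat c ** (?X ** \<Theta>0 x u)"
      "(mat c ** ?X) ** (mat d ** ?X) = mat (c * d) ** (?X ** ?X)" for u c d
    proof -
      show "\<Theta>0 x u ** (mat c ** ?X) = mat c ** (\<Theta>0 x u ** ?X)" "(mat c ** ?X) ** \<Theta>0 x u = mat c ** (?X ** \<Theta>0 x u)"
        by (simp_all add: matrix_mul_assoc comm)
      have "(mat c ** ?X) ** (mat d ** ?X) = mat c ** ((?X ** mat d) ** ?X)" by (simp only: matrix_mul_assoc)
      also have "\<dots> = mat c ** (mat d ** (?X ** ?X))" by (simp only: comm matrix_mul_assoc)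
      also have "\<dots> = mat (c * d) ** (?X ** ?X)" by (simp add: vec_eq_iff mat_mult_nth)
      finally show "(mat c ** ?X) ** (mat d ** ?X) = mat (c * d) ** (?X ** ?X)" .
    qed
    show ?thesis
      unfolding \<Theta> matrix_add_distrib matrix_diff_distrib 1 by (simp add: mult.commute)
  qed
  then show "ext_deriv \<Theta> x v w = - (\<Theta> x v ** \<Theta> x w - \<Theta> x w ** \<Theta> x v)"
    unfolding e ext_\<Theta>0[OF x] by (simp add: algebra_simps)
  have sk0: "adj (\<Theta>0 x v) ** Jm + Jm ** \<Theta>0 x v = 0"
    unfolding \<Theta>0_def by (rule Tm_skew[OF adj_H[OF x] adj_\<phi>[OF x] adj_\<tau>[OF x]])
  have hX: "adj ?X ** Jm = Jm ** ?X" unfolding X_def by (rule Xm_herm[OF adj_H[OF x]])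
  have \<mu>i: "cnj (\<mu> x v) = - \<mu> x v" by (simp add: \<mu>_def)
  have "adj (mat (\<mu> x v) ** ?X) ** Jm = mat (cnj (\<mu> x v)) ** (adj ?X ** Jm)"
    by (simp add: adj_mult mat_mult_commute[of "cnj (\<mu> x v)"] matrix_mul_assoc)
  also have "\<dots> = - (Jm ** (mat (\<mu> x v) ** ?X))"
    unfolding hX \<mu>i by (simp add: mat_add minus_mult matrix_mul_assoc mat_mult_commute[of _ Jm])
  finally show "adj (\<Theta> x v) ** Jm + Jm ** \<Theta> x v = 0"
    using sk0 by (simp add: \<Theta> adj_add matrix_add_distrib algebra_simps)
  show "?X' v = X x ** \<Theta> x v - \<Theta> x v ** X x"
    unfolding \<Theta> matrix_add_distrib by (simp add: matrix_mul_assoc comm)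
qed

end


lemma matrix_mult_zero: "A ** 0 = 0" "0 ** B = 0" for A B :: "complex^'n::finite^'n"
  by (simp_all add: matrix_matrix_mult_def vec_eq_iff)

lemma has_differential_on_section:
  assumes "has_differential_on P f \<theta>" "open U" "\<And>x. x \<in> U \<Longrightarrow> s x \<in> P"
    and s: "(s has_derivative s') (at x)" and x: "x \<in> U"
  shows "((\<lambda>x. f (s x)) has_derivative (\<lambda>v. \<theta> (s x) (s' v))) (at x)"
proof -
  obtain D where D: "(f has_derivative D) (at (s x) within P)" "\<And>v. v \<in> tangent_space P (s x) \<Longrightarrow> D v = \<theta> (s x) v"
    using assms(1,3) x unfolding has_differential_on_def by blast
  have "(f has_derivative D) (at (s x) within s ` U)"
    using D(1) by (rule has_derivative_subset) (use assms(3) in auto)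
  then have "((\<lambda>x. f (s x)) has_derivative (\<lambda>v. D (s' v))) (at x within U)"
    by (rule has_derivative_in_compose[OF has_derivative_at_withinI[OF s]])
  then show ?thesis
    unfolding at_within_open[OF x assms(2)]
    by (rule has_derivative_eq_rhs) (use D(2) tangent_space_section[OF assms(2,3) s x] in auto)
qed

text \<open>The bound on \<open>k\<close> provides a section of class C^2, along which exterior
  derivatives can be pulled back. From here on everything lives on the base, and the prescribed
  value of the section at \<open>x0\<close> retains the coframe at which \<open>H\<close>,
  \<open>T\<close>, \<open>V\<close> are given.\<close>

lemma bochner_kaehler_frame:
  fixes \<Omega> :: "'n::finite form2"
  assumes bk: "bochner_kaehler_on k U \<Omega> H T V" and k: "2 \<le> k"
  obtains A \<phi> where "Cn_on 2 U A" "\<And>x. x \<in> U \<Longrightarrow> (x, A x) \<in> coframe_bundle U \<Omega>"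
    "(x0, A0) \<in> coframe_bundle U \<Omega> \<Longrightarrow> A x0 = A0"
    "bk_frame U A \<phi> (\<lambda>x. H (x, A x)) (\<lambda>x. T (x, A x)) (\<lambda>x. V (x, A x))"
proof -
  have kf: "kaehler_form_on k U \<Omega>" using bk by (simp add: bochner_kaehler_on_def)
  note U = kaehler_form_open[OF kf]
  let ?P = "coframe_bundle U \<Omega>"
  obtain A where A: "Cn_on 2 U A" "\<And>x. x \<in> U \<Longrightarrow> (x, A x) \<in> ?P" "(x0, A0) \<in> ?P \<Longrightarrow> A x0 = A0"
    using coframe_section[OF kf, of 2] k by (metis numeral_eq_enat)
  obtain \<phi>0 where conn: "connection_form U \<Omega> \<phi>0"
    and ext: "has_ext_derivative_on ?P \<phi>0 (\<lambda>p v w.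
           - wedge (**) (\<phi>0 p) (\<phi>0 p) v w
           + H p ** mat (wedge star_dot (taut_form p) (taut_form p) v w)
           - H p ** wedge dot_star (taut_form p) (taut_form p) v w
           - wedge dot_star (taut_form p) (taut_form p) v w ** H p
           + mat (wedge star_dot (taut_form p) (\<lambda>u. H p *v taut_form p u) v w)
           + mat (trace (H p)) **
               (mat (wedge star_dot (taut_form p) (taut_form p) v w) - wedge dot_star (taut_form p) (taut_form p) v w))"
    and dH: "has_differential_on ?P H (\<lambda>p v.
           - (\<phi>0 p v ** H p) + H p ** \<phi>0 p v + dot_star (T p) (taut_form p v) + dot_star (taut_form p v) (T p))"
    and dT: "has_differential_on ?P T (\<lambda>p v.
           - (\<phi>0 p v *v T p)
           + (H p ** H p + mat (trace (H p)) ** H p + mat (of_real (V p))) *v taut_form p v)"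
    and dV: "has_differential_on ?P (\<lambda>p. complex_of_real (V p)) (\<lambda>p v.
           trace (H p) * (star_dot (T p) (taut_form p v) + star_dot (taut_form p v) (T p))
           + (star_dot (T p) (H p *v taut_form p v) + star_dot (taut_form p v) (H p *v T p)))"
    using bk unfolding bochner_kaehler_on_def Let_def by blast
  define s where "s x = (x, A x)" for x
  define s' where "s' x v = (v, frechet_derivative A (at x) v)" for x v
  have s2: "Cn_on 2 U s" unfolding s_def by (intro Cn_on_Pair Cn_on_id U A)
  have A2: "Cn_on (Suc (Suc 0)) U A" using A(1) by (simp add: numeral_2_eq_2)
  have ds: "(s has_derivative s' x) (at x)" if "x \<in> U" for x
    unfolding s_def[abs_def] s'_def[abs_def]
    by (intro has_derivative_Pair has_derivative_ident Cn_on_SucD[OF A2 that])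
  have fds: "frechet_derivative s (at x) v = s' x v" if "x \<in> U" for x v
    by (rule frechet_derivative_apply[OF ds[OF that]])
  have sP: "s x \<in> ?P" if "x \<in> U" for x using A(2)[OF that] by (simp add: s_def)
  have tan: "s' x v \<in> tangent_space ?P (s x)" if "x \<in> U" for x v
    by (rule tangent_space_section[OF U sP ds]) (use that in auto)
  have lin: "linear (s' x)" if "x \<in> U" for x using ds[OF that] by (rule has_derivative_linear)
  have taut: "taut_form (s x) (s' x v) = A x *v v" for x v by (simp add: taut_form_def s_def s'_def)
  define \<phi> where "\<phi> x v = \<phi>0 (s x) (s' x v)" for x v
  have lin\<phi>: "linear (\<phi>0 p)" and sk: "v \<in> tangent_space ?P p \<Longrightarrow> skew_hermitian (\<phi>0 p v)" if "p \<in> ?P" for p v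
    using conn that unfolding connection_form_def Let_def by auto
  have tors: "has_ext_derivative_on ?P taut_form (\<lambda>p v w. - wedge (*v) (\<phi>0 p) (taut_form p) v w)"
    using conn unfolding connection_form_def Let_def by auto
  have ext_cong: "ext_deriv a x v w = ext_deriv b x v w" and Cn_cong: "Cn_on 1 U (\<lambda>x. a x v) \<Longrightarrow> Cn_on 1 U (\<lambda>x. b x v)"
    if "\<And>y u. y \<in> U \<Longrightarrow> a y u = b y u" "x \<in> U" "\<And>u. Cn_on 1 U (\<lambda>x. a x u)"
    for a b :: "complex^'n \<Rightarrow> complex^'n \<Rightarrow> 'z::real_normed_vector" and x v w
  proof -
    have "frechet_derivative (\<lambda>x. b x u) (at x) z = frechet_derivative (\<lambda>x. a x u) (at x) z" for u z
    proof (rule frechet_derivative_apply)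
      have "((\<lambda>x. a x u) has_derivative frechet_derivative (\<lambda>x. a x u) (at x)) (at x)"
        using Cn_on_SucD[of 0, OF _ that(2)] that(3)[of u] by simp
      then show "((\<lambda>x. b x u) has_derivative frechet_derivative (\<lambda>x. a x u) (at x)) (at x)"
        by (rule has_derivative_transform_within_open[OF _ U that(2)]) (simp add: that(1))
    qed
    then show "ext_deriv a x v w = ext_deriv b x v w" by (simp add: ext_deriv_def)
    show "Cn_on 1 U (\<lambda>x. a x v) \<Longrightarrow> Cn_on 1 U (\<lambda>x. b x v)"
      by (erule Cn_on_cong) (simp_all add: that(1) U)
  qed
  have sP': "\<And>x. x \<in> U \<Longrightarrow> s x \<in> ?P" by (rule sP)
  have pull: "Cn_on 1 U (\<lambda>x. \<alpha> (s x) (frechet_derivative s (at x) v))"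
    "x \<in> U \<Longrightarrow> ext_deriv (\<lambda>x v. \<alpha> (s x) (frechet_derivative s (at x) v)) x v w =
       \<beta> (s x) (frechet_derivative s (at x) v) (frechet_derivative s (at x) w)"
    if "has_ext_derivative_on ?P \<alpha> \<beta>"
    for \<alpha> :: "'n coframe \<Rightarrow> 'n coframe \<Rightarrow> 'z::euclidean_space" and \<beta> x v w
    using pullback_ext_derivative[OF U s2 sP' that] by auto
  note pb\<omega> = pull[OF tors] and pb\<phi> = pull[OF ext]
  have e\<omega>: "taut_form (s x) (frechet_derivative s (at x) v) = A x *v v" if "x \<in> U" for x v
    using fds[OF that] taut by simp
  have e\<phi>: "\<phi>0 (s x) (frechet_derivative s (at x) v) = \<phi> x v" if "x \<in> U" for x v
    using fds[OF that] by (simp add: \<phi>_def)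
  have "bk_frame U A \<phi> (\<lambda>x. H (s x)) (\<lambda>x. T (s x)) (\<lambda>x. V (s x))"
  proof (rule bk_frame.intro)
    have "linear (\<lambda>v. A x *v v)" for x
      by (rule bounded_linear.linear[OF bounded_bilinear.bounded_linear_right[OF bounded_bilinear_matrix_vector]])
    moreover have "Cn_on 1 U (\<lambda>x. A x *v v)" for v
      by (rule Cn_on_cong[OF pb\<omega>(1)[of v]]) (simp_all add: e\<omega> U)
    ultimately show "C1_form U (\<lambda>x v. A x *v v)" using U by (simp add: C1_form_def del: Cn_on.simps One_nat_def)
    have "linear (\<phi> x)" if "x \<in> U" for x
      unfolding \<phi>_def[abs_def] using linear_compose[OF lin[OF that] lin\<phi>[OF sP[OF that]]] by (simp add: o_def)
    moreover have "Cn_on 1 U (\<lambda>x. \<phi> x v)" for v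
      by (rule Cn_on_cong[OF pb\<phi>(1)[of v]]) (simp_all add: e\<phi> U)
    ultimately show "C1_form U \<phi>" using U by (simp add: C1_form_def del: Cn_on.simps One_nat_def)
    show "adj (\<phi> x v) = - \<phi> x v" if "x \<in> U" for x v
      using sk[OF sP[OF that] tan[OF that]] by (simp add: \<phi>_def skew_hermitian_def)
    show "adj (H (s x)) = H (s x)" if "x \<in> U" for x
      using bk sP[OF that] unfolding bochner_kaehler_on_def Let_def hermitian_def by blast
    show "ext_deriv (\<lambda>x v. A x *v v) x v w = - (\<phi> x v *v (A x *v w) - \<phi> x w *v (A x *v v))" if "x \<in> U" for x v w
      using pb\<omega>(2)[OF that, of v w] ext_cong[of "\<lambda>x v. taut_form (s x) (frechet_derivative s (at x) v)" "\<lambda>x v. A x *v v", OF e\<omega> that pb\<omega>(1)]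
      by (simp add: wedge_def fds[OF that] taut \<phi>_def)
    show "ext_deriv \<phi> x v w = - (\<phi> x v ** \<phi> x w - \<phi> x w ** \<phi> x v)
      + H (s x) ** mat (star_dot (A x *v v) (A x *v w) - star_dot (A x *v w) (A x *v v))
      - H (s x) ** (dot_star (A x *v v) (A x *v w) - dot_star (A x *v w) (A x *v v))
      - (dot_star (A x *v v) (A x *v w) - dot_star (A x *v w) (A x *v v)) ** H (s x)
      + mat (star_dot (A x *v v) (H (s x) *v (A x *v w)) - star_dot (A x *v w) (H (s x) *v (A x *v v)))
      + mat (trace (H (s x))) ** (mat (star_dot (A x *v v) (A x *v w) - star_dot (A x *v w) (A x *v v))
           - (dot_star (A x *v v) (A x *v w) - dot_star (A x *v w) (A x *v v)))" if "x \<in> U" for x v w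
      using pb\<phi>(2)[OF that, of v w] ext_cong[of "\<lambda>x v. \<phi>0 (s x) (frechet_derivative s (at x) v)" \<phi>, OF e\<phi> that pb\<phi>(1)]
      by (simp only: wedge_def fds[OF that] taut \<phi>_def[symmetric])
    fix x assume x: "x \<in> U"
    show "((\<lambda>x. H (s x)) has_derivative (\<lambda>v. - (\<phi> x v ** H (s x)) + H (s x) ** \<phi> x v
      + dot_star (T (s x)) (A x *v v) + dot_star (A x *v v) (T (s x)))) (at x)"
      using has_differential_on_section[OF dH U sP ds[OF x] x] by (simp only: taut \<phi>_def[symmetric])
    show "((\<lambda>x. T (s x)) has_derivative (\<lambda>v. - (\<phi> x v *v T (s x))
      + (H (s x) ** H (s x) + mat (trace (H (s x))) ** H (s x) + mat (of_real (V (s x)))) *v (A x *v v))) (at x)"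
      using has_differential_on_section[OF dT U sP ds[OF x] x] by (simp only: taut \<phi>_def[symmetric])
    show "((\<lambda>x. complex_of_real (V (s x))) has_derivative (\<lambda>v.
      trace (H (s x)) * (star_dot (T (s x)) (A x *v v) + star_dot (A x *v v) (T (s x)))
      + (star_dot (T (s x)) (H (s x) *v (A x *v v)) + star_dot (A x *v v) (H (s x) *v T (s x))))) (at x)"
      using has_differential_on_section[OF dV U sP ds[OF x] x] by (simp only: taut)
  qed
  then have fr: "bk_frame U A \<phi> (\<lambda>x. H (x, A x)) (\<lambda>x. T (x, A x)) (\<lambda>x. V (x, A x))"
    unfolding s_def .
  show ?thesis by (rule that[OF A(1) _ _ fr]) (rule A; assumption)+
qed

lemma bk_frame_subset:
  assumes "bk_frame U A \<phi> H T V" "open S" "S \<subseteq> U"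
  shows "bk_frame S A \<phi> H T V"
proof -
  interpret U: bk_frame U A \<phi> H T V by fact
  show ?thesis
  proof (rule bk_frame.intro)
    show "C1_form S (\<lambda>x v. A x *v v)" by (rule C1_form_subset[OF U.form_A assms(2,3)])
    show "C1_form S \<phi>" by (rule C1_form_subset[OF U.form_\<phi> assms(2,3)])
  qed (rule U.adj_\<phi> U.adj_H U.torsion U.curvature U.dH U.dT U.dV; use assms(3) in blast)+
qed

text \<open>The first column \<open>G x e\<^sub>1\<close> of the frame \<open>G\<close> develops the structure into the null cone of the
  Hermitian form \<open>Jm\<close>, up to the flow of \<open>X0\<close>.\<close>

lemma developing_frame:
  fixes \<Omega> :: "'n::finite form2"
  assumes bk: "bochner_kaehler_on k U \<Omega> H T V" and k: "2 \<le> k" and p0: "(x0, A0) \<in> coframe_bundle U \<Omega>"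
  defines "X0 \<equiv> Xm (H (x0, A0)) (T (x0, A0)) (V (x0, A0))"
  obtains r A G X \<tau> \<mu> where "r > 0" "ball x0 r \<subseteq> U" "\<And>x. x \<in> ball x0 r \<Longrightarrow> (x, A x) \<in> coframe_bundle U \<Omega>" "A x0 = A0"
    "G x0 = mat 1"
    "\<And>x. x \<in> ball x0 r \<Longrightarrow> adj (G x) ** Jm ** G x = Jm"
    "\<And>x. x \<in> ball x0 r \<Longrightarrow> G x ** X x = X0 ** G x"
    "\<And>x. x \<in> ball x0 r \<Longrightarrow> \<exists>H T V. X x = Xm H T V \<and> adj H = H"
    "\<And>x. x \<in> ball x0 r \<Longrightarrow> ((\<lambda>x. G x *v Bv 1 0 0) has_derivative (\<lambda>v. \<tau> x v *s (G x *v Bv 1 0 0)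
        + \<mu> x v *s (X0 *v (G x *v Bv 1 0 0)) + G x *v Bvi (A x *v v))) (at x)"
    "\<And>v. continuous_on (ball x0 r) (\<lambda>x. \<tau> x v *s (G x *v Bv 1 0 0)
        + \<mu> x v *s (X0 *v (G x *v Bv 1 0 0)) + G x *v Bvi (A x *v v))"
proof -
  obtain A \<phi> where A: "Cn_on 2 U A" "\<And>x. x \<in> U \<Longrightarrow> (x, A x) \<in> coframe_bundle U \<Omega>"
    "(x0, A0) \<in> coframe_bundle U \<Omega> \<Longrightarrow> A x0 = A0"
    and fr: "bk_frame U A \<phi> (\<lambda>x. H (x, A x)) (\<lambda>x. T (x, A x)) (\<lambda>x. V (x, A x))"
    using bochner_kaehler_frame[OF bk k] by blast
  have kf: "kaehler_form_on k U \<Omega>" using bk by (simp add: bochner_kaehler_on_def)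
  have x0: "x0 \<in> U" using p0 by (simp add: coframe_bundle_def)
  then obtain r1 where r1: "r1 > 0" "ball x0 r1 \<subseteq> U"
    using kaehler_form_open[OF kf] open_contains_ball by blast
  let ?S = "ball x0 r1"
  interpret bk_frame ?S A \<phi> "\<lambda>x. H (x, A x)" "\<lambda>x. T (x, A x)" "\<lambda>x. V (x, A x)"
    by (rule bk_frame_subset[OF fr open_ball r1(2)])
  have C1\<Omega>: "Cn_on 1 ?S (\<lambda>x. \<Omega> x v w)" for v w
  proof -
    have "enat 1 \<le> k" using k by (metis one_enat_def order.trans one_le_numeral)
    then have "Cn_on 1 U (\<lambda>x. \<Omega> x v w)" using kf unfolding kaehler_form_on_def Ck_on_def by blast
    then show ?thesis using Cn_on_subset r1(2) by blast
  qed
  obtain lam where lam: "C1_form ?S lam" "\<And>x v w. x \<in> ?S \<Longrightarrow> ext_deriv lam x v w = \<Omega> x v w"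
  proof (rule poincare_2_form[of x0 r1 \<Omega>])
    show "bilinear (\<Omega> x)" if "x \<in> ?S" for x using kaehler_form_bilinear[OF kf] that r1 by blast
    show "\<Omega> x v w = - \<Omega> x w v" if "x \<in> ?S" for x v w using kaehler_form_skew[OF kf] that r1 by blast
    show "frechet_derivative (\<lambda>y. \<Omega> y v w) (at x) u + frechet_derivative (\<lambda>y. \<Omega> y w u) (at x) v
        + frechet_derivative (\<lambda>y. \<Omega> y u v) (at x) w = 0" if "x \<in> ?S" for x u v w
      using kf that r1 unfolding kaehler_form_on_def by blast
  qed (use C1\<Omega> in auto)
  have \<Omega>A: "\<Omega> x v w = Im (star_dot (A x *v v) (A x *v w))" if "x \<in> ?S" for x v w
    using kaehler_form_eq[OF kf, of x v w] coframe_bundle_iff[OF kf, of x "A x"] A(2)[of x] that r1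
    by (auto simp: star_dot_adj matrix_vector_mul_assoc)
  define \<Theta> where "\<Theta> x v = \<Theta>0 x v + mat (- 2 * \<i> * of_real (lam x v)) ** X x" for x v
  have lam2: "ext_deriv lam x v w = Im (star_dot (A x *v v) (A x *v w))" if "x \<in> ?S" for x v w
    using lam(2) \<Omega>A that by simp
  have \<Theta>_eq: "\<Theta> = (\<lambda>x v. \<Theta>0 x v + mat (- 2 * \<i> * of_real (lam x v)) ** X x)"
    by (intro ext) (rule \<Theta>_def)
  have fl1: "C1_form ?S \<Theta>"
    unfolding \<Theta>_eq by (rule flat_frame(1)[OF lam(1)]) (rule lam2)
  have fl2: "ext_deriv \<Theta> x v w = - (\<Theta> x v ** \<Theta> x w - \<Theta> x w ** \<Theta> x v)"
    and fl3: "adj (\<Theta> x v) ** Jm + Jm ** \<Theta> x v = 0"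
    and fl4: "X x ** \<Theta>0 x v - \<Theta>0 x v ** X x = X x ** \<Theta> x v - \<Theta> x v ** X x" if "x \<in> ?S" for x v w
    unfolding \<Theta>_eq
    by (rule flat_frame(2)[OF lam(1) lam2 that] flat_frame(3)[OF lam(1) lam2 that] flat_frame(4)[OF lam(1) lam2 that];
        assumption)+
  have x0S: "x0 \<in> ?S" using r1 by simp
  have "\<exists>r G. r > 0 \<and> ball x0 r \<subseteq> ?S \<and> G x0 = mat 1 \<and>
      (\<forall>x\<in>ball x0 r. (G has_derivative (\<lambda>v. G x ** \<Theta> x v)) (at x))"
    by (rule flat_connection_solution[OF fl1 x0S fl2], assumption) (intro exI conjI ballI; assumption)
  then obtain r G where r: "r > 0" "ball x0 r \<subseteq> ?S" and G: "G x0 = mat 1"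
    "\<And>x. x \<in> ball x0 r \<Longrightarrow> (G has_derivative (\<lambda>v. G x ** \<Theta> x v)) (at x)"
    by blast
  let ?B = "ball x0 r"
  note FD = bounded_bilinear.FDERIV[OF bounded_bilinear_matrix_mult]
  have J: "adj (G x) ** Jm ** G x = Jm" and GX: "G x ** X x = X0 ** G x" if x: "x \<in> ?B" for x
  proof -
    have const: "f x = f x0" if "\<And>y. y \<in> ?B \<Longrightarrow> (f has_derivative (\<lambda>v. 0)) (at y)"
      for f :: "complex^'n \<Rightarrow> complex^('n option option)^('n option option)"
      using has_derivative_zero_unique[of ?B f x x0] that x r by (auto intro: has_derivative_at_withinI)
    have sk: "\<Theta> y v ** Jm + Jm ** adj (\<Theta> y v) = 0" if "y \<in> ?B" for y v
    proof -
      have "adj (\<Theta> y v) ** Jm + Jm ** \<Theta> y v = 0" using fl3 that r by blast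
      then have "Jm ** (adj (\<Theta> y v) ** Jm + Jm ** \<Theta> y v) ** Jm = 0" by (simp add: matrix_mult_zero)
      then have "Jm ** adj (\<Theta> y v) ** (Jm ** Jm) + (Jm ** Jm) ** \<Theta> y v ** Jm = 0"
        by (simp add: matrix_add_distrib matrix_mul_assoc)
      then show ?thesis by (simp add: Jm_Jm add.commute)
    qed
    \<comment> \<open>Since \<open>G\<close> is multiplied by \<open>\<Theta>\<close> from the
      right, it is \<open>G Jm adj G\<close> whose derivative contains the vanishing expression in
      \<open>\<Theta>\<close>; the inverse matrix then turns this into the identity for
      \<open>adj G Jm G\<close>.\<close>
    have dJ: "((\<lambda>x. G x ** (Jm ** adj (G x))) has_derivative (\<lambda>v. 0)) (at y)" if y: "y \<in> ?B" for y
    proof (rule has_derivative_eq_rhs)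
      show "((\<lambda>x. G x ** (Jm ** adj (G x))) has_derivative
        (\<lambda>v. G y ** (Jm ** adj (G y ** \<Theta> y v)) + (G y ** \<Theta> y v) ** (Jm ** adj (G y)))) (at y)"
        using FD[OF G(2)[OF y] bounded_linear.has_derivative[OF bounded_bilinear.bounded_linear_right[OF bounded_bilinear_matrix_mult]
            bounded_linear.has_derivative[OF bounded_linear_adj G(2)[OF y]]]] .
      have "G y ** (Jm ** adj (G y ** \<Theta> y v)) + (G y ** \<Theta> y v) ** (Jm ** adj (G y)) =
         G y ** (\<Theta> y v ** Jm + Jm ** adj (\<Theta> y v)) ** adj (G y)" for v
        by (simp add: matrix_add_distrib adj_mult matrix_mul_assoc add.commute)
      then show "(\<lambda>v. G y ** (Jm ** adj (G y ** \<Theta> y v)) + (G y ** \<Theta> y v) ** (Jm ** adj (G y))) = (\<lambda>v. 0)"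
        by (simp only: sk[OF y] matrix_mult_zero)
    qed
    have "G x ** (Jm ** adj (G x)) = Jm"
      using const[OF dJ] by (simp add: G)
    then have "(G x ** (Jm ** adj (G x))) ** Jm = mat 1" by (simp add: Jm_Jm)
    then have "(G x ** Jm) ** (adj (G x) ** Jm) = mat 1" by (simp only: matrix_mul_assoc)
    then have GJ: "(adj (G x) ** Jm) ** (G x ** Jm) = mat 1" using matrix_left_right_inverse by blast
    then have "(adj (G x) ** Jm) ** (G x ** Jm) ** Jm = Jm" by simp
    then have "adj (G x) ** Jm ** G x ** (Jm ** Jm) = Jm" by (simp only: matrix_mul_assoc)
    then show "adj (G x) ** Jm ** G x = Jm" by (simp add: Jm_Jm)
    have dX': "(X has_derivative (\<lambda>v. X y ** \<Theta> y v - \<Theta> y v ** X y)) (at y)" if "y \<in> ?B" for y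
      using dX[of y] fl4[of y] that r by auto
    \<comment> \<open>Up to a constant factor \<open>Jm\<close> this is \<open>X\<close> conjugated
      by \<open>G\<close>, with the inverse of \<open>G\<close> written as
      \<open>Jm adj G Jm\<close>.\<close>
    have dGX: "((\<lambda>x. (G x ** X x) ** (Jm ** adj (G x))) has_derivative (\<lambda>v. 0)) (at y)" if y: "y \<in> ?B" for y
    proof (rule has_derivative_eq_rhs)
      show "((\<lambda>x. (G x ** X x) ** (Jm ** adj (G x))) has_derivative
        (\<lambda>v. (G y ** X y) ** (Jm ** adj (G y ** \<Theta> y v)) + (G y ** (X y ** \<Theta> y v - \<Theta> y v ** X y) + (G y ** \<Theta> y v) ** X y) ** (Jm ** adj (G y)))) (at y)"
        using FD[OF FD[OF G(2)[OF y] dX'[OF y]] bounded_linear.has_derivative[OF bounded_bilinear.bounded_linear_right[OF bounded_bilinear_matrix_mult]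
            bounded_linear.has_derivative[OF bounded_linear_adj G(2)[OF y]]]] .
      have "(G y ** X y) ** (Jm ** adj (G y ** \<Theta> y v)) + (G y ** (X y ** \<Theta> y v - \<Theta> y v ** X y) + (G y ** \<Theta> y v) ** X y) ** (Jm ** adj (G y)) =
         G y ** X y ** (\<Theta> y v ** Jm + Jm ** adj (\<Theta> y v)) ** adj (G y)" for v
        by (simp add: matrix_add_distrib matrix_diff_distrib adj_mult matrix_mul_assoc add.commute)
      then show "(\<lambda>v. (G y ** X y) ** (Jm ** adj (G y ** \<Theta> y v)) + (G y ** (X y ** \<Theta> y v - \<Theta> y v ** X y) + (G y ** \<Theta> y v) ** X y) ** (Jm ** adj (G y))) = (\<lambda>v. 0)"
        by (simp only: sk[OF y] matrix_mult_zero)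
    qed
    have e: "(G x ** X x) ** (Jm ** adj (G x)) = X x0 ** Jm"
      using const[OF dGX] by (simp add: G)
    have "G x ** X x = (G x ** X x) ** (Jm ** (adj (G x) ** Jm ** G x))"
      unfolding \<open>adj (G x) ** Jm ** G x = Jm\<close> by (simp add: Jm_Jm)
    also have "\<dots> = ((G x ** X x) ** (Jm ** adj (G x))) ** (Jm ** G x)"
      by (simp only: matrix_mul_assoc)
    also have "\<dots> = X x0 ** (Jm ** Jm) ** G x"
      unfolding e by (simp only: matrix_mul_assoc)
    also have "\<dots> = X x0 ** G x" by (simp add: Jm_Jm)
    finally have "G x ** X x = X x0 ** G x" .
    moreover have "X x0 = X0" using A(3)[OF p0] by (simp add: X_def X0_def)
    ultimately show "G x ** X x = X0 ** G x" by simp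
  qed
  define \<mu> where "\<mu> x v = - 2 * \<i> * complex_of_real (lam x v)" for x v
  let ?e = "Bv 1 0 0 :: complex^('n option option)"
  let ?N = "\<lambda>x. G x *v ?e"
  \<comment> \<open>In the first column of the connection, the scalar part gives a multiple of
    \<open>N\<close>, and the twist gives a multiple of \<open>X e1\<close>, which \<open>G\<close>
    carries to \<open>X0 N\<close>. Modulo these two directions only the coframe \<open>A\<close> is
    left.\<close>
  have \<Theta>e: "G x *v (\<Theta> x v *v ?e) = \<tau> x v *s ?N x + \<mu> x v *s (X0 *v ?N x) + G x *v Bvi (A x *v v)" if "x \<in> ?B" for x v
  proof -
    have "\<Theta>0 x v *v ?e = \<tau> x v *s ?e + Bvi (A x *v v)"
      by (simp add: \<Theta>0_def Tm_def Bv_mult Bvi_def Bv_smult Bv_add \<omega>_def)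
    then have "\<Theta> x v *v ?e = \<tau> x v *s ?e + Bvi (A x *v v) + \<mu> x v *s (X x *v ?e)"
      unfolding \<Theta>_def \<mu>_def by (simp add: matrix_add_distrib matrix_vector_mul_assoc[symmetric])
    then show ?thesis
      using GX[OF that] by (simp add: matrix_add_distrib matrix_vector_smult matrix_vector_mul_assoc)
  qed
  have contG: "continuous_on ?B G"
    using has_derivative_continuous[OF G(2)] by (rule continuous_at_imp_continuous_on[OF ballI])
  have c: "continuous_on ?B (\<lambda>x. G x *v (\<Theta> x v *v ?e))" for v
  proof -
    have "continuous_on ?B (\<lambda>x. \<Theta> x v)"
      using Cn_on_imp_continuous_on[OF C1_form.C1[OF fl1]] r continuous_on_subset by blast
    then show ?thesis
      by (intro bounded_bilinear.continuous_on[OF bounded_bilinear_matrix_vector] contG continuous_on_const)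
  qed
  show ?thesis
  proof (rule that[of r A G X \<tau> \<mu>])
    show "r > 0" "ball x0 r \<subseteq> U" "A x0 = A0" "G x0 = mat 1" using r r1 A p0 G by auto
    show "(x, A x) \<in> coframe_bundle U \<Omega>" if "x \<in> ?B" for x using A(2) that r r1 by blast
    show "\<exists>H T V. X x = Xm H T V \<and> adj H = H" if "x \<in> ?B" for x
      using adj_H[of x] that r unfolding X_def by blast
    show "((\<lambda>x. ?N x) has_derivative (\<lambda>v. \<tau> x v *s ?N x + \<mu> x v *s (X0 *v ?N x) + G x *v Bvi (A x *v v))) (at x)"
      if "x \<in> ?B" for x
      using bounded_linear.has_derivative[OF bounded_bilinear.bounded_linear_left[OF bounded_bilinear_matrix_vector, of ?e] G(2)[OF that]]
      by (simp only: matrix_vector_mul_assoc[symmetric] \<Theta>e[OF that])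
    show "continuous_on ?B (\<lambda>x. \<tau> x v *s ?N x + \<mu> x v *s (X0 *v ?N x) + G x *v Bvi (A x *v v))" for v
      by (rule continuous_on_eq[OF c[of v]]) (rule \<Theta>e)
  qed (use J GX in auto)
qed


section \<open>Holomorphic functions of several variables\<close>

text \<open>Continuous differentiability with complex-linear derivative. Together with Cauchy's
  formula on complex lines this yields all higher derivatives.\<close>

definition holo :: "(complex^'k::finite) set \<Rightarrow> (complex^'k \<Rightarrow> complex) \<Rightarrow> bool" where
  "holo S f \<longleftrightarrow> open S \<and> Cn_on 1 S f \<and>
     (\<forall>x\<in>S. \<forall>v. frechet_derivative f (at x) (\<i> *s v) = \<i> * frechet_derivative f (at x) v)"

definition dird :: "(complex^'k::finite) \<Rightarrow> (complex^'k \<Rightarrow> complex) \<Rightarrow> complex^'k \<Rightarrow> complex" where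
  "dird w f x = frechet_derivative f (at x) w"

lemma holoI:
  assumes "open S" "\<And>x. x \<in> S \<Longrightarrow> (f has_derivative f' x) (at x)" "\<And>v. continuous_on S (\<lambda>x. f' x v)"
    "\<And>x v. x \<in> S \<Longrightarrow> f' x (\<i> *s v) = \<i> * f' x v"
  shows "holo S f"
proof -
  have "Cn_on (Suc 0) S f" by (rule Cn_on_SucI[OF assms(2)]) (use assms in auto)
  then show ?thesis
    using assms frechet_derivative_apply[OF assms(2)] by (simp add: holo_def)
qed

lemma
  assumes "holo S f"
  shows holo_open: "open S"
    and holo_has_derivative: "x \<in> S \<Longrightarrow> (f has_derivative (\<lambda>v. dird v f x)) (at x)"
    and holo_continuous_dird: "continuous_on S (dird v f)"
    and holo_dird_i: "x \<in> S \<Longrightarrow> dird (\<i> *s v) f x = \<i> * dird v f x"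
    and holo_continuous: "continuous_on S f"
  using assms Cn_on_SucD[of 0 S f x] Cn_on_imp_continuous_on[of 1 S f]
  by (auto simp: holo_def dird_def[abs_def])

lemma holo_linear_dird: "holo S f \<Longrightarrow> x \<in> S \<Longrightarrow> linear (\<lambda>v. dird v f x)"
  using holo_has_derivative has_derivative_linear by blast

lemma holo_dird_smult:
  assumes "holo S f" "x \<in> S"
  shows "dird (c *s v) f x = c * dird v f x"
proof -
  note l = holo_linear_dird[OF assms]
  have "c *s v = Re c *\<^sub>R v + Im c *\<^sub>R (\<i> *s v)"
    by (simp add: vec_eq_iff complex_eq_iff)
  then have "dird (c *s v) f x = Re c *\<^sub>R dird v f x + Im c *\<^sub>R (\<i> * dird v f x)"
    by (simp only: linear_add[OF l] linear_cmul[OF l] holo_dird_i[OF assms])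
  then show ?thesis by (simp add: complex_eq_iff)
qed

lemma holo_dird_sum:
  assumes "holo S f" "x \<in> S"
  shows "dird v f x = (\<Sum>i\<in>UNIV. dird (axis i 1) f x * v $ i)"
proof -
  have "v = (\<Sum>i\<in>UNIV. v $ i *s axis i 1)"
    by (simp add: vec_eq_iff axis_def if_distrib cong: if_cong)
  then have "dird v f x = (\<Sum>i\<in>UNIV. dird (v $ i *s axis i 1) f x)"
    using linear_sum[OF holo_linear_dird[OF assms]] by metis
  then show ?thesis by (simp only: holo_dird_smult[OF assms] mult.commute)
qed

lemma holo_subset: "holo S f \<Longrightarrow> open T \<Longrightarrow> T \<subseteq> S \<Longrightarrow> holo T f"
  unfolding holo_def using Cn_on_subset by blast

lemma holo_cong:
  assumes "holo S f" "\<And>x. x \<in> S \<Longrightarrow> g x = f x"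
  shows "holo S g"
proof (rule holoI[where f'="\<lambda>x v. dird v f x"])
  show "(g has_derivative (\<lambda>v. dird v f x)) (at x)" if "x \<in> S" for x
    by (rule has_derivative_transform_within_open[OF holo_has_derivative[OF assms(1) that] holo_open[OF assms(1)] that])
       (simp add: assms(2))
qed (use assms(1) holo_open holo_continuous_dird[OF assms(1)] holo_dird_i in \<open>auto simp: dird_def[abs_def]\<close>)

lemma holo_local:
  assumes "open S" "\<And>x. x \<in> S \<Longrightarrow> \<exists>N. x \<in> N \<and> holo N f"
  shows "holo S f"
  unfolding holo_def
proof (intro conjI ballI allI)
  show "Cn_on 1 S f"
  proof (rule Cn_on_local)
    fix x assume "x \<in> S"
    then obtain N where "x \<in> N" "holo N f" using assms(2) by blast
    then show "\<exists>N. open N \<and> x \<in> N \<and> Cn_on 1 N f" unfolding holo_def by (intro exI[of _ N]) simp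
  qed
  show "frechet_derivative f (at x) (\<i> *s v) = \<i> * frechet_derivative f (at x) v" if "x \<in> S" for x v
    using assms(2)[OF that] unfolding holo_def by auto
qed (rule assms(1))

lemma holo_const: "open S \<Longrightarrow> holo S (\<lambda>x. c)"
  by (rule holoI[where f'="\<lambda>_ _. 0"]) auto

lemma holo_nth: "open S \<Longrightarrow> holo S (\<lambda>x. x $ i)"
  by (rule holoI[where f'="\<lambda>_ v. v $ i"])
     (auto intro: bounded_linear.has_derivative[OF bounded_linear_vec_nth has_derivative_ident])

lemma holo_add: "holo S f \<Longrightarrow> holo S g \<Longrightarrow> holo S (\<lambda>x. f x + g x)"
  by (rule holoI[OF holo_open has_derivative_add[OF holo_has_derivative holo_has_derivative]])
     (auto intro!: continuous_intros holo_continuous_dird simp: holo_dird_i algebra_simps)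

lemma holo_mult: "holo S f \<Longrightarrow> holo S g \<Longrightarrow> holo S (\<lambda>x. f x * g x)"
proof (rule holoI[OF holo_open])
  assume f: "holo S f" and g: "holo S g"
  show "((\<lambda>x. f x * g x) has_derivative (\<lambda>v. f x * dird v g x + dird v f x * g x)) (at x)" if "x \<in> S" for x
    by (rule has_derivative_mult[OF holo_has_derivative[OF f that] holo_has_derivative[OF g that]])
  show "continuous_on S (\<lambda>x. f x * dird v g x + dird v f x * g x)" for v
    by (intro continuous_on_add continuous_on_mult holo_continuous_dird[OF f] holo_continuous_dird[OF g]
        holo_continuous[OF f] holo_continuous[OF g])
qed (auto simp: holo_dird_i algebra_simps)

lemma holo_minus: "holo S f \<Longrightarrow> holo S (\<lambda>x. - f x)"
  by (rule holoI[OF holo_open has_derivative_minus[OF holo_has_derivative]])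
     (auto intro!: continuous_intros holo_continuous_dird simp: holo_dird_i)

lemma holo_sum: "open S \<Longrightarrow> (\<And>i. i \<in> I \<Longrightarrow> holo S (f i)) \<Longrightarrow> holo S (\<lambda>x. \<Sum>i\<in>I. f i x)"
  by (induction I rule: infinite_finite_induct) (auto intro!: holo_const holo_add)

lemma holo_compose_field:
  assumes f: "holo S f" and \<phi>: "\<And>z. z \<in> T \<Longrightarrow> (\<phi> has_field_derivative \<phi>' z) (at z)"
    and c: "continuous_on T \<phi>'" and T: "f ` S \<subseteq> T"
  shows "holo S (\<lambda>x. \<phi> (f x))"
proof (rule holoI[OF holo_open[OF f]])
  show "((\<lambda>x. \<phi> (f x)) has_derivative (\<lambda>v. \<phi>' (f x) * dird v f x)) (at x)" if "x \<in> S" for x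
    using has_derivative_compose[OF holo_has_derivative[OF f that], of \<phi> "\<lambda>z. \<phi>' (f x) * z"] \<phi>[of "f x"] T that
    by (auto simp: has_field_derivative_def)
  show "continuous_on S (\<lambda>x. \<phi>' (f x) * dird v f x)" for v
    by (intro continuous_on_mult continuous_on_compose2[OF c holo_continuous[OF f] T] holo_continuous_dird[OF f])
qed (simp add: holo_dird_i[OF f])

lemma holo_inverse:
  assumes "holo S f" "\<And>x. x \<in> S \<Longrightarrow> f x \<noteq> 0"
  shows "holo S (\<lambda>x. inverse (f x))"
  by (rule holo_compose_field[OF assms(1), where T="- {0}" and \<phi>'="\<lambda>z. - (inverse z * inverse z)"])
     (use assms(2) in \<open>auto intro!: continuous_intros derivative_eq_intros\<close>)

lemma holo_compose:
  fixes f :: "complex^'k::finite \<Rightarrow> complex^'m::finite"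
  assumes g: "holo T g" and f: "\<And>j. holo S (\<lambda>x. f x $ j)" and T: "f ` S \<subseteq> T"
  shows "holo S (\<lambda>x. g (f x))"
proof -
  have S: "open S" using holo_open[OF f] .
  define f' where "f' x v = (\<chi> j. dird v (\<lambda>x. f x $ j) x)" for x v
  have df: "(f has_derivative f' x) (at x)" if "x \<in> S" for x
  proof -
    have "((\<lambda>x. \<Sum>j\<in>UNIV. f x $ j *s axis j 1) has_derivative (\<lambda>v. \<Sum>j\<in>UNIV. dird v (\<lambda>x. f x $ j) x *s axis j 1)) (at x)"
      by (intro has_derivative_sum bounded_linear.has_derivative[OF bounded_bilinear.bounded_linear_left[OF bounded_bilinear_smult]]
          holo_has_derivative[OF f that])
    moreover have "(\<Sum>j\<in>UNIV. y j *s axis j 1) = (\<chi> j. y j)" for y :: "'m \<Rightarrow> complex"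
      by (simp add: vec_eq_iff axis_def if_distrib cong: if_cong)
    ultimately show ?thesis by (simp add: f'_def[abs_def])
  qed
  have fc: "continuous_on S f"
    using has_derivative_continuous[OF df] by (rule continuous_at_imp_continuous_on[OF ballI])
  show ?thesis
  proof (rule holoI[OF S])
    show "((\<lambda>x. g (f x)) has_derivative (\<lambda>v. dird (f' x v) g (f x))) (at x)" if "x \<in> S" for x
      using has_derivative_compose[OF df[OF that] holo_has_derivative[OF g]] T that by auto
    have "continuous_on S (\<lambda>x. \<Sum>j\<in>UNIV. dird (axis j 1) g (f x) * f' x v $ j)" for v
      unfolding f'_def
      by (simp, intro continuous_intros continuous_on_compose2[OF holo_continuous_dird[OF g] fc T] holo_continuous_dird[OF f])
    then show "continuous_on S (\<lambda>x. dird (f' x v) g (f x))" for v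
      by (rule continuous_on_eq) (use T holo_dird_sum[OF g] in force)
    have "f' x (\<i> *s v) = \<i> *s f' x v" if "x \<in> S" for x v
      using holo_dird_i[OF f that] by (simp add: f'_def vec_eq_iff)
    then show "dird (f' x (\<i> *s v)) g (f x) = \<i> * dird (f' x v) g (f x)" if "x \<in> S" for x v
      using holo_dird_i[OF g] T that by force
  qed
qed

lemma holo_line:
  assumes "holo S f" "z + \<zeta> *s w \<in> S"
  shows "((\<lambda>\<zeta>. f (z + \<zeta> *s w)) has_field_derivative dird w f (z + \<zeta> *s w)) (at \<zeta>)"
proof -
  have "((\<lambda>\<zeta>. z + \<zeta> *s w) has_derivative (\<lambda>h. 0 + h *s w)) (at \<zeta>)"
    by (intro has_derivative_add has_derivative_const
        bounded_linear.has_derivative[OF bounded_bilinear.bounded_linear_left[OF bounded_bilinear_smult]] has_derivative_ident)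
  from has_derivative_compose[OF this holo_has_derivative[OF assms]]
  have "((\<lambda>\<zeta>. f (z + \<zeta> *s w)) has_derivative (\<lambda>h. dird (0 + h *s w) f (z + \<zeta> *s w))) (at \<zeta>)" .
  then show ?thesis
    unfolding has_field_derivative_def
    by (rule has_derivative_eq_rhs) (simp add: fun_eq_iff holo_dird_smult[OF assms])
qed

lemma cauchy_derivative_circle:
  fixes h :: "complex \<Rightarrow> complex"
  assumes "r > 0" "\<And>\<zeta>. norm \<zeta> \<le> r \<Longrightarrow> (h has_field_derivative h' \<zeta>) (at \<zeta>)"
  shows "h' 0 = integral {0..1} (\<lambda>t. h (r * exp (2 * pi * \<i> * of_real t)) / (r * exp (2 * pi * \<i> * of_real t)))"
proof -
  have hol: "h holomorphic_on ball 0 r"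
    by (rule holomorphic_onI) (use assms(2) in \<open>auto simp: field_differentiable_def intro: has_field_derivative_at_within less_imp_le\<close>)
  have cont: "continuous_on (cball 0 r) h"
    by (rule continuous_at_imp_continuous_on, rule ballI, rule DERIV_isCont, rule assms(2)) simp
  have "(h has_field_derivative (1 / (2 * of_real pi * \<i>) * contour_integral (circlepath 0 r) (\<lambda>u. h u / (u - 0)^2))) (at 0)"
    by (rule Cauchy_derivative_integral_circlepath(2)[OF cont hol]) (use assms in simp)
  then have "h' 0 = 1 / (2 * of_real pi * \<i>) * contour_integral (circlepath 0 r) (\<lambda>u. h u / u^2)"
    using assms DERIV_unique[of h _ 0 "h' 0"] by auto
  also have "contour_integral (circlepath 0 r) (\<lambda>u. h u / u^2) =
      integral {0..1} (\<lambda>t. (2 * of_real pi * \<i>) * (h (r * exp (2 * pi * \<i> * of_real t)) / (r * exp (2 * pi * \<i> * of_real t))))"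
    unfolding contour_integral_integral
    by (rule integral_cong, unfold vector_derivative_circlepath)
       (use assms(1) in \<open>simp add: circlepath power2_eq_square field_simps\<close>)
  also have "\<dots> = (2 * of_real pi * \<i>) * integral {0..1} (\<lambda>t. h (r * exp (2 * pi * \<i> * of_real t)) / (r * exp (2 * pi * \<i> * of_real t)))"
    by (rule integral_mult_right)
  finally show ?thesis by simp
qed

text \<open>On the complex line through \<open>z\<close> in the direction \<open>w\<close>, Cauchy's
  formula writes the derivative as an integral of values of \<open>f\<close> over a circle. The
  circle is the same for all \<open>z\<close> near \<open>p\<close>, so one may differentiate under
  the integral in \<open>z\<close>, and complex linearity passes to the integral.\<close>

lemma holo_dird:
  fixes f :: "complex^'k::finite \<Rightarrow> complex"
  assumes f: "holo S f"
  shows "holo S (dird w f)"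
proof (rule holo_local[OF holo_open[OF f]])
  fix p assume "p \<in> S"
  then obtain R where R: "R > 0" "cball p R \<subseteq> S"
    using holo_open[OF f] open_contains_cball by blast
  \<comment> \<open>From a point in the ball of radius \<open>R / 2\<close> the circle of this
    radius in the direction \<open>w\<close> stays within distance \<open>R\<close> of
    \<open>p\<close>; the summand 1 covers \<open>w = 0\<close>.\<close>
  define r where "r = R / (2 * (norm w + 1))"
  have pos: "norm w + 1 > 0" by (smt (verit) norm_ge_zero)
  have r: "r > 0" using R pos by (simp add: r_def)
  let ?B = "ball p (R / 2)"
  have inS: "z + \<zeta> *s w \<in> S" if "z \<in> ?B" "norm \<zeta> \<le> r" for z \<zeta>
  proof -
    have "norm (\<zeta> *s w) = norm \<zeta> * norm w"
      by (simp add: norm_vec_def L2_set_def norm_mult power_mult_distrib real_sqrt_mult sum_distrib_left[symmetric])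
    also have "\<dots> \<le> r * (norm w + 1)" using that r by (intro mult_mono) auto
    also have "\<dots> = R / 2" using pos by (simp add: r_def field_simps)
    finally have "dist p (z + \<zeta> *s w) \<le> R"
      using that dist_triangle[of p "z + \<zeta> *s w" z] by (simp add: dist_norm)
    then show ?thesis using R by auto
  qed
  define c where "c t = r * exp (2 * pi * \<i> * of_real t)" for t :: real
  have nc: "norm (c t) = r" for t using r by (simp add: c_def norm_mult)
  then have c0: "c t \<noteq> 0" for t using r by (metis norm_zero less_irrefl)
  have cc: "continuous_on X c" for X unfolding c_def by (intro continuous_intros)
  let ?F = "\<lambda>z t. f (z + c t *s w) / c t"
  let ?F' = "\<lambda>z t v. dird v f (z + c t *s w) / c t"
  have cp: "continuous_on X (\<lambda>x. u x + c (t x) *s w)" if "continuous_on X u" "continuous_on X t"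
    for X :: "'z::topological_space set" and u t
    by (intro continuous_on_add that bounded_bilinear.continuous_on[OF bounded_bilinear_smult]
        continuous_on_const continuous_on_compose2[OF cc that(2) subset_UNIV])
  have d: "((\<lambda>z. ?F z t) has_derivative ?F' z t) (at z)" if "z \<in> ?B" "t \<in> {0..1}" for z t
  proof -
    have "((\<lambda>z. z + c t *s w) has_derivative (\<lambda>v. v)) (at z)"
      by (auto intro!: derivative_eq_intros)
    from has_derivative_compose[OF this holo_has_derivative[OF f inS[OF that(1)]]] nc
    have "((\<lambda>z. f (z + c t *s w)) has_derivative (\<lambda>v. dird v f (z + c t *s w))) (at z)" by simp
    then show ?thesis
      by (rule bounded_linear.has_derivative[OF bounded_linear_divide])
  qed
  have cF: "continuous_on {0..1} (?F z)" if "z \<in> ?B" for z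
    using inS[OF that] nc c0
    by (intro continuous_on_divide continuous_on_compose2[OF holo_continuous[OF f] cp] cc continuous_intros) auto
  have cF': "continuous_on (?B \<times> {0..1}) (\<lambda>(z, t). ?F' z t v)" for v
    unfolding split_beta
    using inS nc c0
    by (intro continuous_on_divide continuous_on_compose2[OF holo_continuous_dird[OF f] cp]
        continuous_on_compose2[OF cc continuous_on_snd[OF continuous_on_id]] continuous_intros) auto
  note L = leibniz_parametric[OF open_ball convex_ball d cF cF']
  have eq: "dird w f z = integral {0..1} (?F z)" if "z \<in> ?B" for z
    using cauchy_derivative_circle[OF r holo_line[OF f inS[OF that]]] by (simp add: c_def)
  have LD: "((\<lambda>x. integral {0..1} (?F x)) has_derivative (\<lambda>v. integral {0..1} (\<lambda>t. ?F' x t v))) (at x)" if "x \<in> ?B" for x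
    by (rule leibniz_parametric(1)[OF open_ball convex_ball d cF cF']) (rule that | assumption)+
  have L1: "Cn_on 1 ?B (\<lambda>x. integral {0..1} (?F x))"
    by (rule leibniz_parametric(2)[OF open_ball convex_ball d cF cF']) assumption+
  have "holo ?B (\<lambda>z. integral {0..1} (?F z))"
    unfolding holo_def
  proof (intro conjI ballI allI L1 open_ball)
    fix x v assume x: "x \<in> ?B"
    have "integral {0..1} (\<lambda>t. ?F' x t (\<i> *s v)) = integral {0..1} (\<lambda>t. \<i> * ?F' x t v)"
      by (rule integral_cong) (use holo_dird_i[OF f inS[OF x]] nc in simp)
    then show "frechet_derivative (\<lambda>z. integral {0..1} (?F z)) (at x) (\<i> *s v) =
        \<i> * frechet_derivative (\<lambda>z. integral {0..1} (?F z)) (at x) v"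
      unfolding frechet_derivative_apply[OF LD[OF x]] by (simp only: integral_mult_right)
  qed
  then have "holo ?B (dird w f)" by (rule holo_cong) (rule eq)
  then show "\<exists>N. p \<in> N \<and> holo N (dird w f)" using R by (intro exI[of _ ?B]) auto
qed


subsection \<open>Power series\<close>

text \<open>The dominating series for power series in several variables. The induction splits off
  one exponent.\<close>

lemma multi_geometric_summable:
  fixes t :: "'b \<Rightarrow> real"
  assumes "finite B" "\<And>b. b \<in> B \<Longrightarrow> 0 \<le> t b \<and> t b < 1"
  shows "(\<lambda>\<alpha>. \<Prod>b\<in>B. t b ^ \<alpha> b) summable_on {\<alpha> :: 'b \<Rightarrow> nat. \<forall>b. b \<notin> B \<longrightarrow> \<alpha> b = 0}"
  using assms
proof (induction B)
  case empty
  have "{\<alpha> :: 'b \<Rightarrow> nat. \<forall>b. b \<notin> {} \<longrightarrow> \<alpha> b = 0} = {\<lambda>_. 0}" by auto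
  then show ?case by simp
next
  case (insert c B)
  let ?A = "\<lambda>B. {\<alpha> :: 'b \<Rightarrow> nat. \<forall>b. b \<notin> B \<longrightarrow> \<alpha> b = 0}"
  let ?P = "\<lambda>\<alpha>. \<Prod>b\<in>B. t b ^ \<alpha> b"
  have P: "?P summable_on ?A B" using insert by simp
  have "(\<lambda>k. t c ^ k) summable_on UNIV"
    using insert.prems[of c] by (intro summable_nonneg_imp_summable_on) (auto intro: summable_geometric)
  then have "(\<lambda>k. t c ^ k * infsum ?P (?A B)) summable_on UNIV" by (rule summable_on_cmult_left)
  then have "(\<lambda>(k, \<alpha>). t c ^ k * ?P \<alpha>) summable_on Sigma UNIV (\<lambda>_. ?A B)"
    by (intro summable_on_SigmaI[where g="\<lambda>k. t c ^ k * infsum ?P (?A B)"])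
       (use insert.prems P in \<open>auto intro!: has_sum_cmult_right mult_nonneg_nonneg prod_nonneg\<close>)
  moreover have "bij_betw (\<lambda>\<alpha>. (\<alpha> c, \<alpha>(c := 0))) (?A (insert c B)) (Sigma UNIV (\<lambda>_. ?A B))"
    by (rule bij_betw_byWitness[where f'="\<lambda>(k, \<alpha>). \<alpha>(c := k)"]) (use insert.hyps in auto)
  ultimately have "(\<lambda>\<alpha>. case (\<alpha> c, \<alpha>(c := 0)) of (k, \<alpha>) \<Rightarrow> t c ^ k * ?P \<alpha>) summable_on ?A (insert c B)"
    using summable_on_reindex_bij_betw by blast
  moreover have "(\<Prod>b\<in>insert c B. t b ^ \<alpha> b) = (case (\<alpha> c, \<alpha>(c := 0)) of (k, \<alpha>) \<Rightarrow> t c ^ k * ?P \<alpha>)" for \<alpha>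
  proof -
    have "?P (\<alpha>(c := 0)) = ?P \<alpha>" by (rule prod.cong) (use insert.hyps in auto)
    then show ?thesis using insert.hyps by simp
  qed
  ultimately show ?case by simp
qed

lemma holo_dird_power: "holo S f \<Longrightarrow> holo S ((dird w ^^ k) f)"
  by (induction k) (auto intro: holo_dird)

text \<open>Identifies the one-variable Taylor coefficients on a line, to which Cauchy's inequality
  applies, with iterated directional derivatives, which are holomorphic in the remaining
  variables.\<close>

lemma dird_power_line:
  assumes f: "holo S f" and "z + \<zeta> *s w \<in> S"
  shows "(deriv ^^ k) (\<lambda>\<zeta>. f (z + \<zeta> *s w)) \<zeta> = (dird w ^^ k) f (z + \<zeta> *s w)"
  using assms(2)
proof (induction k arbitrary: \<zeta>)
  case (Suc k)
  have "continuous_on UNIV (\<lambda>\<zeta>. z + \<zeta> *s w)"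
    by (intro continuous_on_add continuous_on_const continuous_on_id bounded_bilinear.continuous_on[OF bounded_bilinear_smult])
  then have "open ((\<lambda>\<zeta>. z + \<zeta> *s w) -` S)"
    using open_vimage[OF holo_open[OF f]] by blast
  moreover have "\<zeta> \<in> (\<lambda>\<zeta>. z + \<zeta> *s w) -` S" using Suc.prems by simp
  moreover have "(deriv ^^ k) (\<lambda>\<zeta>. f (z + \<zeta> *s w)) x = (dird w ^^ k) f (z + x *s w)" if "x \<in> (\<lambda>\<zeta>. z + \<zeta> *s w) -` S" for x
    by (rule Suc.IH) (use that in simp)
  ultimately have "\<forall>\<^sub>F x in nhds \<zeta>. (deriv ^^ k) (\<lambda>\<zeta>. f (z + \<zeta> *s w)) x = (dird w ^^ k) f (z + x *s w)"
    unfolding eventually_nhds by blast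
  then have "deriv ((deriv ^^ k) (\<lambda>\<zeta>. f (z + \<zeta> *s w))) \<zeta> = deriv (\<lambda>\<zeta>. (dird w ^^ k) f (z + \<zeta> *s w)) \<zeta>"
    by (intro deriv_cong_ev[of "(deriv ^^ k) (\<lambda>\<zeta>. f (z + \<zeta> *s w))" "\<lambda>\<zeta>. (dird w ^^ k) f (z + \<zeta> *s w)"] refl)
  also have "\<dots> = dird w ((dird w ^^ k) f) (z + \<zeta> *s w)"
    by (rule DERIV_imp_deriv[OF holo_line[OF holo_dird_power[OF f] Suc.prems]])
  finally show ?case by simp
qed simp

text \<open>Induction on the number of variables: the coefficients of the power series in one variable are
  holomorphic in the others and satisfy Cauchy's estimate.\<close>

lemma holo_power_series:
  fixes e :: "'b \<Rightarrow> complex^'k::finite" and r :: real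
  assumes "finite B" and r: "r > 0"
    and "holo S f" "\<And>\<zeta>. (\<forall>b\<in>B. norm (\<zeta> b) \<le> r) \<Longrightarrow> p + (\<Sum>b\<in>B. \<zeta> b *s e b) \<in> S \<and> norm (f (p + (\<Sum>b\<in>B. \<zeta> b *s e b))) \<le> M"
  shows "\<exists>a. (\<forall>\<alpha>. norm (a \<alpha>) \<le> M / r ^ (\<Sum>b\<in>B. \<alpha> b)) \<and>
    (\<forall>\<zeta>. (\<forall>b\<in>B. norm (\<zeta> b) < r) \<longrightarrow>
      ((\<lambda>\<alpha>. (\<Prod>b\<in>B. \<zeta> b ^ \<alpha> b) * a \<alpha>) has_sum f (p + (\<Sum>b\<in>B. \<zeta> b *s e b))) {\<alpha>. \<forall>b. b \<notin> B \<longrightarrow> \<alpha> b = 0})"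
  using assms(1,3,4)
proof (induction B arbitrary: f M)
  case empty
  have "{\<alpha> :: 'b \<Rightarrow> nat. \<forall>b. b \<notin> {} \<longrightarrow> \<alpha> b = 0} = {\<lambda>_. 0}" by auto
  then show ?case using empty by (intro exI[of _ "\<lambda>_. f p"]) (auto intro: has_sum_finiteI)
next
  case (insert c B)
  let ?A = "\<lambda>B. {\<alpha> :: 'b \<Rightarrow> nat. \<forall>b. b \<notin> B \<longrightarrow> \<alpha> b = 0}"
  let ?z = "\<lambda>\<zeta>. p + (\<Sum>b\<in>B. \<zeta> b *s e b)"
  have line: "?z \<zeta> + x *s e c \<in> S \<and> norm (f (?z \<zeta> + x *s e c)) \<le> M"
    if "\<forall>b\<in>B. norm (\<zeta> b) \<le> r" "norm x \<le> r" for \<zeta> x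
  proof -
    have "(\<Sum>b\<in>insert c B. (\<zeta>(c := x)) b *s e b) = x *s e c + (\<Sum>b\<in>B. \<zeta> b *s e b)"
      using insert.hyps by (simp cong: sum.cong) (rule sum.cong, auto)
    then have eq: "p + (\<Sum>b\<in>insert c B. (\<zeta>(c := x)) b *s e b) = ?z \<zeta> + x *s e c" by (simp only: add_ac)
    have "\<forall>b\<in>insert c B. norm ((\<zeta>(c := x)) b) \<le> r"
      using \<open>norm x \<le> r\<close> \<open>\<forall>b\<in>B. norm (\<zeta> b) \<le> r\<close> by auto
    from insert.prems(2)[OF this] show ?thesis unfolding eq .
  qed
  have zS: "?z \<zeta> \<in> S" if "\<forall>b\<in>B. norm (\<zeta> b) \<le> r" for \<zeta>
    using line[of \<zeta> 0, OF that] r by simp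
  have hol: "(\<lambda>x. f (?z \<zeta> + x *s e c)) holomorphic_on ball 0 r" "continuous_on (cball 0 r) (\<lambda>x. f (?z \<zeta> + x *s e c))"
    if "\<forall>b\<in>B. norm (\<zeta> b) \<le> r" for \<zeta>
  proof -
    have d: "((\<lambda>x. f (?z \<zeta> + x *s e c)) has_field_derivative dird (e c) f (?z \<zeta> + x *s e c)) (at x)" if "norm x \<le> r" for x
      using holo_line[OF insert.prems(1)] line[OF \<open>\<forall>b\<in>B. norm (\<zeta> b) \<le> r\<close> that] by blast
    then show "(\<lambda>x. f (?z \<zeta> + x *s e c)) holomorphic_on ball 0 r"
      by (intro holomorphic_onI) (auto simp: field_differentiable_def intro: has_field_derivative_at_within less_imp_le)
    show "continuous_on (cball 0 r) (\<lambda>x. f (?z \<zeta> + x *s e c))"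
      by (rule continuous_at_imp_continuous_on, rule ballI, rule DERIV_isCont, rule d) simp
  qed
  have der: "(deriv ^^ k) (\<lambda>x. f (?z \<zeta> + x *s e c)) 0 = (dird (e c) ^^ k) f (?z \<zeta>)" if "\<forall>b\<in>B. norm (\<zeta> b) \<le> r" for \<zeta> k
    using dird_power_line[OF insert.prems(1), of "?z \<zeta>" 0 "e c" k] zS[OF that] by simp
  define g where "g k z = inverse (fact k) * (dird (e c) ^^ k) f z" for k z
  have hg: "holo S (g k)" for k
    unfolding g_def using insert.prems(1) by (intro holo_mult holo_const holo_dird_power holo_open)
  have bg: "norm (g k (?z \<zeta>)) \<le> M / r ^ k" if "\<forall>b\<in>B. norm (\<zeta> b) \<le> r" for \<zeta> k
  proof -
    have "norm ((deriv ^^ k) (\<lambda>x. f (?z \<zeta> + x *s e c)) 0) \<le> fact k * M / r ^ k"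
      by (rule Cauchy_inequality[OF hol[OF that] r]) (use line[OF that] in auto)
    then show ?thesis
      unfolding der[OF that] g_def norm_mult norm_inverse using zero_less_power[OF r, of k] by (simp add: pos_le_divide_eq pos_divide_le_eq field_simps)
  qed
  let ?Q = "\<lambda>k a. (\<forall>\<alpha>. norm (a \<alpha>) \<le> (M / r ^ k) / r ^ (\<Sum>b\<in>B. \<alpha> b)) \<and>
    (\<forall>\<zeta>. (\<forall>b\<in>B. norm (\<zeta> b) < r) \<longrightarrow> ((\<lambda>\<alpha>. (\<Prod>b\<in>B. \<zeta> b ^ \<alpha> b) * a \<alpha>) has_sum g k (?z \<zeta>)) (?A B))"
  have "\<exists>a. ?Q k a" for k
    by (rule insert.IH[OF hg]) (use zS bg in auto)
  then have "\<exists>a. \<forall>k. ?Q k (a k)" by (intro choice allI)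
  then obtain a where Q: "\<forall>k. ?Q k (a k)" ..
  have a: "norm (a k \<alpha>) \<le> (M / r ^ k) / r ^ (\<Sum>b\<in>B. \<alpha> b)"
    "\<forall>b\<in>B. norm (\<zeta> b) < r \<Longrightarrow> ((\<lambda>\<alpha>. (\<Prod>b\<in>B. \<zeta> b ^ \<alpha> b) * a k \<alpha>) has_sum g k (?z \<zeta>)) (?A B)" for k \<alpha> \<zeta>
    using Q[rule_format, of k] by auto
  define a' where "a' \<alpha> = a (\<alpha> c) (\<alpha>(c := 0))" for \<alpha>
  have restr: "(\<Sum>b\<in>B. (\<alpha>(c := 0)) b) = (\<Sum>b\<in>B. \<alpha> b)" for \<alpha> :: "'b \<Rightarrow> nat"
    by (rule sum.cong) (use insert.hyps in auto)
  have "norm (a' \<alpha>) \<le> M / r ^ (\<Sum>b\<in>insert c B. \<alpha> b)" for \<alpha>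
    using a(1)[of "\<alpha> c" "\<alpha>(c := 0)"] insert.hyps unfolding restr by (simp add: a'_def power_add)
  moreover have "((\<lambda>\<alpha>. (\<Prod>b\<in>insert c B. \<zeta> b ^ \<alpha> b) * a' \<alpha>) has_sum f (p + (\<Sum>b\<in>insert c B. \<zeta> b *s e b))) (?A (insert c B))"
    if \<zeta>: "\<forall>b\<in>insert c B. norm (\<zeta> b) < r" for \<zeta>
  proof -
    have \<zeta>B: "\<forall>b\<in>B. norm (\<zeta> b) < r" "\<forall>b\<in>B. norm (\<zeta> b) \<le> r" and \<zeta>c: "norm (\<zeta> c) < r" using \<zeta> by (auto intro: less_imp_le)
    let ?h = "\<lambda>(k, \<alpha>). \<zeta> c ^ k * ((\<Prod>b\<in>B. \<zeta> b ^ \<alpha> b) * a k \<alpha>)"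
    have inner: "((\<lambda>\<alpha>. ?h (k, \<alpha>)) has_sum \<zeta> c ^ k * g k (?z \<zeta>)) (?A B)" for k
      using has_sum_cmult_right[OF a(2)[OF \<zeta>B(1)], of "\<zeta> c ^ k" k] by simp
    have "(\<lambda>k. (deriv ^^ k) (\<lambda>x. f (?z \<zeta> + x *s e c)) 0 / fact k * (\<zeta> c - 0) ^ k) sums f (?z \<zeta> + \<zeta> c *s e c)"
      by (rule holomorphic_power_series[OF hol(1)[OF \<zeta>B(2)]]) (use \<zeta>c in auto)
    then have sums: "(\<lambda>k. \<zeta> c ^ k * g k (?z \<zeta>)) sums f (?z \<zeta> + \<zeta> c *s e c)"
      unfolding der[OF \<zeta>B(2)] g_def by (simp add: divide_inverse mult_ac)
    have tc: "norm (\<zeta> c) / r < 1" "0 \<le> norm (\<zeta> c) / r" using \<zeta>c r by auto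
    have "summable (\<lambda>k. norm (\<zeta> c ^ k * g k (?z \<zeta>)))"
    proof (rule summable_comparison_test')
      show "summable (\<lambda>k. M * (norm (\<zeta> c) / r) ^ k)"
        using tc by (intro summable_mult summable_geometric) auto
      fix k :: nat
      have "norm (\<zeta> c ^ k * g k (?z \<zeta>)) \<le> norm (\<zeta> c) ^ k * (M / r ^ k)"
        unfolding norm_mult norm_power by (intro mult_left_mono bg \<zeta>B) auto
      then show "norm (norm (\<zeta> c ^ k * g k (?z \<zeta>))) \<le> M * (norm (\<zeta> c) / r) ^ k"
        by (simp add: power_divide mult.commute)
    qed
    then have outer: "((\<lambda>k. \<zeta> c ^ k * g k (?z \<zeta>)) has_sum f (?z \<zeta> + \<zeta> c *s e c)) UNIV"
      using sums by (rule norm_summable_imp_has_sum)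
    have M: "M \<ge> 0" using order.trans[OF norm_ge_zero bg[OF \<zeta>B(2), of 0]] by simp
    have bij: "bij_betw (\<lambda>\<alpha>. (\<alpha> c, \<alpha>(c := 0))) (?A (insert c B)) (Sigma UNIV (\<lambda>_. ?A B))"
      by (rule bij_betw_byWitness[where f'="\<lambda>(k, \<alpha>). \<alpha>(c := k)"]) (use insert.hyps in auto)
    have Pins: "(\<Prod>b\<in>insert c B. u b ^ \<alpha> b) = u c ^ \<alpha> c * (\<Prod>b\<in>B. u b ^ (\<alpha>(c := 0)) b)"
      for \<alpha> :: "'b \<Rightarrow> nat" and u :: "'b \<Rightarrow> 'z::comm_semiring_1"
    proof -
      have "(\<Prod>b\<in>B. u b ^ (\<alpha>(c := 0)) b) = (\<Prod>b\<in>B. u b ^ \<alpha> b)" by (rule prod.cong) (use insert.hyps in auto)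
      then show ?thesis using insert.hyps by simp
    qed
    \<comment> \<open>Summing first over the remaining exponents and then over that of
      \<open>c\<close> is justified by absolute convergence. The majorant is a product of geometric
      series, which is where all \<open>\<zeta> b\<close> have to be strictly smaller than
      \<open>r\<close>.\<close>
    have "(\<lambda>\<alpha>. M * (\<Prod>b\<in>insert c B. (norm (\<zeta> b) / r) ^ \<alpha> b)) summable_on ?A (insert c B)"
      using \<zeta> r insert.hyps by (intro summable_on_cmult_right multi_geometric_summable) auto
    then have "(\<lambda>x. norm (?h x)) summable_on Sigma UNIV (\<lambda>_. ?A B)"
    proof (subst summable_on_reindex_bij_betw[OF bij, symmetric], elim summable_on_comparison_test)
      fix \<alpha> :: "'b \<Rightarrow> nat"
      let ?\<beta> = "\<alpha>(c := 0)"
      have "norm (?h (\<alpha> c, ?\<beta>)) = norm (\<zeta> c) ^ \<alpha> c * ((\<Prod>b\<in>B. norm (\<zeta> b) ^ ?\<beta> b) * norm (a (\<alpha> c) ?\<beta>))"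
        by (simp add: norm_mult norm_power prod_norm[symmetric])
      also have "\<dots> \<le> norm (\<zeta> c) ^ \<alpha> c * ((\<Prod>b\<in>B. norm (\<zeta> b) ^ ?\<beta> b) * ((M / r ^ \<alpha> c) / r ^ (\<Sum>b\<in>B. ?\<beta> b)))"
        by (intro mult_left_mono a(1) prod_nonneg) auto
      also have "\<dots> = M * ((norm (\<zeta> c) / r) ^ \<alpha> c * (\<Prod>b\<in>B. (norm (\<zeta> b) / r) ^ ?\<beta> b))"
        by (simp only: power_divide prod_dividef power_sum) (simp add: field_simps)
      also have "\<dots> = M * (\<Prod>b\<in>insert c B. (norm (\<zeta> b) / r) ^ \<alpha> b)" by (simp only: Pins)
      finally show "norm (?h (\<alpha> c, ?\<beta>)) \<le> M * (\<Prod>b\<in>insert c B. (norm (\<zeta> b) / r) ^ \<alpha> b)" .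
    qed auto
    then have "?h summable_on Sigma UNIV (\<lambda>_. ?A B)" by (rule abs_summable_summable)
    from has_sum_SigmaI[OF inner outer this]
    have "(?h has_sum f (?z \<zeta> + \<zeta> c *s e c)) (Sigma UNIV (\<lambda>_. ?A B))" .
    then have "((\<lambda>\<alpha>. ?h (\<alpha> c, \<alpha>(c := 0))) has_sum f (?z \<zeta> + \<zeta> c *s e c)) (?A (insert c B))"
      by (subst has_sum_reindex_bij_betw[OF bij])
    moreover have "?h (\<alpha> c, \<alpha>(c := 0)) = (\<Prod>b\<in>insert c B. \<zeta> b ^ \<alpha> b) * a' \<alpha>" for \<alpha>
      by (simp only: Pins a'_def prod.case mult.assoc)
    moreover have "?z \<zeta> + \<zeta> c *s e c = p + (\<Sum>b\<in>insert c B. \<zeta> b *s e b)"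
      using insert.hyps by (simp add: add_ac)
    ultimately show ?thesis by simp
  qed
  ultimately show ?case by blast
qed

subsection \<open>Polarization\<close>

text \<open>The totally real embedding of C^n into C^(2n) whose second half of coordinates is the
  conjugate of the first.\<close>

definition polar :: "complex^'n::finite \<Rightarrow> complex^('n + 'n)" where
  "polar x = (\<chi> i. case i of Inl j \<Rightarrow> x $ j | Inr j \<Rightarrow> cnj (x $ j))"

lemma polar_nth [simp]: "polar x $ Inl j = x $ j" "polar x $ Inr j = cnj (x $ j)"
  by (simp_all add: polar_def)

lemma bounded_linear_polar: "bounded_linear (polar :: complex^'n::finite \<Rightarrow> _)"
  unfolding linear_conv_bounded_linear[symmetric]
  by (rule linearI) (auto simp: polar_def vec_eq_iff split: sum.splits)

lemma polar_Cn_on: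
  fixes F :: "complex^('n::finite + 'n) \<Rightarrow> complex" and N :: "(complex^'n) set"
  assumes "holo S F" "open N" "\<And>x. x \<in> N \<Longrightarrow> polar x \<in> S"
  shows "Cn_on k N (\<lambda>x. F (polar x))"
  using assms(1)
proof (induction k arbitrary: F)
  case 0
  have "continuous_on N (\<lambda>x. F (polar x))"
    by (rule continuous_on_compose2[OF holo_continuous[OF 0] linear_continuous_on[OF bounded_linear_polar]])
       (use assms(3) in blast)
  then show ?case by simp
next
  case (Suc k)
  have d: "((\<lambda>x. F (polar x)) has_derivative (\<lambda>v. dird (polar v) F (polar x))) (at x)" if "x \<in> N" for x
    by (rule has_derivative_compose[OF bounded_linear.has_derivative[OF bounded_linear_polar has_derivative_ident]
          holo_has_derivative[OF Suc.prems assms(3)[OF that]]])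
  show ?case
    by (rule Cn_on_SucI[OF d Suc.IH[OF holo_dird[OF Suc.prems]] assms(2)])
qed

lemma norm_smult: "norm (c *s x) = norm c * norm x" for x :: "complex^'n::finite"
  by (simp add: norm_vec_def L2_set_def norm_mult power_mult_distrib real_sqrt_mult sum_distrib_left[symmetric])

text \<open>The power series of \<open>F\<close> at \<open>polar p\<close> is taken in the complex
  directions \<open>polar b\<close>, for \<open>b\<close> in the real basis of C^n. Real
  coefficients \<open>y \<bullet> b\<close> in these directions lead exactly to
  \<open>polar (p + y)\<close>, so restricting the coefficients to the reals gives a real power
  series of \<open>f\<close>.\<close>

lemma polar_real_analytic:
  fixes F :: "complex^('n::finite + 'n) \<Rightarrow> complex" and N :: "(complex^'n) set"
  assumes F: "holo S F" and S: "\<And>x. x \<in> N \<Longrightarrow> polar x \<in> S" and f: "\<And>x. x \<in> N \<Longrightarrow> f x = F (polar x)" and N: "open N"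
  shows "real_analytic_on N f"
  unfolding real_analytic_on_def
proof
  fix p assume p: "p \<in> N"
  let ?p = "polar p"
  obtain d1 where d1: "d1 > 0" "ball ?p d1 \<subseteq> S"
    using S[OF p] holo_open[OF F] open_contains_ball by blast
  obtain d2 where d2: "d2 > 0" "\<And>z. dist z ?p < d2 \<Longrightarrow> dist (F z) (F ?p) < 1"
  proof -
    have "isCont F ?p"
      using holo_continuous[OF F] S[OF p] holo_open[OF F] continuous_on_eq_continuous_at by blast
    then show ?thesis using that unfolding continuous_at_eps_delta by (metis zero_less_one)
  qed
  obtain d3 where d3: "d3 > 0" "ball p d3 \<subseteq> N" using p N open_contains_ball by blast
  define c where "c = (\<Sum>b\<in>Basis. norm (polar (b :: complex^'n))) + 1"
  have c: "c > 0" unfolding c_def by (smt (verit) sum_nonneg norm_ge_zero)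
  define r where "r = min d1 d2 / (2 * c)"
  have r: "r > 0" using d1 d2 c by (simp add: r_def)
  have near: "dist (?p + (\<Sum>b\<in>Basis. \<zeta> b *s polar b)) ?p < min d1 d2"
    if "\<forall>b\<in>Basis. norm (\<zeta> b) \<le> r" for \<zeta> :: "complex^'n \<Rightarrow> complex"
  proof -
    have "norm (\<Sum>b\<in>Basis. \<zeta> b *s polar b) \<le> (\<Sum>b\<in>Basis. norm (\<zeta> b *s polar b))" by (rule norm_sum)
    also have "\<dots> \<le> (\<Sum>b\<in>Basis. r * norm (polar (b :: complex^'n)))"
      unfolding norm_smult using that by (intro sum_mono mult_right_mono) auto
    also have "\<dots> \<le> r * c" using r by (simp add: c_def sum_distrib_left[symmetric])
    also have "\<dots> = min d1 d2 / 2" using c by (simp add: r_def)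
    also have "\<dots> < min d1 d2" using d1(1) d2(1) by linarith
    finally show ?thesis by (simp add: dist_norm)
  qed
  obtain a :: "(complex^'n \<Rightarrow> nat) \<Rightarrow> complex" where a: "\<And>\<zeta>. (\<forall>b\<in>Basis. norm (\<zeta> b) < r) \<Longrightarrow>
      ((\<lambda>\<alpha>. (\<Prod>b\<in>Basis. \<zeta> b ^ \<alpha> b) * a \<alpha>) has_sum F (?p + (\<Sum>b\<in>Basis. \<zeta> b *s polar b))) {\<alpha>. \<forall>b. b \<notin> Basis \<longrightarrow> \<alpha> b = 0}"
  proof -
    have "?p + (\<Sum>b\<in>Basis. \<zeta> b *s polar b) \<in> S \<and> norm (F (?p + (\<Sum>b\<in>Basis. \<zeta> b *s polar b))) \<le> norm (F ?p) + 1"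
      if "\<forall>b\<in>Basis. norm (\<zeta> b) \<le> r" for \<zeta> :: "complex^'n \<Rightarrow> complex"
    proof -
      let ?z = "?p + (\<Sum>b\<in>Basis. \<zeta> b *s polar b)"
      have "dist (F ?z) (F ?p) < 1" using near[OF that] d2 by simp
      then have "norm (F ?z) \<le> norm (F ?p) + 1"
        using norm_triangle_ineq2[of "F ?z" "F ?p"] by (simp add: dist_norm)
      then show ?thesis using near[OF that] d1 by (auto simp: dist_commute subset_iff)
    qed
    from holo_power_series[OF finite_Basis r F this] show ?thesis using that by blast
  qed
  show "\<exists>r>0. \<exists>a. \<forall>y. norm y < r \<longrightarrow>
     ((\<lambda>\<alpha>. (\<Prod>b\<in>Basis. (y \<bullet> b) ^ \<alpha> b) *\<^sub>R a \<alpha>) has_sum f (p + y)) {\<alpha>. \<forall>b. b \<notin> Basis \<longrightarrow> \<alpha> b = 0}"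
  proof (intro exI[of _ "min r d3"] exI[of _ a] conjI allI impI)
    fix y :: "complex^'n" assume y: "norm y < min r d3"
    have "norm (complex_of_real (y \<bullet> b)) < r" if "b \<in> Basis" for b
      using Basis_le_norm[OF that, of y] y by simp
    from a[of "\<lambda>b. complex_of_real (y \<bullet> b)"] this
    have "((\<lambda>\<alpha>. (\<Prod>b\<in>Basis. complex_of_real (y \<bullet> b) ^ \<alpha> b) * a \<alpha>) has_sum
        F (?p + (\<Sum>b\<in>Basis. complex_of_real (y \<bullet> b) *s polar b))) {\<alpha>. \<forall>b. b \<notin> Basis \<longrightarrow> \<alpha> b = 0}" by blast
    moreover have "?p + (\<Sum>b\<in>Basis. complex_of_real (y \<bullet> b) *s polar b) = polar (p + y)"
    proof -
      note l = bounded_linear.linear[OF bounded_linear_polar]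
      have "(\<Sum>b\<in>Basis. complex_of_real (y \<bullet> b) *s polar b) = (\<Sum>b\<in>Basis. polar ((y \<bullet> b) *\<^sub>R b))"
        by (rule sum.cong) (auto simp: polar_def vec_eq_iff scaleR_conv_of_real[where 'a=complex] split: sum.splits)
      also have "\<dots> = polar y" by (simp add: linear_sum[OF l, symmetric] euclidean_representation)
      finally show ?thesis by (simp add: linear_add[OF l])
    qed
    moreover have "p + y \<in> N" using d3 y by (auto simp: dist_norm subset_iff)
    ultimately show "((\<lambda>\<alpha>. (\<Prod>b\<in>Basis. (y \<bullet> b) ^ \<alpha> b) *\<^sub>R a \<alpha>) has_sum f (p + y)) {\<alpha>. \<forall>b. b \<notin> Basis \<longrightarrow> \<alpha> b = 0}"
      by (simp add: f scaleR_conv_of_real)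
  qed (use r d3 in auto)
qed

lemma real_analytic_on_Im:
  assumes "real_analytic_on N f"
  shows "real_analytic_on N (\<lambda>x. Im (f x))"
  unfolding real_analytic_on_def
proof
  fix p assume "p \<in> N"
  with assms have "\<exists>r>0. \<exists>a. \<forall>y. norm y < r \<longrightarrow>
     ((\<lambda>\<alpha>. (\<Prod>b\<in>Basis. (y \<bullet> b) ^ \<alpha> b) *\<^sub>R a \<alpha>) has_sum f (p + y)) {\<alpha>. \<forall>b. b \<notin> Basis \<longrightarrow> \<alpha> b = 0}"
    unfolding real_analytic_on_def by (rule bspec)
  then obtain r a where r: "r > 0" "\<forall>y. norm y < r \<longrightarrow>
      ((\<lambda>\<alpha>. (\<Prod>b\<in>Basis. (y \<bullet> b) ^ \<alpha> b) *\<^sub>R a \<alpha>) has_sum f (p + y)) {\<alpha>. \<forall>b. b \<notin> Basis \<longrightarrow> \<alpha> b = 0}"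
    by (elim exE conjE)
  show "\<exists>r>0. \<exists>a. \<forall>y. norm y < r \<longrightarrow>
     ((\<lambda>\<alpha>. (\<Prod>b\<in>Basis. (y \<bullet> b) ^ \<alpha> b) *\<^sub>R a \<alpha>) has_sum Im (f (p + y))) {\<alpha>. \<forall>b. b \<notin> Basis \<longrightarrow> \<alpha> b = 0}"
  proof (intro exI conjI allI impI)
    show "r > 0" by (rule r)
    show "((\<lambda>\<alpha>. (\<Prod>b\<in>Basis. (y \<bullet> b) ^ \<alpha> b) *\<^sub>R Im (a \<alpha>)) has_sum Im (f (p + y))) {\<alpha>. \<forall>b. b \<notin> Basis \<longrightarrow> \<alpha> b = 0}"
      if "norm y < r" for y
      using has_sum_Im[OF r(2)[rule_format, OF that]] by simp
  qed
qed

lemma real_analytic_on_local: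
  assumes "\<And>p. p \<in> S \<Longrightarrow> \<exists>N. p \<in> N \<and> real_analytic_on N f"
  shows "real_analytic_on S f"
  unfolding real_analytic_on_def
proof
  fix p assume "p \<in> S"
  then obtain N where N: "p \<in> N" "real_analytic_on N f" using assms by blast
  show "\<exists>r>0. \<exists>a. \<forall>y. norm y < r \<longrightarrow>
     ((\<lambda>\<alpha>. (\<Prod>b\<in>Basis. (y \<bullet> b) ^ \<alpha> b) *\<^sub>R a \<alpha>) has_sum f (p + y)) {\<alpha>. \<forall>b. b \<notin> Basis \<longrightarrow> \<alpha> b = 0}"
    using N(2) unfolding real_analytic_on_def by (rule bspec) (rule N(1))
qed


subsection \<open>Inverse functions\<close>

text \<open>If \<open>u\<close> solves \<open>L y u = v\<close>, then \<open>L y0\<close> maps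
  \<open>u y - u y0\<close> to \<open>-(L y - L y0)\<close> applied to \<open>u y\<close>. With a
  bound for the inverse at \<open>y0\<close> this first bounds \<open>u y\<close> near
  \<open>y0\<close> and then makes the difference small.\<close>

lemma continuous_on_inv_blinfun:
  fixes L :: "'x::topological_space \<Rightarrow> 'a::euclidean_space \<Rightarrow>\<^sub>L 'a"
  assumes c: "continuous_on V L" and bij: "\<And>y. y \<in> V \<Longrightarrow> bij (blinfun_apply (L y))"
  shows "continuous_on V (\<lambda>y. inv (blinfun_apply (L y)) v)"
  unfolding continuous_on_def
proof
  fix y0 assume y0: "y0 \<in> V"
  let ?u = "\<lambda>y. inv (blinfun_apply (L y)) v"
  have Lu: "L y (?u y) = v" if "y \<in> V" for y
    using bij[OF that] by (simp add: bij_is_surj surj_f_inv_f)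
  obtain h where h: "linear h" "h \<circ> blinfun_apply (L y0) = id"
    using linear_injective_left_inverse[OF bounded_linear.linear[OF blinfun.bounded_linear_right] bij_is_inj[OF bij[OF y0]]] by blast
  have hL: "h (L y0 x) = x" for x using h(2) by (simp add: fun_eq_iff)
  moreover have "L y0 (h w) = w" for w
    using bij[OF y0] hL by (metis bij_pointE)
  ultimately have "inv (blinfun_apply (L y0)) = h" by (rule inv_equality)
  then have "linear (inv (blinfun_apply (L y0)))" using h(1) by simp
  then obtain K where K: "K > 0" "\<And>w. norm (inv (blinfun_apply (L y0)) w) \<le> norm w * K"
    using linear_conv_bounded_linear bounded_linear.pos_bounded by blast
  have est: "norm (?u y - ?u y0) \<le> 2 * K * norm (?u y0) * norm (L y - L y0)"
    if y: "y \<in> V" and small: "norm (L y - L y0) < 1 / (2 * K)" for y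
  proof -
    have "L y0 (?u y - ?u y0) = - ((L y - L y0) (?u y))"
      using Lu[OF y] Lu[OF y0] by (simp add: blinfun.bilinear_simps)
    moreover have "inv (blinfun_apply (L y0)) (L y0 (?u y - ?u y0)) = ?u y - ?u y0"
      using bij[OF y0] by (simp add: bij_is_inj)
    ultimately have "norm (?u y - ?u y0) \<le> norm ((L y - L y0) (?u y)) * K"
      using K(2) by (metis norm_minus_cancel)
    also have "\<dots> \<le> (norm (L y - L y0) * norm (?u y)) * K"
      using K(1) norm_blinfun by (intro mult_right_mono) auto
    finally have 1: "norm (?u y - ?u y0) \<le> K * norm (L y - L y0) * norm (?u y)" by (simp add: mult_ac)
    also have "\<dots> \<le> (1 / 2) * norm (?u y)"
      using small K by (intro mult_right_mono) (auto simp: field_simps)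
    finally have "norm (?u y) \<le> 2 * norm (?u y0)"
      using norm_triangle_ineq2[of "?u y" "?u y0"] by linarith
    then have "K * norm (L y - L y0) * norm (?u y) \<le> K * norm (L y - L y0) * (2 * norm (?u y0))"
      using K by (intro mult_left_mono) auto
    with 1 show ?thesis by (simp add: mult_ac)
  qed
  have lim: "((\<lambda>y. norm (L y - L y0)) \<longlongrightarrow> 0) (at y0 within V)"
    using c y0 unfolding continuous_on_def by (simp add: tendsto_norm_zero_iff LIM_zero_iff)
  then have "\<forall>\<^sub>F y in at y0 within V. norm (L y - L y0) < 1 / (2 * K)"
    using K order_tendstoD(2) by (metis divide_pos_pos mult_pos_pos zero_less_numeral zero_less_one)
  moreover have "\<forall>\<^sub>F y in at y0 within V. y \<in> V" by (simp add: eventually_at_filter)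
  ultimately have "\<forall>\<^sub>F y in at y0 within V. norm (?u y - ?u y0) \<le> 2 * K * norm (?u y0) * norm (L y - L y0)"
    by eventually_elim (rule est)
  then have "((\<lambda>y. ?u y - ?u y0) \<longlongrightarrow> 0) (at y0 within V)"
    by (rule Lim_null_comparison) (use tendsto_mult_right_zero[OF lim] in auto)
  then show "(?u \<longlongrightarrow> ?u y0) (at y0 within V)" by (simp add: LIM_zero_iff)
qed

definition mderiv :: "(complex^'k::finite \<Rightarrow> complex^'m::finite) \<Rightarrow> complex^'k \<Rightarrow> complex^'k \<Rightarrow> complex^'m" where
  "mderiv F x v = (\<chi> j. dird v (\<lambda>x. F x $ j) x)"

lemma holo_map_derivative:
  fixes F :: "complex^'k::finite \<Rightarrow> complex^'m::finite"
  assumes "\<And>j. holo S (\<lambda>x. F x $ j)" "x \<in> S"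
  shows "(F has_derivative mderiv F x) (at x)"
proof -
  have "((\<lambda>x. \<Sum>j\<in>UNIV. F x $ j *s axis j 1) has_derivative (\<lambda>v. \<Sum>j\<in>UNIV. dird v (\<lambda>x. F x $ j) x *s axis j 1)) (at x)"
    by (intro has_derivative_sum bounded_linear.has_derivative[OF bounded_bilinear.bounded_linear_left[OF bounded_bilinear_smult]]
        holo_has_derivative[OF assms])
  moreover have "(\<Sum>j\<in>UNIV. y j *s axis j 1) = (\<chi> j. y j)" for y :: "'m \<Rightarrow> complex"
    by (simp add: vec_eq_iff axis_def if_distrib cong: if_cong)
  ultimately show ?thesis by (simp add: mderiv_def[abs_def])
qed

lemma mderiv_eq: "(F has_derivative D) (at x) \<Longrightarrow> mderiv F x v = D v"
  unfolding mderiv_def dird_def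
  by (simp add: vec_eq_iff frechet_derivative_apply[OF bounded_linear.has_derivative[OF bounded_linear_vec_nth]])

lemma mderiv_smult:
  assumes "\<And>j. holo S (\<lambda>x. F x $ j)" "x \<in> S"
  shows "mderiv F x (c *s v) = c *s mderiv F x v"
  by (simp add: mderiv_def vec_eq_iff holo_dird_smult[OF assms])

lemma holo_mapI:
  fixes F :: "complex^'k::finite \<Rightarrow> complex^'m::finite"
  assumes "open S" "\<And>x. x \<in> S \<Longrightarrow> (F has_derivative F' x) (at x)" "\<And>v. continuous_on S (\<lambda>x. F' x v)"
    "\<And>x v. x \<in> S \<Longrightarrow> F' x (\<i> *s v) = \<i> *s F' x v"
  shows "holo S (\<lambda>x. F x $ j)"
  by (rule holoI[OF assms(1) bounded_linear.has_derivative[OF bounded_linear_vec_nth assms(2)]])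
     (use assms(3,4) in \<open>auto intro: bounded_linear.continuous_on[OF bounded_linear_vec_nth]\<close>)

text \<open>The real inverse function theorem suffices: the inverse of a complex-linear bijection is
  complex-linear, and it depends continuously on the point.\<close>

lemma holo_inverse_function:
  fixes F :: "complex^'k::finite \<Rightarrow> complex^'k"
  assumes F: "\<And>j. holo S (\<lambda>x. F x $ j)" and p: "p \<in> S" and inj: "\<And>v. mderiv F p v = 0 \<Longrightarrow> v = 0"
  obtains U V g where "open U" "U \<subseteq> S" "p \<in> U" "open V" "homeomorphism U V F g"
    "\<And>j. holo V (\<lambda>y. g y $ j)" "\<And>x. x \<in> U \<Longrightarrow> inj (mderiv F x)"
proof -
  have S: "open S" using holo_open[OF F] .
  note dF = holo_map_derivative[OF F]
  define f' where "f' x = Blinfun (mderiv F x)" for x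
  have ap: "blinfun_apply (f' x) = mderiv F x" if "x \<in> S" for x
    using has_derivative_bounded_linear[OF dF[OF that]] by (simp add: f'_def bounded_linear_Blinfun_apply)
  have cm: "continuous_on S (\<lambda>x. mderiv F x v)" for v
    unfolding mderiv_def by (intro continuous_on_vec_lambda holo_continuous_dird F)
  have cf': "continuous_on S f'"
    by (rule continuous_on_blinfun_componentwise, rule continuous_on_eq[OF cm]) (simp add: ap)
  have lin: "linear (mderiv F p)" using dF[OF p] has_derivative_linear by blast
  then have "inj (mderiv F p)" using inj linear_injective_0 by blast
  then obtain h where h: "linear h" "h \<circ> mderiv F p = id"
    using linear_injective_left_inverse[OF lin] by blast
  then have hbl: "bounded_linear h" by (simp add: linear_conv_bounded_linear)
  have "Blinfun h o\<^sub>L f' p = id_blinfun"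
    using h(2) by (intro blinfun_eqI) (simp add: ap[OF p] bounded_linear_Blinfun_apply[OF hbl] fun_eq_iff)
  from inverse_function_theorem[OF S _ cf' p this]
  obtain U V g g' where UV: "open U" "U \<subseteq> S" "p \<in> U" "open V" "F p \<in> V" "homeomorphism U V F g"
    and dg: "\<And>y. y \<in> V \<Longrightarrow> (g has_derivative (g' y)) (at y)"
    and g': "\<And>y. y \<in> V \<Longrightarrow> g' y = inv (blinfun_apply (f' (g y)))"
    and bij: "\<And>y. y \<in> V \<Longrightarrow> bij (blinfun_apply (f' (g y)))"
    using dF ap by metis
  have gU: "g y \<in> U" "g y \<in> S" if "y \<in> V" for y
    using UV(2,6) that unfolding homeomorphism_def by auto
  have cg: "continuous_on V g" using UV(6) by (simp add: homeomorphism_def)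
  have "continuous_on V (\<lambda>y. f' (g y))"
    by (rule continuous_on_compose2[OF cf' cg]) (use gU in auto)
  from continuous_on_inv_blinfun[OF this bij] have c: "continuous_on V (\<lambda>y. g' y v)" for v
    by (simp add: g' cong: continuous_on_cong)
  have "holo V (\<lambda>y. g y $ j)" for j
  proof (rule holo_mapI[OF UV(4) dg c])
    fix y v assume y: "y \<in> V"
    let ?D = "mderiv F (g y)"
    have b: "bij ?D" using bij[OF y] ap[OF gU(2)[OF y]] by simp
    have gi: "g' y = inv ?D" using g'[OF y] ap[OF gU(2)[OF y]] by simp
    have "?D (\<i> *s g' y v) = \<i> *s v"
      unfolding mderiv_smult[OF F gU(2)[OF y]] gi using b by (simp add: bij_is_surj surj_f_inv_f)
    then show "g' y (\<i> *s v) = \<i> *s g' y v"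
      unfolding gi using b by (metis bij_inv_eq_iff)
  qed
  moreover have "inj (mderiv F x)" if "x \<in> U" for x
  proof -
    have "F x \<in> V" "g (F x) = x" using UV(6) that unfolding homeomorphism_def by auto
    then show ?thesis using bij[of "F x"] ap[of x] that UV(2) by (auto simp: bij_is_inj)
  qed
  ultimately show ?thesis using that UV by blast
qed

section \<open>The matrix exponential\<close>

definition mpow :: "complex^'k^'k \<Rightarrow> nat \<Rightarrow> complex^'k::finite^'k" where
  "mpow X n = ((**) X ^^ n) (mat 1)"

definition mexp :: "complex^'k^'k \<Rightarrow> complex \<Rightarrow> complex^'k::finite^'k" where
  "mexp X s = (\<chi> i j. \<Sum>n. (mpow X n $ i $ j / fact n) * s ^ n)"

lemma mpow_Suc: "mpow X (Suc n) = X ** mpow X n" "mpow X (Suc n) = mpow X n ** X"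
proof -
  show "mpow X (Suc n) = X ** mpow X n" for n by (simp add: mpow_def)
  note 1 = this
  show "mpow X (Suc n) = mpow X n ** X"
  proof (induction n)
    case (Suc n)
    have "mpow X (Suc (Suc n)) = X ** (mpow X n ** X)" unfolding 1[of "Suc n"] Suc ..
    then show ?case by (simp only: matrix_mul_assoc 1[of n])
  qed (simp add: mpow_def)
qed

lemma mpow_bound: "norm (mpow X n $ i $ j) \<le> (\<Sum>i\<in>UNIV. \<Sum>j\<in>UNIV. norm (X $ i $ j)) ^ n"
proof (induction n arbitrary: i)
  case 0
  show ?case by (simp add: mpow_def mat_def)
next
  case (Suc n)
  let ?C = "\<Sum>i\<in>UNIV. \<Sum>j\<in>UNIV. norm (X $ i $ j)"
  have "norm (mpow X (Suc n) $ i $ j) \<le> (\<Sum>k\<in>UNIV. norm (X $ i $ k) * norm (mpow X n $ k $ j))"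
    unfolding mpow_Suc(1) matrix_matrix_mult_def by (simp add: norm_mult[symmetric] sum_norm_le)
  also have "\<dots> \<le> (\<Sum>k\<in>UNIV. norm (X $ i $ k) * ?C ^ n)"
    by (intro sum_mono mult_left_mono Suc.IH) auto
  also have "\<dots> = (\<Sum>k\<in>UNIV. norm (X $ i $ k)) * ?C ^ n" by (simp add: sum_distrib_right)
  also have "\<dots> \<le> ?C * ?C ^ n"
    by (intro mult_right_mono zero_le_power sum_nonneg member_le_sum[of i]) (auto intro: sum_nonneg)
  finally show ?case by simp
qed

lemma mexp_summable: "summable (\<lambda>n. (mpow X n $ i $ j / fact n) * s ^ n)"
proof (rule summable_comparison_test')
  let ?C = "\<Sum>i\<in>UNIV. \<Sum>j\<in>UNIV. norm (X $ i $ j)"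
  show "summable (\<lambda>n. inverse (fact n) * (?C * norm s) ^ n)"
    by (rule summable_exp)
  fix n
  have "norm ((mpow X n $ i $ j / fact n) * s ^ n) = inverse (fact n) * (norm (mpow X n $ i $ j) * norm s ^ n)"
    by (simp add: norm_mult norm_inverse norm_power divide_inverse)
  also have "\<dots> \<le> inverse (fact n) * (?C ^ n * norm s ^ n)"
    by (intro mult_left_mono mult_right_mono mpow_bound) auto
  finally show "norm ((mpow X n $ i $ j / fact n) * s ^ n) \<le> inverse (fact n) * (?C * norm s) ^ n"
    by (simp add: power_mult_distrib)
qed

lemma mexp_sums: "(\<lambda>n. (mpow X n $ i $ j / fact n) * s ^ n) sums (mexp X s $ i $ j)"
  using summable_sums[OF mexp_summable] by (simp add: mexp_def)

lemma mexp_0 [simp]: "mexp X 0 = mat 1"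
proof -
  have "(\<Sum>n. (mpow X n $ i $ j / fact n) * 0 ^ n) = mpow X 0 $ i $ j" for i j
    using powser_zero[of "\<lambda>n. mpow X n $ i $ j / fact n"] by simp
  then show ?thesis by (simp add: mexp_def vec_eq_iff) (simp add: mpow_def)
qed

lemma mexp_mult_sums: "(\<lambda>n. (mpow X (Suc n) $ i $ j / fact n) * s ^ n) sums ((X ** mexp X s) $ i $ j)"
  "(\<lambda>n. (mpow X (Suc n) $ i $ j / fact n) * s ^ n) sums ((mexp X s ** X) $ i $ j)"
proof -
  have "(\<lambda>n. \<Sum>k\<in>UNIV. X $ i $ k * ((mpow X n $ k $ j / fact n) * s ^ n)) sums (\<Sum>k\<in>UNIV. X $ i $ k * mexp X s $ k $ j)"
    by (intro sums_sum sums_mult mexp_sums)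
  then show "(\<lambda>n. (mpow X (Suc n) $ i $ j / fact n) * s ^ n) sums ((X ** mexp X s) $ i $ j)"
    unfolding mpow_Suc(1) by (simp add: matrix_matrix_mult_def sum_divide_distrib sum_distrib_right mult.assoc)
  have "(\<lambda>n. \<Sum>k\<in>UNIV. ((mpow X n $ i $ k / fact n) * s ^ n) * X $ k $ j) sums (\<Sum>k\<in>UNIV. mexp X s $ i $ k * X $ k $ j)"
    by (intro sums_sum sums_mult2 mexp_sums)
  moreover have "(\<Sum>k\<in>UNIV. ((mpow X n $ i $ k / fact n) * s ^ n) * X $ k $ j) = (mpow X (Suc n) $ i $ j / fact n) * s ^ n" for n
    unfolding mpow_Suc(2) by (simp add: matrix_matrix_mult_def sum_distrib_left sum_distrib_right divide_inverse mult_ac)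
  ultimately show "(\<lambda>n. (mpow X (Suc n) $ i $ j / fact n) * s ^ n) sums ((mexp X s ** X) $ i $ j)"
    by (simp add: matrix_matrix_mult_def)
qed

lemma mexp_commute: "mexp X s ** X = X ** mexp X s"
proof -
  have "(mexp X s ** X) $ i $ j = (X ** mexp X s) $ i $ j" for i j
    by (rule sums_unique2[OF mexp_mult_sums(2) mexp_mult_sums(1)])
  then show ?thesis by (simp add: vec_eq_iff)
qed

lemma mexp_entry_derivative: "((\<lambda>s. mexp X s $ i $ j) has_field_derivative (X ** mexp X s) $ i $ j) (at s)"
proof -
  have "((\<lambda>s. \<Sum>n. (mpow X n $ i $ j / fact n) * s ^ n) has_field_derivative
      (\<Sum>n. diffs (\<lambda>n. mpow X n $ i $ j / fact n) n * s ^ n)) (at s)"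
    by (rule termdiffs_strong_converges_everywhere) (rule mexp_summable)
  moreover have "diffs (\<lambda>n. mpow X n $ i $ j / fact n) n * s ^ n = (mpow X (Suc n) $ i $ j / fact n) * s ^ n" for n
    by (simp add: diffs_def field_simps del: of_nat_Suc)
  ultimately show ?thesis
    using sums_unique[OF mexp_mult_sums(1)[of X i j s]] by (simp add: mexp_def)
qed

lemma mexp_has_derivative: "(mexp X has_derivative (\<lambda>h. mat h ** (X ** mexp X s))) (at s)"
proof -
  have "((\<lambda>s. \<Sum>i\<in>UNIV. \<Sum>j\<in>UNIV. (\<chi> k l. if k = i \<and> l = j then mexp X s $ i $ j else 0)) has_derivative
     (\<lambda>h. \<Sum>i\<in>UNIV. \<Sum>j\<in>UNIV. (\<chi> k l. if k = i \<and> l = j then (X ** mexp X s) $ i $ j * h else 0))) (at s)"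
  proof (intro has_derivative_sum)
    fix i j
    have "bounded_linear (\<lambda>z. (\<chi> k l. if k = i \<and> l = j then z else 0) :: complex^'a^'a)"
      unfolding linear_conv_bounded_linear[symmetric] by (auto intro!: linearI simp: vec_eq_iff)
    from bounded_linear.has_derivative[OF this mexp_entry_derivative[unfolded has_field_derivative_def]]
    show "((\<lambda>s. (\<chi> k l. if k = i \<and> l = j then mexp X s $ i $ j else 0) :: complex^'a^'a) has_derivative
     (\<lambda>h. (\<chi> k l. if k = i \<and> l = j then (X ** mexp X s) $ i $ j * h else 0))) (at s)" .
  qed
  moreover have "(\<Sum>i\<in>UNIV. \<Sum>j\<in>UNIV. (\<chi> k l. if k = i \<and> l = j then M $ i $ j else 0)) = M" for M :: "complex^'a^'a"
  proof -
    have "(\<Sum>i\<in>UNIV. \<Sum>j\<in>UNIV. if k = i \<and> l = j then M $ i $ j else 0) = (\<Sum>i\<in>UNIV. if k = i then M $ i $ l else 0)" for k l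
      by (rule sum.cong) auto
    then show ?thesis by (simp add: vec_eq_iff)
  qed
  moreover have "(X ** mexp X s) $ i $ j * h = (mat h ** (X ** mexp X s)) $ i $ j" for i j h
    by (simp add: mat_mult_nth mult.commute)
  ultimately show ?thesis by (simp only:)
qed

text \<open>The product of the exponentials at times \<open>u\<close> and \<open>s + t - u\<close>
  has derivative zero in \<open>u\<close>; it is compared at \<open>u = s\<close> and
  \<open>u = 0\<close>.\<close>

lemma mexp_add:
  fixes X :: "complex^'k::finite^'k"
  shows "mexp X (s + t) = mexp X s ** mexp X t"
proof -
  let ?f = "\<lambda>u. mexp X u ** mexp X (s + t - u)"
  have "(?f has_derivative (\<lambda>h. 0)) (at u within UNIV)" for u
  proof (rule has_derivative_eq_rhs)
    have "((\<lambda>u. s + t - u) has_derivative (\<lambda>h. - h)) (at u)"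
      by (auto intro!: derivative_eq_intros)
    from has_derivative_compose[OF this mexp_has_derivative]
    have "((\<lambda>u. mexp X (s + t - u)) has_derivative (\<lambda>h. mat (- h) ** (X ** mexp X (s + t - u)))) (at u)" .
    from bounded_bilinear.FDERIV[OF bounded_bilinear_matrix_mult mexp_has_derivative this]
    show "(?f has_derivative (\<lambda>h. mexp X u ** (mat (- h) ** (X ** mexp X (s + t - u)))
        + (mat h ** (X ** mexp X u)) ** mexp X (s + t - u))) (at u)" .
    have "mexp X u ** (mat (- h) ** (X ** B)) = - (mat h ** (X ** mexp X u) ** B)" for h and B :: "complex^'k^'k"
    proof -
      have "mexp X u ** (mat (- h) ** (X ** B)) = (mexp X u ** mat (- h)) ** (X ** B)"
        by (simp only: matrix_mul_assoc)
      also have "\<dots> = mat (- h) ** (mexp X u ** X) ** B"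
        by (simp only: mat_mult_commute[of "- h"] matrix_mul_assoc)
      also have "\<dots> = - (mat h ** (X ** mexp X u) ** B)"
        unfolding mexp_commute by (simp add: mat_add minus_mult matrix_mul_assoc)
      finally show ?thesis .
    qed
    then show "(\<lambda>h. mexp X u ** (mat (- h) ** (X ** mexp X (s + t - u)))
        + (mat h ** (X ** mexp X u)) ** mexp X (s + t - u)) = (\<lambda>h. 0)" by simp
  qed
  from has_derivative_zero_unique[OF convex_UNIV this, of s 0]
  show ?thesis by simp
qed

text \<open>A selfadjoint \<open>X\<close> moves to the other side of the form at the cost of
  conjugating the time. Hence imaginary times act by isometries, and two real times \<open>s\<close>
  on both sides combine to the time \<open>2 s\<close> on one side.\<close>

lemma mexp_adj:
  assumes "adj X ** K = K ** X"
  shows "adj (mexp X s) ** K = K ** mexp X (cnj s)"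
proof -
  have pow: "adj (mpow X n) ** K = K ** mpow X n" for n
  proof (induction n)
    case (Suc n)
    have "adj (mpow X (Suc n)) ** K = adj (mpow X n) ** (adj X ** K)"
      unfolding mpow_Suc(1) adj_mult by (simp add: matrix_mul_assoc)
    also have "\<dots> = K ** mpow X n ** X" unfolding assms by (simp add: matrix_mul_assoc Suc)
    finally show ?case unfolding mpow_Suc(2) by (simp add: matrix_mul_assoc)
  qed (simp add: mpow_def)
  have "(adj (mexp X s) ** K) $ i $ j = (K ** mexp X (cnj s)) $ i $ j" for i j
  proof (rule sums_unique2)
    have "(\<lambda>n. \<Sum>k\<in>UNIV. cnj ((mpow X n $ k $ i / fact n) * s ^ n) * K $ k $ j) sums (\<Sum>k\<in>UNIV. cnj (mexp X s $ k $ i) * K $ k $ j)"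
      by (intro sums_sum sums_mult2) (simp only: sums_cnj mexp_sums)
    moreover have "(\<Sum>k\<in>UNIV. cnj ((mpow X n $ k $ i / fact n) * s ^ n) * K $ k $ j) = ((adj (mpow X n) ** K) $ i $ j / fact n) * cnj s ^ n" for n
      by (simp add: adj_def matrix_matrix_mult_def sum_distrib_left sum_distrib_right divide_inverse mult_ac)
    ultimately show "(\<lambda>n. ((adj (mpow X n) ** K) $ i $ j / fact n) * cnj s ^ n) sums ((adj (mexp X s) ** K) $ i $ j)"
      by (simp add: adj_def matrix_matrix_mult_def)
    have "(\<lambda>n. \<Sum>k\<in>UNIV. K $ i $ k * ((mpow X n $ k $ j / fact n) * cnj s ^ n)) sums (\<Sum>k\<in>UNIV. K $ i $ k * mexp X (cnj s) $ k $ j)"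
      by (intro sums_sum sums_mult mexp_sums)
    moreover have "(\<Sum>k\<in>UNIV. K $ i $ k * ((mpow X n $ k $ j / fact n) * cnj s ^ n)) = ((adj (mpow X n) ** K) $ i $ j / fact n) * cnj s ^ n" for n
      unfolding pow by (simp add: matrix_matrix_mult_def sum_divide_distrib sum_distrib_right mult.assoc)
    ultimately show "(\<lambda>n. ((adj (mpow X n) ** K) $ i $ j / fact n) * cnj s ^ n) sums ((K ** mexp X (cnj s)) $ i $ j)"
      by (simp add: matrix_matrix_mult_def)
  qed
  then show ?thesis by (simp add: vec_eq_iff)
qed


section \<open>The model\<close>

text \<open>The pairing without conjugation. Used with \<open>Zw\<close> for the conjugated
  argument, it keeps the formulas of the model holomorphic.\<close>

definition pr :: "complex^'k::finite \<Rightarrow> complex^'k \<Rightarrow> complex" where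
  "pr a b = (\<Sum>i\<in>UNIV. a $ i * b $ i)"

definition cnjv :: "complex^'k::finite \<Rightarrow> complex^'k" where
  "cnjv a = (\<chi> i. cnj (a $ i))"

lemma star_dot_pr: "star_dot a b = pr (cnjv a) b"
  by (simp add: star_dot_def pr_def cnjv_def)

lemma holo_pr: "open S \<Longrightarrow> (\<And>i. holo S (\<lambda>x. a x $ i)) \<Longrightarrow> (\<And>i. holo S (\<lambda>x. b x $ i)) \<Longrightarrow> holo S (\<lambda>x. pr (a x) (b x))"
  unfolding pr_def by (intro holo_sum holo_mult)

lemma holo_matrix_vector:
  "open S \<Longrightarrow> (\<And>i j. holo S (\<lambda>x. M x $ i $ j)) \<Longrightarrow> (\<And>i. holo S (\<lambda>x. b x $ i)) \<Longrightarrow> holo S (\<lambda>x. (M x *v b x) $ i)"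
  unfolding matrix_vector_mult_def by (simp add: holo_sum holo_mult)

lemma holo_Bv:
  "holo S a \<Longrightarrow> (\<And>i. holo S (\<lambda>x. y x $ i)) \<Longrightarrow> holo S b \<Longrightarrow> holo S (\<lambda>x. Bv (a x) (y x) (b x) $ i)"
proof (cases i)
  case (Some j)
  assume "holo S a" "\<And>i. holo S (\<lambda>x. y x $ i)" "holo S b"
  with Some show ?thesis by (cases j) simp_all
qed simp

lemma holo_mexp: "holo S f \<Longrightarrow> holo S (\<lambda>x. mexp X (f x) $ i $ j)"
proof (rule holo_compose_field[OF _ mexp_entry_derivative])
  have "continuous_on UNIV (\<lambda>s. mexp X s $ i $ j)" for i j
    by (rule continuous_at_imp_continuous_on) (use mexp_entry_derivative DERIV_isCont in blast)
  then show "continuous_on UNIV (\<lambda>s. (X ** mexp X s) $ i $ j)"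
    unfolding matrix_matrix_mult_def by (simp add: continuous_on_sum continuous_on_mult)
qed auto

text \<open>\<open>Zz\<close> and \<open>Zw\<close> are the slice point \<open>Bv 1 y 0\<close> and
  its conjugate after polarization, with the two halves of \<open>q\<close> as independent
  variables.\<close>

definition Zz :: "complex^('n::finite + 'n) \<Rightarrow> complex^('n option option)" where
  "Zz q = Bv 1 (\<chi> j. q $ Inl j) 0"

definition Zw :: "complex^('n::finite + 'n) \<Rightarrow> complex^('n option option)" where
  "Zw q = Bv 1 (\<chi> j. q $ Inr j) 0"

lemma Zz_polar: "Zz (polar y) = Bv 1 y 0"
  by (simp add: Zz_def vec_eq_iff all_option_option)

lemma Zw_polar: "Zw (polar y) = cnjv (Bv 1 y 0)"
  by (simp add: Zw_def cnjv_def vec_eq_iff all_option_option)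

lemma holo_Zz: "open S \<Longrightarrow> holo S (\<lambda>q. Zz q $ i)" and holo_Zw: "open S \<Longrightarrow> holo S (\<lambda>q. Zw q $ i)"
  unfolding Zz_def Zw_def by (auto intro!: holo_Bv holo_const holo_nth)

lemma Zz_0: "Zz 0 = Bv 1 0 0" and Zw_0: "Zw 0 = Bv 1 0 0"
  by (simp_all add: Zz_def Zw_def flip: zero_vec_def)

lemma Xm_e: "Xm H T V *v Bv 1 0 0 = Bv (- (trace H / 2)) 0 1"
  by (simp add: Xm_def Bv_mult)

lemma Jm_Bv: "Jm *v Bv a y b = Bv (- b) y (- a)"
  by (simp add: Jm_def Bv_mult)

text \<open>The polarized defining function of the hyperquadric \<open>Jm = 0\<close> along the flow of \<open>X\<close>, and its
  derivative along the flow.\<close>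

definition Phi :: "complex^('n option option)^('n option option) \<Rightarrow> complex \<Rightarrow> complex^('n::finite + 'n) \<Rightarrow> complex" where
  "Phi X s q = pr (Zw q) (Jm *v (mexp X (2 * s) *v Zz q))"

definition flow_pairing :: "complex^('n option option)^('n option option) \<Rightarrow> complex \<Rightarrow> complex^('n::finite + 'n) \<Rightarrow> complex" where
  "flow_pairing X s q = pr (Zw q) (Jm *v (mexp X (2 * s) *v (X *v Zz q)))"

definition optv :: "complex \<Rightarrow> complex^'m::finite \<Rightarrow> complex^('m option)" where
  "optv s q = (\<chi> i. case i of None \<Rightarrow> s | Some j \<Rightarrow> q $ j)"

lemma optv_nth [simp]: "optv s q $ None = s" "optv s q $ Some j = q $ j"
  by (simp_all add: optv_def)

text \<open>At the origin the derivative of \<open>Phi\<close> in the time is -2, so the time at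
  which a slice point reaches the null cone is an implicit function \<open>\<rho>\<close>. Its
  uniqueness among small times belongs to the conclusion, since it is what shows that
  \<open>\<rho>\<close> is real at real points and that it agrees with the time found in any given
  structure. The sign of \<open>flow_pairing\<close>, which is -1 at the origin, allows the division
  and the square root that normalise \<open>N\<close>.\<close>

lemma Phi_implicit:
  fixes H0 :: "complex^'n::finite^'n" and T0 :: "complex^'n" and V0 :: real
  defines "X0 \<equiv> Xm H0 T0 V0"
  obtains \<rho> \<delta> \<epsilon> where "\<delta> > 0" "\<epsilon> > 0" "holo (ball (0 :: complex^('n + 'n)) \<delta>) \<rho>" "\<rho> 0 = 0"
    "\<And>q. q \<in> ball 0 \<delta> \<Longrightarrow> norm (\<rho> q) < \<epsilon> \<and> Phi X0 (\<rho> q) q = 0 \<and> Re (flow_pairing X0 (\<rho> q) q) < 0"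
    "\<And>q s. q \<in> ball 0 \<delta> \<Longrightarrow> norm s < \<epsilon> \<Longrightarrow> Phi X0 s q = 0 \<Longrightarrow> s = \<rho> q"
proof -
  \<comment> \<open>The implicit function is obtained by inverting the map that replaces the time by
    the value of \<open>Phi\<close> and keeps \<open>q\<close>.\<close>
  define F :: "complex^(('n + 'n) option) \<Rightarrow> complex^(('n + 'n) option)" where
    "F \<xi> = optv (Phi X0 (\<xi> $ None) (\<chi> j. \<xi> $ Some j)) (\<chi> j. \<xi> $ Some j)" for \<xi>
  have hX: "holo S (\<lambda>\<xi>. M $ i $ j)" if "open S" for S :: "(complex^'z::finite) set" and M :: "complex^'y^'x" and i j
    using that by (rule holo_const)
  have hPhi: "holo UNIV (\<lambda>\<xi> :: complex^(('n + 'n) option). Phi X0 (\<xi> $ None) (\<chi> j. \<xi> $ Some j))"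
    unfolding Phi_def Zz_def Zw_def
    by (intro holo_pr holo_matrix_vector holo_mexp holo_Bv holo_mult holo_const holo_nth open_UNIV)
       (simp_all add: holo_nth)
  have hF: "holo UNIV (\<lambda>\<xi>. F \<xi> $ i)" for i
    by (cases i) (simp_all add: F_def hPhi holo_nth)
  have inj: "v = 0" if v: "mderiv F 0 v = 0" for v
  proof -
    have "dird v (\<lambda>\<xi>. F \<xi> $ Some j) 0 = v $ Some j" for j
      unfolding dird_def F_def
      by simp (rule frechet_derivative_apply[OF bounded_linear.has_derivative[OF bounded_linear_vec_nth has_derivative_ident]])
    with v have vS: "v $ Some j = 0" for j
      by (simp add: mderiv_def vec_eq_iff)
    then have ve: "v = v $ None *s axis None 1"
      by (simp add: vec_eq_iff axis_def) (metis not_None_eq)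
    let ?f = "\<lambda>\<xi>. F \<xi> $ None"
    have "((\<lambda>\<zeta>. ?f (0 + \<zeta> *s axis None 1)) has_field_derivative dird (axis None 1) ?f (0 + 0 *s axis None 1)) (at 0)"
      by (rule holo_line[OF hF]) simp
    moreover have "?f (0 + \<zeta> *s axis None 1) = - (mexp X0 (2 * \<zeta>) $ Some None $ None)" for \<zeta>
    proof -
      have "(\<chi> j. (\<zeta> *s axis None 1 :: complex^(('n + 'n) option)) $ Some j) = 0" by (simp add: vec_eq_iff axis_def)
      moreover have "(\<zeta> *s axis None 1 :: complex^(('n + 'n) option)) $ None = \<zeta>" by (simp add: axis_def)
      moreover have "pr (Bv 1 0 0) (Jm *v (M *v Bv 1 0 0)) = - (M $ Some None $ None)" for M :: "complex^('n option option)^('n option option)"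
        by (cases M rule: Blk_cases) (simp add: Bv_mult Jm_Bv pr_def sum_option_option)
      ultimately show ?thesis by (simp add: F_def Phi_def Zz_0 Zw_0)
    qed
    moreover have "((\<lambda>\<zeta>. - (mexp X0 (2 * \<zeta>) $ Some None $ None)) has_field_derivative - ((X0 ** mexp X0 (2 * 0)) $ Some None $ None * 2)) (at 0)"
      by (intro DERIV_minus DERIV_chain2[OF mexp_entry_derivative]) (auto intro!: derivative_eq_intros)
    moreover have "(X0 ** mexp X0 (2 * 0)) $ Some None $ None = 1" by (simp add: X0_def Xm_def)
    ultimately have "dird (axis None 1) ?f 0 = - 2"
      by (simp add: DERIV_unique)
    then have "dird v ?f 0 = v $ None * - 2"
      using holo_dird_smult[OF hF[of None], of 0 "v $ None" "axis None 1"] ve by simp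
    moreover have "dird v ?f 0 = 0" using v by (simp add: mderiv_def vec_eq_iff)
    ultimately show "v = 0" using ve by simp
  qed
  obtain U V g where UV: "open U" "(0 :: complex^(('n + 'n) option)) \<in> U" "open V" "homeomorphism U V F g"
    and hg: "\<And>j. holo V (\<lambda>y. g y $ j)"
    using holo_inverse_function[OF hF UNIV_I inj] by metis
  have o0: "optv 0 0 = (0 :: complex^(('n + 'n) option))" by (simp add: vec_eq_iff optv_def split: option.splits)
  have "Phi X0 0 (0 :: complex^('n + 'n)) = 0"
    by (simp add: Phi_def Zz_0 Zw_0 Jm_Bv pr_def sum_option_option)
  then have F0: "F 0 = 0" using o0 by (simp add: F_def flip: zero_vec_def)
  have "0 \<in> V" using UV(2,4) F0 by (metis homeomorphism_def imageI)
  have g0: "g 0 = 0" using UV(2,4) F0 by (metis homeomorphism_def)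
  have co: "continuous_on X (\<lambda>x. optv (f x) (h x))" if "continuous_on X f" "continuous_on X h"
    for X :: "'z::topological_space set" and f and h :: "'z \<Rightarrow> complex^('n + 'n)"
  proof -
    have "continuous_on X (\<lambda>x. case i of None \<Rightarrow> f x | Some j \<Rightarrow> h x $ j)" for i
      using that by (cases i) (auto intro: continuous_intros)
    then show ?thesis unfolding optv_def by (intro continuous_on_vec_lambda)
  qed
  have "open ((\<lambda>(s, q). optv s q) -` U :: (complex \<times> (complex^('n + 'n))) set)"
    unfolding split_beta by (intro open_vimage UV co continuous_intros)
  moreover have "(0, 0) \<in> (\<lambda>(s, q). optv s q) -` U" using UV(2) o0 by simp
  ultimately obtain e where e: "e > 0" "ball (0, 0) e \<subseteq> (\<lambda>(s, q). optv s q) -` U"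
    using open_contains_ball by blast
  \<comment> \<open>Half of \<open>e\<close>, because the norm of a pair is at most the sum of the
    norms of its components.\<close>
  define \<epsilon> where "\<epsilon> = e / 2"
  have inU: "optv s q \<in> U" if "norm s < \<epsilon>" "norm q < \<epsilon>" for s and q :: "complex^('n + 'n)"
  proof -
    have "dist (0, 0) (s, q) \<le> norm s + norm q"
      by (simp add: dist_norm norm_Pair sqrt_sum_squares_le_sum)
    then have "(s, q) \<in> ball (0, 0) e" using that by (simp add: \<epsilon>_def)
    then show ?thesis using e by auto
  qed
  define W where "W = (\<lambda>q :: complex^('n + 'n). optv 0 q) -` V"
  have W: "open W" "0 \<in> W"
    unfolding W_def using o0 \<open>0 \<in> V\<close> by (auto intro!: open_vimage UV co continuous_intros)
  define \<rho> where "\<rho> q = g (optv 0 q) $ None" for q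
  have h\<rho>: "holo W \<rho>"
    unfolding \<rho>_def
  proof (rule holo_compose[OF hg])
    show "holo W (\<lambda>x. optv 0 x $ j)" for j
      using W(1) by (cases j) (simp_all add: holo_const holo_nth)
  qed (auto simp: W_def)
  have \<rho>0: "\<rho> 0 = 0" by (simp add: \<rho>_def o0 g0)
  have Phi0: "Phi X0 (\<rho> q) q = 0" if "q \<in> W" for q
  proof -
    have "F (g (optv 0 q)) = optv 0 q" using UV(4) that by (auto simp: W_def homeomorphism_def)
    then have *: "F (g (optv 0 q)) $ i = optv 0 q $ i" for i by simp
    from *[of "Some _"] have "g (optv 0 q) $ Some j = q $ j" for j by (simp add: F_def)
    with *[of None] show ?thesis by (simp add: F_def \<rho>_def)
  qed
  have hfl: "holo W (\<lambda>q. flow_pairing X0 (\<rho> q) q)"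
    unfolding flow_pairing_def
    by (intro holo_pr holo_matrix_vector holo_mexp holo_mult holo_const h\<rho> holo_Zz holo_Zw W hX)
  have "flow_pairing X0 (\<rho> 0) 0 = - 1"
    by (simp add: flow_pairing_def \<rho>0 Zz_0 Zw_0 X0_def Xm_e Jm_Bv pr_def sum_option_option)
  moreover have "open (W \<inter> (\<lambda>q. flow_pairing X0 (\<rho> q) q) -` {z. Re z < 0})"
    using continuous_open_preimage[OF holo_continuous[OF hfl] W(1) open_halfspace_Re_lt[of 0]] .
  moreover have "open (W \<inter> \<rho> -` ball 0 \<epsilon>)"
    using continuous_open_preimage[OF holo_continuous[OF h\<rho>] W(1) open_ball] .
  ultimately have "open (W \<inter> (\<lambda>q. flow_pairing X0 (\<rho> q) q) -` {z. Re z < 0} \<inter> (W \<inter> \<rho> -` ball 0 \<epsilon>))"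
    "0 \<in> W \<inter> (\<lambda>q. flow_pairing X0 (\<rho> q) q) -` {z. Re z < 0} \<inter> (W \<inter> \<rho> -` ball 0 \<epsilon>)"
    using W(2) \<rho>0 e by (auto simp: \<epsilon>_def)
  then obtain \<delta>0 where \<delta>0: "\<delta>0 > 0" "ball 0 \<delta>0 \<subseteq> W \<inter> (\<lambda>q. flow_pairing X0 (\<rho> q) q) -` {z. Re z < 0} \<inter> (W \<inter> \<rho> -` ball 0 \<epsilon>)"
    using open_contains_ball by blast
  define \<delta> where "\<delta> = min \<delta>0 \<epsilon>"
  have sub: "ball 0 \<delta> \<subseteq> ball (0 :: complex^('n + 'n)) \<delta>0" by (auto simp: \<delta>_def)
  show ?thesis
  proof (rule that[of \<delta> \<epsilon> \<rho>])
    show "\<delta> > 0" "\<epsilon> > 0" using \<delta>0 e by (auto simp: \<delta>_def \<epsilon>_def)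
    show "holo (ball 0 \<delta>) \<rho>" by (rule holo_subset[OF h\<rho>]) (use sub \<delta>0 in auto)
    show "\<rho> 0 = 0" by (rule \<rho>0)
    show "norm (\<rho> q) < \<epsilon> \<and> Phi X0 (\<rho> q) q = 0 \<and> Re (flow_pairing X0 (\<rho> q) q) < 0" if "q \<in> ball 0 \<delta>" for q
    proof -
      have "q \<in> W \<inter> (\<lambda>q. flow_pairing X0 (\<rho> q) q) -` {z. Re z < 0} \<inter> (W \<inter> \<rho> -` ball 0 \<epsilon>)"
        using sub \<delta>0(2) that by blast
      then show ?thesis using Phi0 by simp
    qed
    show "s = \<rho> q" if "q \<in> ball 0 \<delta>" "norm s < \<epsilon>" "Phi X0 s q = 0" for q s
    proof -
      have "optv s q \<in> U" using that by (intro inU) (auto simp: \<delta>_def)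
      moreover have "F (optv s q) = optv 0 q" using that by (simp add: F_def)
      moreover have "g (F x) = x" if "x \<in> U" for x using UV(4) that by (simp add: homeomorphism_def)
      ultimately have "g (optv 0 q) = optv s q"  by metis
      then show ?thesis by (simp add: \<rho>_def)
    qed
  qed
qed

text \<open>The data of the model: the implicit time \<open>\<rho>\<close> for a fixed initial value
  \<open>X0\<close>, together with its characterisation among all times smaller than
  \<open>\<epsilon>\<close>.\<close>

locale bk_model =
  fixes H0 :: "complex^'n::finite^'n" and T0 :: "complex^'n" and V0 :: real
    and X0 and \<rho> :: "complex^('n + 'n) \<Rightarrow> complex" and \<delta> \<epsilon> :: real
  assumes H0: "adj H0 = H0" and X0_def: "X0 = Xm H0 T0 V0"
    and \<delta>: "\<delta> > 0" and \<epsilon>: "\<epsilon> > 0" and holo_\<rho>: "holo (ball 0 \<delta>) \<rho>" and \<rho>0: "\<rho> 0 = 0"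
    and \<rho>: "q \<in> ball 0 \<delta> \<Longrightarrow> norm (\<rho> q) < \<epsilon> \<and> Phi X0 (\<rho> q) q = 0 \<and> Re (flow_pairing X0 (\<rho> q) q) < 0"
    and \<rho>_unique: "q \<in> ball 0 \<delta> \<Longrightarrow> norm s < \<epsilon> \<Longrightarrow> Phi X0 s q = 0 \<Longrightarrow> s = \<rho> q"
begin

abbreviation "E \<equiv> mexp X0"
abbreviation "e1 \<equiv> Bv 1 0 0 :: complex^('n option option)"

lemma adj_X0: "adj X0 ** Jm = Jm ** X0"
  unfolding X0_def by (rule Xm_herm[OF H0])

lemma adj_E: "adj (E s) ** Jm = Jm ** E (cnj s)"
  by (rule mexp_adj[OF adj_X0])

text \<open>The polarized form \<open>Jp\<close> on vectors \<open>c E(s) P\<close> and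
  \<open>c E(s) Q\<close>, where \<open>c E(s) Z\<close> is the point of the normalised null cone
  above the slice point \<open>Z\<close>: the real part of the time \<open>s\<close> is
  \<open>\<rho>\<close>, and \<open>Jp N (X0 N) = -1\<close> forces the squared modulus of
  \<open>c\<close> to be -1 divided by \<open>flow_pairing\<close>.\<close>

definition br where "br q a b = - pr a (Jm *v (E (2 * \<rho> q) *v b)) / flow_pairing X0 (\<rho> q) q"

text \<open>The form \<open>Jp\<close> restricted to the orthogonal complement of \<open>N\<close>
  and \<open>X0 N\<close>. Their Gram matrix is [[0, -1], [-1, c]] with
  \<open>c = Jp N (X0 (X0 N))\<close>, its inverse is [[-c, -1], [-1, 0]], and subtracting the
  components along the two vectors produces the last three terms. \<open>X0\<close> is moved to the
  second argument throughout.\<close>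

definition hp where "hp q u w = br q (Bvi u) (Bvi w)
    + br q (Bvi u) (X0 *v Zz q) * br q (Zw q) (Bvi w) + br q (Bvi u) (Zz q) * br q (Zw q) (X0 *v Bvi w)
    + br q (Zw q) (X0 *v (X0 *v Zz q)) * br q (Bvi u) (Zz q) * br q (Zw q) (Bvi w)"

definition hmod where "hmod y v w = hp (polar y) (cnjv v) w"

lemma flow_pairing_nz: "q \<in> ball 0 \<delta> \<Longrightarrow> flow_pairing X0 (\<rho> q) q \<noteq> 0"
  using \<rho>[of q] by force

lemma holo_br:
  assumes S: "open S" and Y: "\<And>i. holo S (\<lambda>x. Y x $ i)" "Y ` S \<subseteq> ball 0 \<delta>"
    and "\<And>i. holo S (\<lambda>x. a x $ i)" "\<And>i. holo S (\<lambda>x. b x $ i)"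
  shows "holo S (\<lambda>x. br (Y x) (a x) (b x))"
proof -
  have "holo S (\<lambda>x. Zz (Y x) $ i)" "holo S (\<lambda>x. Zw (Y x) $ i)" for i
    using S Y unfolding Zz_def Zw_def by (auto intro!: holo_Bv holo_const)
  then show ?thesis
    unfolding br_def divide_inverse flow_pairing_def
    by (intro holo_mult holo_minus holo_inverse holo_pr holo_matrix_vector holo_mexp holo_const
        holo_compose[OF holo_\<rho> Y] S assms flow_pairing_nz[unfolded flow_pairing_def]) (use Y in auto)
qed

lemma holo_hp:
  assumes S: "open S" and Y: "\<And>i. holo S (\<lambda>x. Y x $ i)" "Y ` S \<subseteq> ball 0 \<delta>"
    and uw: "\<And>i. holo S (\<lambda>x. u x $ i)" "\<And>i. holo S (\<lambda>x. w x $ i)"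
  shows "holo S (\<lambda>x. hp (Y x) (u x) (w x))"
proof -
  have "holo S (\<lambda>x. Zz (Y x) $ i)" "holo S (\<lambda>x. Zw (Y x) $ i)" "holo S (\<lambda>x. Bvi (u x) $ i)" "holo S (\<lambda>x. Bvi (w x) $ i)" for i
    using S Y uw unfolding Zz_def Zw_def Bvi_def by (auto intro!: holo_Bv holo_const)
  then show ?thesis
    unfolding hp_def by (intro holo_add holo_mult holo_br holo_matrix_vector holo_const S Y)
qed

lemma Phi_polar: "Phi X0 s (polar y) = star_dot (Bv 1 y 0) (Jm *v (E (2 * s) *v Bv 1 y 0))"
  by (simp add: Phi_def Zw_polar Zz_polar star_dot_pr)

text \<open>At a real point the equation \<open>Phi = 0\<close> is invariant under conjugation of
  the time, because \<open>X0\<close> is selfadjoint for \<open>Jm\<close>; uniqueness then makes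
  the small solution equal to its conjugate.\<close>

lemma \<rho>_real:
  assumes "polar y \<in> ball 0 \<delta>"
  shows "\<rho> (polar y) = of_real (Re (\<rho> (polar y)))"
proof -
  let ?s = "\<rho> (polar y)" and ?Z = "Bv 1 y 0"
  have "cnj (star_dot ?Z (Jm *v (E (2 * ?s) *v ?Z))) = star_dot (E (2 * ?s) *v ?Z) (Jm *v ?Z)"
    by (simp only: cnj_star_dot star_dot_adj[of Jm] adj_Jm)
  also have "\<dots> = star_dot ?Z (Jm *v (E (2 * cnj ?s) *v ?Z))"
    by (simp add: star_dot_adj matrix_vector_mul_assoc adj_E)
  finally have "Phi X0 (cnj ?s) (polar y) = 0"
    using \<rho>[OF assms] by (simp add: Phi_polar)
  then have "cnj ?s = ?s"
    using \<rho>[OF assms] by (intro \<rho>_unique[OF assms]) auto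
  then show ?thesis by (simp add: complex_eq_iff)
qed

end


section \<open>Coordinates on the space of orbits of scaling and flow, and the metric in
  them\<close>

definition mid :: "complex^('n::finite option option) \<Rightarrow> complex^'n" where
  "mid \<zeta> = (\<chi> j. \<zeta> $ Some (Some j))"

lemma mid_Bv [simp]: "mid (Bv a y b) = y" "mid (Bvi y) = y"
  by (simp_all add: mid_def Bvi_def vec_eq_iff)

lemma Bv_mid: "Bv (\<zeta> $ None) (mid \<zeta>) (\<zeta> $ Some None) = \<zeta>"
  by (simp add: vec_eq_iff all_option_option mid_def)

lemma mid_simps: "mid (x + y) = mid x + mid y" "mid (x - y) = mid x - mid y" "mid (c *s x) = c *s mid x" "mid 0 = 0"
  by (simp_all add: mid_def vec_eq_iff)

lemma bounded_linear_mid: "bounded_linear mid"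
  unfolding linear_conv_bounded_linear[symmetric]
  by (rule linearI) (simp_all add: mid_def vec_eq_iff)

lemma bounded_linear_Bvi: "bounded_linear Bvi"
  unfolding linear_conv_bounded_linear[symmetric]
  by (rule linearI) (simp_all add: Bvi_def vec_eq_iff all_option_option)

lemma cnjv_Bvi: "cnjv (Bvi u) = Bvi (cnjv u)"
  by (simp add: cnjv_def Bvi_def vec_eq_iff all_option_option)

text \<open>Coordinates of C^(n+2) near the first basis vector adapted to the orbits: the first
  component of \<open>\<zeta>\<close> is the scaling, the last one the time of the flow, and the
  middle part the slice point, which is what remains in the quotient.\<close>

definition Psi :: "complex^('n option option)^('n option option) \<Rightarrow> complex^('n option option) \<Rightarrow> complex^('n::finite option option)" where
  "Psi X \<zeta> = \<zeta> $ None *s (mexp X (\<zeta> $ Some None) *v Bv 1 (mid \<zeta>) 0)"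

lemma holo_Psi: "holo UNIV (\<lambda>\<zeta>. Psi X \<zeta> $ i)"
  unfolding Psi_def vector_smult_component mid_def
  by (intro holo_mult holo_matrix_vector holo_mexp holo_Bv holo_const holo_nth open_UNIV)
     (simp add: holo_nth)

lemma mderiv_Psi:
  "mderiv (Psi X) \<zeta> v = v $ None *s (mexp X (\<zeta> $ Some None) *v Bv 1 (mid \<zeta>) 0)
    + \<zeta> $ None *s (v $ Some None *s (X *v (mexp X (\<zeta> $ Some None) *v Bv 1 (mid \<zeta>) 0))
    + mexp X (\<zeta> $ Some None) *v Bvi (mid v))"
proof -
  have E: "((\<lambda>\<zeta>. mexp X (\<zeta> $ Some None)) has_derivative
      (\<lambda>v. mat (v $ Some None) ** (X ** mexp X (\<zeta> $ Some None)))) (at \<zeta>)"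
    by (rule has_derivative_compose[OF bounded_linear.has_derivative[OF bounded_linear_vec_nth has_derivative_ident] mexp_has_derivative])
  have "((\<lambda>\<zeta>. Bv 1 0 0 + Bvi (mid \<zeta>)) has_derivative (\<lambda>v. 0 + Bvi (mid v))) (at \<zeta>)"
    by (intro has_derivative_add has_derivative_const bounded_linear.has_derivative[OF bounded_linear_Bvi]
        bounded_linear.has_derivative[OF bounded_linear_mid] has_derivative_ident)
  then have B: "((\<lambda>\<zeta>. Bv 1 (mid \<zeta>) 0) has_derivative (\<lambda>v. Bvi (mid v))) (at \<zeta>)"
    by (simp add: Bvi_def Bv_add)
  have "(Psi X has_derivative (\<lambda>v. \<zeta> $ None *s (mexp X (\<zeta> $ Some None) *v Bvi (mid v)
      + (mat (v $ Some None) ** (X ** mexp X (\<zeta> $ Some None))) *v Bv 1 (mid \<zeta>) 0)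
      + v $ None *s (mexp X (\<zeta> $ Some None) *v Bv 1 (mid \<zeta>) 0))) (at \<zeta>)"
    unfolding Psi_def[abs_def]
    by (rule bounded_bilinear.FDERIV[OF bounded_bilinear_smult
          bounded_linear.has_derivative[OF bounded_linear_vec_nth has_derivative_ident]
          bounded_bilinear.FDERIV[OF bounded_bilinear_matrix_vector E B]])
  from mderiv_eq[OF this] show ?thesis
    by (simp add: matrix_vector_mul_assoc[symmetric] add_ac)
qed

lemma mderiv_compose:
  fixes g :: "complex^'k::finite \<Rightarrow> complex^'m::finite" and N :: "complex^'l::finite \<Rightarrow> complex^'k"
  assumes g: "\<And>j. holo V (\<lambda>y. g y $ j)" and N: "(N has_derivative N') (at x)" "N x \<in> V"
  shows "((\<lambda>x. g (N x)) has_derivative (\<lambda>v. mderiv g (N x) (N' v))) (at x)"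
  by (rule has_derivative_compose[OF N(1) holo_map_derivative[OF g N(2)]])

lemma continuous_on_mderiv:
  fixes g :: "complex^'k::finite \<Rightarrow> complex^'m::finite" and N w :: "'x::topological_space \<Rightarrow> complex^'k"
  assumes g: "\<And>j. holo V (\<lambda>y. g y $ j)" and N: "continuous_on S N" "N ` S \<subseteq> V" and w: "continuous_on S w"
  shows "continuous_on S (\<lambda>x. mderiv g (N x) (w x))"
proof -
  have "continuous_on S (\<lambda>x. dird (axis i 1) (\<lambda>y. g y $ j) (N x))" for i j
    using continuous_on_compose2[OF holo_continuous_dird[OF g] N] .
  then have "continuous_on S (\<lambda>x. \<Sum>i\<in>UNIV. dird (axis i 1) (\<lambda>y. g y $ j) (N x) * w x $ i)" for j
    using w by (intro continuous_on_sum continuous_on_mult continuous_on_component)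
  moreover have "(\<Sum>i\<in>UNIV. dird (axis i 1) (\<lambda>y. g y $ j) (N x) * w x $ i) = dird (w x) (\<lambda>y. g y $ j) (N x)"
    if "x \<in> S" for x j
    using holo_dird_sum[OF g, of "N x" "w x" j] N(2) that by auto
  ultimately have "continuous_on S (\<lambda>x. dird (w x) (\<lambda>y. g y $ j) (N x))" for j
    using continuous_on_cong[OF refl] by force
  then show ?thesis unfolding mderiv_def by (intro continuous_on_vec_lambda)
qed

lemma mderiv_linear:
  fixes g :: "complex^'k::finite \<Rightarrow> complex^'m::finite"
  assumes g: "\<And>j. holo V (\<lambda>y. g y $ j)" "x \<in> V"
  shows "linear (mderiv g x)"
  using has_derivative_linear[OF holo_map_derivative[OF g]] .

definition Jp :: "complex^('n option option) \<Rightarrow> complex^('n::finite option option) \<Rightarrow> complex" where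
  "Jp P Q = star_dot P (Jm *v Q)"

lemma bounded_bilinear_Jp: "bounded_bilinear Jp"
  unfolding Jp_def
  by (rule bounded_bilinear.comp[OF bounded_bilinear_star_dot bounded_linear_ident
        bounded_bilinear.bounded_linear_right[OF bounded_bilinear_matrix_vector]])

lemma Jp_linear: "Jp (P + Q) R = Jp P R + Jp Q R" "Jp R (P + Q) = Jp R P + Jp R Q"
  "Jp (k *s P) Q = cnj k * Jp P Q" "Jp P (k *s Q) = k * Jp P Q"
  by (simp_all add: Jp_def star_dot_add star_dot_smult matrix_vector_smult matrix_add_distrib)

lemma cnj_Jp: "cnj (Jp P Q) = Jp Q P"
  by (simp add: Jp_def cnj_star_dot star_dot_adj adj_Jm)

lemma Jp_Bv: "Jp (Bv a y b) (Bv a' y' b') = star_dot y y' - cnj a * b' - cnj b * a'"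
  by (simp add: Jp_def Jm_Bv Bv_star_dot)

context bk_model
begin

lemma Jp_X0: "Jp (X0 *v P) Q = Jp P (X0 *v Q)"
  by (simp add: Jp_def star_dot_adj matrix_vector_mul_assoc adj_X0)

lemma Jp_E: "Jp (E s *v P) Q = Jp P (E (cnj s) *v Q)"
  by (simp add: Jp_def star_dot_adj matrix_vector_mul_assoc adj_E)

lemma E_X0: "E s *v (X0 *v P) = X0 *v (E s *v P)"
  by (simp add: matrix_vector_mul_assoc mexp_commute)

lemma flow_pairing_Jp: "flow_pairing X0 s (polar y) = Jp (Bv 1 y 0) (E (2 * s) *v (X0 *v Bv 1 y 0))"
  by (simp add: flow_pairing_def Zw_polar Zz_polar Jp_def star_dot_pr)

text \<open>With \<open>Jm\<close> as the metric of signature \<open>(n+1,1)\<close>, the frame relations determine the induced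
  Hermitian metric on the space of \<open>X0\<close>-orbits in the null cone.\<close>

lemma orbit_metric:
  fixes G X :: "complex^('n option option)^('n option option)" and N
  defines "N \<equiv> G *v e1"
  assumes G: "adj G ** Jm ** G = Jm" and X: "G ** X = X0 ** G" "X = Xm H T V" "adj H = H"
    and q: "polar y \<in> ball 0 \<delta>" and s: "norm s < \<epsilon>"
    and N: "N = c *s (E s *v Bv 1 y 0)"
    and v: "c *s (E s *v Bvi v) = a *s N + b *s (X0 *v N) + G *v Bvi \<xi>"
    and v': "c *s (E s *v Bvi v') = a' *s N + b' *s (X0 *v N) + G *v Bvi \<xi>'"
  shows "star_dot \<xi> \<xi>' = hmod y v v'"
proof -
  have GJ: "Jp (G *v P) (G *v Q) = Jp P Q" for P Q
    by (simp add: Jp_def star_dot_adj matrix_vector_mul_assoc matrix_mul_assoc G)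
  have XN: "X0 *v N = G *v (X *v e1)"
    by (simp only: N_def matrix_vector_mul_assoc X(1))
  have Xe: "X *v e1 = Bv (- (trace H / 2)) 0 1" by (simp add: X Xm_e)
  have N0: "Jp N N = 0" unfolding N_def GJ by (simp add: Jp_Bv)
  have NX: "Jp N (X0 *v N) = - 1" unfolding XN unfolding N_def GJ Xe by (simp add: Jp_Bv)
  have XN1: "Jp (X0 *v N) N = - 1" using Jp_X0 NX by simp
  define q where "q = Jp (X0 *v N) (X0 *v N)"
  have NF: "Jp N (G *v Bvi z) = 0" for z unfolding N_def GJ by (simp add: Bvi_def Jp_Bv)
  have FN: "Jp (G *v Bvi z) N = 0" for z using NF cnj_Jp by (metis complex_cnj_zero)
  have XF: "Jp (X0 *v N) (G *v Bvi z) = 0" for z unfolding XN GJ Xe by (simp add: Bvi_def Jp_Bv)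
  have FX: "Jp (G *v Bvi z) (X0 *v N) = 0" for z using XF cnj_Jp by (metis complex_cnj_zero)
  have FF: "Jp (G *v Bvi z) (G *v Bvi z') = star_dot z z'" for z z' unfolding GJ by (simp add: Bvi_def Jp_Bv)
  let ?P = "c *s (E s *v Bvi v)" and ?P' = "c *s (E s *v Bvi v')"
  have e: "Jp ?P ?P' = - (cnj a * b') - cnj b * a' + cnj b * b' * q + star_dot \<xi> \<xi>'"
    "Jp ?P (X0 *v N) = - cnj a + cnj b * q" "Jp N ?P' = - b'" "Jp ?P N = - cnj b" "Jp (X0 *v N) ?P' = - a' + b' * q"
    unfolding v v' Jp_linear N0 NX XN1 q_def[symmetric] NF FN XF FX FF by (simp_all add: algebra_simps)
  \<comment> \<open>The complement's metric is recovered by subtracting the components along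
    \<open>N\<close> and \<open>X0 N\<close>. In this form it contains only \<open>N\<close> and the
    two vectors \<open>?P\<close>, \<open>?P'\<close>, and neither the coefficients
    \<open>a\<close>, \<open>b\<close> nor \<open>G\<close>.\<close>
  have hpN: "star_dot \<xi> \<xi>' = Jp ?P ?P' + Jp ?P (X0 *v N) * Jp N ?P' + Jp ?P N * Jp N (X0 *v ?P')
      + Jp N (X0 *v (X0 *v N)) * Jp ?P N * Jp N ?P'"
  proof -
    have "Jp N (X0 *v (X0 *v N)) = q" "Jp N (X0 *v ?P') = Jp (X0 *v N) ?P'" by (simp_all add: q_def Jp_X0)
    then show ?thesis unfolding e by (simp only: e) (simp add: algebra_simps)
  qed
  have EJ: "Jp (c *s (E s *v P)) (c *s (E s *v Q)) = cnj c * c * Jp P (E (cnj s + s) *v Q)" for P Q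
    by (simp add: Jp_linear Jp_E mexp_add matrix_vector_mul_assoc)
  have "c \<noteq> 0" using NX N by (auto simp: Jp_def)
  then have c: "cnj c * c \<noteq> 0" by simp
  let ?Z = "Bv 1 y 0" and ?q = "polar y"
  have ss: "cnj s + s = 2 * of_real (Re s)" by (simp add: complex_eq_iff)
  have "cnj c * c * Jp ?Z (E (cnj s + s) *v ?Z) = 0"
    using N0 EJ[of ?Z ?Z] unfolding N by simp
  \<comment> \<open>The imaginary part of the time acts by isometries and disappears from the null
    condition, so uniqueness identifies the real part with \<open>\<rho>\<close>. The phase of
    \<open>c\<close> disappears in the same way, and its modulus is fixed by
    \<open>Jp N (X0 N) = -1\<close>.\<close>
  then have "Phi X0 (of_real (Re s)) ?q = 0" using c by (simp add: Phi_polar Jp_def ss)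
  moreover have "norm (of_real (Re s) :: complex) < \<epsilon>"
    using s abs_Re_le_cmod[of s] by simp
  ultimately have rs: "cnj s + s = 2 * \<rho> ?q" using \<rho>_unique[OF q] ss by simp
  have XE: "X0 *v (c *s (E s *v P)) = c *s (E s *v (X0 *v P))" for P
    by (simp add: matrix_vector_smult E_X0)
  have "cnj c * c * flow_pairing X0 (\<rho> ?q) ?q = - 1"
    using NX EJ[of ?Z "X0 *v ?Z"] unfolding N XE rs flow_pairing_Jp by simp
  then have "cnj c * c = - 1 / flow_pairing X0 (\<rho> ?q) ?q"
    using flow_pairing_nz[OF q] by (simp add: field_simps)
  then have "Jp (c *s (E s *v P)) (c *s (E s *v Q)) = br ?q (cnjv P) Q" for P Q
    unfolding EJ rs unfolding br_def Jp_def star_dot_pr by simp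
  then show ?thesis
    unfolding hpN unfolding N XE hmod_def hp_def Zz_polar Zw_polar cnjv_Bvi[symmetric] by simp
qed

text \<open>The chart \<open>y\<close> is the slice coordinate of the developing map
  \<open>N\<close>. The forms \<open>\<tau>\<close> and \<open>\<mu>\<close> in the derivative of
  \<open>N\<close> are only real-linear, but they multiply \<open>N\<close> and \<open>X0 N\<close>,
  the two directions lost in the quotient. The remaining part \<open>A v\<close> is complex-linear,
  hence so is the derivative of \<open>y\<close>. At \<open>x0\<close> that derivative is
  \<open>A0\<close>, so \<open>y\<close> is a chart near \<open>x0\<close>, and
  \<open>orbit_metric\<close> gives the metric in it.\<close>

lemma model_chart:
  assumes bk: "bochner_kaehler_on k U \<Omega> H T V" and k: "2 \<le> k" and p0: "(x0, A0) \<in> coframe_bundle U \<Omega>"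
    and HTV: "H (x0, A0) = H0" "T (x0, A0) = T0" "V (x0, A0) = V0"
  obtains W Y y g where "open W" "x0 \<in> W" "W \<subseteq> U" "open Y" "y x0 = 0" "homeomorphism W Y y g"
    "\<And>j. holo W (\<lambda>x. y x $ j)" "\<And>j. holo Y (\<lambda>x. g x $ j)" "\<And>x. x \<in> W \<Longrightarrow> polar (y x) \<in> ball 0 \<delta>"
    "\<And>x v w. x \<in> W \<Longrightarrow> \<Omega> x v w = Im (hmod (y x) (mderiv y x v) (mderiv y x w))"
proof -
  have kf: "kaehler_form_on k U \<Omega>" using bk by (simp add: bochner_kaehler_on_def)
  obtain r A G X \<tau> \<mu> where r: "r > 0" "ball x0 r \<subseteq> U" and A: "\<And>x. x \<in> ball x0 r \<Longrightarrow> (x, A x) \<in> coframe_bundle U \<Omega>" "A x0 = A0"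
    and G: "G x0 = mat 1" "\<And>x. x \<in> ball x0 r \<Longrightarrow> adj (G x) ** Jm ** G x = Jm" "\<And>x. x \<in> ball x0 r \<Longrightarrow> G x ** X x = X0 ** G x"
    and X: "\<And>x. x \<in> ball x0 r \<Longrightarrow> \<exists>H T V. X x = Xm H T V \<and> adj H = H"
    and dN: "\<And>x. x \<in> ball x0 r \<Longrightarrow> ((\<lambda>x. G x *v e1) has_derivative (\<lambda>v. \<tau> x v *s (G x *v e1)
        + \<mu> x v *s (X0 *v (G x *v e1)) + G x *v Bvi (A x *v v))) (at x)"
    and cN: "\<And>v. continuous_on (ball x0 r) (\<lambda>x. \<tau> x v *s (G x *v e1) + \<mu> x v *s (X0 *v (G x *v e1)) + G x *v Bvi (A x *v v))"
    using developing_frame[OF bk k p0] unfolding HTV X0_def[symmetric] by blast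
  define N where "N x = G x *v e1" for x
  define N' where "N' x v = \<tau> x v *s N x + \<mu> x v *s (X0 *v N x) + G x *v Bvi (A x *v v)" for x v
  have dN: "(N has_derivative N' x) (at x)" if "x \<in> ball x0 r" for x
    using dN[OF that] unfolding N'_def[abs_def] N_def[abs_def] .
  have cN: "continuous_on (ball x0 r) (\<lambda>x. N' x v)" for v using cN unfolding N'_def N_def .
  have Nc: "continuous_on (ball x0 r) N"
    using dN has_derivative_continuous by (intro continuous_at_imp_continuous_on) blast
  have mid0: "mid e1 = 0" by simp
  have Psi_e1: "Psi X0 e1 = e1" by (simp add: Psi_def)
  have Xe: "X0 *v e1 = Bv (- (trace H0 / 2)) 0 1" unfolding X0_def by (rule Xm_e)
  have me1: "mderiv (Psi X0) e1 v = Bv (v $ None - v $ Some None * trace H0 / 2) (mid v) (v $ Some None)" for v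
    unfolding mderiv_Psi by (simp add: Xe Bv_smult Bv_add Bvi_def)
  obtain U' V' g where U': "open U'" "e1 \<in> U'" "open V'" "homeomorphism U' V' (Psi X0) g"
    and hg: "\<And>j. holo V' (\<lambda>y. g y $ j)" and injU: "\<And>\<zeta>. \<zeta> \<in> U' \<Longrightarrow> inj (mderiv (Psi X0) \<zeta>)"
  proof (rule holo_inverse_function[of UNIV "Psi X0" e1])
    show "v = 0" if "mderiv (Psi X0) e1 v = 0" for v
    proof -
      have *: "v $ None = 0" "mid v = 0" "v $ Some None = 0"
        using that unfolding me1 Bv_zero Bv_eq_iff by auto
      show ?thesis using Bv_mid[of v] unfolding * by (simp add: Bv_zero)
    qed
  qed (simp_all add: holo_Psi)
  have N0: "N x0 = e1" by (simp add: N_def G)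
  have gPsi: "g (Psi X0 \<zeta>) = \<zeta>" if "\<zeta> \<in> U'" for \<zeta> using U'(4) that by (simp add: homeomorphism_def)
  have Psig: "Psi X0 (g z) = z" "g z \<in> U'" if "z \<in> V'" for z using U'(4) that by (auto simp: homeomorphism_def)
  have e1V: "e1 \<in> V'" using U'(2,4) Psi_e1 by (metis homeomorphism_def imageI)
  have ge1: "g e1 = e1" using gPsi[OF U'(2)] by (simp add: Psi_e1)
  define W0 where "W0 = ball x0 r \<inter> N -` V'"
  have W0: "open W0" "x0 \<in> W0" "W0 \<subseteq> ball x0 r" "N ` W0 \<subseteq> V'"
    using continuous_open_preimage[OF Nc open_ball U'(3)] r(1) N0 e1V by (auto simp: W0_def)
  define \<zeta> where "\<zeta> x = g (N x)" for x
  define \<zeta>' where "\<zeta>' x v = mderiv g (N x) (N' x v)" for x v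
  have d\<zeta>: "(\<zeta> has_derivative \<zeta>' x) (at x)" if "x \<in> W0" for x
    unfolding \<zeta>_def[abs_def] \<zeta>'_def[abs_def] using mderiv_compose[OF hg dN] that W0 by blast
  have c\<zeta>': "continuous_on W0 (\<lambda>x. \<zeta>' x v)" for v
    unfolding \<zeta>'_def using W0 by (intro continuous_on_mderiv[OF hg] continuous_on_subset[OF Nc] continuous_on_subset[OF cN])
  have Psi\<zeta>: "Psi X0 (\<zeta> x) = N x" "\<zeta> x \<in> U'" if "x \<in> W0" for x
    using Psig that by (auto simp: \<zeta>_def W0_def)
  have rel: "mderiv (Psi X0) (\<zeta> x) (\<zeta>' x v) = N' x v" if x: "x \<in> W0" for x v
  proof -
    have "((\<lambda>x. Psi X0 (\<zeta> x)) has_derivative (\<lambda>v. mderiv (Psi X0) (\<zeta> x) (\<zeta>' x v))) (at x)"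
      by (rule mderiv_compose[OF holo_Psi d\<zeta>[OF x]]) simp
    then have "(N has_derivative (\<lambda>v. mderiv (Psi X0) (\<zeta> x) (\<zeta>' x v))) (at x)"
      by (rule has_derivative_transform_within_open[OF _ W0(1) x]) (simp add: Psi\<zeta>)
    then show ?thesis using has_derivative_unique[OF _ dN] x W0(3) by (metis subsetD)
  qed
  define c where "c x = \<zeta> x $ None" for x
  define s where "s x = \<zeta> x $ Some None" for x
  define y where "y x = mid (\<zeta> x)" for x
  have Neq: "N x = c x *s (E (s x) *v Bv 1 (y x) 0)" if "x \<in> W0" for x
    using Psi\<zeta>(1)[OF that] by (simp add: Psi_def c_def s_def y_def)
  have c0: "c x \<noteq> 0" if "x \<in> W0" for x
  proof
    assume "c x = 0"
    then have "G x *v e1 = 0" using Neq[OF that] by (simp add: N_def)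
    then have "(adj (G x) ** Jm ** G x) *v e1 = 0" by (simp add: matrix_vector_mul_assoc[symmetric])
    then have "Jm *v e1 = 0" using G(2) that W0(3) by auto
    then show False by (simp add: Jm_Bv Bv_zero Bv_eq_iff)
  qed
  have rel2: "mderiv (Psi X0) (\<zeta> x) v = (v $ None / c x) *s N x + v $ Some None *s (X0 *v N x) + c x *s (E (s x) *v Bvi (mid v))"
    if "x \<in> W0" for x v
    unfolding mderiv_Psi Neq[OF that] using c0[OF that]
    by (simp add: c_def s_def y_def smult_simps matrix_vector_smult vector_smult_assoc)
  define y' where "y' x v = mid (\<zeta>' x v)" for x v
  have dy: "(y has_derivative y' x) (at x)" if "x \<in> W0" for x
    unfolding y_def[abs_def] y'_def[abs_def] using bounded_linear.has_derivative[OF bounded_linear_mid d\<zeta>[OF that]] .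
  have eta: "c x *s (E (s x) *v Bvi (y' x v)) = (\<tau> x v - \<zeta>' x v $ None / c x) *s N x
      + (\<mu> x v - \<zeta>' x v $ Some None) *s (X0 *v N x) + G x *v Bvi (A x *v v)" if "x \<in> W0" for x v
    using rel[OF that, of v] unfolding rel2[OF that] N'_def y'_def[symmetric]
    by (simp add: smult_simps algebra_simps)
  have y'i: "y' x (\<i> *s v) = \<i> *s y' x v" if x: "x \<in> W0" for x v
  proof -
    let ?d = "\<zeta>' x (\<i> *s v) - \<i> *s \<zeta>' x v"
    \<comment> \<open>The failure of the derivative of \<open>N\<close> to be complex-linear lies in
      the span of \<open>N\<close> and \<open>X0 N\<close>. This vector, which has only scaling and
      time components, is its preimage under the derivative of \<open>Psi\<close>.\<close>
    define e where "e = Bv (c x * ((\<tau> x (\<i> *s v) - \<i> * \<tau> x v))) (0 :: complex^'n) (\<mu> x (\<i> *s v) - \<i> * \<mu> x v)"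
    have "mderiv (Psi X0) (\<zeta> x) ?d = mderiv (Psi X0) (\<zeta> x) (\<zeta>' x (\<i> *s v)) - \<i> *s mderiv (Psi X0) (\<zeta> x) (\<zeta>' x v)"
      by (simp add: linear_diff[OF mderiv_linear[OF holo_Psi UNIV_I]] mderiv_smult[OF holo_Psi UNIV_I])
    also have "\<dots> = (\<tau> x (\<i> *s v) - \<i> * \<tau> x v) *s N x + (\<mu> x (\<i> *s v) - \<i> * \<mu> x v) *s (X0 *v N x)"
    proof -
      have "G x *v Bvi (A x *v (\<i> *s v)) = \<i> *s (G x *v Bvi (A x *v v))"
        by (simp add: matrix_vector_smult Bvi_def Bv_smult flip: matrix_vector_smult)
      then show ?thesis unfolding rel[OF x] N'_def
        by (simp add: smult_simps vector_smult_assoc algebra_simps)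
    qed
    also have "\<dots> = mderiv (Psi X0) (\<zeta> x) e"
      unfolding rel2[OF x] using c0[OF x] by (simp add: e_def Bvi_def flip: Bv_zero)
    finally have "?d = e" using injU[OF Psi\<zeta>(2)[OF x]] by (simp add: inj_eq)
    then have "mid ?d = 0" by (simp add: e_def)
    then show ?thesis by (simp add: y'_def mid_simps)
  qed
  have hy: "holo W0 (\<lambda>x. y x $ j)" for j
  proof (rule holo_mapI[OF W0(1) dy])
    show "continuous_on W0 (\<lambda>x. y' x v)" for v
      unfolding y'_def by (rule bounded_linear.continuous_on[OF bounded_linear_mid c\<zeta>'])
  qed (use y'i in auto)
  have y0: "y x0 = 0" and s0: "s x0 = 0" by (simp_all add: y_def s_def \<zeta>_def N0 ge1)
  have ys: "mderiv y x v = y' x v" if "x \<in> W0" for x v by (rule mderiv_eq[OF dy[OF that]])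
  have y'0: "y' x0 v = A0 *v v" for v
  proof -
    have "c x0 = 1" by (simp add: c_def \<zeta>_def N0 ge1)
    then have "Bvi (y' x0 v) = (\<tau> x0 v - \<zeta>' x0 v $ None) *s e1
      + (\<mu> x0 v - \<zeta>' x0 v $ Some None) *s (X0 *v e1) + Bvi (A0 *v v)"
      using eta[OF W0(2), of v] by (simp add: s0 N0 G A)
    then have "mid (Bvi (y' x0 v)) = mid ((\<tau> x0 v - \<zeta>' x0 v $ None) *s e1
      + (\<mu> x0 v - \<zeta>' x0 v $ Some None) *s (X0 *v e1) + Bvi (A0 *v v))" by simp
    then show ?thesis by (simp add: mid_simps Xe)
  qed
  \<comment> \<open>Here the time \<open>s\<close> and the polarized slice point are small enough
    for the uniqueness of \<open>\<rho>\<close>.\<close>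
  define W1 where "W1 = W0 \<inter> (\<lambda>x. (s x, polar (y x))) -` (ball 0 \<epsilon> \<times> ball 0 \<delta>)"
  have "continuous_on W0 \<zeta>"
    using d\<zeta> has_derivative_continuous by (intro continuous_at_imp_continuous_on) blast
  then have "continuous_on W0 (\<lambda>x. (s x, polar (y x)))"
    unfolding s_def y_def
    by (intro continuous_on_Pair continuous_on_component bounded_linear.continuous_on[OF bounded_linear_polar]
        bounded_linear.continuous_on[OF bounded_linear_mid])
  then have W1: "open W1" unfolding W1_def
    using continuous_open_preimage[OF _ W0(1) open_Times[OF open_ball open_ball]] by blast
  have "polar (0 :: complex^'n) = 0" using linear_0[OF bounded_linear.linear[OF bounded_linear_polar]] .
  then have x0W1: "x0 \<in> W1" using W0(2) \<delta> \<epsilon> by (simp add: W1_def s0 y0)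
  have W1sub: "W1 \<subseteq> W0" by (auto simp: W1_def)
  have hW1: "\<And>j. holo W1 (\<lambda>x. y x $ j)" using holo_subset[OF hy W1 W1sub] .
  have injy: "v = 0" if "mderiv y x0 v = 0" for v
  proof (rule ccontr)
    assume "v \<noteq> 0"
    have "x0 \<in> U" using p0 by (simp add: coframe_bundle_def)
    then have "Re (star_dot v (herm_matrix \<Omega> x0 *v v)) > 0" using herm_matrix_pos[OF kf] \<open>v \<noteq> 0\<close> by blast
    moreover have "herm_matrix \<Omega> x0 *v v = adj A0 *v (A0 *v v)"
      using coframe_bundle_iff[OF kf] p0 by (metis matrix_vector_mul_assoc)
    moreover have "A0 *v v = 0" using that by (simp add: ys[OF W0(2)] y'0)
    ultimately show False by simp
  qed
  obtain W Y gi where W: "open W" "W \<subseteq> W1" "x0 \<in> W" "open Y" "homeomorphism W Y y gi" and hgi: "\<And>j. holo Y (\<lambda>y. gi y $ j)"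
    using holo_inverse_function[OF hW1 x0W1 injy] by metis
  show ?thesis
  proof (rule that[of W Y y gi])
    show "W \<subseteq> U" using W(2) W1sub W0(3) r(2) by blast
    show "holo W (\<lambda>x. y x $ j)" for j by (rule holo_subset[OF hW1 W(1,2)])
    show "polar (y x) \<in> ball 0 \<delta>" if "x \<in> W" for x using that W(2) by (auto simp: W1_def)
    show "\<Omega> x v w = Im (hmod (y x) (mderiv y x v) (mderiv y x w))" if x: "x \<in> W" for x v w
    proof -
      have x0: "x \<in> W0" "x \<in> ball x0 r" "x \<in> U" using x W(2) W1sub W0(3) r(2) by blast+
      obtain H' T' V' where X': "X x = Xm H' T' V'" "adj H' = H'" using X[OF x0(2)] by blast
      have b: "polar (y x) \<in> ball 0 \<delta>" "norm (s x) < \<epsilon>" using x W(2) by (auto simp: W1_def)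
      have "star_dot (A x *v v) (A x *v w) = hmod (y x) (y' x v) (y' x w)"
        by (rule orbit_metric[OF G(2,3)[OF x0(2)] X' b Neq[OF x0(1), unfolded N_def]
              eta[OF x0(1), unfolded N_def] eta[OF x0(1), unfolded N_def]])
      moreover have "\<Omega> x v w = Im (star_dot (A x *v v) (A x *v w))"
        using kaehler_form_eq[OF kf x0(3)] coframe_bundle_iff[OF kf, of x "A x"] A(1)[OF x0(2)]
        by (simp add: star_dot_adj matrix_vector_mul_assoc)
      ultimately show ?thesis by (simp add: ys[OF x0(1)])
    qed
  qed (use W hgi y0 in auto)
qed

end


section \<open>Uniqueness and real-analyticity\<close>

lemma holo_imp_holomorphic_map_on:
  fixes f :: "complex^'n::finite \<Rightarrow> complex^'m::finite"
  assumes "\<And>j. holo S (\<lambda>x. f x $ j)"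
  shows "holomorphic_map_on S f"
  unfolding holomorphic_map_on_def
proof
  fix x assume x: "x \<in> S"
  define A :: "complex^'n^'m" where "A = (\<chi> j i. dird (axis i 1) (\<lambda>x. f x $ j) x)"
  have "mderiv f x = (*v) A"
  proof
    fix v
    have "dird v (\<lambda>x. f x $ j) x = (\<Sum>i\<in>UNIV. A $ j $ i * v $ i)" for j
      unfolding A_def by (simp add: holo_dird_sum[OF assms x, of v])
    then show "mderiv f x v = A *v v" by (simp add: mderiv_def vec_eq_iff matrix_vector_mult_def)
  qed
  then show "\<exists>A. (f has_derivative (*v) A) (at x)"
    using holo_map_derivative[OF assms x] by (intro exI[of _ A]) simp
qed

lemma bk_model_exists:
  fixes H0 :: "complex^'n::finite^'n"
  assumes "hermitian H0"
  obtains \<rho> \<delta> \<epsilon> where "bk_model H0 T0 V0 (Xm H0 T0 V0) \<rho> \<delta> \<epsilon>"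
proof (rule Phi_implicit[of H0 T0 V0])
  fix \<rho> \<delta> \<epsilon>
  assume r: "\<delta> > 0" "\<epsilon> > 0" "holo (ball (0 :: complex^('n + 'n)) \<delta>) \<rho>" "\<rho> 0 = 0"
    "\<And>q. q \<in> ball 0 \<delta> \<Longrightarrow> norm (\<rho> q) < \<epsilon> \<and> Phi (Xm H0 T0 V0) (\<rho> q) q = 0 \<and> Re (flow_pairing (Xm H0 T0 V0) (\<rho> q) q) < 0"
    "\<And>q s. q \<in> ball 0 \<delta> \<Longrightarrow> norm s < \<epsilon> \<Longrightarrow> Phi (Xm H0 T0 V0) s q = 0 \<Longrightarrow> s = \<rho> q"
  show thesis
    by (rule that, rule bk_model.intro) (rule r assms[unfolded hermitian_def] refl | assumption)+
qed

text \<open>The function \<open>hmod\<close> belongs to \<open>X0\<close> alone, so both structures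
  have the same expression in their charts \<open>y1\<close> and \<open>y2\<close>; the isomorphism
  is \<open>y1\<close> followed by the inverse of \<open>y2\<close>.\<close>

lemma isomorphic_germs_attaining:
  assumes H0: "hermitian H0" and k: "2 \<le> k1" "2 \<le> k2"
    and "attains_at_0 k1 U1 \<Omega>1 H0 T0 V0" "attains_at_0 k2 U2 \<Omega>2 H0 T0 V0"
  shows "isomorphic_germs_at_0 U1 \<Omega>1 U2 (\<Omega>2 :: 'n::finite form2)"
proof -
  obtain \<rho> \<delta> \<epsilon> where "bk_model H0 T0 V0 (Xm H0 T0 V0) \<rho> \<delta> \<epsilon>"
    by (rule bk_model_exists[OF H0])
  then interpret bk_model H0 T0 V0 "Xm H0 T0 V0" \<rho> \<delta> \<epsilon> .
  obtain A1 H1 T1 V1 where 1: "bochner_kaehler_on k1 U1 \<Omega>1 H1 T1 V1" "(0, A1) \<in> coframe_bundle U1 \<Omega>1"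
    "H1 (0, A1) = H0" "T1 (0, A1) = T0" "V1 (0, A1) = V0"
    using assms(4) unfolding attains_at_0_def by force
  obtain A2 H2 T2 V2 where 2: "bochner_kaehler_on k2 U2 \<Omega>2 H2 T2 V2" "(0, A2) \<in> coframe_bundle U2 \<Omega>2"
    "H2 (0, A2) = H0" "T2 (0, A2) = T0" "V2 (0, A2) = V0"
    using assms(5) unfolding attains_at_0_def by force
  obtain W1 Y1 y1 g1 where W1: "open W1" "0 \<in> W1" "W1 \<subseteq> U1" "open Y1" "y1 0 = 0" "homeomorphism W1 Y1 y1 g1"
    and h1: "\<And>j. holo W1 (\<lambda>x. y1 x $ j)" "\<And>j. holo Y1 (\<lambda>x. g1 x $ j)"
    and "\<And>x. x \<in> W1 \<Longrightarrow> polar (y1 x) \<in> ball 0 \<delta>"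
    and \<Omega>1: "\<And>x v w. x \<in> W1 \<Longrightarrow> \<Omega>1 x v w = Im (hmod (y1 x) (mderiv y1 x v) (mderiv y1 x w))"
    by (rule model_chart[OF 1(1) k(1) 1(2-5)]) (rule that; assumption)
  obtain W2 Y2 y2 g2 where W2: "open W2" "0 \<in> W2" "W2 \<subseteq> U2" "open Y2" "y2 0 = 0" "homeomorphism W2 Y2 y2 g2"
    and h2: "\<And>j. holo W2 (\<lambda>x. y2 x $ j)" "\<And>j. holo Y2 (\<lambda>x. g2 x $ j)"
    and "\<And>x. x \<in> W2 \<Longrightarrow> polar (y2 x) \<in> ball 0 \<delta>"
    and \<Omega>2: "\<And>x v w. x \<in> W2 \<Longrightarrow> \<Omega>2 x v w = Im (hmod (y2 x) (mderiv y2 x v) (mderiv y2 x w))"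
    by (rule model_chart[OF 2(1) k(2) 2(2-5)]) (rule that; assumption)
  note c1 = homeomorphism_cont1[OF W1(6)] homeomorphism_cont2[OF W1(6)]
  note c2 = homeomorphism_cont1[OF W2(6)] homeomorphism_cont2[OF W2(6)]
  have i1: "g1 (y1 x) = x" "y1 x \<in> Y1" if "x \<in> W1" for x using W1(6) that by (auto simp: homeomorphism_def)
  have i2: "g2 (y2 x) = x" "y2 x \<in> Y2" if "x \<in> W2" for x using W2(6) that by (auto simp: homeomorphism_def)
  have j1: "y1 (g1 z) = z" "g1 z \<in> W1" if "z \<in> Y1" for z using W1(6) that by (auto simp: homeomorphism_def)
  have j2: "y2 (g2 z) = z" "g2 z \<in> W2" if "z \<in> Y2" for z using W2(6) that by (auto simp: homeomorphism_def)
  define N1 where "N1 = W1 \<inter> y1 -` Y2"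
  define N2 where "N2 = W2 \<inter> y2 -` Y1"
  define f where "f = g2 \<circ> y1"
  define g where "g = g1 \<circ> y2"
  have N: "open N1" "open N2"
    unfolding N1_def N2_def
    using continuous_open_preimage[OF c1(1) W1(1) W2(4)] continuous_open_preimage[OF c2(1) W2(1) W1(4)] .
  have m: "f x \<in> N2" "g (f x) = x" "y2 (f x) = y1 x" if "x \<in> N1" for x
    using that i1 j2 by (auto simp: N1_def N2_def f_def g_def)
  have m': "g x \<in> N1" "f (g x) = x" if "x \<in> N2" for x
    using that i2 j1 by (auto simp: N1_def N2_def f_def g_def)
  have hf: "holo N1 (\<lambda>x. f x $ j)" for j
    unfolding f_def o_def
    by (rule holo_compose[OF h2(2) holo_subset[OF h1(1) N(1)]]) (auto simp: N1_def)
  have hg: "holo N2 (\<lambda>x. g x $ j)" for j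
    unfolding g_def o_def
    by (rule holo_compose[OF h1(2) holo_subset[OF h2(1) N(2)]]) (auto simp: N2_def)
  have "continuous_on N1 f" "continuous_on N2 g"
    using holo_map_derivative[OF hf] holo_map_derivative[OF hg] has_derivative_continuous
    by (intro continuous_at_imp_continuous_on; blast)+
  then have hom: "homeomorphism N1 N2 f g"
    using m m' by (intro homeomorphismI) auto
  have f0: "f 0 = 0" "0 \<in> N1" using i1[OF W1(2)] i2[OF W2(2)] W1 W2 by (auto simp: f_def N1_def)
  have "pullback_form f \<Omega>2 x = \<Omega>1 x" if x: "x \<in> N1" for x
  proof (intro ext)
    fix v w
    have x1: "x \<in> W1" using x by (simp add: N1_def)
    have fx: "f x \<in> W2" using m(1)[OF x] by (simp add: N2_def)
    have df: "(f has_derivative mderiv f x) (at x)" by (rule holo_map_derivative[OF hf x])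
    have "((\<lambda>x. y2 (f x)) has_derivative (\<lambda>v. mderiv y2 (f x) (mderiv f x v))) (at x)"
      by (rule mderiv_compose[OF h2(1) df fx])
    then have "(y1 has_derivative (\<lambda>v. mderiv y2 (f x) (mderiv f x v))) (at x)"
      by (rule has_derivative_transform_within_open[OF _ N(1) x]) (simp add: m)
    then have "mderiv y1 x u = mderiv y2 (f x) (mderiv f x u)" for u by (rule mderiv_eq)
    then show "pullback_form f \<Omega>2 x v w = \<Omega>1 x v w"
      by (simp add: pullback_form_def \<Omega>1[OF x1] \<Omega>2[OF fx] m(3)[OF x] frechet_derivative_apply[OF df])
  qed
  then show ?thesis
    unfolding isomorphic_germs_at_0_def
    using N W1(3) W2(3) hom f0 holo_imp_holomorphic_map_on[OF hf] holo_imp_holomorphic_map_on[OF hg]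
    by (intro exI[of _ N1] exI[of _ N2] exI[of _ f] exI[of _ g]) (auto simp: N1_def N2_def)
qed

lemma cnjv_nth [simp]: "cnjv x $ i = cnj (x $ i)"
  by (simp add: cnjv_def)

lemma bounded_linear_cnjv: "bounded_linear (cnjv :: complex^'n::finite \<Rightarrow> _)"
  unfolding linear_conv_bounded_linear[symmetric] by (rule linearI) (simp_all add: vec_eq_iff)

text \<open>Schwarz reflection: the two conjugations cancel in the derivative. It makes the
  conjugated chart a holomorphic function of the second half of the polarized variables.\<close>

lemma holo_cnj:
  fixes f :: "complex^'k::finite \<Rightarrow> complex"
  assumes f: "holo S f" and T: "open T" "cnjv ` T \<subseteq> S"
  shows "holo T (\<lambda>z. cnj (f (cnjv z)))"
proof (rule holoI[OF T(1)])
  fix x assume x: "x \<in> T"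
  have "((\<lambda>z. f (cnjv z)) has_derivative (\<lambda>v. dird (cnjv v) f (cnjv x))) (at x)"
    by (rule has_derivative_compose[OF bounded_linear.has_derivative[OF bounded_linear_cnjv has_derivative_ident] holo_has_derivative[OF f]])
       (use x T in auto)
  from bounded_linear.has_derivative[OF bounded_linear_cnj this]
  show "((\<lambda>z. cnj (f (cnjv z))) has_derivative (\<lambda>v. cnj (dird (cnjv v) f (cnjv x)))) (at x)" .
  have "cnjv (\<i> *s v) = - \<i> *s cnjv v" for v :: "complex^'k" by (simp add: vec_eq_iff)
  then show "cnj (dird (cnjv (\<i> *s v)) f (cnjv x)) = \<i> * cnj (dird (cnjv v) f (cnjv x))" for v
    using holo_dird_smult[OF f, of "cnjv x" "- \<i>"] x T by auto
next
  show "continuous_on T (\<lambda>x. cnj (dird (cnjv v) f (cnjv x)))" for v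
    by (intro continuous_on_cnj continuous_on_compose2[OF holo_continuous_dird[OF f]]
        bounded_linear.continuous_on[OF bounded_linear_cnjv] continuous_on_id T)
qed

lemma real_analytic_on_cong:
  assumes f: "real_analytic_on S f" and S: "open S" and g: "\<And>x. x \<in> S \<Longrightarrow> g x = f x"
  shows "real_analytic_on S g"
  unfolding real_analytic_on_def
proof
  fix p assume p: "p \<in> S"
  then obtain d where d: "d > 0" "ball p d \<subseteq> S" using S open_contains_ball by blast
  from bspec[OF f[unfolded real_analytic_on_def] p] obtain r a where r: "r > 0" and a: "\<forall>y. norm y < r \<longrightarrow>
      ((\<lambda>\<alpha>. (\<Prod>b\<in>Basis. (y \<bullet> b) ^ \<alpha> b) *\<^sub>R a \<alpha>) has_sum f (p + y)) {\<alpha>. \<forall>b. b \<notin> Basis \<longrightarrow> \<alpha> b = 0}"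
    by (elim exE conjE) (rule that; assumption)
  have "g (p + y) = f (p + y)" if "norm y < d" for y
    using d that by (intro g) (auto simp: subset_iff dist_norm)
  then show "\<exists>r>0. \<exists>a. \<forall>y. norm y < r \<longrightarrow>
      ((\<lambda>\<alpha>. (\<Prod>b\<in>Basis. (y \<bullet> b) ^ \<alpha> b) *\<^sub>R a \<alpha>) has_sum g (p + y)) {\<alpha>. \<forall>b. b \<notin> Basis \<longrightarrow> \<alpha> b = 0}"
    using a r d by (intro exI[of _ "min r d"] conjI exI[of _ a]) auto
qed

text \<open>Near each point the model is taken with the values of \<open>H\<close>,
  \<open>T\<close>, \<open>V\<close> at that point. The chart \<open>y\<close> is holomorphic in the
  given coordinates, so the expression of \<open>\<Omega>\<close> in these coordinates also extends
  to a holomorphic function of the point and its conjugate.\<close>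

lemma real_analytic_bochner_kaehler:
  assumes bk: "bochner_kaehler_on k U \<Omega> H T V" and k: "2 \<le> k"
  shows "real_analytic_form_on U (\<Omega> :: 'n::finite form2)"
  unfolding real_analytic_form_on_def
proof (intro allI real_analytic_on_local)
  fix v w :: "complex^'n" and p assume p: "p \<in> U"
  have kf: "kaehler_form_on k U \<Omega>" using bk by (simp add: bochner_kaehler_on_def)
  obtain A where "\<And>x. x \<in> U \<Longrightarrow> (x, A x) \<in> coframe_bundle U \<Omega>"
    using coframe_section[OF kf, of 0] by (metis enat_0 zero_le)
  then have p0: "(p, A p) \<in> coframe_bundle U \<Omega>" using p by blast
  define H0 where "H0 = H (p, A p)"
  define T0 where "T0 = T (p, A p)"
  define V0 where "V0 = V (p, A p)"
  have H0: "hermitian H0" using bk p0 unfolding bochner_kaehler_on_def Let_def H0_def by blast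
  obtain \<rho> \<delta> \<epsilon> where "bk_model H0 T0 V0 (Xm H0 T0 V0) \<rho> \<delta> \<epsilon>"
    by (rule bk_model_exists[OF H0])
  then interpret bk_model H0 T0 V0 "Xm H0 T0 V0" \<rho> \<delta> \<epsilon> .
  obtain W Y0 y g where W: "open W" "p \<in> W" "W \<subseteq> U" and "open Y0" "y p = 0" "homeomorphism W Y0 y g" and hy: "\<And>j. holo W (\<lambda>x. y x $ j)"
    and "\<And>j. holo Y0 (\<lambda>x. g x $ j)" and yb: "\<And>x. x \<in> W \<Longrightarrow> polar (y x) \<in> ball 0 \<delta>"
    and \<Omega>: "\<And>x v w. x \<in> W \<Longrightarrow> \<Omega> x v w = Im (hmod (y x) (mderiv y x v) (mderiv y x w))"
    by (rule model_chart[OF bk k p0 H0_def[symmetric] T0_def[symmetric] V0_def[symmetric]]) (rule that; assumption)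
  define l :: "complex^('n + 'n) \<Rightarrow> complex^'n" where "l q = (\<chi> j. q $ Inl j)" for q
  define r :: "complex^('n + 'n) \<Rightarrow> complex^'n" where "r q = (\<chi> j. q $ Inr j)" for q
  have lr [simp]: "l q $ j = q $ Inl j" "r q $ j = q $ Inr j" for q j by (simp_all add: l_def r_def)
  have cl: "continuous_on X l" and cr: "continuous_on X r" for X
    unfolding l_def r_def by (intro continuous_on_vec_lambda continuous_on_component continuous_on_id)+
  have lrp: "l (polar x) = x" "cnjv (r (polar x)) = x" for x by (simp_all add: vec_eq_iff)
  define S0 where "S0 = {q. l q \<in> W \<and> cnjv (r q) \<in> W}"
  have "S0 = l -` W \<inter> (\<lambda>q. cnjv (r q)) -` W" by (auto simp: S0_def)
  then have S0: "open S0"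
    by (auto intro!: open_vimage W cl cr bounded_linear.continuous_on[OF bounded_linear_cnjv])
  \<comment> \<open>The polarization of the chart: \<open>y\<close> in the first half of the
    variables and the reflected chart in the second, so that \<open>Y\<close> sends
    \<open>polar x\<close> to \<open>polar (y x)\<close>.\<close>
  define Y where "Y q = (\<chi> i. case i of Inl j \<Rightarrow> y (l q) $ j | Inr j \<Rightarrow> cnj (y (cnjv (r q)) $ j))" for q
  have hl: "holo S0 (\<lambda>q. f (l q))" and hr: "holo S0 (\<lambda>q. cnj (f (cnjv (r q))))" if "holo W f" for f
  proof -
    show "holo S0 (\<lambda>q. f (l q))"
      by (rule holo_compose[OF that]) (use S0 in \<open>auto simp: S0_def holo_nth\<close>)
    have "open (cnjv -` W)" by (intro open_vimage W bounded_linear.continuous_on[OF bounded_linear_cnjv] continuous_on_id)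
    then have "holo (cnjv -` W) (\<lambda>z. cnj (f (cnjv z)))" by (rule holo_cnj[OF that]) auto
    from holo_compose[OF this, of S0 r] show "holo S0 (\<lambda>q. cnj (f (cnjv (r q))))"
      using S0 by (auto simp: S0_def holo_nth)
  qed
  have hY: "holo S0 (\<lambda>q. Y q $ i)" for i
    by (cases i) (simp_all add: Y_def hl[OF hy] hr[OF hy])
  have Yp: "Y (polar x) = polar (y x)" for x
    by (simp add: Y_def polar_def lrp[unfolded polar_def] vec_eq_iff split: sum.splits)
  have "continuous_on S0 (\<lambda>q. \<chi> i. Y q $ i)"
    by (intro continuous_on_vec_lambda holo_continuous[OF hY])
  then have "continuous_on S0 Y" by simp
  then have S: "open (S0 \<inter> Y -` ball 0 \<delta>)" using continuous_open_preimage[OF _ S0 open_ball] by blast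
  let ?S = "S0 \<inter> Y -` ball 0 \<delta>"
  \<comment> \<open>The holomorphic extension of the metric coefficient. The derivative of
    \<open>y\<close> that enters conjugated is taken at the reflected second half of the
    variables.\<close>
  let ?F = "\<lambda>q. hp (Y q) (cnjv (mderiv y (cnjv (r q)) v)) (mderiv y (l q) w)"
  have "holo ?S ?F"
  proof (rule holo_hp[OF S])
    show "holo ?S (\<lambda>q. Y q $ i)" for i using holo_subset[OF hY S] by blast
    show "holo ?S (\<lambda>q. cnjv (mderiv y (cnjv (r q)) v) $ i)" for i
      using holo_subset[OF hr[OF holo_dird[OF hy]] S] by (simp add: mderiv_def)
    show "holo ?S (\<lambda>q. mderiv y (l q) w $ i)" for i
      using holo_subset[OF hl[OF holo_dird[OF hy]] S] by (simp add: mderiv_def)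
  qed auto
  then have "real_analytic_on W (\<lambda>x. hmod (y x) (mderiv y x v) (mderiv y x w))"
  proof (rule polar_real_analytic)
    show "polar x \<in> ?S" if "x \<in> W" for x
      using yb that by (simp add: S0_def Yp lrp)
    show "hmod (y x) (mderiv y x v) (mderiv y x w) = ?F (polar x)" for x
      by (simp add: hmod_def Yp lrp)
  qed (rule W)
  then have "real_analytic_on W (\<lambda>x. Im (hmod (y x) (mderiv y x v) (mderiv y x w)))"
    by (rule real_analytic_on_Im)
  then have "real_analytic_on W (\<lambda>x. \<Omega> x v w)"
    by (rule real_analytic_on_cong[OF _ W(1)]) (rule \<Omega>)
  then show "\<exists>N. p \<in> N \<and> real_analytic_on N (\<lambda>x. \<Omega> x v w)"
    by (intro exI[of _ W] conjI W(2))
qed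


section \<open>Existence\<close>

lemma star_dot_eqI:
  fixes A B :: "complex^'k::finite^'k"
  assumes "\<And>x y. star_dot x (A *v y) = star_dot x (B *v y)"
  shows "A = B"
proof -
  have "A *v y = B *v y" for y
  proof -
    have "star_dot (A *v y - B *v y) (A *v y - B *v y) = 0"
      by (simp add: star_dot_add assms)
    then show ?thesis by (simp add: star_dot_self)
  qed
  then show ?thesis by (simp add: matrix_eq)
qed

text \<open>Identities such as the unitarity of the frame hold only on the coframe bundle, not on
  the open set where the functions are differentiated. They may therefore be differentiated only
  along tangent vectors of the bundle, by restricting to curves.\<close>

lemma tangent_space_derivative_eq:
  assumes v: "v \<in> tangent_space P p"
    and F: "(F has_derivative F') (at p)" and G: "(G has_derivative G') (at p)"
    and eq: "\<And>q. q \<in> P \<Longrightarrow> F q = G q"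
  shows "F' v = G' v"
proof -
  obtain \<gamma> e where e: "e > 0" "\<gamma> 0 = p" "\<And>t. \<bar>t\<bar> < e \<Longrightarrow> \<gamma> t \<in> P" and \<gamma>: "(\<gamma> has_vector_derivative v) (at (0::real))"
    using v unfolding tangent_space_def by blast
  have *: "((\<lambda>t. K (\<gamma> t)) has_vector_derivative K' v) (at 0)" if "(K has_derivative K') (at p)" for K :: "'a \<Rightarrow> 'b" and K'
  proof -
    have "((\<lambda>t. K (\<gamma> t)) has_derivative (\<lambda>h. K' (h *\<^sub>R v))) (at 0)"
      by (rule has_derivative_compose[OF \<gamma>[unfolded has_vector_derivative_def]]) (simp add: e that)
    then show ?thesis
      by (simp add: has_vector_derivative_def linear_scale[OF has_derivative_linear[OF that]])
  qed
  have "((\<lambda>t. F (\<gamma> t)) has_vector_derivative G' v) (at 0)"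
    using *[OF G]
  proof (rule has_vector_derivative_transform_within_open)
    show "open {-e<..<e}" "0 \<in> {-e<..<e}" using e by auto
    show "G (\<gamma> t) = F (\<gamma> t)" if "t \<in> {-e<..<e}" for t using eq[OF e(3)] that by auto
  qed
  then show ?thesis using vector_derivative_unique_at[OF *[OF F]] by blast
qed

definition midm :: "complex^('n option option)^('n::finite option option) \<Rightarrow> complex^'n^'n" where
  "midm M = (\<chi> i j. M $ Some (Some i) $ Some (Some j))"

lemma midm_Blk [simp]: "midm (Blk a b c d M e f g i) = M"
  by (simp add: midm_def vec_eq_iff)

lemma midm_star_dot: "star_dot (Bvi v) (M *v Bvi w) = star_dot v (midm M *v w)"
  by (cases M rule: Blk_cases) (simp add: Bvi_def Bv_mult Bv_star_dot)

lemma bounded_linear_midm: "bounded_linear midm"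
  unfolding linear_conv_bounded_linear[symmetric]
  by (rule linearI) (simp_all add: midm_def vec_eq_iff)

text \<open>Converse of \<open>Xm_parallel\<close>. Of the derivative of \<open>X\<close> only the
  block shape is used: the zero in the lower left corner makes the two outer diagonal entries of
  \<open>\<Theta>\<close> equal, the zeros of the last row fix the block \<open>b\<close>, and the
  equality of the outer diagonal entries fixes the upper right corner. Skewness for
  \<open>Jm\<close> gives the rest. The twist \<open>\<mu>\<close> is read off in the lower left
  corner, where \<open>Tm\<close> has 0 and \<open>Xm\<close> has 1.\<close>

lemma Tm_exhaust:
  fixes \<Theta> :: "complex^('n::finite option option)^('n option option)"
  assumes H: "adj H = H" and sk: "adj \<Theta> ** Jm + Jm ** \<Theta> = 0"
    and X: "Xm H T V ** \<Theta> - \<Theta> ** Xm H T V = Blk (- t') b' c' 0 H' T' 0 0 (- t')"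
  defines "\<mu> \<equiv> \<Theta> $ Some None $ None"
  defines "\<tau> \<equiv> \<Theta> $ None $ None + \<mu> * trace H / 2"
  defines "\<phi> \<equiv> midm \<Theta> - mat \<mu> ** H - mat \<tau>"
  shows "\<Theta> = Tm \<tau> H T \<phi> (mid (\<Theta> *v Bv 1 0 0)) + mat \<mu> ** Xm H T V"
    and "adj \<phi> = - \<phi>" "cnj \<tau> = - \<tau>" "cnj \<mu> = - \<mu>"
proof -
  obtain a b c d M e f g i where \<Theta>: "\<Theta> = Blk a b c d M e f g i" using Blk_cases .
  have tH: "cnj (trace H) = trace H" using H by (simp add: cnj_trace)
  have sd: "star_dot (H *v x) y = star_dot x (H *v y)" for x y by (simp add: star_dot_adj H)
  have s: "cnj f = - f" "g = d" "cnj a = - i" "e = b" "adj M = - M" "cnj i = - a"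
  proof -
    note e = sk[unfolded \<Theta> Jm_def Blk_adj Blk_mult Blk_add Blk_zero]
    show "cnj f = - f" using Blk_eqD(1)[OF e] by (simp add: algebra_simps eq_neg_iff_add_eq_0)
    show "g = d" using Blk_eqD(2)[OF e] by (simp add: smult_simps)
    show "cnj a = - i" using Blk_eqD(3)[OF e] by (simp add: algebra_simps eq_neg_iff_add_eq_0)
    show "adj M = - M" using Blk_eqD(5)[OF e] by (simp add: eq_neg_iff_add_eq_0)
    show "e = b" using Blk_eqD(6)[OF e] by (simp add: smult_simps algebra_simps)
    show "cnj i = - a" using Blk_eqD(7)[OF e] by (simp add: algebra_simps eq_neg_iff_add_eq_0)
  qed
  have x: "a = i" "b = H *v d + (trace H / 2) *s d + f *s T" "c - f * ((trace H)\<^sup>2 / 4 - of_real V) = (star_dot d T - star_dot T d) / 2"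
  proof -
    note e = X[unfolded \<Theta> Xm_def Blk_mult Blk_diff]
    show "a = i" using Blk_eqD(7)[OF e] by simp
    show "b = H *v d + (trace H / 2) *s d + f *s T"
      using Blk_eqD(8)[OF e] by (simp add: s tH H smult_simps algebra_simps eq_neg_iff_add_eq_0)
    have "f * ((trace H)\<^sup>2 / 4 - of_real V) - c - star_dot T d = - t'"
      using Blk_eqD(1)[OF e] by (simp add: minus_mult algebra_simps)
    moreover have "c - (f * ((trace H)\<^sup>2 / 4 - of_real V) + star_dot d T) = - t'"
      using Blk_eqD(9)[OF e] by (simp add: s minus_mult algebra_simps)
    ultimately have "f * ((trace H)\<^sup>2 / 4 - of_real V) - c - star_dot T d = c - (f * ((trace H)\<^sup>2 / 4 - of_real V) + star_dot d T)"
      by simp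
    moreover have "c - x = (q - p) / 2" if "x - c - p = c - (x + q)" for x p q :: complex
    proof -
      have "(c - x) * 2 = q - p" using that by algebra
      then show ?thesis by (simp add: eq_divide_eq)
    qed
    ultimately show "c - f * ((trace H)\<^sup>2 / 4 - of_real V) = (star_dot d T - star_dot T d) / 2"
      by blast
  qed
  show "cnj \<mu> = - \<mu>" by (simp add: \<mu>_def \<Theta> s)
  show "cnj \<tau> = - \<tau>" using s x(1) by (simp add: \<tau>_def \<mu>_def \<Theta> tH)
  have \<phi>': "\<phi> = M - mat f ** H - mat \<tau>" by (simp add: \<phi>_def \<mu>_def \<Theta>)
  show "adj \<phi> = - \<phi>"
    unfolding \<phi>' adj_add adj_mult H adj_mat s \<open>cnj \<tau> = - \<tau>\<close>
    by (simp add: mat_mult_commute[of f] mat_add minus_mult)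
  have c: "c = (star_dot d T - star_dot T d) / 2 + f * ((trace H)\<^sup>2 / 4 - of_real V)"
    using x(3) by (simp only: diff_eq_eq)
  show "\<Theta> = Tm \<tau> H T \<phi> (mid (\<Theta> *v Bv 1 0 0)) + mat \<mu> ** Xm H T V"
    unfolding \<phi>' unfolding \<tau>_def \<mu>_def \<Theta> Bv_mult mid_Bv Tm_def Xm_def Blk_scale Blk_add Blk_eq_iff Blk_nth
    using x(1,2) c s by (simp add: algebra_simps smult_simps)
qed

lemma bounded_linear_mat_diff: "bounded_linear (\<lambda>Z :: complex^('n::finite option option)^('n option option). midm Z - mat (Z $ None $ None))"
  by (intro bounded_linear_sub bounded_linear_midm bounded_linear_compose[OF bounded_linear_mat]
      bounded_linear_compose[OF bounded_linear_vec_nth] bounded_linear_vec_nth)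

text \<open>Reads the structure equations off a known curvature. The middle of the first column is
  the torsion equation; in the middle block the derivative of \<open>\<phi>\<close> comes together
  with that of the scalar \<open>\<tau>\<close>, which is the upper left entry and is
  subtracted.\<close>

lemma structure_curvature:
  fixes H P Q :: "complex^'n::finite^'n" and a b T :: "complex^'n" and p q :: complex and V :: real
  assumes H: "adj H = H" and P: "adj P = - P" and Q: "adj Q = - Q" and p: "cnj p = - p" and q: "cnj q = - q"
  defines "D \<equiv> mat (star_dot a b - star_dot b a) ** Xm H T V - (Tm p H T P a ** Tm q H T Q b - Tm q H T Q b ** Tm p H T P a)"
  shows "mid (D *v Bv 1 0 0) = - (P *v b - Q *v a)"
    and "midm D - mat (D $ None $ None) = - (P ** Q - Q ** P) + H ** mat (star_dot a b - star_dot b a)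
      - H ** (dot_star a b - dot_star b a) - (dot_star a b - dot_star b a) ** H
      + mat (star_dot a (H *v b) - star_dot b (H *v a))
      + mat (trace H) ** (mat (star_dot a b - star_dot b a) - (dot_star a b - dot_star b a))"
proof -
  have c: "cnj (trace H) = trace H" using H by (simp add: cnj_trace)
  have sd: "star_dot (H *v x) y = star_dot x (H *v y)" for x y
    by (simp add: star_dot_adj H)
  show "mid (D *v Bv 1 0 0) = - (P *v b - Q *v a)"
    unfolding D_def Tm_def Xm_def Blk_mult Blk_scale Blk_diff Bv_mult mid_Bv
    by (simp add: matrix_add_distrib vec_eq_iff algebra_simps)
  show "midm D - mat (D $ None $ None) = - (P ** Q - Q ** P) + H ** mat (star_dot a b - star_dot b a)
      - H ** (dot_star a b - dot_star b a) - (dot_star a b - dot_star b a) ** H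
      + mat (star_dot a (H *v b) - star_dot b (H *v a))
      + mat (trace H) ** (mat (star_dot a b - star_dot b a) - (dot_star a b - dot_star b a))"
    unfolding D_def Tm_def Xm_def Blk_mult Blk_scale Blk_diff midm_Blk Blk_nth
    apply (simp_all only: c H P Q p q adj_add adj_mat adj_mult minus_mult matrix_add_distrib matrix_diff_distrib star_dot_add star_dot_smult sd
          dot_star_add dot_star_mult matrix_vector_mul_assoc[symmetric] smult_simps matrix_vector_smult star_dot_zero dot_star_zero mat_vec_mult)
    by (simp add: vec_eq_iff dot_star_nth mat_mult_nth mat_nth matrix_diff_distrib c field_simps power2_eq_square)
qed


lemma bounded_linear_Blk_mid: "bounded_linear (\<lambda>M. Blk 0 0 0 0 M 0 0 0 0)"
  by (intro bounded_linear_Blk bounded_linear_zero bounded_linear_ident)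

lemma derivative_constant_zero:
  assumes "(F has_derivative F') (at x)" "open U" "x \<in> U" "\<And>y. y \<in> U \<Longrightarrow> F y = c"
  shows "F' v = 0"
proof -
  have "((\<lambda>y. c) has_derivative F') (at x)"
    by (rule has_derivative_transform_within_open[OF assms(1-3)]) (rule assms(4))
  then show ?thesis using has_derivative_unique[OF _ has_derivative_const] by metis
qed

text \<open>The axioms of a section \<open>N\<close> of the null cone transversal to the flow of \<open>X0\<close>; the matrix \<open>Wm y\<close> lifts
  tangent vectors at \<open>y\<close> to the orthogonal complement of \<open>N y\<close> and \<open>X0 N y\<close>. The Kaehler form comes from
  the restriction \<open>h\<close> of \<open>Jm\<close> to these lifts, and \<open>N\<close>, the lifts of a unitary frame and \<open>M\<close> make up a
  frame \<open>G\<close> whose logarithmic derivative is the connection.\<close>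

locale bk_orbit =
  fixes H0 :: "complex^'n::finite^'n" and T0 V0 X0 and U :: "(complex^'n) set"
    and N :: "complex^'n \<Rightarrow> complex^('n option option)" and Wm :: "complex^'n \<Rightarrow> complex^('n option option)^('n option option)"
    and h hi :: "complex^'n \<Rightarrow> complex^'n^'n"
  assumes H0: "adj H0 = H0" and X0_def: "X0 = Xm H0 T0 V0" and U: "open U"
    and N2: "Cn_on 2 U N" and W2: "Cn_on 2 U Wm" and hk: "\<And>k. Cn_on k U h" and hi2: "Cn_on 2 U hi"
    and NN: "y \<in> U \<Longrightarrow> Jp (N y) (N y) = 0" and NX: "y \<in> U \<Longrightarrow> Jp (N y) (X0 *v N y) = - 1"
    and NW: "y \<in> U \<Longrightarrow> Jp (N y) (Wm y *v Bvi v) = 0" and XW: "y \<in> U \<Longrightarrow> Jp (X0 *v N y) (Wm y *v Bvi v) = 0"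
    and WW: "y \<in> U \<Longrightarrow> Jp (Wm y *v Bvi v) (Wm y *v Bvi w) = star_dot v (h y *v w)"
    and dN_orbit: "y \<in> U \<Longrightarrow> \<exists>a b. frechet_derivative N (at y) v = a *s N y + b *s (X0 *v N y) + Wm y *v Bvi v"
    and h_herm: "y \<in> U \<Longrightarrow> adj (h y) = h y" and h_pos: "y \<in> U \<Longrightarrow> v \<noteq> 0 \<Longrightarrow> Re (star_dot v (h y *v v)) > 0"
    and hi: "y \<in> U \<Longrightarrow> hi y ** h y = mat 1"
begin

definition \<Omega> where "\<Omega> y v w = Im (star_dot v (h y *v w))"

definition t where "t y = Jp (X0 *v N y) (X0 *v N y)"

text \<open>The null vector in the plane of \<open>N\<close> and \<open>X0 N\<close> with
  \<open>Jp N M = -1\<close>. It completes \<open>N\<close> to the null pair on which the first and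
  last basis vectors are mapped.\<close>

definition M where "M y = X0 *v N y + (t y / 2) *s N y"

lemma Jp_X0: "Jp (X0 *v P) Q = Jp P (X0 *v Q)"
  unfolding X0_def by (simp add: Jp_def star_dot_adj matrix_vector_mul_assoc Xm_herm[OF H0])

lemma trace_X0: "trace X0 = 0"
  unfolding X0_def by (simp add: Xm_def Blk_trace)

lemma cnj_t: "cnj (t y) = t y"
  by (simp add: t_def cnj_Jp)

lemma XN: "y \<in> U \<Longrightarrow> Jp (X0 *v N y) (N y) = - 1"
  using NX Jp_X0 by simp

lemma WN: "y \<in> U \<Longrightarrow> Jp (Wm y *v Bvi v) (N y) = 0" and WX: "y \<in> U \<Longrightarrow> Jp (Wm y *v Bvi v) (X0 *v N y) = 0"
  using NW XW by (metis cnj_Jp complex_cnj_zero)+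

lemma has_dN: "y \<in> U \<Longrightarrow> (N has_derivative frechet_derivative N (at y)) (at y)"
  using Cn_on_SucD[of 1 U N] N2 by (simp add: numeral_2_eq_2 del: Cn_on.simps)

text \<open>Differentiating \<open>Jp N N = 0\<close> shows that \<open>b\<close> is imaginary, and
  differentiating \<open>Jp N (X0 N) = -1\<close> then shows it for \<open>a\<close>.\<close>

lemma dN_cases:
  assumes y: "y \<in> U"
  obtains a b where "frechet_derivative N (at y) v = a *s N y + b *s (X0 *v N y) + Wm y *v Bvi v"
    "cnj a = - a" "cnj b = - b"
proof -
  obtain a b where ab: "frechet_derivative N (at y) v = a *s N y + b *s (X0 *v N y) + Wm y *v Bvi v"
    using dN_orbit[OF y] by blast
  note bl = bounded_linear.has_derivative[OF bounded_bilinear.bounded_linear_right[OF bounded_bilinear_matrix_vector, of X0]]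
  note Js = Jp_linear NN[OF y] NX[OF y] XN[OF y] NW[OF y] XW[OF y] WN[OF y] WX[OF y] t_def[symmetric]
  have "Jp (N y) (frechet_derivative N (at y) v) + Jp (frechet_derivative N (at y) v) (N y) = 0"
    by (rule derivative_constant_zero[OF bounded_bilinear.FDERIV[OF bounded_bilinear_Jp has_dN[OF y] has_dN[OF y]] U y NN])
  then have b: "cnj b = - b"
    unfolding ab Js by (simp add: eq_neg_iff_add_eq_0 add.commute)
  have "Jp (N y) (X0 *v frechet_derivative N (at y) v) + Jp (frechet_derivative N (at y) v) (X0 *v N y) = 0"
    by (rule derivative_constant_zero[OF bounded_bilinear.FDERIV[OF bounded_bilinear_Jp has_dN[OF y] bl[OF has_dN[OF y]]] U y NX])
  then have "cnj a = - a"
    unfolding Jp_X0[of "N y", symmetric] unfolding ab Js by (simp add: b eq_neg_iff_add_eq_0 add.commute)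
  with ab b show ?thesis using that by blast
qed

text \<open>The coefficients along \<open>N\<close> and \<open>X0 N\<close> are imaginary, so they
  contribute only real terms. Thus \<open>\<Omega>\<close> is the pullback under \<open>N\<close> of
  a constant 2-form on C^(n+2).\<close>

lemma \<Omega>_dN:
  assumes y: "y \<in> U"
  shows "\<Omega> y v w = Im (Jp (frechet_derivative N (at y) v) (frechet_derivative N (at y) w))"
proof -
  obtain a b where ab: "frechet_derivative N (at y) v = a *s N y + b *s (X0 *v N y) + Wm y *v Bvi v"
    "cnj a = - a" "cnj b = - b" using dN_cases[OF y] .
  obtain a' b' where ab': "frechet_derivative N (at y) w = a' *s N y + b' *s (X0 *v N y) + Wm y *v Bvi w"
    "cnj a' = - a'" "cnj b' = - b'" using dN_cases[OF y] .
  have re: "Re z = 0" if "cnj z = - z" for z using that by (simp add: complex_eq_iff)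
  have "Im (t y) = 0" using cnj_t[of y] by (simp add: complex_eq_iff)
  then show ?thesis
    unfolding ab(1) ab'(1) Jp_linear NN[OF y] NX[OF y] XN[OF y] NW[OF y] XW[OF y] WN[OF y] WX[OF y] WW[OF y] t_def[symmetric] \<Omega>_def
    by (simp add: re ab(2,3) ab'(2,3))
qed

text \<open>Closedness is that of a pullback of a constant form: the derivatives of
  \<open>\<Omega>\<close> contain only second derivatives of \<open>N\<close>, and by their symmetry
  the six terms of the cyclic sum cancel in pairs.\<close>

lemma kaehler: "kaehler_form_on \<infinity> U \<Omega>"
  unfolding kaehler_form_on_def
proof (intro conjI ballI allI impI)
  show "open U" by (rule U)
  show "Ck_on \<infinity> U (\<lambda>x. \<Omega> x v w)" for v w
    unfolding Ck_on_def \<Omega>_def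
    by (intro allI impI Cn_on_linear[OF U bounded_linear_Im] Cn_on_bilinear[OF U bounded_bilinear_star_dot]
        Cn_on_bilinear[OF U bounded_bilinear_matrix_vector] Cn_on_const[OF U] hk)
next
  fix x assume x: "x \<in> U"
  show "bilinear (\<Omega> x)"
    unfolding bilinear_def
    by (intro conjI allI linearI)
       (simp_all add: \<Omega>_def star_dot_add matrix_add_distrib matrix_scaleR_assoc
          bounded_bilinear.scaleR_left[OF bounded_bilinear_star_dot] bounded_bilinear.scaleR_right[OF bounded_bilinear_star_dot])
  show "\<Omega> x v v = 0" for v
  proof -
    have "cnj (star_dot v (h x *v v)) = star_dot v (h x *v v)"
      by (simp add: cnj_star_dot star_dot_adj h_herm[OF x])
    then show ?thesis by (simp add: \<Omega>_def complex_eq_iff)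
  qed
  show "\<Omega> x (\<i> *s v) (\<i> *s w) = \<Omega> x v w" for v w
    by (simp add: \<Omega>_def star_dot_smult matrix_vector_smult)
  show "\<Omega> x v (\<i> *s v) > 0" if "v \<noteq> 0" for v
    using h_pos[OF x that] by (simp add: \<Omega>_def star_dot_smult matrix_vector_smult)
  define B where "B v u = frechet_derivative (\<lambda>y. frechet_derivative N (at y) v) (at x) u" for u v
  have sym: "B v u = B u v" for u v
    unfolding B_def by (rule Cn_2_symmetric[OF U N2 x])
  have dd: "((\<lambda>y. frechet_derivative N (at y) v) has_derivative B v) (at x)" for v
    unfolding B_def[abs_def] using Cn_on_SucD[OF _ x, of 0 "\<lambda>y. frechet_derivative N (at y) v"] Cn_on_SucD'[of 1 U N] N2
    by (simp add: numeral_2_eq_2 del: Cn_on.simps)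
  have d: "frechet_derivative (\<lambda>y. \<Omega> y v w) (at x) u = Im (Jp (frechet_derivative N (at x) v) (B w u) + Jp (B v u) (frechet_derivative N (at x) w))" for u v w
  proof -
    have "((\<lambda>y. Im (Jp (frechet_derivative N (at y) v) (frechet_derivative N (at y) w))) has_derivative
        (\<lambda>u. Im (Jp (frechet_derivative N (at x) v) (B w u) + Jp (B v u) (frechet_derivative N (at x) w)))) (at x)"
      by (rule bounded_linear.has_derivative[OF bounded_linear_Im bounded_bilinear.FDERIV[OF bounded_bilinear_Jp dd dd]])
    then have "((\<lambda>y. \<Omega> y v w) has_derivative
        (\<lambda>u. Im (Jp (frechet_derivative N (at x) v) (B w u) + Jp (B v u) (frechet_derivative N (at x) w)))) (at x)"
      by (rule has_derivative_transform_within_open[OF _ U x]) (simp add: \<Omega>_dN)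
    then show ?thesis by (rule frechet_derivative_apply)
  qed
  have im: "Im (Jp P Q) = - Im (Jp Q P)" for P Q
    using arg_cong[OF cnj_Jp[of P Q], of Im] by simp
  show "frechet_derivative (\<lambda>y. \<Omega> y v w) (at x) u + frechet_derivative (\<lambda>y. \<Omega> y w u) (at x) v
        + frechet_derivative (\<lambda>y. \<Omega> y u v) (at x) w = 0" for u v w
    unfolding d using im[of "B v u"] im[of "B w u"] im[of "B w v"] sym[of v u] sym[of w u] sym[of w v] by simp
qed

lemma coframe_iff: "(y, A) \<in> coframe_bundle U \<Omega> \<longleftrightarrow> y \<in> U \<and> adj A ** A = h y"
proof -
  have "herm_matrix \<Omega> y = h y" if y: "y \<in> U"
  proof (rule star_dot_eqI)
    fix v w
    show "star_dot v (herm_matrix \<Omega> y *v w) = star_dot v (h y *v w)"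
      unfolding herm_form_matrix[OF kaehler y, symmetric] herm_form_def \<Omega>_def
      by (simp add: star_dot_smult matrix_vector_smult complex_eq_iff)
  qed
  then show ?thesis using coframe_bundle_iff[OF kaehler] by auto
qed

lemma hi_herm: "y \<in> U \<Longrightarrow> adj (hi y) = hi y" and h_hi: "y \<in> U \<Longrightarrow> h y ** hi y = mat 1"
proof -
  assume y: "y \<in> U"
  show *: "h y ** hi y = mat 1" using hi[OF y] by (simp add: matrix_left_right_inverse)
  have "h y ** adj (hi y) = mat 1" using arg_cong[OF hi[OF y], of adj] by (simp add: adj_mult h_herm[OF y])
  then have "hi y ** (h y ** adj (hi y)) = hi y" by simp
  then show "adj (hi y) = hi y" by (simp add: matrix_mul_assoc hi[OF y])
qed

text \<open>The columns are \<open>N\<close>, the lifts of the frame dual to the coframe, and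
  \<open>M\<close>. On the bundle \<open>hi adj A\<close> is the inverse of \<open>A\<close>;
  written in this way it is defined and smooth for every matrix \<open>A\<close>, so
  \<open>G\<close> extends to an open set and can be differentiated there.\<close>

definition G :: "(complex^'n) \<times> (complex^'n^'n) \<Rightarrow> complex^('n option option)^('n option option)" where
  "G p = dot_star (N (fst p)) (Bv 1 0 0) + Wm (fst p) ** Blk 0 0 0 0 (hi (fst p) ** adj (snd p)) 0 0 0 0
    + dot_star (M (fst p)) (Bv 0 0 1)"

lemma G_apply: "G (y, A) *v Bv a z b = a *s N y + Wm y *v Bvi (hi y *v (adj A *v z)) + b *s M y"
  by (simp add: G_def matrix_add_distrib dot_star_mult Bv_star_dot Bv_mult Bvi_def matrix_vector_mul_assoc[symmetric])

definition S :: "((complex^'n) \<times> (complex^'n^'n)) set" where "S = U \<times> UNIV"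

lemma S: "open S"
  unfolding S_def by (intro open_Times U open_UNIV)

lemma coframe_S: "coframe_bundle U \<Omega> \<subseteq> S"
  by (auto simp: S_def coframe_bundle_def)

lemma G2: "Cn_on 2 S G"
proof -
  have f: "Cn_on 2 S (\<lambda>p. f (fst p))" if "Cn_on 2 U f" for f :: "complex^'n \<Rightarrow> 'z::real_normed_vector"
    by (rule Cn_on_compose_linear[OF U S bounded_linear_fst _ that]) (auto simp: S_def)
  have X: "Cn_on 2 U (\<lambda>y. X0 *v N y)"
    by (rule Cn_on_linear[OF U bounded_bilinear.bounded_linear_right[OF bounded_bilinear_matrix_vector] N2])
  have "Cn_on 2 U (\<lambda>y. t y / 2)"
    unfolding t_def by (rule Cn_on_linear[OF U bounded_linear_divide Cn_on_bilinear[OF U bounded_bilinear_Jp X X]])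
  then have M: "Cn_on 2 U M"
    unfolding M_def[abs_def] by (intro Cn_on_add[OF U X] Cn_on_bilinear[OF U bounded_bilinear_smult _ N2])
  have s: "Cn_on 2 S (\<lambda>p. adj (snd p))"
    by (rule Cn_on_linear[OF S bounded_linear_compose[OF bounded_linear_adj bounded_linear_snd, unfolded o_def] Cn_on_id[OF S]])
  show ?thesis
    unfolding G_def[abs_def]
    by (intro Cn_on_add[OF S] Cn_on_bilinear[OF S bounded_bilinear_dot_star] Cn_on_bilinear[OF S bounded_bilinear_matrix_mult]
        Cn_on_linear[OF S bounded_linear_Blk_mid] Cn_on_const[OF S] f N2 W2 M hi2 s)
qed

lemma
  assumes p: "p \<in> coframe_bundle U \<Omega>"
  shows G_unitary: "adj (G p) ** Jm ** G p = Jm"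
    and G_left_inverse: "Jm ** adj (G p) ** Jm ** G p = mat 1"
    and G_right_inverse: "G p ** (Jm ** adj (G p) ** Jm) = mat 1"
proof -
  obtain y A where pe: "p = (y, A)" by fastforce
  then have y: "y \<in> U" and A: "adj A ** A = h y" using p coframe_iff by auto
  have "(hi y ** adj A) ** A = mat 1" by (simp add: matrix_mul_assoc[symmetric] A hi[OF y])
  then have A2: "A ** (hi y ** adj A) = mat 1" by (simp add: matrix_left_right_inverse)
  have MM: "Jp (M y) (M y) = 0" "Jp (N y) (M y) = - 1" "Jp (M y) (N y) = - 1" "Jp (M y) (Wm y *v Bvi v) = 0"
    "Jp (Wm y *v Bvi v) (M y) = 0" for v
    unfolding M_def Jp_linear NN[OF y] NX[OF y] XN[OF y] NW[OF y] XW[OF y] WN[OF y] WX[OF y]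
    by (simp_all add: cnj_t t_def[symmetric])
  show 1: "adj (G p) ** Jm ** G p = Jm"
  proof (rule star_dot_eqI)
    fix P Q :: "complex^('n option option)"
    obtain a z b where P: "P = Bv a z b" using Bv_cases .
    obtain a' z' b' where Q: "Q = Bv a' z' b'" using Bv_cases .
    have W: "Jp (Wm y *v Bvi (hi y *v (adj A *v z))) (Wm y *v Bvi (hi y *v (adj A *v z'))) = star_dot z z'"
    proof -
      have "star_dot (hi y *v (adj A *v z)) (h y *v (hi y *v (adj A *v z'))) = star_dot z ((A ** (hi y ** (h y ** hi y) ** adj A)) *v z')"
        by (simp only: star_dot_adj hi_herm[OF y] adj_adj) (simp only: matrix_vector_mul_assoc matrix_mul_assoc)
      then show ?thesis unfolding WW[OF y] by (simp add: h_hi[OF y] A2)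
    qed
    have "star_dot P ((adj (G p) ** Jm ** G p) *v Q) = Jp (G p *v P) (G p *v Q)"
      by (simp add: Jp_def star_dot_adj matrix_vector_mul_assoc matrix_mul_assoc)
    also have "\<dots> = Jp P Q"
      unfolding pe P Q G_apply Jp_linear MM W NN[OF y] NW[OF y] WN[OF y] Jp_Bv by simp
    finally show "star_dot P ((adj (G p) ** Jm ** G p) *v Q) = star_dot P (Jm *v Q)" by (simp add: Jp_def)
  qed
  have "Jm ** adj (G p) ** Jm ** G p = Jm ** (adj (G p) ** Jm ** G p)" by (simp only: matrix_mul_assoc)
  then show 2: "Jm ** adj (G p) ** Jm ** G p = mat 1" by (simp add: 1 Jm_Jm)
  then show "G p ** (Jm ** adj (G p) ** Jm) = mat 1" by (simp add: matrix_left_right_inverse)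
qed

definition X where "X p = Jm ** adj (G p) ** Jm ** X0 ** G p"

lemma X_e1:
  assumes p: "p \<in> coframe_bundle U \<Omega>"
  shows "X p *v Bv 1 0 0 = Bv (- (t (fst p) / 2)) 0 1"
proof -
  obtain y A where pe: "p = (y, A)" by fastforce
  have "X0 *v (G p *v Bv 1 0 0) = G p *v Bv (- (t y / 2)) 0 1"
    unfolding pe G_apply M_def by (simp add: Bvi_def smult_simps flip: Bv_zero)
  then have "X p *v Bv 1 0 0 = (Jm ** adj (G p) ** Jm ** G p) *v Bv (- (t y / 2)) 0 1"
    unfolding X_def matrix_vector_mul_assoc[symmetric] by simp
  then show ?thesis using G_left_inverse[OF p] pe by simp
qed

definition H where "H p = midm (X p)"
definition T where "T p = mid (X p *v Bv 0 0 1)"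
definition V where "V p = Re ((trace (H p))\<^sup>2 / 4 - X p $ None $ Some None)"

text \<open>Selfadjointness for \<open>Jm\<close> pairs the blocks, the first column of
  \<open>X\<close> is known because \<open>X0 N\<close> is \<open>M\<close> minus a multiple of
  \<open>N\<close>, and the trace condition relates \<open>H\<close> to \<open>t\<close>. Together
  these leave exactly the shape \<open>Xm\<close>.\<close>

lemma X_eq:
  assumes p: "p \<in> coframe_bundle U \<Omega>"
  shows "X p = Xm (H p) (T p) (V p)" and "adj (H p) = H p"
proof -
  obtain a b c d K e f g i where X: "X p = Blk a b c d K e f g i" using Blk_cases .
  have "adj (Jm ** X p) = Jm ** X p"
  proof -
    have JX: "Jm ** X p = adj (G p) ** (Jm ** X0) ** G p"
      unfolding X_def by (simp add: matrix_mul_assoc Jm_Jm)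
    have "adj (Jm ** X0) = Jm ** X0"
      using Xm_herm[OF H0, of T0 V0] by (simp add: adj_mult adj_Jm X0_def)
    then show ?thesis unfolding JX adj_mult adj_adj by (simp only: matrix_mul_assoc adj_mult)
  qed
  moreover have "Jm ** X p = Blk (- f) (- g) (- i) d K e (- a) (- b) (- c)"
    by (simp add: X Jm_def Blk_mult smult_simps)
  ultimately have e: "adj (Blk (- f) (- g) (- i) d K e (- a) (- b) (- c)) = Blk (- f) (- g) (- i) d K e (- a) (- b) (- c)"
    by simp
  note e = e[unfolded Blk_adj]
  have gd: "g = - d" using Blk_eqD(2)[OF e] by simp
  have ia: "i = cnj a" using Blk_eqD(3)[OF e] by simp
  have K: "adj K = K" using Blk_eqD(5)[OF e] .
  have eb: "e = - b" using Blk_eqD(8)[OF e] .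
  have c: "cnj c = c" using Blk_eqD(9)[OF e] by simp
  have col: "a = - (t (fst p) / 2)" "d = 0" "f = 1"
    using X_e1[OF p] unfolding X Bv_mult Bv_eq_iff by simp_all
  \<comment> \<open>On the bundle \<open>X\<close> is conjugate to the trace-free \<open>X0\<close>,
    which gives the trace of \<open>H\<close> the value \<open>t\<close>.\<close>
  have "trace (X p) = trace ((Jm ** adj (G p) ** Jm) ** (X0 ** G p))" unfolding X_def by (simp only: matrix_mul_assoc)
  also have "\<dots> = trace (X0 ** (G p ** (Jm ** adj (G p) ** Jm)))" by (subst trace_mul_sym) (simp only: matrix_mul_assoc)
  also have "\<dots> = 0" by (simp add: G_right_inverse[OF p] trace_X0)
  finally have tr: "trace K = t (fst p)" using ia col(1) cnj_t by (simp add: X Blk_trace)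
  have HT: "H p = K" "T p = e" by (simp_all add: H_def T_def X Bv_mult)
  have "of_real (V p) = (trace K)\<^sup>2 / 4 - c"
    unfolding V_def HT using c cnj_t[of "fst p"] by (simp add: complex_eq_iff X tr)
  then show "X p = Xm (H p) (T p) (V p)"
    unfolding X HT Xm_def Blk_eq_iff using col ia gd eb tr cnj_t by simp
  show "adj (H p) = H p" by (simp add: HT K)
qed

end


section \<open>The structure equations from the logarithmic derivative of the frame\<close>

lemma commutator_shift:
  fixes P Q X :: "complex^'k::finite^'k"
  shows "(P + mat m ** X) ** (Q + mat n ** X) - (Q + mat n ** X) ** (P + mat m ** X) =
    (P ** Q - Q ** P) - mat n ** (X ** P - P ** X) + mat m ** (X ** Q - Q ** X)"
proof -
  have 1: "A ** (mat c ** B) = mat c ** (A ** B)" for A B :: "complex^'k^'k" and c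
    by (simp only: matrix_mul_assoc mat_mult_commute[of c A])
  have 2: "mat m ** (mat n ** (X ** X)) = mat n ** (mat m ** (X ** X))"
    by (rule 1)
  show ?thesis
    by (simp add: matrix_add_distrib matrix_diff_distrib matrix_mul_assoc[symmetric] 1[of P] 1[of Q] 1[of X] 2)
qed

lemma commutator_frame:
  fixes X Z :: "complex^'k::finite^'k"
  shows "X ** (Z + mat m ** X) - (Z + mat m ** X) ** X = X ** Z - Z ** X"
proof -
  have "X ** (mat m ** X) = mat m ** X ** X"
    by (simp only: matrix_mul_assoc) (simp only: mat_mult_commute[of m X])
  then show ?thesis by (simp add: matrix_add_distrib)
qed

lemma ext_deriv_cong:
  assumes \<alpha>: "C1_form S \<alpha>" and x: "x \<in> S" and eq: "\<And>y v. y \<in> S \<Longrightarrow> \<beta> y v = \<alpha> y v"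
  shows "ext_deriv \<beta> x v w = ext_deriv \<alpha> x v w"
proof -
  interpret C1_form S \<alpha> by fact
  have "frechet_derivative (\<lambda>y. \<beta> y w) (at x) v = D x w v" for v w
    by (rule frechet_derivative_apply[OF has_derivative_transform_within_open[OF has_D[OF x] S x]]) (simp add: eq)
  then show ?thesis by (simp add: ext_deriv_def ext_D[unfolded ext_deriv_def])
qed

lemma Ck_on_1: "Cn_on 1 S f \<Longrightarrow> Ck_on 1 S f"
  unfolding Ck_on_def using Cn_on_le[of 1 S f] by (simp add: one_enat_def del: Cn_on.simps)

lemma bounded_linear_matrix_vector_left: "bounded_linear (\<lambda>Z :: complex^'k::finite^'m::finite. Z *v x)"
  by (rule bounded_bilinear.bounded_linear_left[OF bounded_bilinear_matrix_vector])

context bk_orbit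
begin

definition dG where "dG p = frechet_derivative G (at p)"

text \<open>The inverse of \<open>G\<close> on the bundle. Off the bundle it is merely a real-linear
  expression in \<open>G\<close>, differentiable without any invertibility.\<close>

definition Gi where "Gi p = Jm ** adj (G p) ** Jm"

definition \<Theta> where "\<Theta> p v = Gi p ** dG p v"

lemma dG: "p \<in> S \<Longrightarrow> (G has_derivative dG p) (at p)"
  unfolding dG_def using Cn_on_SucD[of 1 S G] G2 by (simp add: numeral_2_eq_2 del: Cn_on.simps)

lemma dG_form: "C1_form S dG" and ext_dG: "p \<in> S \<Longrightarrow> ext_deriv dG p v w = 0"
proof -
  show "C1_form S dG"
    unfolding C1_form_def
    using S has_derivative_linear[OF dG] Cn_on_SucD'[of 1 S G] G2 by (simp add: dG_def numeral_2_eq_2 del: Cn_on.simps)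
  show "ext_deriv dG p v w = 0" if "p \<in> S"
    unfolding ext_deriv_def dG_def using Cn_2_symmetric[OF S G2 that] by simp
qed

lemma bounded_linear_Gi: "bounded_linear (\<lambda>Z :: complex^('n option option)^('n option option). Jm ** adj Z ** Jm)"
  by (intro bounded_linear_compose[OF bounded_bilinear.bounded_linear_left[OF bounded_bilinear_matrix_mult]]
      bounded_linear_compose[OF bounded_bilinear.bounded_linear_right[OF bounded_bilinear_matrix_mult]] bounded_linear_adj)

lemma Gi1: "Cn_on 1 S Gi"
  unfolding Gi_def[abs_def] by (rule Cn_on_linear[OF S bounded_linear_Gi Cn_on_le[OF G2]]) simp

lemma dGi: "p \<in> S \<Longrightarrow> frechet_derivative Gi (at p) v = Jm ** adj (dG p v) ** Jm"
  unfolding Gi_def[abs_def]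
  by (rule frechet_derivative_apply[OF bounded_linear.has_derivative[OF bounded_linear_Gi dG]])

lemma \<Theta>_form: "C1_form S \<Theta>"
  and ext_\<Theta>_ambient: "p \<in> S \<Longrightarrow> ext_deriv \<Theta> p v w = Jm ** adj (dG p v) ** Jm ** dG p w - Jm ** adj (dG p w) ** Jm ** dG p v"
proof -
  show "C1_form S \<Theta>" unfolding \<Theta>_def[abs_def] by (rule C1_form_mult(1)[OF dG_form Gi1])
  show "ext_deriv \<Theta> p v w = Jm ** adj (dG p v) ** Jm ** dG p w - Jm ** adj (dG p w) ** Jm ** dG p v" if p: "p \<in> S"
    unfolding \<Theta>_def[abs_def] C1_form_mult(2)[OF dG_form Gi1 p] by (simp add: dGi[OF p] ext_dG[OF p])
qed

definition dX where "dX p = frechet_derivative X (at p)"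

lemma X1: "Cn_on 1 S X"
proof -
  have "Cn_on 1 S (\<lambda>p. Gi p ** X0 ** G p)"
    by (intro Cn_on_bilinear[OF S bounded_bilinear_matrix_mult] Cn_on_const[OF S] Gi1 Cn_on_le[OF G2]) simp
  then show ?thesis by (simp add: X_def[abs_def] Gi_def)
qed

lemma dX: "p \<in> S \<Longrightarrow> (X has_derivative dX p) (at p)"
  unfolding dX_def using Cn_on_SucD[of 0 S X] X1 by simp

definition dH where "dH p v = midm (dX p v)"
definition dT where "dT p v = mid (dX p v *v Bv 0 0 1)"
definition dV where "dV p v = Re (trace (H p) * trace (dH p v) / 2 - dX p v $ None $ Some None)"

lemma
  assumes p: "p \<in> S"
  shows has_dH: "(H has_derivative dH p) (at p)" and has_dT: "(T has_derivative dT p) (at p)"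
    and has_dV: "(V has_derivative dV p) (at p)"
proof -
  show H: "(H has_derivative dH p) (at p)"
    unfolding H_def[abs_def] dH_def[abs_def] by (rule bounded_linear.has_derivative[OF bounded_linear_midm dX[OF p]])
  show "(T has_derivative dT p) (at p)"
    unfolding T_def[abs_def] dT_def[abs_def]
    by (rule bounded_linear.has_derivative[OF bounded_linear_compose[OF bounded_linear_mid bounded_linear_matrix_vector_left] dX[OF p]])
  have tr: "((\<lambda>p. trace (H p)) has_derivative (\<lambda>v. trace (dH p v))) (at p)"
    by (rule bounded_linear.has_derivative[OF bounded_linear_trace H])
  have "((\<lambda>p. trace (H p) * trace (H p) / 4 - X p $ None $ Some None) has_derivative
      (\<lambda>v. (trace (H p) * trace (dH p v) + trace (dH p v) * trace (H p)) / 4 - dX p v $ None $ Some None)) (at p)"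
    by (intro has_derivative_diff bounded_linear.has_derivative[OF bounded_linear_divide] has_derivative_mult[OF tr tr]
        bounded_linear.has_derivative[OF bounded_linear_vec_nth] dX[OF p])
  from bounded_linear.has_derivative[OF bounded_linear_Re this]
  show "(V has_derivative dV p) (at p)"
    unfolding V_def[abs_def] dV_def[abs_def] by (simp add: power2_eq_square mult.commute[of "trace (dH p _)"] field_simps)
qed

context
  fixes p assumes p: "p \<in> coframe_bundle U \<Omega>"
begin

lemma pS: "p \<in> S"
  using p coframe_S by blast

lemma Gi_G: "Gi p ** G p = mat 1" "G p ** Gi p = mat 1"
  using G_left_inverse[OF p] G_right_inverse[OF p] by (simp_all add: Gi_def)

lemma dG_eq: "dG p v = G p ** \<Theta> p v"
  by (simp add: \<Theta>_def matrix_mul_assoc Gi_G)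

lemma \<Theta>_skew:
  assumes v: "v \<in> tangent_space (coframe_bundle U \<Omega>) p"
  shows "adj (\<Theta> p v) ** Jm + Jm ** \<Theta> p v = 0"
proof -
  have a: "((\<lambda>p. adj (G p) ** Jm) has_derivative (\<lambda>v. adj (dG p v) ** Jm)) (at p)"
    by (rule bounded_linear.has_derivative[OF bounded_linear_compose[OF bounded_bilinear.bounded_linear_left[OF bounded_bilinear_matrix_mult] bounded_linear_adj] dG[OF pS]])
  have "adj (G p) ** Jm ** dG p v + adj (dG p v) ** Jm ** G p = 0"
    using tangent_space_derivative_eq[OF v bounded_bilinear.FDERIV[OF bounded_bilinear_matrix_mult a dG[OF pS]] has_derivative_const G_unitary] .
  moreover have "Jm ** \<Theta> p v = adj (G p) ** Jm ** dG p v"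
    unfolding \<Theta>_def Gi_def by (simp add: matrix_mul_assoc Jm_Jm)
  moreover have "adj (\<Theta> p v) ** Jm = adj (dG p v) ** Jm ** G p ** (Jm ** Jm)"
    unfolding \<Theta>_def Gi_def by (simp only: adj_mult adj_adj adj_Jm matrix_mul_assoc)
  ultimately show ?thesis by (simp add: Jm_Jm add.commute)
qed

lemma dX_eq:
  assumes v: "v \<in> tangent_space (coframe_bundle U \<Omega>) p"
  shows "dX p v = X p ** \<Theta> p v - \<Theta> p v ** X p"
proof -
  have GX: "G q ** X q = X0 ** G q" if "q \<in> coframe_bundle U \<Omega>" for q
  proof -
    have "G q ** X q = (G q ** (Jm ** adj (G q) ** Jm)) ** X0 ** G q" unfolding X_def by (simp only: matrix_mul_assoc)
    then show ?thesis by (simp add: G_right_inverse[OF that])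
  qed
  have "G p ** dX p v + dG p v ** X p = X0 ** dG p v"
    using tangent_space_derivative_eq[OF v bounded_bilinear.FDERIV[OF bounded_bilinear_matrix_mult dG[OF pS] dX[OF pS]]
      bounded_linear.has_derivative[OF bounded_bilinear.bounded_linear_right[OF bounded_bilinear_matrix_mult] dG[OF pS]] GX] .
  then have "Gi p ** (G p ** dX p v + dG p v ** X p) = Gi p ** (X0 ** dG p v)" by simp
  then have "dX p v + \<Theta> p v ** X p = (Gi p ** X0 ** G p) ** \<Theta> p v"
    unfolding dG_eq matrix_add_distrib by (simp add: matrix_mul_assoc Gi_G)
  moreover have "Gi p ** X0 ** G p = X p" by (simp add: Gi_def X_def)
  ultimately show ?thesis by (simp add: eq_diff_eq)
qed

text \<open>On the bundle \<open>X\<close> has the shape \<open>Xm\<close>, so its derivative along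
  the bundle has the differentiated shape. This is the hypothesis under which
  \<open>Tm_exhaust\<close> recognises \<open>\<Theta>\<close>.\<close>

lemma dX_Blk:
  assumes v: "v \<in> tangent_space (coframe_bundle U \<Omega>) p"
  shows "dX p v = Blk (- (trace (dH p v) / 2)) (- dT p v) (trace (H p) * trace (dH p v) / 2 - of_real (dV p v))
    0 (dH p v) (dT p v) 0 0 (- (trace (dH p v) / 2))"
proof -
  note d = has_dH[OF pS] has_dT[OF pS] has_dV[OF pS]
  have tr: "((\<lambda>p. trace (H p)) has_derivative (\<lambda>v. trace (dH p v))) (at p)"
    by (rule bounded_linear.has_derivative[OF bounded_linear_trace d(1)])
  have "((\<lambda>q. Xm (H q) (T q) (V q)) has_derivative (\<lambda>v. Blk (- (trace (dH p v) / 2)) (- dT p v)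
      ((trace (H p) * trace (dH p v) + trace (dH p v) * trace (H p)) / 4 - of_real (dV p v)) 0 (dH p v) (dT p v) 0 0 (- (trace (dH p v) / 2)))) (at p)"
    unfolding Xm_def power2_eq_square
    by (intro has_derivative_Blk has_derivative_minus has_derivative_diff has_derivative_const d
        bounded_linear.has_derivative[OF bounded_linear_divide] has_derivative_mult[OF tr tr] tr
        bounded_linear.has_derivative[OF bounded_linear_of_real])
  from tangent_space_derivative_eq[OF v dX[OF pS] this X_eq(1)]
  show ?thesis by (simp add: mult.commute)
qed

end

text \<open>The coefficient of the twist: in this corner the untwisted connection has 0 and
  \<open>X\<close> has 1.\<close>

definition \<mu> where "\<mu> p v = \<Theta> p v $ Some None $ None"

definition \<Theta>0 where "\<Theta>0 p v = \<Theta> p v - mat (\<mu> p v) ** X p"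

text \<open>The middle block of the untwisted connection is \<open>\<phi>\<close> plus its scalar
  part, which also stands in the upper left corner.\<close>

definition \<phi> where "\<phi> p v = midm (\<Theta>0 p v) - mat (\<Theta>0 p v $ None $ None)"

text \<open>The first column of \<open>G\<close> is \<open>N\<close> at the base point, so the
  middle of the first column of \<open>\<Theta>\<close> pairs the derivative of \<open>N\<close>
  with the lifts of the dual frame. Only the lift of the base vector survives this pairing, and its
  components in the frame are \<open>A v\<close>. The identity holds on all of \<open>S\<close>, so
  it may be differentiated there.\<close>

lemma taut_form_eq:
  assumes p: "p \<in> S"
  shows "taut_form p v = mid (\<Theta> p v *v Bv 1 0 0)"
proof -
  obtain y A where pe: "p = (y, A)" by fastforce
  have y: "y \<in> U" using p by (simp add: S_def pe)
  have "G q *v Bv 1 0 0 = N (fst q)" for q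
    using G_apply[of "fst q" "snd q" 1 0 0] by (simp add: Bvi_def flip: Bv_zero)
  then have "((\<lambda>q. N (fst q)) has_derivative (\<lambda>v. dG p v *v Bv 1 0 0)) (at p)"
    using bounded_linear.has_derivative[OF bounded_linear_matrix_vector_left dG[OF p], of "Bv 1 0 0"] by simp
  moreover have "((\<lambda>q. N (fst q)) has_derivative (\<lambda>v. frechet_derivative N (at y) (fst v))) (at p)"
    by (rule has_derivative_compose[OF bounded_linear.has_derivative[OF bounded_linear_fst has_derivative_ident]])
       (simp add: pe has_dN[OF y])
  ultimately have dGe: "dG p v *v Bv 1 0 0 = frechet_derivative N (at y) (fst v)"
    using has_derivative_unique by metis
  obtain a b where ab: "frechet_derivative N (at y) (fst v) = a *s N y + b *s (X0 *v N y) + Wm y *v Bvi (fst v)"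
    using dN_orbit[OF y] by blast
  have "star_dot z (mid (\<Theta> p v *v Bv 1 0 0)) = star_dot z (A *v fst v)" for z
  proof -
    have "star_dot z (mid u) = star_dot (Bvi z) u" for u
      by (cases u rule: Bv_cases) (simp add: Bvi_def Bv_star_dot)
    moreover have "star_dot (Bvi z) (Jm *v u) = star_dot (Bvi z) u" for u
      by (cases u rule: Bv_cases) (simp add: Bvi_def Jm_Bv Bv_star_dot)
    ultimately have "star_dot z (mid (\<Theta> p v *v Bv 1 0 0)) = star_dot (Bvi z) (adj (G p) *v (Jm *v (dG p v *v Bv 1 0 0)))"
      by (simp add: \<Theta>_def Gi_def matrix_vector_mul_assoc[symmetric])
    also have "\<dots> = Jp (G p *v Bvi z) (dG p v *v Bv 1 0 0)"
      by (simp add: Jp_def star_dot_adj)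
    also have "\<dots> = Jp (Wm y *v Bvi (hi y *v (adj A *v z))) (dG p v *v Bv 1 0 0)"
      unfolding pe Bvi_def[of z] G_apply by (simp add: Bvi_def)
    also have "\<dots> = star_dot (hi y *v (adj A *v z)) (h y *v fst v)"
      unfolding dGe ab Jp_linear WN[OF y] WX[OF y] WW[OF y] by simp
    also have "\<dots> = star_dot z (A *v (hi y *v (h y *v fst v)))"
      by (simp only: star_dot_adj hi_herm[OF y] adj_adj)
    finally show ?thesis by (simp add: matrix_vector_mul_assoc[of "hi y"] hi[OF y])
  qed
  then have "star_dot z (mid (\<Theta> p v *v Bv 1 0 0) - A *v fst v) = 0" for z
    by (simp add: star_dot_add)
  from this[of "mid (\<Theta> p v *v Bv 1 0 0) - A *v fst v"] show ?thesis
    by (simp add: star_dot_self taut_form_def pe)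
qed

lemma tangent_frame:
  assumes p: "p \<in> coframe_bundle U \<Omega>" and v: "v \<in> tangent_space (coframe_bundle U \<Omega>) p"
  obtains \<tau> where "\<Theta> p v = Tm \<tau> (H p) (T p) (\<phi> p v) (taut_form p v) + mat (\<mu> p v) ** X p"
    "cnj \<tau> = - \<tau>" "adj (\<phi> p v) = - \<phi> p v"
proof -
  have "Xm (H p) (T p) (V p) ** \<Theta> p v - \<Theta> p v ** Xm (H p) (T p) (V p) =
    Blk (- (trace (dH p v) / 2)) (- dT p v) (trace (H p) * trace (dH p v) / 2 - of_real (dV p v))
    0 (dH p v) (dT p v) 0 0 (- (trace (dH p v) / 2))"
    using dX_eq[OF p v] dX_Blk[OF p v] X_eq(1)[OF p] by simp
  note * = Tm_exhaust[OF X_eq(2)[OF p] \<Theta>_skew[OF p v] this]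
  have ph: "midm (\<Theta> p v) - mat (\<mu> p v) ** H p - mat (\<Theta> p v $ None $ None + \<mu> p v * trace (H p) / 2) = \<phi> p v"
  proof -
    have "midm (\<Theta>0 p v) = midm (\<Theta> p v) - mat (\<mu> p v) ** H p"
      unfolding \<Theta>0_def by (simp add: midm_def H_def vec_eq_iff mat_mult_nth)
    moreover have "X p $ None $ None = - (trace (H p) / 2)" by (subst X_eq(1)[OF p]) (simp add: Xm_def)
    ultimately show ?thesis by (simp add: \<phi>_def \<Theta>0_def mat_mult_nth)
  qed
  show ?thesis
    using that *[folded \<mu>_def, unfolded ph taut_form_eq[OF pS[OF p], symmetric] X_eq(1)[OF p, symmetric]] by blast
qed

text \<open>The derivative of \<open>X\<close> is its commutator with \<open>\<Theta>\<close>, to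
  which the twist contributes nothing. \<open>Xm_parallel\<close> computes the same commutator from
  the structure equations, and equal block matrices have equal blocks.\<close>

lemma differentials:
  assumes p: "p \<in> coframe_bundle U \<Omega>" and v: "v \<in> tangent_space (coframe_bundle U \<Omega>) p"
  shows "dH p v = - (\<phi> p v ** H p) + H p ** \<phi> p v + dot_star (T p) (taut_form p v) + dot_star (taut_form p v) (T p)"
    and "dT p v = - (\<phi> p v *v T p)
      + (H p ** H p + mat (trace (H p)) ** H p + mat (of_real (V p))) *v taut_form p v"
    and "complex_of_real (dV p v) = trace (H p) * (star_dot (T p) (taut_form p v) + star_dot (taut_form p v) (T p))
      + (star_dot (T p) (H p *v taut_form p v) + star_dot (taut_form p v) (H p *v T p))"
proof -
  obtain \<tau> where \<tau>: "\<Theta> p v = Tm \<tau> (H p) (T p) (\<phi> p v) (taut_form p v) + mat (\<mu> p v) ** X p"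
    "cnj \<tau> = - \<tau>" "adj (\<phi> p v) = - \<phi> p v" using tangent_frame[OF p v] .
  have "dX p v = X p ** Tm \<tau> (H p) (T p) (\<phi> p v) (taut_form p v) - Tm \<tau> (H p) (T p) (\<phi> p v) (taut_form p v) ** X p"
    unfolding dX_eq[OF p v] \<tau>(1) commutator_frame ..
  note e = this[unfolded dX_Blk[OF p v] X_eq(1)[OF p] Xm_parallel[OF X_eq(2)[OF p] refl refl refl \<tau>(3,2), symmetric]]
  show 1: "dH p v = - (\<phi> p v ** H p) + H p ** \<phi> p v + dot_star (T p) (taut_form p v) + dot_star (taut_form p v) (T p)"
    by (rule Blk_eqD(5)[OF e])
  show "dT p v = - (\<phi> p v *v T p)
      + (H p ** H p + mat (trace (H p)) ** H p + mat (of_real (V p))) *v taut_form p v"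
    by (rule Blk_eqD(6)[OF e])
  show "complex_of_real (dV p v) = trace (H p) * (star_dot (T p) (taut_form p v) + star_dot (taut_form p v) (T p))
      + (star_dot (T p) (H p *v taut_form p v) + star_dot (taut_form p v) (H p *v T p))"
    using Blk_eqD(3)[OF e] unfolding 1 by algebra
qed

lemma bounded_bilinear_mat_smult: "bounded_bilinear (\<lambda>(Z :: complex^('n option option)^('n option option)) c. mat c ** Z)"
  by (rule bounded_bilinear.flip[OF bounded_bilinear.comp[OF bounded_bilinear_matrix_mult bounded_linear_mat bounded_linear_ident]])

lemma \<mu>_form: "C1_form S \<mu>" and ext_\<mu>: "p \<in> S \<Longrightarrow> ext_deriv \<mu> p v w = ext_deriv \<Theta> p v w $ Some None $ None"
proof -
  have L: "bounded_linear (\<lambda>Z :: complex^('n option option)^('n option option). Z $ Some None $ None)"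
    by (intro bounded_linear_compose[OF bounded_linear_vec_nth] bounded_linear_vec_nth)
  show "C1_form S \<mu>" "p \<in> S \<Longrightarrow> ext_deriv \<mu> p v w = ext_deriv \<Theta> p v w $ Some None $ None"
    using C1_form_linear[OF L \<Theta>_form] unfolding \<mu>_def[abs_def] by blast+
qed

lemma \<Theta>0_form: "C1_form S \<Theta>0"
  and ext_\<Theta>0: "p \<in> S \<Longrightarrow> ext_deriv \<Theta>0 p v w = ext_deriv \<Theta> p v w
    - (mat (\<mu> p w) ** dX p v - mat (\<mu> p v) ** dX p w + mat (ext_deriv \<mu> p v w) ** X p)"
proof -
  note m = C1_form_bilinear[OF bounded_bilinear_mat_smult \<mu>_form X1]
  show "C1_form S \<Theta>0" unfolding \<Theta>0_def[abs_def] by (rule C1_form_diff(1)[OF \<Theta>_form m(1)])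
  show "ext_deriv \<Theta>0 p v w = ext_deriv \<Theta> p v w
    - (mat (\<mu> p w) ** dX p v - mat (\<mu> p v) ** dX p w + mat (ext_deriv \<mu> p v w) ** X p)" if p: "p \<in> S"
    unfolding \<Theta>0_def[abs_def] C1_form_diff(2)[OF \<Theta>_form m(1) p] m(2)[OF p] by (simp add: dX_def)
qed

lemma \<phi>_form: "C1_form S \<phi>"
  and ext_\<phi>: "p \<in> S \<Longrightarrow> ext_deriv \<phi> p v w = midm (ext_deriv \<Theta>0 p v w) - mat (ext_deriv \<Theta>0 p v w $ None $ None)"
  using C1_form_linear[OF bounded_linear_mat_diff \<Theta>0_form] unfolding \<phi>_def[abs_def] by blast+

lemma taut_form_form: "C1_form S taut_form"
  and ext_taut_form: "p \<in> S \<Longrightarrow> ext_deriv taut_form p v w = mid (ext_deriv \<Theta> p v w *v Bv 1 0 0)"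
proof -
  note m = C1_form_linear[OF bounded_linear_compose[OF bounded_linear_mid bounded_linear_matrix_vector_left[of "Bv 1 0 0"]] \<Theta>_form]
  show "ext_deriv taut_form p v w = mid (ext_deriv \<Theta> p v w *v Bv 1 0 0)" if p: "p \<in> S"
    using ext_deriv_cong[OF m(1) p taut_form_eq] m(2)[OF p] by simp
  show "C1_form S taut_form"
    unfolding C1_form_def
  proof (intro conjI allI impI)
    show "linear (taut_form q)" if "q \<in> S" for q :: "'n coframe"
      by (rule linearI) (simp_all add: taut_form_def matrix_add_distrib matrix_scaleR_assoc)
    show "Cn_on 1 S (\<lambda>q. taut_form q v)" for v
      by (rule Cn_on_cong[OF C1_form.C1[OF m(1)] taut_form_eq S])
  qed (rule S)
qed

text \<open>The Maurer-Cartan equation says that \<open>\<Theta>\<close> is flat. Removing the twist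
  leaves a connection whose curvature is \<open>X\<close> times the scalar \<open>c\<close>, the
  value of \<open>\<omega>\<^sup>* \<and> \<omega>\<close>; torsion and curvature are two of its
  blocks.\<close>

lemma curvature:
  assumes p: "p \<in> coframe_bundle U \<Omega>" and v: "v \<in> tangent_space (coframe_bundle U \<Omega>) p"
    and w: "w \<in> tangent_space (coframe_bundle U \<Omega>) p"
  shows "ext_deriv taut_form p v w = - (\<phi> p v *v taut_form p w - \<phi> p w *v taut_form p v)"
    and "ext_deriv \<phi> p v w = - (\<phi> p v ** \<phi> p w - \<phi> p w ** \<phi> p v)
      + H p ** mat (star_dot (taut_form p v) (taut_form p w) - star_dot (taut_form p w) (taut_form p v))
      - H p ** (dot_star (taut_form p v) (taut_form p w) - dot_star (taut_form p w) (taut_form p v))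
      - (dot_star (taut_form p v) (taut_form p w) - dot_star (taut_form p w) (taut_form p v)) ** H p
      + mat (star_dot (taut_form p v) (H p *v taut_form p w) - star_dot (taut_form p w) (H p *v taut_form p v))
      + mat (trace (H p)) ** (mat (star_dot (taut_form p v) (taut_form p w) - star_dot (taut_form p w) (taut_form p v))
         - (dot_star (taut_form p v) (taut_form p w) - dot_star (taut_form p w) (taut_form p v)))"
proof -
  note pS = pS[OF p]
  let ?a = "taut_form p v" and ?b = "taut_form p w"
  obtain \<tau> where \<tau>: "\<Theta> p v = Tm \<tau> (H p) (T p) (\<phi> p v) ?a + mat (\<mu> p v) ** X p"
    "cnj \<tau> = - \<tau>" "adj (\<phi> p v) = - \<phi> p v" using tangent_frame[OF p v] .
  obtain \<sigma> where \<sigma>: "\<Theta> p w = Tm \<sigma> (H p) (T p) (\<phi> p w) ?b + mat (\<mu> p w) ** X p"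
    "cnj \<sigma> = - \<sigma>" "adj (\<phi> p w) = - \<phi> p w" using tangent_frame[OF p w] .
  define P where "P = Tm \<tau> (H p) (T p) (\<phi> p v) ?a"
  define Q where "Q = Tm \<sigma> (H p) (T p) (\<phi> p w) ?b"
  define c where "c = star_dot ?a ?b - star_dot ?b ?a"
  define D where "D = mat c ** X p - (P ** Q - Q ** P)"
  \<comment> \<open>The product of the derivatives of \<open>Gi\<close> and \<open>G\<close> that
    makes up the exterior derivative of \<open>\<Theta>\<close>. Unitarity and skewness turn it into
    minus the product of \<open>\<Theta>\<close> with itself.\<close>
  have gi: "Jm ** adj (dG p v) ** Jm ** dG p w = - (\<Theta> p v ** \<Theta> p w)"
    if "v \<in> tangent_space (coframe_bundle U \<Omega>) p" for v w
  proof -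
    have "Jm ** adj (dG p v) ** Jm ** dG p w = Jm ** (adj (\<Theta> p v) ** (adj (G p) ** Jm ** G p)) ** \<Theta> p w"
      unfolding dG_eq[OF p] adj_mult by (simp only: matrix_mul_assoc)
    also have "\<dots> = Jm ** (adj (\<Theta> p v) ** Jm) ** \<Theta> p w" by (simp only: G_unitary[OF p])
    also have "adj (\<Theta> p v) ** Jm = - (Jm ** \<Theta> p v)"
      using \<Theta>_skew[OF p that] by (simp add: eq_neg_iff_add_eq_0)
    finally show ?thesis by (simp add: minus_mult matrix_mul_assoc Jm_Jm)
  qed
  have dXP: "dX p v = X p ** P - P ** X p" "dX p w = X p ** Q - Q ** X p"
    unfolding dX_eq[OF p v] dX_eq[OF p w] \<tau>(1) \<sigma>(1) commutator_frame P_def Q_def by simp_all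
  have ext\<Theta>: "ext_deriv \<Theta> p v w = mat (\<mu> p w) ** dX p v - mat (\<mu> p v) ** dX p w - (P ** Q - Q ** P)"
    unfolding ext_\<Theta>_ambient[OF pS] gi[OF v] gi[OF w]
    using commutator_shift[of P "\<mu> p v" "X p" Q "\<mu> p w"] unfolding \<tau>(1)[folded P_def] \<sigma>(1)[folded Q_def] dXP
    by (simp add: algebra_simps)
  \<comment> \<open>The lower left corner is the only place where the twist is visible. There the
    last row of one factor meets the first column of the other, so the exterior derivative of
    \<open>\<mu>\<close> is the scalar \<open>-c\<close>.\<close>
  have "(P ** Q - Q ** P) $ Some None $ None = c"
    unfolding P_def Q_def Tm_def Blk_mult Blk_diff by (simp add: c_def)
  moreover have "dX p v $ Some None $ None = 0" "dX p w $ Some None $ None = 0"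
    unfolding dX_Blk[OF p v] dX_Blk[OF p w] by simp_all
  ultimately have "ext_deriv \<mu> p v w = - c"
    unfolding ext_\<mu>[OF pS] ext\<Theta> by (simp add: mat_mult_nth)
  then have D: "ext_deriv \<Theta>0 p v w = D"
    unfolding ext_\<Theta>0[OF pS] ext\<Theta> D_def by (simp add: mat_add minus_mult)
  note curv = structure_curvature[OF X_eq(2)[OF p] \<tau>(3) \<sigma>(3) \<tau>(2) \<sigma>(2), where a = ?a and b = ?b and V = "V p" and T = "T p",
      folded P_def Q_def X_eq(1)[OF p] c_def, folded D_def]
  have "mid (X p *v Bv 1 0 0) = 0" by (subst X_eq(1)[OF p]) (simp add: Xm_def Bv_mult)
  moreover have "mid (dX p v *v Bv 1 0 0) = 0" "mid (dX p w *v Bv 1 0 0) = 0"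
    unfolding dX_Blk[OF p v] dX_Blk[OF p w] by (simp_all add: Bv_mult)
  moreover have "ext_deriv \<Theta> p v w = D - mat c ** X p + mat (\<mu> p w) ** dX p v - mat (\<mu> p v) ** dX p w"
    unfolding ext\<Theta> D_def by simp
  ultimately have "mid (ext_deriv \<Theta> p v w *v Bv 1 0 0) = mid (D *v Bv 1 0 0)"
    by (simp add: matrix_add_distrib matrix_diff_distrib mid_simps matrix_vector_mul_assoc[symmetric])
  then show "ext_deriv taut_form p v w = - (\<phi> p v *v ?b - \<phi> p w *v ?a)"
    unfolding ext_taut_form[OF pS] curv(1) by simp
  show "ext_deriv \<phi> p v w = - (\<phi> p v ** \<phi> p w - \<phi> p w ** \<phi> p v)
      + H p ** mat (star_dot ?a ?b - star_dot ?b ?a)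
      - H p ** (dot_star ?a ?b - dot_star ?b ?a)
      - (dot_star ?a ?b - dot_star ?b ?a) ** H p
      + mat (star_dot ?a (H p *v ?b) - star_dot ?b (H p *v ?a))
      + mat (trace (H p)) ** (mat (star_dot ?a ?b - star_dot ?b ?a) - (dot_star ?a ?b - dot_star ?b ?a))"
    unfolding ext_\<phi>[OF pS] D curv(2) c_def ..
qed

text \<open>The forms are defined on the open set \<open>S\<close> and serve as their own ambient
  extensions.\<close>

lemma has_ext_derivative_onI:
  assumes \<alpha>: "C1_form S \<alpha>"
    and ext: "\<And>p v w. p \<in> coframe_bundle U \<Omega> \<Longrightarrow> v \<in> tangent_space (coframe_bundle U \<Omega>) p \<Longrightarrow>
      w \<in> tangent_space (coframe_bundle U \<Omega>) p \<Longrightarrow> ext_deriv \<alpha> p v w = \<beta> p v w"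
  shows "has_ext_derivative_on (coframe_bundle U \<Omega>) \<alpha> \<beta>"
  unfolding has_ext_derivative_on_def
proof
  fix p assume p: "p \<in> coframe_bundle U \<Omega>"
  show "\<exists>W A. open W \<and> p \<in> W \<and> (\<forall>q\<in>W. linear (A q)) \<and> (\<forall>v. Ck_on 1 W (\<lambda>q. A q v)) \<and>
        (\<forall>q\<in>coframe_bundle U \<Omega> \<inter> W. \<forall>v\<in>tangent_space (coframe_bundle U \<Omega>) q. A q v = \<alpha> q v) \<and>
        (\<forall>v\<in>tangent_space (coframe_bundle U \<Omega>) p. \<forall>w\<in>tangent_space (coframe_bundle U \<Omega>) p.
           \<beta> p v w = frechet_derivative (\<lambda>q. A q w) (at p) v - frechet_derivative (\<lambda>q. A q v) (at p) w)"
  proof (intro exI[of _ S] exI[of _ \<alpha>] conjI ballI allI)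
    show "linear (\<alpha> q)" if "q \<in> S" for q using \<alpha> that unfolding C1_form_def by blast
    show "Ck_on 1 S (\<lambda>q. \<alpha> q v)" for v using \<alpha> Ck_on_1 unfolding C1_form_def by blast
  qed (use S pS[OF p] ext[OF p] in \<open>simp_all add: ext_deriv_def\<close>)
qed

theorem bochner_kaehler: "bochner_kaehler_on \<infinity> U \<Omega> H T V"
  unfolding bochner_kaehler_on_def Let_def
proof (intro conjI ballI exI[of _ \<phi>])
  show "kaehler_form_on \<infinity> U \<Omega>" by (rule kaehler)
  show "hermitian (H p)" if "p \<in> coframe_bundle U \<Omega>" for p
    unfolding hermitian_def by (rule X_eq(2)[OF that])
  show "connection_form U \<Omega> \<phi>"
    unfolding connection_form_def Let_def
  proof (intro conjI ballI)
    show "linear (\<phi> p)" if "p \<in> coframe_bundle U \<Omega>" for p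
      using \<phi>_form pS[OF that] unfolding C1_form_def by blast
    show "skew_hermitian (\<phi> p v)" if "p \<in> coframe_bundle U \<Omega>" "v \<in> tangent_space (coframe_bundle U \<Omega>) p" for p v
      unfolding skew_hermitian_def by (rule tangent_frame[OF that])
    show "has_ext_derivative_on (coframe_bundle U \<Omega>) taut_form (\<lambda>p v w. - wedge (*v) (\<phi> p) (taut_form p) v w)"
      by (rule has_ext_derivative_onI[OF taut_form_form]) (simp add: wedge_def curvature(1))
  qed
  show "has_ext_derivative_on (coframe_bundle U \<Omega>) \<phi> (\<lambda>p v w.
           - wedge (**) (\<phi> p) (\<phi> p) v w
           + H p ** mat (wedge star_dot (taut_form p) (taut_form p) v w)
           - H p ** wedge dot_star (taut_form p) (taut_form p) v w
           - wedge dot_star (taut_form p) (taut_form p) v w ** H p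
           + mat (wedge star_dot (taut_form p) (\<lambda>u. H p *v taut_form p u) v w)
           + mat (trace (H p)) **
               (mat (wedge star_dot (taut_form p) (taut_form p) v w) - wedge dot_star (taut_form p) (taut_form p) v w))"
    by (rule has_ext_derivative_onI[OF \<phi>_form]) (simp only: wedge_def curvature(2))
  note within = has_derivative_at_withinI
  show "has_differential_on (coframe_bundle U \<Omega>) H (\<lambda>p v.
           - (\<phi> p v ** H p) + H p ** \<phi> p v + dot_star (T p) (taut_form p v) + dot_star (taut_form p v) (T p))"
    unfolding has_differential_on_def using within[OF has_dH] pS differentials(1) by blast
  show "has_differential_on (coframe_bundle U \<Omega>) T (\<lambda>p v.
           - (\<phi> p v *v T p)
           + (H p ** H p + mat (trace (H p)) ** H p + mat (of_real (V p))) *v taut_form p v)"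
    unfolding has_differential_on_def using within[OF has_dT] pS differentials(2) by blast
  show "has_differential_on (coframe_bundle U \<Omega>) (\<lambda>p. complex_of_real (V p)) (\<lambda>p v.
           trace (H p) * (star_dot (T p) (taut_form p v) + star_dot (taut_form p v) (T p))
           + (star_dot (T p) (H p *v taut_form p v) + star_dot (taut_form p v) (H p *v T p)))"
    unfolding has_differential_on_def
    using within[OF bounded_linear.has_derivative[OF bounded_linear_of_real has_dV]] pS differentials(3) by blast
qed

end


section \<open>The normalised section of the null cone over the slice, and the structure it
  defines\<close>

lemma polar_0: "polar 0 = 0"
  by (simp add: vec_eq_iff polar_def split: sum.splits)

context bk_model
begin

definition U0 :: "(complex^'n) set" where "U0 = {y. polar y \<in> ball 0 \<delta>}"

text \<open>The positive scaling that normalises \<open>Jp N (X0 N)\<close> to -1.\<close>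

definition kappa where "kappa y = inverse (sqrt (- Re (flow_pairing X0 (\<rho> (polar y)) (polar y))))"

definition Pm where "Pm y = mat (of_real (kappa y)) ** E (\<rho> (polar y))"

definition N where "N y = Pm y *v Bv 1 y 0"

text \<open>The projection along \<open>N\<close> and \<open>X0 N\<close> onto their orthogonal complement.\<close>

definition Km where "Km y = mat 1 + dot_star (X0 *v N y) (Jm *v N y)
    + mat (Jp (X0 *v N y) (X0 *v N y)) ** dot_star (N y) (Jm *v N y) + dot_star (N y) (Jm *v (X0 *v N y))"

text \<open>The lift \<open>Pm\<close> made orthogonal to \<open>N\<close> and \<open>X0 N\<close>.
  The correction is a combination of these two vectors and so does not change the class of a tangent
  vector modulo the orbit.\<close>

definition Wm where "Wm y = Km y ** Pm y"

definition h where "h y = midm (adj (Wm y) ** Jm ** Wm y)"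

lemma U0: "open U0" "0 \<in> U0"
proof -
  have "U0 = polar -` ball 0 \<delta>" by (auto simp: U0_def)
  then show "open U0"
    by (simp add: open_vimage bounded_linear.continuous_on[OF bounded_linear_polar continuous_on_id])
  show "0 \<in> U0"
    using \<delta> by (simp add: U0_def polar_0)
qed

context
  fixes y assumes y: "y \<in> U0"
begin

lemma cnj_\<rho>: "cnj (\<rho> (polar y)) = \<rho> (polar y)"
  using \<rho>_real[of y] y unfolding U0_def by (metis complex_cnj_complex_of_real mem_Collect_eq)

lemma flow_pairing_real: "flow_pairing X0 (\<rho> (polar y)) (polar y) = of_real (Re (flow_pairing X0 (\<rho> (polar y)) (polar y)))"
proof -
  have "cnj (flow_pairing X0 (\<rho> (polar y)) (polar y)) = flow_pairing X0 (\<rho> (polar y)) (polar y)"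
    by (simp add: flow_pairing_Jp cnj_Jp Jp_E Jp_X0 E_X0 cnj_\<rho>)
  then show ?thesis by (simp add: complex_eq_iff)
qed

lemma flow_pairing_neg: "- Re (flow_pairing X0 (\<rho> (polar y)) (polar y)) > 0"
  using \<rho>[of "polar y"] y by (simp add: U0_def)

lemma kappa_pos: "kappa y > 0"
  using flow_pairing_neg by (simp add: kappa_def)

text \<open>The time \<open>\<rho>\<close> is real here, so the two flows combine to the time
  \<open>2 \<rho>\<close>, and the square of \<open>kappa\<close> is -1 divided by
  \<open>flow_pairing\<close>.\<close>

lemma Jp_Pm: "Jp (Pm y *v P) (Pm y *v Q) = - Jp P (E (2 * \<rho> (polar y)) *v Q) / flow_pairing X0 (\<rho> (polar y)) (polar y)"
proof -
  define f where "f = Re (flow_pairing X0 (\<rho> (polar y)) (polar y))"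
  have f: "flow_pairing X0 (\<rho> (polar y)) (polar y) = of_real f" "f < 0"
    using flow_pairing_real flow_pairing_neg by (simp_all add: f_def)
  have "(sqrt (- f))\<^sup>2 = - f" using f(2) by simp
  then have "kappa y * kappa y = - 1 / f"
    using f(2) unfolding kappa_def f_def[symmetric] by (simp add: power2_eq_square field_simps)
  then have k: "of_real (kappa y) * of_real (kappa y) = - 1 / (of_real f :: complex)"
    by (metis of_real_mult of_real_divide of_real_minus of_real_1)
  have "Jp (Pm y *v P) (Pm y *v Q) = (of_real (kappa y) * of_real (kappa y)) * Jp P (E (\<rho> (polar y)) *v (E (\<rho> (polar y)) *v Q))"
    by (simp add: Pm_def matrix_vector_mul_assoc[symmetric] Jp_linear Jp_E cnj_\<rho>)
  also have "E (\<rho> (polar y)) *v (E (\<rho> (polar y)) *v Q) = E (2 * \<rho> (polar y)) *v Q"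
    by (simp only: matrix_vector_mul_assoc mexp_add[symmetric] mult_2)
  finally show ?thesis unfolding k f(1) by simp
qed

lemma X0_Pm: "X0 *v (Pm y *v P) = Pm y *v (X0 *v P)"
  by (simp add: Pm_def matrix_vector_mul_assoc[symmetric] E_X0 matrix_vector_smult)

lemma NN: "Jp (N y) (N y) = 0"
proof -
  have "Jp (Bv 1 y 0) (E (2 * \<rho> (polar y)) *v Bv 1 y 0) = 0"
    using \<rho>[of "polar y"] y by (simp add: U0_def Phi_polar Jp_def)
  then show ?thesis by (simp add: N_def Jp_Pm)
qed

lemma NX: "Jp (N y) (X0 *v N y) = - 1"
  using flow_pairing_nz[of "polar y"] y unfolding N_def X0_Pm Jp_Pm flow_pairing_Jp[symmetric] by (simp add: U0_def)

lemma XN: "Jp (X0 *v N y) (N y) = - 1"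
  using NX Jp_X0 by simp

lemma Wm_apply: "Wm y *v P = Pm y *v P + Jp (N y) (Pm y *v P) *s (X0 *v N y)
    + (Jp (X0 *v N y) (X0 *v N y) * Jp (N y) (Pm y *v P) + Jp (X0 *v N y) (Pm y *v P)) *s N y"
proof -
  have "dot_star P (Jm *v Q) *v R = Jp Q R *s P" for P Q R :: "complex^('n option option)"
    by (simp add: dot_star_mult Jp_def star_dot_adj adj_Jm)
  then show ?thesis
    by (simp add: Wm_def Km_def matrix_vector_mul_assoc[symmetric] matrix_add_distrib smult_simps vector_smult_assoc add_ac)
qed

lemma NW: "Jp (N y) (Wm y *v P) = 0" and XW: "Jp (X0 *v N y) (Wm y *v P) = 0"
  unfolding Wm_apply Jp_linear NN NX XN by simp_all

lemma WW: "Jp (Wm y *v Bvi v) (Wm y *v Bvi w) = star_dot v (h y *v w)"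
  unfolding h_def midm_star_dot[symmetric]
  by (simp add: Jp_def star_dot_adj matrix_vector_mul_assoc matrix_mul_assoc)

lemma h_herm: "adj (h y) = h y"
proof (rule star_dot_eqI)
  fix v w
  show "star_dot v (adj (h y) *v w) = star_dot v (h y *v w)"
    using cnj_Jp[of "Wm y *v Bvi w" "Wm y *v Bvi v"] unfolding WW by (simp add: cnj_star_dot star_dot_adj)
qed

end

lemma Cn_on_kappa: "Cn_on k U0 kappa"
proof -
  have "holo (ball 0 \<delta>) (\<lambda>q. flow_pairing X0 (\<rho> q) q)"
    unfolding flow_pairing_def
    by (intro holo_pr holo_matrix_vector holo_mexp holo_mult holo_const holo_\<rho> holo_Zz holo_Zw open_ball)
  from polar_Cn_on[OF this U0(1)]
  have "Cn_on k U0 (\<lambda>y. - Re (flow_pairing X0 (\<rho> (polar y)) (polar y)))"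
    by (intro Cn_on_minus[OF U0(1)] Cn_on_linear[OF U0(1) bounded_linear_Re]) (simp add: U0_def)
  then show ?thesis
    unfolding kappa_def[abs_def] by (rule Cn_on_inverse_sqrt[OF U0(1) _ flow_pairing_neg])
qed

lemma Cn_on_Pm: "Cn_on k U0 Pm"
proof -
  have p: "polar x \<in> ball 0 \<delta>" if "x \<in> U0" for x using that by (simp add: U0_def)
  have "Cn_on k U0 (\<lambda>y. E (\<rho> (polar y)) $ i $ j)" for i j
    by (rule polar_Cn_on[OF holo_mexp[OF holo_\<rho>] U0(1) p])
  then have "Cn_on k U0 (\<lambda>y. \<chi> i j. E (\<rho> (polar y)) $ i $ j)"
    by (intro Cn_on_vec_lambda[OF U0(1)])
  then have E: "Cn_on k U0 (\<lambda>y. E (\<rho> (polar y)))" by simp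
  show ?thesis
    unfolding Pm_def[abs_def]
    by (intro Cn_on_bilinear[OF U0(1) bounded_bilinear_matrix_mult _ E]
        Cn_on_linear[OF U0(1) bounded_linear_compose[OF bounded_linear_mat bounded_linear_of_real]] Cn_on_kappa)
qed

lemma has_derivative_Z: "((\<lambda>y. Bv 1 y 0) has_derivative Bvi) (at y)"
proof -
  have "((\<lambda>y. Bv 1 0 0 + Bvi y) has_derivative (\<lambda>v. 0 + Bvi v)) (at y)"
    by (intro has_derivative_add has_derivative_const bounded_linear.has_derivative[OF bounded_linear_Bvi] has_derivative_ident)
  then show ?thesis by (simp add: Bvi_def[abs_def] Bv_add)
qed

lemma Cn_on_N: "Cn_on k U0 N"
proof -
  have "Cn_on k U0 (\<lambda>y. Bv 1 0 0 + Bvi y)"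
    by (intro Cn_on_add Cn_on_const Cn_on_linear[OF _ bounded_linear_Bvi] Cn_on_id U0)
  then have "Cn_on k U0 (\<lambda>y. Bv 1 y 0)" by (simp add: Bvi_def Bv_add)
  then show ?thesis
    unfolding N_def[abs_def] by (rule Cn_on_bilinear[OF U0(1) bounded_bilinear_matrix_vector Cn_on_Pm])
qed

lemma Cn_on_Wm: "Cn_on k U0 Wm"
proof -
  note mv = Cn_on_linear[OF U0(1) bounded_bilinear.bounded_linear_right[OF bounded_bilinear_matrix_vector]]
  have X: "Cn_on k U0 (\<lambda>y. X0 *v N y)" by (rule mv[OF Cn_on_N])
  show ?thesis
    unfolding Wm_def[abs_def] Km_def
    by (intro Cn_on_add[OF U0(1)] Cn_on_const[OF U0(1)] Cn_on_bilinear[OF U0(1) bounded_bilinear_matrix_mult]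
        Cn_on_bilinear[OF U0(1) bounded_bilinear_dot_star] Cn_on_linear[OF U0(1) bounded_linear_mat]
        Cn_on_bilinear[OF U0(1) bounded_bilinear_Jp] mv X Cn_on_N Cn_on_Pm)
qed

lemma Cn_on_h: "Cn_on k U0 h"
  unfolding h_def[abs_def]
  by (intro Cn_on_linear[OF U0(1) bounded_linear_midm] Cn_on_bilinear[OF U0(1) bounded_bilinear_matrix_mult]
      Cn_on_linear[OF U0(1) bounded_linear_adj] Cn_on_const[OF U0(1)] Cn_on_Wm)

text \<open>Differentiating the scaling gives a multiple of \<open>N\<close>, differentiating the
  time a multiple of \<open>X0 N\<close>, and differentiating the slice point the lift
  \<open>Pm\<close>, which differs from \<open>Wm\<close> by further multiples of these two
  vectors.\<close>

lemma dN_orbit: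
  assumes y: "y \<in> U0"
  shows "\<exists>a b. frechet_derivative N (at y) v = a *s N y + b *s (X0 *v N y) + Wm y *v Bvi v"
proof -
  let ?\<rho> = "\<lambda>y. \<rho> (polar y)"
  have p: "polar x \<in> ball 0 \<delta>" if "x \<in> U0" for x using that by (simp add: U0_def)
  define r where "r = frechet_derivative ?\<rho> (at y)"
  define k where "k v = (of_real (frechet_derivative kappa (at y) v) :: complex)" for v
  have d\<rho>: "(?\<rho> has_derivative r) (at y)"
    unfolding r_def by (rule Cn_on_SucD[OF polar_Cn_on[OF holo_\<rho> U0(1) p] y])
  have dE: "((\<lambda>y. E (?\<rho> y)) has_derivative (\<lambda>v. mat (r v) ** (X0 ** E (?\<rho> y)))) (at y)"
    by (rule has_derivative_compose[OF d\<rho> mexp_has_derivative])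
  have dk: "((\<lambda>y. of_real (kappa y)) has_derivative k) (at y)"
    unfolding k_def[abs_def] by (rule bounded_linear.has_derivative[OF bounded_linear_of_real Cn_on_SucD[OF Cn_on_kappa y]])
  have N: "N = (\<lambda>y. of_real (kappa y) *s (E (?\<rho> y) *v Bv 1 y 0))"
    by (simp add: fun_eq_iff N_def Pm_def flip: matrix_vector_mul_assoc)
  have "(N has_derivative (\<lambda>v. of_real (kappa y) *s (E (?\<rho> y) *v Bvi v + (mat (r v) ** (X0 ** E (?\<rho> y))) *v Bv 1 y 0)
      + k v *s (E (?\<rho> y) *v Bv 1 y 0))) (at y)"
    unfolding N by (rule bounded_bilinear.FDERIV[OF bounded_bilinear_smult dk
      bounded_bilinear.FDERIV[OF bounded_bilinear_matrix_vector dE has_derivative_Z]])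
  then have "frechet_derivative N (at y) v = of_real (kappa y) *s (E (?\<rho> y) *v Bvi v + (mat (r v) ** (X0 ** E (?\<rho> y))) *v Bv 1 y 0)
      + k v *s (E (?\<rho> y) *v Bv 1 y 0)"
    by (rule frechet_derivative_apply)
  also have "\<dots> = Pm y *v Bvi v + r v *s (X0 *v N y) + (k v / of_real (kappa y)) *s N y"
    using kappa_pos[OF y]
    by (simp add: N_def Pm_def matrix_vector_mul_assoc[symmetric] smult_simps vector_smult_assoc matrix_vector_smult mult.commute)
  finally have "frechet_derivative N (at y) v
      = (k v / of_real (kappa y) - (Jp (X0 *v N y) (X0 *v N y) * Jp (N y) (Pm y *v Bvi v) + Jp (X0 *v N y) (Pm y *v Bvi v))) *s N y
      + (r v - Jp (N y) (Pm y *v Bvi v)) *s (X0 *v N y) + Wm y *v Bvi v"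
    unfolding Wm_apply[OF y] by (simp add: smult_simps)
  then show ?thesis by blast
qed

lemma N_0: "N 0 = e1" and Pm_0: "Pm 0 = mat 1"
proof -
  have "flow_pairing X0 0 (polar (0 :: complex^'n)) = - 1"
    unfolding flow_pairing_Jp by (simp add: X0_def Xm_e Jp_Bv)
  then have "kappa 0 = 1" by (simp add: kappa_def polar_0 \<rho>0)
  then show "Pm 0 = mat 1" by (simp add: Pm_def polar_0 \<rho>0)
  then show "N 0 = e1" by (simp add: N_def)
qed

lemma X0_e1: "X0 *v e1 = Bv (- (trace H0 / 2)) 0 1"
  unfolding X0_def by (rule Xm_e)

lemma Wm_0: "Wm 0 *v Bvi v = Bvi v"
  unfolding Wm_apply[OF U0(2)] N_0 Pm_0 X0_e1 by (simp add: Bvi_def Jp_Bv)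

lemma h_0: "h 0 = mat 1"
proof (rule star_dot_eqI)
  show "star_dot v (h 0 *v w) = star_dot v (mat 1 *v w)" for v w
    unfolding WW[OF U0(2), symmetric] Wm_0 by (simp add: Bvi_def Jp_Bv)
qed

text \<open>At the origin \<open>N\<close> is the first basis vector and the metric is the identity,
  so in the identity coframe the frame \<open>G\<close> is the identity matrix. There
  \<open>X\<close> equals \<open>X0\<close>, whose blocks are the prescribed values.\<close>

theorem attained: "\<exists>U \<Omega>. attains_at_0 \<infinity> U \<Omega> H0 T0 V0"
proof -
  obtain K where K: "K > 0" "\<And>(A :: complex^'n^'n) x. norm (A *v x) \<le> norm A * norm x * K"
    using bounded_bilinear.pos_bounded[OF bounded_bilinear_matrix_vector] by metis
  \<comment> \<open>A matrix this close to the identity is still positive; \<open>K\<close> bounds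
    the product of a matrix and a vector.\<close>
  define U where "U = U0 \<inter> (\<lambda>y. norm (h y - mat 1) * K) -` {..<1}"
  have "continuous_on U0 (\<lambda>y. norm (h y - mat 1) * K)"
    by (intro continuous_intros Cn_on_imp_continuous_on[OF Cn_on_h])
  then have U: "open U" "0 \<in> U" "U \<subseteq> U0"
    using continuous_open_preimage[OF _ U0(1) open_lessThan] U0(2) by (auto simp: U_def h_0)
  have pos: "Re (star_dot v (h y *v v)) > 0" if y: "y \<in> U" and v: "v \<noteq> 0" for y v
  proof -
    have "h y *v v = v + (h y - mat 1) *v v" by (simp add: matrix_diff_distrib)
    then have "Re (star_dot v (h y *v v)) = v \<bullet> v + v \<bullet> ((h y - mat 1) *v v)"
      by (simp add: star_dot_add inner_complex_vec)
    moreover have "\<bar>v \<bullet> ((h y - mat 1) *v v)\<bar> \<le> norm v * norm ((h y - mat 1) *v v)"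
      by (rule Cauchy_Schwarz_ineq2)
    moreover have "norm v * norm ((h y - mat 1) *v v) \<le> norm v * (norm (h y - mat 1) * norm v * K)"
      by (rule mult_left_mono[OF K(2)]) simp
    moreover have "norm v * (norm (h y - mat 1) * norm v * K) < norm v * norm v"
      using y v by (simp add: U_def mult_ac)
    ultimately show ?thesis by (simp add: dot_square_norm power2_eq_square)
  qed
  have herm: "hermitian (h y)" if "y \<in> U" for y
    unfolding hermitian_def using h_herm U(3) that by blast
  obtain Q where Q: "Cn_on 2 U Q" "\<And>y. y \<in> U \<Longrightarrow> adj (Q y) ** h y ** Q y = mat 1"
    using gram_schmidt[OF U(1) Cn_on_subset[OF Cn_on_h U(3)] herm pos] by metis
  \<comment> \<open>If \<open>adj Q h Q\<close> is the identity, then \<open>Q adj Q\<close> inverts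
    \<open>h\<close>, and it is as differentiable as \<open>Q\<close>.\<close>
  define hi where "hi y = Q y ** adj (Q y)" for y
  have hih: "hi y ** h y = mat 1" if "y \<in> U" for y
    using Q(2)[OF that] unfolding hi_def by (metis matrix_left_right_inverse matrix_mul_assoc)
  interpret orb: bk_orbit H0 T0 V0 X0 U N Wm h hi
  proof (rule bk_orbit.intro)
    show "Cn_on 2 U hi"
      unfolding hi_def[abs_def] by (intro Cn_on_bilinear[OF U(1) bounded_bilinear_matrix_mult] Cn_on_linear[OF U(1) bounded_linear_adj] Q)
  qed (use U H0 X0_def pos hih NN NX NW XW WW h_herm dN_orbit Cn_on_subset[OF Cn_on_N U(3)] Cn_on_subset[OF Cn_on_Wm U(3)]
      Cn_on_subset[OF Cn_on_h U(3)] in \<open>auto simp del: Cn_on.simps\<close>)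
  let ?u = "(0, mat 1) :: 'n coframe"
  have u: "?u \<in> coframe_bundle U orb.\<Omega>"
    using U(2) by (simp add: orb.coframe_iff h_0)
  have hi0: "hi 0 = mat 1" using hih[OF U(2)] by (simp add: h_0)
  have M0: "orb.M 0 = Bv 0 0 1"
  proof -
    have c: "cnj (trace H0) = trace H0" using H0 by (simp add: cnj_trace)
    have "orb.t 0 = trace H0" unfolding orb.t_def N_0 X0_e1 by (simp add: Jp_Bv c)
    then show ?thesis unfolding orb.M_def N_0 X0_e1 by (simp add: Bv_smult Bv_add)
  qed
  have "orb.G ?u *v x = x" for x
    by (cases x rule: Bv_cases) (simp add: orb.G_apply N_0 M0 hi0 Wm_0, simp add: Bv_smult Bv_add Bvi_def)
  then have "orb.G ?u = mat 1" by (simp add: matrix_eq)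
  then have X: "orb.X ?u = X0" by (simp add: orb.X_def Jm_Jm)
  have "orb.H ?u = H0" "orb.T ?u = T0" "orb.V ?u = V0"
    unfolding orb.V_def orb.T_def orb.H_def X by (simp_all add: X0_def Xm_def Bv_mult)
  then show ?thesis
    unfolding attains_at_0_def using U u orb.bochner_kaehler by (metis fst_conv)
qed

end

theorem theorem1:
  "(\<forall>(H0 :: complex^'n^'n) (T0 :: complex^'n) (V0 :: real). hermitian H0 \<longrightarrow>
      (\<exists>U \<Omega>. attains_at_0 \<infinity> U \<Omega> H0 T0 V0))
   \<and>
   (\<forall>(H0 :: complex^'n^'n) (T0 :: complex^'n) (V0 :: real) U1 \<Omega>1 U2 \<Omega>2. hermitian H0 \<longrightarrow>
      attains_at_0 \<infinity> U1 \<Omega>1 H0 T0 V0 \<and> real_analytic_form_on U1 \<Omega>1 \<longrightarrow>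
      attains_at_0 \<infinity> U2 \<Omega>2 H0 T0 V0 \<and> real_analytic_form_on U2 \<Omega>2 \<longrightarrow>
      isomorphic_germs_at_0 U1 \<Omega>1 U2 \<Omega>2)
   \<and>
   (\<forall>(X :: 'm topology) (\<A> :: ('m, 'n) chart set) \<Omega> H T V.
      bochner_kaehler_manifold 5 X \<A> \<Omega> H T V \<longrightarrow>
      (\<forall>c\<in>\<A>. real_analytic_form_on (chart_image c) (\<Omega> c)))"
proof (intro conjI allI impI ballI)
  fix H0 :: "complex^'n^'n" and T0 :: "complex^'n" and V0 :: real
  assume H0: "hermitian H0"
  obtain \<rho> \<delta> \<epsilon> where "bk_model H0 T0 V0 (Xm H0 T0 V0) \<rho> \<delta> \<epsilon>"
    by (rule bk_model_exists[OF H0])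
  then show "\<exists>U \<Omega>. attains_at_0 \<infinity> U \<Omega> H0 T0 V0"
    by (rule bk_model.attained)
next
  fix H0 :: "complex^'n^'n" and T0 :: "complex^'n" and V0 :: real and U1 \<Omega>1 U2 \<Omega>2
  assume "hermitian H0"
    "attains_at_0 \<infinity> U1 \<Omega>1 H0 T0 V0 \<and> real_analytic_form_on U1 \<Omega>1"
    "attains_at_0 \<infinity> U2 \<Omega>2 H0 T0 V0 \<and> real_analytic_form_on U2 \<Omega>2"
  then show "isomorphic_germs_at_0 U1 \<Omega>1 U2 \<Omega>2"
    by (intro isomorphic_germs_attaining[of H0 \<infinity> \<infinity> U1 \<Omega>1 T0 V0 U2 \<Omega>2]) simp_all
next
  fix X :: "'m topology" and \<A> :: "('m, 'n) chart set" and \<Omega> H T V c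
  assume "bochner_kaehler_manifold 5 X \<A> \<Omega> H T V" "c \<in> \<A>"
  then have "bochner_kaehler_on 5 (chart_image c) (\<Omega> c) (H c) (T c) (V c)"
    unfolding bochner_kaehler_manifold_def by blast
  then show "real_analytic_form_on (chart_image c) (\<Omega> c)"
    by (rule real_analytic_bochner_kaehler) simp
qed

end
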